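(* Let $\mathcal{P}$ be a nonempty small category enriched over $\mathbf{Top}$. Then the projective model structure $[\mathcal{P},\mathbf{Top}_Q]^{proj}_0$ is proper (i.e. left proper and right proper).
   Context: $\mathbf{Top}$ is the category of $\Delta$-generated spaces, i.e. the full subcategory of general topological spaces consisting of colimits of topological simplices (no separation axiom is assumed). It is locally presentable and cartesian closed, with internal hom $\mathbf{TOP}(-,-)$; products are taken in $\mathbf{Top}$. $\mathbf{Top}_Q$ is $\mathbf{Top}$ with the Quillen model structure (weak equivalences: weak homotopy equivalences; fibrations: Serre fibrations). A category enriched over $\mathbf{Top}$ has spaces of maps $\mathcal{P}(\ell,\ell')\in\mathbf{Top}$ with continuous composition; $\mathcal{P}_0$ is the underlying ordinary category. $[\mathcal{P},\mathbf{Top}]_0$ is the full subcategory of the functor category $\mathbf{Top}^{\mathcal{P}_0}$ spanned by the enriched functors, i.e. those $F$ such that all maps $\mathcal{P}(\ell,\ell')\to\mathbf{TOP}(F(\ell),F(\ell'))$ are continuous. $[\mathcal{P},\mathbf{Top}_Q]^{proj}_0$ is $[\mathcal{P},\mathbf{Top}]_0$ with the projective model structure: weak equivalences are the pointwise weak homotopy equivalences, fibrations are the pointwise Serre fibrations; it is cofibrantly generated with generating cofibrations $\mathcal{P}(\ell,-)\times\mathbf{S}^{n-1}\to\mathcal{P}(\ell,-)\times\mathbf{D}^n$ for $n\geq 0$, $\ell\in\mathrm{Obj}(\mathcal{P})$ (where $\mathbf{S}^{-1}=\varnothing$, $\mathbf{D}^0$ is a point). *)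

theory Defs
  imports "HOL-Homology.Homology"
begin

section \<open>Universes\<close>

text \<open>
  A type \<open>'u\<close> plays the role of the universe of small sets: small spaces are topologies on
  subsets of \<open>'u\<close>, and a small category has its objects and its spaces of maps in \<open>'u\<close>.
  HOL has no type that is closed under all small constructions; what is required of \<open>'u\<close> is
  \<open>|'u| \<ge> 2\<close> and \<open>|'u| ^ |\<real>| = |'u|\<close>.  This makes \<open>|'u|\<close> infinite and makes the spaces in \<open>'u\<close> closed,
  up to homeomorphism, under finite limits and colimits, under mapping spaces out of simplices,
  discs and spheres, and under the small object argument for the generating (trivial)
  cofibrations of the projective model structure.  By \<open>universe_exists\<close> every type embeds into
  a universe, so any given small diagram of spaces lives in a suitable \<open>'u\<close>.
\<close>

definition universe :: "'u itself \<Rightarrow> bool" where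
  "universe _ \<longleftrightarrow> (\<exists>x y :: 'u. x \<noteq> y) \<and> (\<exists>i :: (real \<Rightarrow> 'u) \<Rightarrow> 'u. inj i)"

lemma universe_exists: "universe TYPE(real \<Rightarrow> 'b option)"
proof -
  have "|UNIV \<times> UNIV :: (real \<times> real) set| =o |UNIV :: real set|"
    by (rule card_of_Times_same_infinite) (simp add: infinite_UNIV_char_0)
  then obtain h :: "real \<times> real \<Rightarrow> real" where "bij h"
    unfolding card_of_ordIso[symmetric] by auto
  define i :: "(real \<Rightarrow> real \<Rightarrow> 'b option) \<Rightarrow> real \<Rightarrow> 'b option"
    where "i = (\<lambda>f r. case_prod f (inv_into UNIV h r))"
  have "inj i"
  proof (rule injI)
    fix f g assume eq: "i f = i g"
    have "f a b = g a b" for a b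
      using fun_cong[OF eq, of "h (a, b)"] \<open>bij h\<close>
      by (simp add: i_def bij_is_inj)
    then show "f = g" by blast
  qed
  moreover have "(\<lambda>_. None) \<noteq> (\<lambda>_ :: real. Some (undefined :: 'b))"
    by (simp add: fun_eq_iff)
  ultimately show ?thesis
    unfolding universe_def by blast
qed


section \<open>\<open>\<Delta>\<close>-generated spaces\<close>

definition top_simplex :: "nat \<Rightarrow> (nat \<Rightarrow> real) topology" where
  "top_simplex n = subtopology (powertop_real UNIV) (standard_simplex n)"

text \<open>
  A colimit of topological simplices, formed among all topological spaces: a diagram has
  objects \<open>j \<in> J\<close> with value the simplex of dimension \<open>d j\<close>, and arrows \<open>(j, \<theta>, k) \<in> A\<close> with value
  \<open>\<theta>\<close>; \<open>X\<close> is a colimit with cocone \<open>\<sigma>\<close> iff \<open>\<sigma>\<close> exhibits \<open>X\<close> as the quotient of the disjoint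
  union by the equivalence relation generated by \<open>(j, p) \<sim> (k, \<theta> p)\<close>.  Closing \<open>A\<close> under identities
  and composition does not change the colimit, so this is not required.
\<close>

definition simplex_diagram ::
    "'j set \<Rightarrow> ('j \<Rightarrow> nat) \<Rightarrow> ('j \<times> ((nat \<Rightarrow> real) \<Rightarrow> (nat \<Rightarrow> real)) \<times> 'j) set \<Rightarrow> bool" where
  "simplex_diagram J d A \<longleftrightarrow>
     (\<forall>(j, \<theta>, k) \<in> A. j \<in> J \<and> k \<in> J \<and> continuous_map (top_simplex (d j)) (top_simplex (d k)) \<theta>)"

definition simplex_colimit ::
    "'j set \<Rightarrow> ('j \<Rightarrow> nat) \<Rightarrow> ('j \<times> ((nat \<Rightarrow> real) \<Rightarrow> (nat \<Rightarrow> real)) \<times> 'j) set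
      \<Rightarrow> ('j \<Rightarrow> (nat \<Rightarrow> real) \<Rightarrow> 'a) \<Rightarrow> 'a topology \<Rightarrow> bool" where
  "simplex_colimit J d A \<sigma> X \<longleftrightarrow>
     (let S = sum_topology (\<lambda>j. top_simplex (d j)) J;
          leg = (\<lambda>(j, p). \<sigma> j p);
          R = (\<lambda>x y. \<exists>j \<theta> k p. (j, \<theta>, k) \<in> A \<and> p \<in> topspace (top_simplex (d j))
                                 \<and> x = (j, p) \<and> y = (k, \<theta> p))
      in quotient_map S X leg \<and>
         (\<forall>x \<in> topspace S. \<forall>y \<in> topspace S. leg x = leg y \<longleftrightarrow> equivclp R x y))"

text \<open>
  The index type is large enough: it contains the index set of the diagram of all singular
  simplices of \<open>X\<close>, whose colimit is \<open>X\<close> whenever \<open>X\<close> is a colimit of some diagram of simplices.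
\<close>

definition delta_generated :: "'a topology \<Rightarrow> bool" where
  "delta_generated X \<longleftrightarrow>
     (\<exists>(J :: (nat \<times> ((nat \<Rightarrow> real) \<Rightarrow> 'a)) set) d A \<sigma>.
        simplex_diagram J d A \<and> simplex_colimit J d A \<sigma> X)"

text \<open>
  The \<open>\<Delta>\<close>-kelleyfication: the coreflection of topological spaces onto \<open>\<Delta>\<close>-generated ones.
\<close>

definition kelleyfication :: "'a topology \<Rightarrow> 'a topology" where
  "kelleyfication X =
     topology (\<lambda>U. U \<subseteq> topspace X \<and>
       (\<forall>n \<sigma>. continuous_map (top_simplex n) X \<sigma> \<longrightarrow>
              openin (top_simplex n) {p \<in> topspace (top_simplex n). \<sigma> p \<in> U}))"

lemma openin_kelleyfication:
  "openin (kelleyfication X) U \<longleftrightarrow>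
     U \<subseteq> topspace X \<and>
     (\<forall>n \<sigma>. continuous_map (top_simplex n) X \<sigma> \<longrightarrow>
            openin (top_simplex n) {p \<in> topspace (top_simplex n). \<sigma> p \<in> U})"
proof -
  let ?P = "\<lambda>U. U \<subseteq> topspace X \<and>
     (\<forall>n \<sigma>. continuous_map (top_simplex n) X \<sigma> \<longrightarrow>
            openin (top_simplex n) {p \<in> topspace (top_simplex n). \<sigma> p \<in> U})"
  have "istopology ?P"
    unfolding istopology_def
  proof (intro conjI allI impI)
    fix S T n \<sigma>
    assume "?P S" "?P T" "continuous_map (top_simplex n) X \<sigma>"
    then have "openin (top_simplex n)
        ({p \<in> topspace (top_simplex n). \<sigma> p \<in> S} \<inter> {p \<in> topspace (top_simplex n). \<sigma> p \<in> T})"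
      by (intro openin_Int) auto
    moreover have "{p \<in> topspace (top_simplex n). \<sigma> p \<in> S} \<inter> {p \<in> topspace (top_simplex n). \<sigma> p \<in> T}
        = {p \<in> topspace (top_simplex n). \<sigma> p \<in> S \<inter> T}" by auto
    ultimately show "openin (top_simplex n) {p \<in> topspace (top_simplex n). \<sigma> p \<in> S \<inter> T}" by simp
  next
    fix \<K> n \<sigma>
    assume "\<forall>K\<in>\<K>. ?P K" "continuous_map (top_simplex n) X \<sigma>"
    then have "openin (top_simplex n) (\<Union>K\<in>\<K>. {p \<in> topspace (top_simplex n). \<sigma> p \<in> K})"
      by (intro openin_Union) auto
    moreover have "(\<Union>K\<in>\<K>. {p \<in> topspace (top_simplex n). \<sigma> p \<in> K})
        = {p \<in> topspace (top_simplex n). \<sigma> p \<in> \<Union>\<K>}" by auto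
    ultimately show "openin (top_simplex n) {p \<in> topspace (top_simplex n). \<sigma> p \<in> \<Union>\<K>}" by simp
  qed auto
  then show ?thesis
    unfolding kelleyfication_def by (simp add: topology_inverse')
qed

lemma delta_generated_iff_kelleyfication: "delta_generated X \<longleftrightarrow> kelleyfication X = X"
proof
  assume "delta_generated X"
  then obtain J :: "(nat \<times> ((nat \<Rightarrow> real) \<Rightarrow> 'a)) set" and d A \<sigma>
    where q: "quotient_map (sum_topology (\<lambda>j. top_simplex (d j)) J) X (\<lambda>(j, p). \<sigma> j p)"
    unfolding delta_generated_def simplex_colimit_def Let_def by blast
  have leg: "continuous_map (top_simplex (d j)) X (\<sigma> j)" if "j \<in> J" for j
    using continuous_map_compose[OF continuous_map_component_injection[OF that]
        quotient_imp_continuous_map[OF q]] by (simp add: o_def)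
  have "openin X U" if U: "openin (kelleyfication X) U" for U
  proof -
    have sub: "U \<subseteq> topspace X" using U by (simp add: openin_kelleyfication)
    let ?V = "{x \<in> topspace (sum_topology (\<lambda>j. top_simplex (d j)) J). (case x of (j, p) \<Rightarrow> \<sigma> j p) \<in> U}"
    have "{p. (j, p) \<in> ?V} = {p \<in> topspace (top_simplex (d j)). \<sigma> j p \<in> U}" if "j \<in> J" for j
      using that by auto
    then have "openin (sum_topology (\<lambda>j. top_simplex (d j)) J) ?V"
      using U leg unfolding openin_sum_topology openin_kelleyfication by auto
    then show ?thesis using q sub unfolding quotient_map_def by blast
  qed
  moreover have "openin (kelleyfication X) U" if "openin X U" for U
    using that by (simp add: openin_kelleyfication openin_subset openin_continuous_map_preimage)
  ultimately show "kelleyfication X = X" by (auto simp: topology_eq)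
next
  assume X: "kelleyfication X = X"
  define J where "J = {(n, \<sigma>). continuous_map (top_simplex n) X \<sigma>}"
  define d :: "nat \<times> ((nat \<Rightarrow> real) \<Rightarrow> 'a) \<Rightarrow> nat" where "d = fst"
  define \<sigma> :: "nat \<times> ((nat \<Rightarrow> real) \<Rightarrow> 'a) \<Rightarrow> (nat \<Rightarrow> real) \<Rightarrow> 'a" where "\<sigma> = snd"
  define A where "A = {(j, \<theta>, k). j \<in> J \<and> k \<in> J \<and>
      continuous_map (top_simplex (d j)) (top_simplex (d k)) \<theta> \<and>
      (\<forall>p \<in> topspace (top_simplex (d j)). \<sigma> j p = \<sigma> k (\<theta> p))}"
  define S where "S = sum_topology (\<lambda>j. top_simplex (d j)) J"
  define leg where "leg = (\<lambda>(j, p). \<sigma> j p)"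
  define R where "R = (\<lambda>x y. \<exists>j \<theta> k p. (j, \<theta>, k) \<in> A \<and> p \<in> topspace (top_simplex (d j))
                                 \<and> x = (j, p) \<and> y = (k, \<theta> p))"
  define v :: "nat \<Rightarrow> real" where "v = (\<lambda>i. if i = 0 then 1 else 0)"
  have v: "v \<in> topspace (top_simplex 0)"
    by (simp add: top_simplex_def v_def standard_simplex_def)
  have TS: "topspace S = {(j, p). j \<in> J \<and> p \<in> topspace (top_simplex (d j))}"
    by (auto simp: S_def)
  have pt: "(0, \<lambda>_. x) \<in> J" if "x \<in> topspace X" for x
    using that by (simp add: J_def)
  have legX: "leg x \<in> topspace X" if "x \<in> topspace S" for x
    using that continuous_map_image_subset_topspace
    by (fastforce simp: TS J_def d_def \<sigma>_def leg_def)
  have quot: "quotient_map S X leg"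
    unfolding quotient_map_def
  proof (intro conjI allI impI)
    have "x \<in> leg ` topspace S" if "x \<in> topspace X" for x
    proof -
      have "((0, \<lambda>_. x), v) \<in> topspace S"
        using pt[OF that] v by (simp add: TS d_def)
      moreover have "leg ((0, \<lambda>_. x), v) = x" by (simp add: leg_def \<sigma>_def)
      ultimately show ?thesis by (metis imageI)
    qed
    then show "leg ` topspace S = topspace X" using legX by auto
    fix U assume U: "U \<subseteq> topspace X"
    have "openin S {x \<in> topspace S. leg x \<in> U} \<longleftrightarrow>
        (\<forall>j\<in>J. openin (top_simplex (d j)) {p \<in> topspace (top_simplex (d j)). \<sigma> j p \<in> U})"
    proof -
      have "{p. (j, p) \<in> {x \<in> topspace S. leg x \<in> U}}
          = {p \<in> topspace (top_simplex (d j)). \<sigma> j p \<in> U}" if "j \<in> J" for j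
        using that by (auto simp: TS leg_def)
      moreover have "{x \<in> topspace S. leg x \<in> U} \<subseteq> Sigma J (topspace \<circ> (\<lambda>j. top_simplex (d j)))"
        by (auto simp: TS)
      ultimately show ?thesis by (simp add: S_def openin_sum_topology cong: ball_cong)
    qed
    also have "\<dots> \<longleftrightarrow> openin (kelleyfication X) U"
      using U by (auto simp: openin_kelleyfication J_def d_def \<sigma>_def)
    finally show "openin S {x \<in> topspace S. leg x \<in> U} = openin X U" by (simp add: X)
  qed
  have ker: "leg x = leg y \<longleftrightarrow> equivclp R x y" if x: "x \<in> topspace S" and y: "y \<in> topspace S" for x y
  proof
    assume eq: "leg x = leg y"
    have "R ((0, \<lambda>_. leg x), v) z" if z: "z \<in> topspace S" "leg z = leg x" for z
    proof -
      obtain j p where jp: "z = (j, p)" by (cases z)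
      have "((0, \<lambda>_. leg x), (\<lambda>_. p), j) \<in> A"
        using z jp pt legX[OF x] by (auto simp: A_def TS leg_def d_def \<sigma>_def)
      moreover have "v \<in> topspace (top_simplex (d (0, \<lambda>_. leg x)))"
        using v by (simp add: d_def)
      ultimately show ?thesis unfolding R_def jp by blast
    qed
    then have "R ((0, \<lambda>_. leg x), v) x" "R ((0, \<lambda>_. leg x), v) y"
      using x y eq by auto
    then show "equivclp R x y"
      by (blast intro: equivclp_sym equivclp_trans r_into_equivclp)
  next
    assume "equivclp R x y"
    then show "leg x = leg y"
      by (induction rule: equivclp_induct) (auto simp: R_def A_def leg_def)
  qed
  have "simplex_diagram J d A"
    by (auto simp: simplex_diagram_def A_def)
  moreover have "simplex_colimit J d A \<sigma> X"
    using quot ker unfolding simplex_colimit_def Let_def S_def leg_def R_def by blast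
  ultimately show "delta_generated X"
    unfolding delta_generated_def by blast
qed

text \<open>Binary products and internal hom in the category of \<open>\<Delta>\<close>-generated spaces.\<close>

definition delta_prod :: "'a topology \<Rightarrow> 'b topology \<Rightarrow> ('a \<times> 'b) topology" where
  "delta_prod X Y = kelleyfication (prod_topology X Y)"

text \<open>Maps are normalised to \<open>undefined\<close> outside the domain, so that equality of maps is equality.\<close>

definition top_maps :: "'a topology \<Rightarrow> 'b topology \<Rightarrow> ('a \<Rightarrow> 'b) set" where
  "top_maps X Y = {f. continuous_map X Y f \<and> f \<in> extensional (topspace X)}"

definition compact_open_topology :: "'a topology \<Rightarrow> 'b topology \<Rightarrow> ('a \<Rightarrow> 'b) topology" where
  "compact_open_topology X Y =
     topology_generated_by {{f \<in> top_maps X Y. f ` K \<subseteq> U} | K U. compactin X K \<and> openin Y U}"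

definition TOP :: "'a topology \<Rightarrow> 'b topology \<Rightarrow> ('a \<Rightarrow> 'b) topology" where
  "TOP X Y = kelleyfication (compact_open_topology X Y)"

lemma topspace_TOP [simp]: "topspace (TOP X Y) = top_maps X Y"
proof -
  have "topspace (kelleyfication Z) = topspace Z" for Z :: "('a \<Rightarrow> 'b) topology"
  proof
    show "topspace (kelleyfication Z) \<subseteq> topspace Z"
      using openin_kelleyfication[of Z "topspace (kelleyfication Z)"] by blast
    have "openin (kelleyfication Z) (topspace Z)"
      by (simp add: openin_kelleyfication openin_continuous_map_preimage)
    then show "topspace Z \<subseteq> topspace (kelleyfication Z)" by (rule openin_subset)
  qed
  moreover have "topspace (compact_open_topology X Y) = top_maps X Y"
  proof -
    have "{f \<in> top_maps X Y. f ` {} \<subseteq> topspace Y}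
        \<in> {{f \<in> top_maps X Y. f ` K \<subseteq> U} | K U. compactin X K \<and> openin Y U}"
      using compactin_empty[of X] openin_topspace[of Y] by blast
    then show ?thesis
      by (auto simp: compact_open_topology_def topology_generated_by_topspace)
  qed
  ultimately show ?thesis by (simp add: TOP_def)
qed


section \<open>Categories and functors\<close>

text \<open>\<open>Comp C a b c g f\<close> is the composite of \<open>f \<in> Hom C a b\<close> and \<open>g \<in> Hom C b c\<close>.\<close>

record ('o, 'm) category =
  Obj :: "'o set"
  Hom :: "'o \<Rightarrow> 'o \<Rightarrow> 'm set"
  Comp :: "'o \<Rightarrow> 'o \<Rightarrow> 'o \<Rightarrow> 'm \<Rightarrow> 'm \<Rightarrow> 'm"
  Ident :: "'o \<Rightarrow> 'm"

definition is_category :: "('o, 'm) category \<Rightarrow> bool" where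
  "is_category C \<longleftrightarrow>
     (\<forall>a \<in> Obj C. Ident C a \<in> Hom C a a) \<and>
     (\<forall>a \<in> Obj C. \<forall>b \<in> Obj C. \<forall>c \<in> Obj C. \<forall>f \<in> Hom C a b. \<forall>g \<in> Hom C b c.
        Comp C a b c g f \<in> Hom C a c) \<and>
     (\<forall>a \<in> Obj C. \<forall>b \<in> Obj C. \<forall>f \<in> Hom C a b.
        Comp C a a b f (Ident C a) = f \<and> Comp C a b b (Ident C b) f = f) \<and>
     (\<forall>a \<in> Obj C. \<forall>b \<in> Obj C. \<forall>c \<in> Obj C. \<forall>d \<in> Obj C.
        \<forall>f \<in> Hom C a b. \<forall>g \<in> Hom C b c. \<forall>h \<in> Hom C c d.
        Comp C a c d h (Comp C a b c g f) = Comp C a b d (Comp C b c d h g) f)"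

record ('o, 'm, 'p, 'n) ftor =
  fob :: "'o \<Rightarrow> 'p"
  farr :: "'o \<Rightarrow> 'o \<Rightarrow> 'm \<Rightarrow> 'n"

definition is_functor ::
    "('o, 'm) category \<Rightarrow> ('p, 'n) category \<Rightarrow> ('o, 'm, 'p, 'n) ftor \<Rightarrow> bool" where
  "is_functor C D F \<longleftrightarrow>
     (\<forall>a \<in> Obj C. fob F a \<in> Obj D) \<and>
     (\<forall>a \<in> Obj C. \<forall>b \<in> Obj C. \<forall>f \<in> Hom C a b. farr F a b f \<in> Hom D (fob F a) (fob F b)) \<and>
     (\<forall>a \<in> Obj C. farr F a a (Ident C a) = Ident D (fob F a)) \<and>
     (\<forall>a \<in> Obj C. \<forall>b \<in> Obj C. \<forall>c \<in> Obj C. \<forall>f \<in> Hom C a b. \<forall>g \<in> Hom C b c.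
        farr F a c (Comp C a b c g f)
          = Comp D (fob F a) (fob F b) (fob F c) (farr F b c g) (farr F a b f))"

definition nat_transfs ::
    "('o, 'm) category \<Rightarrow> ('p, 'n) category \<Rightarrow> ('o, 'm, 'p, 'n) ftor \<Rightarrow> ('o, 'm, 'p, 'n) ftor
      \<Rightarrow> ('o \<Rightarrow> 'n) set" where
  "nat_transfs C D F G =
     {\<alpha>. \<alpha> \<in> (\<Pi>\<^sub>E a \<in> Obj C. Hom D (fob F a) (fob G a)) \<and>
         (\<forall>a \<in> Obj C. \<forall>b \<in> Obj C. \<forall>f \<in> Hom C a b.
            Comp D (fob F a) (fob F b) (fob G b) (\<alpha> b) (farr F a b f)
              = Comp D (fob F a) (fob G a) (fob G b) (farr G a b f) (\<alpha> a))}"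

text \<open>
  Values of a functor outside \<open>C\<close> are not normalised; functors that differ only there are
  isomorphic objects of the functor category.
\<close>

definition functor_category ::
    "('o, 'm) category \<Rightarrow> ('p, 'n) category \<Rightarrow> (('o, 'm, 'p, 'n) ftor, 'o \<Rightarrow> 'n) category" where
  "functor_category C D =
     \<lparr>Obj = {F. is_functor C D F},
      Hom = nat_transfs C D,
      Comp = (\<lambda>F G H \<beta> \<alpha>. \<lambda>a \<in> Obj C. Comp D (fob F a) (fob G a) (fob H a) (\<beta> a) (\<alpha> a)),
      Ident = (\<lambda>F. \<lambda>a \<in> Obj C. Ident D (fob F a))\<rparr>"

definition full_subcategory :: "('o, 'm) category \<Rightarrow> ('o \<Rightarrow> bool) \<Rightarrow> ('o, 'm) category" where
  "full_subcategory C Q = C\<lparr>Obj := {a \<in> Obj C. Q a}\<rparr>"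

definition is_pushout ::
    "('o, 'm) category \<Rightarrow> 'o \<Rightarrow> 'o \<Rightarrow> 'o \<Rightarrow> 'o \<Rightarrow> 'm \<Rightarrow> 'm \<Rightarrow> 'm \<Rightarrow> 'm \<Rightarrow> bool" where
  \<comment> \<open>the square \<open>f : a \<rightarrow> b\<close>, \<open>g : a \<rightarrow> c\<close>, \<open>i : b \<rightarrow> d\<close>, \<open>j : c \<rightarrow> d\<close>\<close>
  "is_pushout C a b c d f g i j \<longleftrightarrow>
     a \<in> Obj C \<and> b \<in> Obj C \<and> c \<in> Obj C \<and> d \<in> Obj C \<and>
     f \<in> Hom C a b \<and> g \<in> Hom C a c \<and> i \<in> Hom C b d \<and> j \<in> Hom C c d \<and>
     Comp C a b d i f = Comp C a c d j g \<and>
     (\<forall>x \<in> Obj C. \<forall>u \<in> Hom C b x. \<forall>v \<in> Hom C c x.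
        Comp C a b x u f = Comp C a c x v g \<longrightarrow>
        (\<exists>!h. h \<in> Hom C d x \<and> Comp C b d x h i = u \<and> Comp C c d x h j = v))"

definition is_pullback ::
    "('o, 'm) category \<Rightarrow> 'o \<Rightarrow> 'o \<Rightarrow> 'o \<Rightarrow> 'o \<Rightarrow> 'm \<Rightarrow> 'm \<Rightarrow> 'm \<Rightarrow> 'm \<Rightarrow> bool" where
  \<comment> \<open>the square \<open>f : b \<rightarrow> a\<close>, \<open>g : c \<rightarrow> a\<close>, \<open>i : d \<rightarrow> b\<close>, \<open>j : d \<rightarrow> c\<close>\<close>
  "is_pullback C a b c d f g i j \<longleftrightarrow>
     a \<in> Obj C \<and> b \<in> Obj C \<and> c \<in> Obj C \<and> d \<in> Obj C \<and>
     f \<in> Hom C b a \<and> g \<in> Hom C c a \<and> i \<in> Hom C d b \<and> j \<in> Hom C d c \<and>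
     Comp C d b a f i = Comp C d c a g j \<and>
     (\<forall>x \<in> Obj C. \<forall>u \<in> Hom C x b. \<forall>v \<in> Hom C x c.
        Comp C x b a f u = Comp C x c a g v \<longrightarrow>
        (\<exists>!h. h \<in> Hom C x d \<and> Comp C x d b i h = u \<and> Comp C x d c j h = v))"

definition has_lifting_property ::
    "('o, 'm) category \<Rightarrow> 'o \<Rightarrow> 'o \<Rightarrow> 'm \<Rightarrow> 'o \<Rightarrow> 'o \<Rightarrow> 'm \<Rightarrow> bool" where
  "has_lifting_property C a b i x y p \<longleftrightarrow>
     (\<forall>u \<in> Hom C a x. \<forall>v \<in> Hom C b y.
        Comp C a x y p u = Comp C a b y v i \<longrightarrow>
        (\<exists>h \<in> Hom C b x. Comp C a b x h i = u \<and> Comp C b x y p h = v))"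


section \<open>Model structures and properness\<close>

text \<open>The predicates are only meaningful at \<open>a b f\<close> with \<open>f \<in> Hom C a b\<close>.\<close>

record ('o, 'm) model_structure =
  weq :: "'o \<Rightarrow> 'o \<Rightarrow> 'm \<Rightarrow> bool"
  fib :: "'o \<Rightarrow> 'o \<Rightarrow> 'm \<Rightarrow> bool"
  cof :: "'o \<Rightarrow> 'o \<Rightarrow> 'm \<Rightarrow> bool"

text \<open>In a model category the cofibrations are determined by the other two classes.\<close>

definition model_structure_of ::
    "('o, 'm) category \<Rightarrow> ('o \<Rightarrow> 'o \<Rightarrow> 'm \<Rightarrow> bool) \<Rightarrow> ('o \<Rightarrow> 'o \<Rightarrow> 'm \<Rightarrow> bool)
      \<Rightarrow> ('o, 'm) model_structure" where
  "model_structure_of C W F =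
     \<lparr>weq = W, fib = F,
      cof = (\<lambda>a b i. \<forall>x \<in> Obj C. \<forall>y \<in> Obj C. \<forall>p \<in> Hom C x y.
               W x y p \<and> F x y p \<longrightarrow> has_lifting_property C a b i x y p)\<rparr>"

definition left_proper :: "('o, 'm) category \<Rightarrow> ('o, 'm) model_structure \<Rightarrow> bool" where
  "left_proper C M \<longleftrightarrow>
     (\<forall>a b c d f g i j. is_pushout C a b c d f g i j \<and> cof M a b f \<and> weq M a c g
        \<longrightarrow> weq M b d i)"

definition right_proper :: "('o, 'm) category \<Rightarrow> ('o, 'm) model_structure \<Rightarrow> bool" where
  "right_proper C M \<longleftrightarrow>
     (\<forall>a b c d f g i j. is_pullback C a b c d f g i j \<and> fib M b a f \<and> weq M c a g
        \<longrightarrow> weq M d b i)"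

definition proper :: "('o, 'm) category \<Rightarrow> ('o, 'm) model_structure \<Rightarrow> bool" where
  "proper C M \<longleftrightarrow> left_proper C M \<and> right_proper C M"


section \<open>The Quillen model structure on \<open>\<Delta>\<close>-generated spaces\<close>

definition Top :: "('u topology, 'u \<Rightarrow> 'u) category" where
  "Top = \<lparr>Obj = {X. delta_generated X},
          Hom = top_maps,
          Comp = (\<lambda>X Y Z g f. compose (topspace X) g f),
          Ident = (\<lambda>X. \<lambda>x \<in> topspace X. x)\<rparr>"

text \<open>
  \<open>\<pi>\<^sub>n(X, x)\<close> as the set of pointed homotopy classes of pointed maps from the \<open>n\<close>-sphere; for \<open>n = 0\<close>
  this is the set of path components.  The map induced on \<open>\<pi>\<^sub>n\<close>, \<open>n \<ge> 1\<close>, by a continuous map is a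
  group homomorphism, so it is an isomorphism iff it is bijective.
\<close>

definition sphere_base :: "nat \<Rightarrow> real" where
  "sphere_base = (\<lambda>i. if i = 0 then 1 else 0)"

definition sphere_maps :: "nat \<Rightarrow> 'a topology \<Rightarrow> 'a \<Rightarrow> ((nat \<Rightarrow> real) \<Rightarrow> 'a) set" where
  "sphere_maps n X x = {\<gamma>. continuous_map (nsphere n) X \<gamma> \<and> \<gamma> sphere_base = x}"

definition sphere_homotopy ::
    "nat \<Rightarrow> 'a topology \<Rightarrow> 'a \<Rightarrow> (((nat \<Rightarrow> real) \<Rightarrow> 'a) \<times> ((nat \<Rightarrow> real) \<Rightarrow> 'a)) set" where
  "sphere_homotopy n X x =
     {(\<gamma>, \<delta>). \<gamma> \<in> sphere_maps n X x \<and> \<delta> \<in> sphere_maps n X x \<and>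
              homotopic_with (\<lambda>\<epsilon>. \<epsilon> sphere_base = x) (nsphere n) X \<gamma> \<delta>}"

definition homotopy_group :: "nat \<Rightarrow> 'a topology \<Rightarrow> 'a \<Rightarrow> ((nat \<Rightarrow> real) \<Rightarrow> 'a) set set" where
  "homotopy_group n X x = sphere_maps n X x // sphere_homotopy n X x"

definition homotopy_group_map ::
    "nat \<Rightarrow> 'b topology \<Rightarrow> ('a \<Rightarrow> 'b) \<Rightarrow> 'a \<Rightarrow> ((nat \<Rightarrow> real) \<Rightarrow> 'a) set \<Rightarrow> ((nat \<Rightarrow> real) \<Rightarrow> 'b) set" where
  "homotopy_group_map n Y f x c = sphere_homotopy n Y (f x) `` ((\<lambda>\<gamma>. f \<circ> \<gamma>) ` c)"

definition weak_homotopy_equivalence :: "'a topology \<Rightarrow> 'b topology \<Rightarrow> ('a \<Rightarrow> 'b) \<Rightarrow> bool" where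
  "weak_homotopy_equivalence X Y f \<longleftrightarrow>
     continuous_map X Y f \<and>
     (topspace X = {} \<longrightarrow> topspace Y = {}) \<and>
     (\<forall>n. \<forall>x \<in> topspace X.
        bij_betw (homotopy_group_map n Y f x) (homotopy_group n X x) (homotopy_group n Y (f x)))"

definition disc :: "nat \<Rightarrow> (nat \<Rightarrow> real) topology" where
  "disc n = subtopology (Euclidean_space n) {x. (\<Sum>i<n. x i ^ 2) \<le> 1}"

definition Serre_fibration :: "'a topology \<Rightarrow> 'b topology \<Rightarrow> ('a \<Rightarrow> 'b) \<Rightarrow> bool" where
  "Serre_fibration X Y f \<longleftrightarrow>
     continuous_map X Y f \<and>
     (\<forall>n g h. continuous_map (disc n) X g \<and>
              continuous_map (prod_topology (disc n) (top_of_set {0..1 :: real})) Y h \<and>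
              (\<forall>p \<in> topspace (disc n). f (g p) = h (p, 0)) \<longrightarrow>
        (\<exists>k. continuous_map (prod_topology (disc n) (top_of_set {0..1 :: real})) X k \<and>
             (\<forall>p \<in> topspace (disc n). k (p, 0) = g p) \<and>
             (\<forall>p \<in> topspace (disc n). \<forall>t \<in> {0..1}. f (k (p, t)) = h (p, t))))"


section \<open>Enriched categories and the projective model structure\<close>

record ('o, 'a) enriched_category =
  EObj :: "'o set"
  EHom :: "'o \<Rightarrow> 'o \<Rightarrow> 'a topology"
  EComp :: "'o \<Rightarrow> 'o \<Rightarrow> 'o \<Rightarrow> 'a \<Rightarrow> 'a \<Rightarrow> 'a"
  EIdent :: "'o \<Rightarrow> 'a"

definition underlying_category :: "('o, 'a) enriched_category \<Rightarrow> ('o, 'a) category" where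
  "underlying_category P =
     \<lparr>Obj = EObj P, Hom = (\<lambda>a b. topspace (EHom P a b)), Comp = EComp P, Ident = EIdent P\<rparr>"

definition is_enriched_category :: "('o, 'a) enriched_category \<Rightarrow> bool" where
  "is_enriched_category P \<longleftrightarrow>
     is_category (underlying_category P) \<and>
     (\<forall>a \<in> EObj P. \<forall>b \<in> EObj P. delta_generated (EHom P a b)) \<and>
     (\<forall>a \<in> EObj P. \<forall>b \<in> EObj P. \<forall>c \<in> EObj P.
        continuous_map (delta_prod (EHom P a b) (EHom P b c)) (EHom P a c)
          (\<lambda>(f, g). EComp P a b c g f))"

definition is_enriched_functor ::
    "('o, 'a) enriched_category \<Rightarrow> ('o, 'a, 'u topology, 'u \<Rightarrow> 'u) ftor \<Rightarrow> bool" where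
  "is_enriched_functor P F \<longleftrightarrow>
     is_functor (underlying_category P) Top F \<and>
     (\<forall>a \<in> EObj P. \<forall>b \<in> EObj P.
        continuous_map (EHom P a b) (TOP (fob F a) (fob F b)) (farr F a b))"

definition enriched_functor_category ::
    "('u, 'u) enriched_category
      \<Rightarrow> (('u, 'u, 'u topology, 'u \<Rightarrow> 'u) ftor, 'u \<Rightarrow> 'u \<Rightarrow> 'u) category" where
  "enriched_functor_category P =
     full_subcategory (functor_category (underlying_category P) Top) (is_enriched_functor P)"

definition projective_model_structure ::
    "('u, 'u) enriched_category
      \<Rightarrow> (('u, 'u, 'u topology, 'u \<Rightarrow> 'u) ftor, 'u \<Rightarrow> 'u \<Rightarrow> 'u) model_structure" where
  "projective_model_structure P =
     model_structure_of (enriched_functor_category P)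
       (\<lambda>F G \<alpha>. \<forall>a \<in> EObj P. weak_homotopy_equivalence (fob F a) (fob G a) (\<alpha> a))
       (\<lambda>F G \<alpha>. \<forall>a \<in> EObj P. Serre_fibration (fob F a) (fob G a) (\<alpha> a))"

end

theory Submission
  imports Defs "HOL-Analysis.Analysis"
begin

text \<open>
  Everything is tested on cubes: a map is a weak equivalence iff every square from a boundary
  inclusion \<open>\<partial>I\<^sup>n \<rightarrow> I\<^sup>n\<close> has a lift, up to a homotopy relative to the boundary in the lower
  triangle.  With this criterion right properness is relative homotopy lifting, applied pointwise.

  For left properness, neither relative cell complexes nor an explicit pushout is needed.  Given
  natural maps \<open>c : C \<rightarrow> D\<close> and \<open>b : B \<rightarrow> D\<close>, let \<open>T\<close> be the functor of paths in \<open>D\<close> with a height \<open>s\<close>,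
  a preimage in \<open>C\<close> of the end of the path if \<open>s > 0\<close>, and a preimage in \<open>B\<close> of its start if \<open>s < 1\<close>.
  For \<open>f : A \<rightarrow> B\<close> and the identity of \<open>B\<close>, evaluation \<open>T \<rightarrow> B\<close> at the start is a trivial fibration, so
  a projective cofibration \<open>f\<close> lifts to \<open>B \<rightarrow> T\<close>; this is a natural structure of neighbourhood
  deformation retract.  For a pushout square the universal property extends it to \<open>D \<rightarrow> T\<close>, which
  covers \<open>D\<close> by the region \<open>s < 1\<close>, which lifts to \<open>B\<close>, and the region \<open>s > 0\<close>, which deforms into \<open>C\<close>.
  Subdividing a cube into small boxes that lie over one of the two regions, one lifts the
  boxes of the second kind through the weak equivalence \<open>A \<rightarrow> C\<close>, face by face.

  Topologies on functor values are given by plots (maps out of simplices), for which enrichment of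
  a functor amounts to the action sending pairs of plots to plots.
\<close>

section \<open>Maps out of Euclidean sets and \<open>\<Delta>\<close>-generated spaces\<close>

text \<open>A cofibration is known only through its lifting property and a pushout only through its
  universal property. Quotient topologies are hard to map into, so both properties are applied to
  target objects whose incoming maps can be described component by component; this shapes
  \<open>T\<close>. It has to be an honest enriched functor with values in the universe, and here
  the size of \<open>'u\<close> enters: a path, a height and two points must be coded by one
  element. The two preimage coordinates let one construction serve twice: with the identity of
  \<open>B\<close> as second leg it is a trivial fibration over \<open>B\<close>, with the leg
  \<open>B \<rightarrow> D\<close> it receives compatible maps from \<open>B\<close> and
  \<open>C\<close>. The cone is given its coarse topology because a preimage has to vary
  continuously only where the height allows it to exist. The threshold 1/3 in the subdivision leaves
  room on both sides: a small box on which the height is not everywhere above 1/3 keeps it below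
  2/3, so one of the two ways of lifting works on the whole box.\<close>

abbreviation cm :: "'a::topological_space set \<Rightarrow> 'b topology \<Rightarrow> ('a \<Rightarrow> 'b) \<Rightarrow> bool" where
  "cm S X f \<equiv> continuous_map (top_of_set S) X f"

lemma cm_compose:
  "cm S X f \<Longrightarrow> continuous_on T \<phi> \<Longrightarrow> (\<And>x. x \<in> T \<Longrightarrow> \<phi> x \<in> S) \<Longrightarrow> cm T X (\<lambda>x. f (\<phi> x))"
  using continuous_map_compose[of "top_of_set T" "top_of_set S" \<phi> X f]
  by (auto simp: o_def continuous_map_in_subtopology)

lemma cm_subset: "cm S X f \<Longrightarrow> T \<subseteq> S \<Longrightarrow> cm T X f"
  by (metis continuous_map_from_subtopology_mono)

lemma cm_cong: "cm S X f \<Longrightarrow> (\<And>x. x \<in> S \<Longrightarrow> f x = g x) \<Longrightarrow> cm S X g"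
  by (metis continuous_map_eq topspace_euclidean_subtopology)

lemma cm_image: "cm S X f \<Longrightarrow> x \<in> S \<Longrightarrow> f x \<in> topspace X"
  by (metis continuous_map_funspace funcset_mem topspace_euclidean_subtopology)

lemma cm_into: "continuous_on S f \<Longrightarrow> (\<And>x. x \<in> S \<Longrightarrow> f x \<in> T) \<Longrightarrow> cm S (top_of_set T) f"
  by (auto simp: continuous_map_in_subtopology)

lemma cm_post: "cm S X f \<Longrightarrow> continuous_map X Y g \<Longrightarrow> cm S Y (\<lambda>x. g (f x))"
  using continuous_map_compose by (fastforce simp: o_def)

text \<open>Both closed pieces come from one inequality between continuous real functions, which is
  the shape of all piecewise homotopies below.\<close>

lemma cm_If_le:
  fixes p q :: "_ \<Rightarrow> real"
  assumes "continuous_on S p" "continuous_on S q"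
    and "cm {x \<in> S. p x \<le> q x} X f" "cm {x \<in> S. q x \<le> p x} X g"
    and "\<And>x. x \<in> S \<Longrightarrow> p x = q x \<Longrightarrow> f x = g x"
  shows "cm S X (\<lambda>x. if p x \<le> q x then f x else g x)"
proof (rule continuous_map_cases_le)
  have *: "{x \<in> S. P x} = S \<inter> {x. x \<in> S \<and> P x}" for P by auto
  show "cm S euclideanreal p" "cm S euclideanreal q" using assms by auto
  show "continuous_map (subtopology (top_of_set S) {x \<in> topspace (top_of_set S). p x \<le> q x}) X f"
    "continuous_map (subtopology (top_of_set S) {x \<in> topspace (top_of_set S). q x \<le> p x}) X g"
    using assms by (simp_all add: subtopology_subtopology *[symmetric])
qed (use assms in auto)

lemma cm_closed_Un:
  assumes "closedin (top_of_set (S \<union> T)) S" "closedin (top_of_set (S \<union> T)) T" "cm S X f" "cm T X f"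
  shows "cm (S \<union> T) X f"
  unfolding continuous_map_closedin
proof (intro conjI ballI allI impI)
  show "f \<in> topspace (top_of_set (S \<union> T)) \<rightarrow> topspace X" using assms(3,4) cm_image by fastforce
next
  fix C assume C: "closedin X C"
  have "closedin (top_of_set S) {x \<in> S. f x \<in> C}" "closedin (top_of_set T) {x \<in> T. f x \<in> C}"
    using C assms(3,4) by (auto simp: continuous_map_closedin)
  then have "closedin (top_of_set (S \<union> T)) {x \<in> S. f x \<in> C}" 
    "closedin (top_of_set (S \<union> T)) {x \<in> T. f x \<in> C}"
    using assms(1,2) by (meson closedin_trans)+
  then have "closedin (top_of_set (S \<union> T)) ({x \<in> S. f x \<in> C} \<union> {x \<in> T. f x \<in> C})"
    by (rule closedin_Un)
  then show "closedin (top_of_set (S \<union> T)) {x \<in> topspace (top_of_set (S \<union> T)). f x \<in> C}"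
    by (rule back_subst[of "closedin _"]) auto
qed

lemma top_simplex_eq: "top_simplex n = top_of_set (standard_simplex n)"
  by (simp add: top_simplex_def euclidean_product_topology)

text \<open>The kelleyfication always refines the given topology, so equality with it amounts to one
  inclusion. Simplices enter as subsets of \<open>nat \<Rightarrow> real\<close>, which makes
  continuity on sets applicable.\<close>

lemma delta_generated_iff:
  "delta_generated X \<longleftrightarrow> (\<forall>U \<subseteq> topspace X. (\<forall>n \<sigma>. cm (standard_simplex n) X \<sigma> \<longrightarrow>
      openin (top_of_set (standard_simplex n)) {p \<in> standard_simplex n. \<sigma> p \<in> U}) \<longrightarrow> openin X U)"
  (is "_ \<longleftrightarrow> ?R")
proof -
  have *: "openin X U \<Longrightarrow> openin (kelleyfication X) U" for U
    by (simp add: openin_kelleyfication openin_subset openin_continuous_map_preimage)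
  have "openin (kelleyfication X) U \<longleftrightarrow> U \<subseteq> topspace X \<and> (\<forall>n \<sigma>. cm (standard_simplex n) X \<sigma> \<longrightarrow>
      openin (top_of_set (standard_simplex n)) {p \<in> standard_simplex n. \<sigma> p \<in> U})" for U
    by (simp add: openin_kelleyfication top_simplex_eq)
  then have 1: "(\<forall>U. openin (kelleyfication X) U \<longrightarrow> openin X U) \<longleftrightarrow> ?R"
    by simp blast
  have "kelleyfication X = X \<longleftrightarrow> (\<forall>U. openin (kelleyfication X) U \<longrightarrow> openin X U)"
    using * unfolding topology_eq by blast
  with 1 show ?thesis
    by (simp add: delta_generated_iff_kelleyfication)
qed

lemma delta_generated_openI:
  assumes "delta_generated X" "U \<subseteq> topspace X"
    and "\<And>n \<sigma>. cm (standard_simplex n) X \<sigma> \<Longrightarrow>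
      openin (top_of_set (standard_simplex n)) {p \<in> standard_simplex n. \<sigma> p \<in> U}"
  shows "openin X U"
  using assms unfolding delta_generated_iff by blast

lemma delta_generated_continuous:
  assumes X: "delta_generated X" and f: "\<And>x. x \<in> topspace X \<Longrightarrow> f x \<in> topspace Y"
    and plot: "\<And>n \<sigma>. cm (standard_simplex n) X \<sigma> \<Longrightarrow> cm (standard_simplex n) Y (\<lambda>p. f (\<sigma> p))"
  shows "continuous_map X Y f"
  unfolding continuous_map
proof (intro conjI allI impI)
  fix U assume U: "openin Y U"
  show "openin X {x \<in> topspace X. f x \<in> U}"
  proof (rule delta_generated_openI[OF X])
    fix n \<sigma> assume \<sigma>: "cm (standard_simplex n) X \<sigma>"
    have "openin (top_of_set (standard_simplex n)) {p \<in> standard_simplex n. f (\<sigma> p) \<in> U}"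
      using openin_continuous_map_preimage[OF plot[OF \<sigma>] U] by simp
    moreover have "{p \<in> standard_simplex n. f (\<sigma> p) \<in> U} = {p \<in> standard_simplex n. \<sigma> p \<in> {x \<in> topspace X. f x \<in> U}}"
      using cm_image[OF \<sigma>] by auto
    ultimately show "openin (top_of_set (standard_simplex n)) {p \<in> standard_simplex n. \<sigma> p \<in> {x \<in> topspace X. f x \<in> U}}"
      by simp
  qed auto
qed (use f in auto)

text \<open>If \<open>U\<close> is open on all simplices of \<open>Y\<close>, its preimage under
  \<open>r\<close> is open in \<open>X\<close>, because \<open>r\<close> carries simplices of
  \<open>X\<close> to simplices of \<open>Y\<close>; pulling back along \<open>s\<close> returns
  \<open>U\<close>. Prisms, cubes and discs are reached from simplices by such retractions.\<close>

lemma delta_generated_retract: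
  assumes X: "delta_generated X" and r: "continuous_map X Y r" and s: "continuous_map Y X s"
    and rs: "\<And>y. y \<in> topspace Y \<Longrightarrow> r (s y) = y"
  shows "delta_generated Y"
  unfolding delta_generated_iff
proof (intro allI impI)
  fix U assume U: "U \<subseteq> topspace Y" and k: "\<forall>n \<sigma>. cm (standard_simplex n) Y \<sigma> \<longrightarrow>
      openin (top_of_set (standard_simplex n)) {p \<in> standard_simplex n. \<sigma> p \<in> U}"
  have "openin X {x \<in> topspace X. r x \<in> U}"
  proof (rule delta_generated_openI[OF X])
    fix n \<sigma> assume \<sigma>: "cm (standard_simplex n) X \<sigma>"
    have "openin (top_of_set (standard_simplex n)) {p \<in> standard_simplex n. r (\<sigma> p) \<in> U}"
      using k cm_post[OF \<sigma> r] by blast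
    then show "openin (top_of_set (standard_simplex n)) {p \<in> standard_simplex n. \<sigma> p \<in> {x \<in> topspace X. r x \<in> U}}"
      using cm_image[OF \<sigma>] by (simp cong: conj_cong)
  qed auto
  then have "openin Y {y \<in> topspace Y. s y \<in> {x \<in> topspace X. r x \<in> U}}"
    using s openin_continuous_map_preimage by blast
  moreover have "{y \<in> topspace Y. s y \<in> {x \<in> topspace X. r x \<in> U}} = U"
    using U rs continuous_map_image_subset_topspace[OF s] by auto
  ultimately show "openin Y U" by simp
qed

section \<open>Simplices, prisms and products with them\<close>

lemma delta_generated_simplex: "delta_generated (top_of_set (standard_simplex n))"
  unfolding delta_generated_iff
proof (intro allI impI)
  fix U :: "(nat \<Rightarrow> real) set"
  assume U: "U \<subseteq> topspace (top_of_set (standard_simplex n))"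
    and *: "\<forall>m \<sigma>. cm (standard_simplex m) (top_of_set (standard_simplex n)) \<sigma> \<longrightarrow>
      openin (top_of_set (standard_simplex m)) {p \<in> standard_simplex m. \<sigma> p \<in> U}"
  have "openin (top_of_set (standard_simplex n)) {p \<in> standard_simplex n. id p \<in> U}"
    using *[rule_format, of n id] by simp
  moreover have "{p \<in> standard_simplex n. id p \<in> U} = U" using U by auto
  ultimately show "openin (top_of_set (standard_simplex n)) U" by simp
qed

lemma delta_generated_retract_on:
  assumes "delta_generated (top_of_set S)" "continuous_on S r" "continuous_on T s"
    and "\<And>x. x \<in> S \<Longrightarrow> r x \<in> T" "\<And>y. y \<in> T \<Longrightarrow> s y \<in> S" "\<And>y. y \<in> T \<Longrightarrow> r (s y) = y"
  shows "delta_generated (top_of_set T)"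
  by (rule delta_generated_retract[OF assms(1) cm_into cm_into, of r T s]) (use assms in auto)

lemma continuous_on_coordinate [continuous_intros]:
  fixes S :: "(nat \<Rightarrow> real) set" and T :: "((nat \<Rightarrow> real) \<times> 'c::topological_space) set"
    and R :: "('c \<times> (nat \<Rightarrow> real)) set"
  shows "continuous_on S (\<lambda>x. x i)" "continuous_on T (\<lambda>x. fst x i)" "continuous_on R (\<lambda>x. snd x i)"
  by (rule continuous_on_product_then_coordinatewise; intro continuous_intros)+

lemma continuous_on_if_const [continuous_intros]:
  "(b \<Longrightarrow> continuous_on S f) \<Longrightarrow> (\<not> b \<Longrightarrow> continuous_on S g) \<Longrightarrow> continuous_on S (\<lambda>x. if b then f x else g x)"
  by (cases b) auto

lemma simplex_D:
  assumes "p \<in> standard_simplex n"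
  shows "0 \<le> p i" "p i \<le> 1" "i > n \<Longrightarrow> p i = 0" "(\<Sum>i\<le>n. p i) = 1"
  using assms by (auto simp: standard_simplex_def)

lemma simplexI:
  assumes "\<And>i. 0 \<le> p i" "\<And>i. i > n \<Longrightarrow> p i = 0" "(\<Sum>i\<le>n. p i) = 1"
  shows "p \<in> standard_simplex n"
proof -
  have "p i \<le> 1" for i
  proof (cases "i \<le> n")
    case True
    then show ?thesis using member_le_sum[of i "{..n}" p] assms by auto
  qed (use assms in auto)
  then show ?thesis using assms by (auto simp: standard_simplex_def)
qed

lemma simplex_sum_less:
  assumes "z \<in> standard_simplex (Suc n)" shows "(\<Sum>i\<le>n. z i) = 1 - z (Suc n)"
  using simplex_D(4)[OF assms] by simp

text \<open>The prism is a retract of the simplex of one dimension higher: \<open>s\<close> gives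
  the extra vertex the weight \<open>t/2\<close> and scales the rest, and \<open>r\<close> undoes
  this.\<close>

lemma delta_generated_simplex_interval:
  "delta_generated (top_of_set (standard_simplex n \<times> {0..1::real}))"
proof -
  \<comment> \<open>On the image of \<open>s\<close> the remaining weight is \<open>1 - t/2\<close>,
    at least 1/2; the cut-off there keeps the division in \<open>r\<close> harmless near the last
    vertex.\<close>
  define l where "l = (\<lambda>z::nat\<Rightarrow>real. max (1/2) (1 - z (Suc n)))"
  \<comment> \<open>The weight lost through the cut-off is put on vertex 0, so that the coordinates
    always sum to 1; on the image of \<open>s\<close> this correction vanishes.\<close>
  define r where "r = (\<lambda>z::nat\<Rightarrow>real. (\<lambda>i. (if i \<le> n then z i / l z else 0) + (if i = 0 then 1 - (1 - z (Suc n)) / l z else 0), min 1 (2 * z (Suc n))))"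
  define s where "s = (\<lambda>(p::nat\<Rightarrow>real, t::real) i. if i \<le> n then (1 - t/2) * p i else if i = Suc n then t/2 else 0)"
  have l: "l z > 0" for z unfolding l_def by simp
  show ?thesis
  proof (rule delta_generated_retract_on[OF delta_generated_simplex[of "Suc n"], of r _ s])
    show "continuous_on (standard_simplex (Suc n)) r"
      unfolding r_def l_def
      by (intro continuous_on_Pair continuous_on_coordinatewise_then_product continuous_on_min) (auto intro!: continuous_intros simp: max_def split: if_splits)
    show "continuous_on (standard_simplex n \<times> {0..1}) s"
      unfolding s_def split_beta
      by (intro continuous_on_coordinatewise_then_product) (auto intro!: continuous_intros)
  next
    fix z assume z: "z \<in> standard_simplex (Suc n)"
    note D = simplex_D[OF z]
    have "fst (r z) \<in> standard_simplex n"
    proof (rule simplexI)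
      show "0 \<le> fst (r z) i" for i
        using D(1,2) l[of z] by (auto simp: r_def l_def)
      have "(\<Sum>i\<le>n. fst (r z) i) = (\<Sum>i\<le>n. z i / l z) + (1 - (1 - z (Suc n)) / l z)"
        unfolding r_def fst_conv sum.distrib by (simp add: sum.delta)
      also have "\<dots> = 1" using simplex_sum_less[OF z] by (simp flip: sum_divide_distrib)
      finally show "(\<Sum>i\<le>n. fst (r z) i) = 1" .
    qed (auto simp: r_def)
    then show "r z \<in> standard_simplex n \<times> {0..1}"
      using D(1,2) by (auto simp: r_def)
  next
    fix y assume "y \<in> standard_simplex n \<times> {0..1::real}"
    then obtain p t where y: "y = (p, t)" and p: "p \<in> standard_simplex n" and t: "0 \<le> t" "t \<le> 1" by auto
    note D = simplex_D[OF p]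
    show "s y \<in> standard_simplex (Suc n)"
    proof (rule simplexI)
      have "(\<Sum>i\<le>n. s y i) = (\<Sum>i\<le>n. (1 - t/2) * p i)" by (rule sum.cong) (auto simp: s_def y)
      also have "\<dots> = 1 - t/2" using D(4) by (simp flip: sum_distrib_left)
      finally show "(\<Sum>i\<le>Suc n. s y i) = 1" by (simp add: s_def y)
    qed (use D t in \<open>auto simp: s_def y\<close>)
    have ls: "l (s y) = 1 - t/2" using t by (simp add: l_def s_def y)
    have "fst (r (s y)) i = p i" for i
      using t D(3)[of i] by (simp add: r_def ls) (auto simp: s_def y)
    then show "r (s y) = y" using t by (auto simp: r_def y s_def)
  qed
qed

lemma delta_generated_interval: "delta_generated (top_of_set {0..1::real})"
proof (rule delta_generated_retract_on[OF delta_generated_simplex_interval[of 0], of snd])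
  show "continuous_on {0..1} (\<lambda>t::real. ((\<lambda>i::nat. if i = 0 then 1 else 0 :: real), t))"
    by (intro continuous_intros)
qed (auto simp: standard_simplex_def intro!: continuous_intros)

lemma continuous_map_prodI:
  "continuous_map Z X f \<Longrightarrow> continuous_map Z Y g \<Longrightarrow> continuous_map Z (prod_topology X Y) (\<lambda>z. (f z, g z))"
  by (simp add: continuous_map_pairwise o_def)

text \<open>Around \<open>(x0, t0)\<close> a compact interval \<open>K\<close> with
  \<open>{x0} \<times> K \<subseteq> W\<close> is chosen; the points \<open>x\<close> with
  \<open>{x} \<times> K \<subseteq> W\<close> form an open set, since the tube lemma shows this on
  every simplex of \<open>X\<close>. It applies because the prism over a simplex is already known to
  be \<Delta>-generated. So the plain product with the interval needs no kelleyfication.\<close>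

lemma delta_generated_prod_interval:
  assumes X: "delta_generated X"
  shows "delta_generated (prod_topology X (top_of_set {0..1::real}))"
  unfolding delta_generated_iff
proof (intro allI impI)
  let ?I = "top_of_set {0..1::real}"
  fix W assume W: "W \<subseteq> topspace (prod_topology X ?I)"
    and k: "\<forall>n \<sigma>. cm (standard_simplex n) (prod_topology X ?I) \<sigma> \<longrightarrow>
      openin (top_of_set (standard_simplex n)) {p \<in> standard_simplex n. \<sigma> p \<in> W}"
  have pull: "openin Z {z \<in> topspace Z. f z \<in> W}"
    if Z: "delta_generated Z" and f: "continuous_map Z (prod_topology X ?I) f" for Z :: "'c topology" and f
  proof (rule delta_generated_openI[OF Z])
    fix n \<sigma> assume \<sigma>: "cm (standard_simplex n) Z \<sigma>"
    have "openin (top_of_set (standard_simplex n)) {p \<in> standard_simplex n. f (\<sigma> p) \<in> W}"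
      using k cm_post[OF \<sigma> f] by blast
    then show "openin (top_of_set (standard_simplex n)) {p \<in> standard_simplex n. \<sigma> p \<in> {x \<in> topspace Z. f x \<in> W}}"
      using cm_image[OF \<sigma>] by (simp cong: conj_cong)
  qed auto
  show "openin (prod_topology X ?I) W"
    unfolding openin_prod_topology_alt
  proof (intro allI impI)
    fix x0 t0 assume xt: "(x0, t0) \<in> W"
    then have x0: "x0 \<in> topspace X" and t0: "t0 \<in> {0..1}" using W by auto
    have "openin ?I {t \<in> topspace ?I. (x0, t) \<in> W}"
      by (rule pull[OF delta_generated_interval]) (intro continuous_map_prodI, use x0 in auto)
    then obtain e where e: "e > 0" "\<And>t. t \<in> {0..1} \<Longrightarrow> dist t t0 < e \<Longrightarrow> (x0, t) \<in> W"
      using xt t0 unfolding openin_euclidean_subtopology_iff by force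
    define K where "K = {0..1} \<inter> cball t0 (e/2)"
    define N where "N = {0..1} \<inter> ball t0 (e/2)"
    have K: "compactin ?I K"
      unfolding K_def by (auto simp: compactin_subtopology intro!: compact_Int)
    have KW: "t \<in> K \<Longrightarrow> (x0, t) \<in> W" for t
      using e by (auto simp: K_def dist_commute)
    define Om where "Om = {x \<in> topspace X. \<forall>t\<in>K. (x, t) \<in> W}"
    have "openin X Om"
    proof (rule delta_generated_openI[OF X])
      fix n \<tau> assume \<tau>: "cm (standard_simplex n) X \<tau>"
      let ?S = "top_of_set (standard_simplex n)"
      have cm': "continuous_map (prod_topology ?S ?I) (prod_topology X ?I) (\<lambda>z. (\<tau> (fst z), snd z))"
        by (intro continuous_map_prodI continuous_map_snd
            continuous_map_compose[OF continuous_map_fst \<tau>, unfolded o_def])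
      have dg: "delta_generated (prod_topology ?S ?I)"
        using delta_generated_simplex_interval by simp
      define W' where "W' = {z \<in> topspace (prod_topology ?S ?I). (\<tau> (fst z), snd z) \<in> W}"
      have W': "openin (prod_topology ?S ?I) W'"
        unfolding W'_def by (rule pull[OF dg cm'])
      show "openin ?S {p \<in> standard_simplex n. \<tau> p \<in> Om}"
      proof (subst openin_subopen, intro ballI)
        fix p assume p: "p \<in> {p \<in> standard_simplex n. \<tau> p \<in> Om}"
        have "{p} \<times> K \<subseteq> W'" using p by (auto simp: W'_def Om_def K_def)
        then obtain U V where UV: "openin ?S U" "p \<in> U" "K \<subseteq> V" "U \<times> V \<subseteq> W'"
          using tube_lemma_right[OF W' K, of p] p by auto
        then have "U \<subseteq> {p \<in> standard_simplex n. \<tau> p \<in> Om}"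
          using cm_image[OF \<tau>] openin_subset[OF UV(1)] by (fastforce simp: W'_def Om_def)
        then show "\<exists>T. openin ?S T \<and> p \<in> T \<and> T \<subseteq> {p \<in> standard_simplex n. \<tau> p \<in> Om}"
          using UV by blast
      qed
    qed (auto simp: Om_def)
    moreover have "openin ?I N" unfolding N_def by (simp add: openin_open_Int)
    moreover have "x0 \<in> Om" "t0 \<in> N" using x0 t0 KW e by (auto simp: Om_def N_def)
    moreover have "Om \<times> N \<subseteq> W" by (auto simp: Om_def N_def K_def)
    ultimately show "\<exists>U V. openin X U \<and> openin ?I V \<and> x0 \<in> U \<and> t0 \<in> V \<and> U \<times> V \<subseteq> W"
      by blast
  qed
qed

text \<open>The simplex of dimension \<open>Suc n\<close> is a retract of the prism over the simplex
  of dimension \<open>n\<close>, so each induction step is a product with the interval.\<close>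

lemma delta_generated_prod_simplex:
  assumes X: "delta_generated X"
  shows "delta_generated (prod_topology X (top_of_set (standard_simplex n)))"
proof (induction n)
  case 0
  let ?v = "\<lambda>i::nat. if i = 0 then 1 else 0 :: real"
  have v: "p = ?v" if "p \<in> standard_simplex 0" for p
    using that by (auto simp: standard_simplex_def)
  have v': "?v \<in> standard_simplex 0" by (simp add: standard_simplex_def)
  show ?case
    by (rule delta_generated_retract[OF X, of _ "\<lambda>x. (x, ?v)" fst])
       (use v v' in \<open>auto intro!: continuous_map_prodI continuous_map_fst\<close>)
next
  case (Suc n)
  let ?S = "top_of_set (standard_simplex n)" let ?S' = "top_of_set (standard_simplex (Suc n))"
  let ?I = "top_of_set {0..1::real}"
  \<comment> \<open>\<open>s\<close> moves the weight of the last vertex to vertex 0 and remembers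
    it as the interval coordinate; \<open>r\<close> moves it back, but never more than vertex 0
    carries.\<close>
  define s where "s = (\<lambda>z::nat\<Rightarrow>real. (\<lambda>i. if i \<le> n then z i + (if i = 0 then z (Suc n) else 0) else 0, z (Suc n)))"
  define r where "r = (\<lambda>(p::nat\<Rightarrow>real, t::real) i. if i = Suc n then min t (p 0) else p i - (if i = 0 then min t (p 0) else 0))"
  have s: "continuous_on (standard_simplex (Suc n)) s"
    unfolding s_def
    by (intro continuous_on_Pair continuous_on_coordinatewise_then_product) (auto intro!: continuous_intros)
  have s': "s z \<in> standard_simplex n \<times> {0..1}" if z: "z \<in> standard_simplex (Suc n)" for z
  proof -
    have "fst (s z) \<in> standard_simplex n"
    proof (rule simplexI)
      have "(\<Sum>i\<le>n. fst (s z) i) = (\<Sum>i\<le>n. z i + (if i = 0 then z (Suc n) else 0))"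
        by (rule sum.cong) (auto simp: s_def)
      also have "\<dots> = 1" using simplex_sum_less[OF z] by (simp add: sum.distrib sum.delta)
      finally show "(\<Sum>i\<le>n. fst (s z) i) = 1" .
    qed (use simplex_D[OF z] in \<open>auto simp: s_def\<close>)
    then show ?thesis using simplex_D[OF z] by (auto simp: s_def)
  qed
  have r: "continuous_on (standard_simplex n \<times> {0..1}) r"
    unfolding r_def split_beta
    by (intro continuous_on_coordinatewise_then_product) (auto intro!: continuous_intros)
  have r': "r (p, t) \<in> standard_simplex (Suc n)" if p: "p \<in> standard_simplex n" and t: "t \<in> {0..1}" for p t
  proof (rule simplexI)
    have "(\<Sum>i\<le>n. r (p, t) i) = (\<Sum>i\<le>n. p i - (if i = 0 then min t (p 0) else 0))"
      by (rule sum.cong) (auto simp: r_def)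
    also have "\<dots> = 1 - min t (p 0)" using simplex_D(4)[OF p] by (simp add: sum_subtractf sum.delta)
    finally show "(\<Sum>i\<le>Suc n. r (p, t) i) = 1" by (simp add: r_def)
  qed (use simplex_D[OF p] t in \<open>auto simp: r_def\<close>)
  have rs: "r (s z) = z" if z: "z \<in> standard_simplex (Suc n)" for z
    using simplex_D[OF z] by (auto simp: r_def s_def fun_eq_iff min_def)
  have "delta_generated (prod_topology (prod_topology X ?S) ?I)"
    by (rule delta_generated_prod_interval[OF Suc])
  then show ?case
  proof (rule delta_generated_retract)
    have cr: "continuous_map (prod_topology ?S ?I) ?S' r"
      using cm_into[OF r, of "standard_simplex (Suc n)"] r' by auto
    have cs: "continuous_map ?S' (prod_topology ?S ?I) s"
      using cm_into[OF s, of "standard_simplex n \<times> {0..1}"] s' by auto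
    let ?Z = "prod_topology (prod_topology X ?S) ?I"
    have 1: "continuous_map ?Z X (\<lambda>z. fst (fst z))" "continuous_map ?Z ?S (\<lambda>z. snd (fst z))"
      using continuous_map_compose[OF continuous_map_fst continuous_map_fst]
        continuous_map_compose[OF continuous_map_fst continuous_map_snd] by (auto simp: o_def)
    then show "continuous_map ?Z (prod_topology X ?S') (\<lambda>z. (fst (fst z), r (snd (fst z), snd z)))"
      by (intro continuous_map_prodI continuous_map_compose[OF _ cr, unfolded o_def] continuous_map_snd)
    have c2: "continuous_map (prod_topology X ?S') (prod_topology ?S ?I) (\<lambda>z. s (snd z))"
      by (intro continuous_map_compose[OF continuous_map_snd cs, unfolded o_def])
    show "continuous_map (prod_topology X ?S') (prod_topology (prod_topology X ?S) ?I) (\<lambda>z. ((fst z, fst (s (snd z))), snd (s (snd z))))"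
      using c2 unfolding continuous_map_pairwise o_def
      by (auto intro: continuous_map_fst)
    show "\<And>y. y \<in> topspace (prod_topology X ?S') \<Longrightarrow>
         (fst (fst ((fst y, fst (s (snd y))), snd (s (snd y)))),
          r (snd (fst ((fst y, fst (s (snd y))), snd (s (snd y)))), snd ((fst y, fst (s (snd y))), snd (s (snd y))))) = y"
      using rs by auto
  qed
qed

section \<open>Mapping spaces and topologies given by plots\<close>

lemma topspace_compact_open [simp]: "topspace (compact_open_topology X Y) = top_maps X Y"
proof -
  have "{f \<in> top_maps X Y. f ` {} \<subseteq> topspace Y}
      \<in> {{f \<in> top_maps X Y. f ` K \<subseteq> U} | K U. compactin X K \<and> openin Y U}"
    using compactin_empty[of X] openin_topspace[of Y] by blast
  then show ?thesis
    by (auto simp: compact_open_topology_def topology_generated_by_topspace)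
qed

lemma openin_compact_open:
  "compactin X K \<Longrightarrow> openin Y U \<Longrightarrow> openin (compact_open_topology X Y) {f \<in> top_maps X Y. f ` K \<subseteq> U}"
  unfolding compact_open_topology_def by (rule topology_generated_by_Basis) blast

lemma openin_kelleyficationI: "openin X U \<Longrightarrow> openin (kelleyfication X) U"
  by (simp add: openin_kelleyfication openin_subset openin_continuous_map_preimage)

text \<open>The coreflection property: a simplex of \<open>Z\<close> followed by \<open>f\<close> is
  a simplex of \<open>X\<close>, and these decide openness in the kelleyfication.\<close>

lemma continuous_map_into_kelleyfication:
  assumes "delta_generated Z" "continuous_map Z X f"
  shows "continuous_map Z (kelleyfication X) f"
  unfolding continuous_map
proof (intro conjI allI impI)
  show "f ` topspace Z \<subseteq> topspace (kelleyfication X)"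
    using assms(2) openin_subset[OF openin_kelleyficationI[OF openin_topspace]]
    by (fastforce simp: continuous_map)
  fix U assume U: "openin (kelleyfication X) U"
  show "openin Z {z \<in> topspace Z. f z \<in> U}"
  proof (rule delta_generated_openI[OF assms(1)])
    fix n \<sigma> assume \<sigma>: "cm (standard_simplex n) Z \<sigma>"
    have "openin (top_of_set (standard_simplex n)) {p \<in> standard_simplex n. f (\<sigma> p) \<in> U}"
      using U cm_post[OF \<sigma> assms(2)] by (auto simp: openin_kelleyfication top_simplex_eq)
    then show "openin (top_of_set (standard_simplex n)) {p \<in> standard_simplex n. \<sigma> p \<in> {z \<in> topspace Z. f z \<in> U}}"
      using cm_image[OF \<sigma>] by (simp cong: conj_cong)
  qed auto
qed

text \<open>One half of the exponential law. The compact set required by the compact-open topology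
  is supplied by the source, as the image under \<open>t\<close> of a compact neighbourhood in
  \<open>Z\<close>, so \<open>X\<close> may be any space.\<close>

lemma continuous_map_evaluation:
  assumes \<Phi>: "continuous_map P (TOP X Y) \<Phi>"
    and Z: "locally_compact_space Z" "Hausdorff_space Z"
    and s: "continuous_map Z P s" and t: "continuous_map Z X t"
  shows "continuous_map Z Y (\<lambda>z. \<Phi> (s z) (t z))"
proof -
  have \<Phi>s: "continuous_map Z (TOP X Y) (\<lambda>z. \<Phi> (s z))"
    using continuous_map_compose[OF s \<Phi>] by (simp add: o_def)
  then have mem: "\<Phi> (s z) \<in> top_maps X Y" if "z \<in> topspace Z" for z
    using that continuous_map_image_subset_topspace by fastforce
  have tz: "t z \<in> topspace X" if "z \<in> topspace Z" for z
    using that t continuous_map_image_subset_topspace by fastforce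
  show ?thesis
    unfolding continuous_map
  proof (intro conjI allI impI)
    show "(\<lambda>z. \<Phi> (s z) (t z)) ` topspace Z \<subseteq> topspace Y"
      using mem tz by (fastforce simp: top_maps_def continuous_map)
    fix U assume U: "openin Y U"
    show "openin Z {z \<in> topspace Z. \<Phi> (s z) (t z) \<in> U}"
    proof (subst openin_subopen, intro ballI)
      fix z0 assume z0: "z0 \<in> {z \<in> topspace Z. \<Phi> (s z) (t z) \<in> U}"
      have "continuous_map Z Y (\<lambda>z. \<Phi> (s z0) (t z))"
        using continuous_map_compose[OF t, of Y "\<Phi> (s z0)"] mem z0 by (simp add: o_def top_maps_def)
      then have "openin Z {z \<in> topspace Z. \<Phi> (s z0) (t z) \<in> U}"
        using U openin_continuous_map_preimage by blast
      moreover have "neighbourhood_base_of (compactin Z) Z"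
        using Z locally_compact_space_neighbourhood_base by blast
      ultimately obtain V K where VK: "openin Z V" "compactin Z K" "z0 \<in> V" "V \<subseteq> K"
        "K \<subseteq> {z \<in> topspace Z. \<Phi> (s z0) (t z) \<in> U}"
        using z0 unfolding neighbourhood_base_of by (metis (no_types, lifting) mem_Collect_eq)
      define W where "W = {f \<in> top_maps X Y. f ` (t ` K) \<subseteq> U}"
      have "openin (TOP X Y) W"
        unfolding W_def TOP_def
        by (intro openin_kelleyficationI openin_compact_open U image_compactin[OF VK(2) t])
      then have "openin Z (V \<inter> {z \<in> topspace Z. \<Phi> (s z) \<in> W})"
        using VK(1) openin_continuous_map_preimage[OF \<Phi>s] by blast
      moreover have "z0 \<in> V \<inter> {z \<in> topspace Z. \<Phi> (s z) \<in> W}"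
        using z0 VK mem by (auto simp: W_def)
      moreover have "V \<inter> {z \<in> topspace Z. \<Phi> (s z) \<in> W} \<subseteq> {z \<in> topspace Z. \<Phi> (s z) (t z) \<in> U}"
        using VK(4) by (auto simp: W_def image_subset_iff subset_eq)
      ultimately show "\<exists>T. openin Z T \<and> z0 \<in> T \<and> T \<subseteq> {z \<in> topspace Z. \<Phi> (s z) (t z) \<in> U}"
        by blast
    qed
  qed
qed

lemma compact_standard_simplex: "compact (standard_simplex n)"
proof -
  have "compactin (powertop_real UNIV) (standard_simplex n)"
    by (rule compactin_standard_simplex)
  then show ?thesis by (simp add: euclidean_product_topology)
qed

text \<open>
  The final topology for a family of maps out of simplices.  It is \<open>\<Delta>\<close>-generated, but simplices
  continuous for it need not belong to the family.
\<close>

definition plot_topology :: "'a set \<Rightarrow> (nat \<Rightarrow> ((nat \<Rightarrow> real) \<Rightarrow> 'a) \<Rightarrow> bool) \<Rightarrow> 'a topology" where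
  "plot_topology S Pl = topology (\<lambda>U. U \<subseteq> S \<and> (\<forall>n \<sigma>. Pl n \<sigma> \<longrightarrow>
      openin (top_of_set (standard_simplex n)) {p \<in> standard_simplex n. \<sigma> p \<in> U}))"

lemma openin_plot_topology:
  "openin (plot_topology S Pl) U \<longleftrightarrow> U \<subseteq> S \<and> (\<forall>n \<sigma>. Pl n \<sigma> \<longrightarrow>
      openin (top_of_set (standard_simplex n)) {p \<in> standard_simplex n. \<sigma> p \<in> U})"
proof -
  let ?P = "\<lambda>U. U \<subseteq> S \<and> (\<forall>n \<sigma>. Pl n \<sigma> \<longrightarrow>
      openin (top_of_set (standard_simplex n)) {p \<in> standard_simplex n. \<sigma> p \<in> U})"
  have "istopology ?P"
    unfolding istopology_def
  proof (intro conjI allI impI)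
    fix U V n \<sigma>
    assume "?P U" "?P V" "Pl n \<sigma>"
    then have "openin (top_of_set (standard_simplex n))
        ({p \<in> standard_simplex n. \<sigma> p \<in> U} \<inter> {p \<in> standard_simplex n. \<sigma> p \<in> V})"
      by (intro openin_Int) auto
    moreover have "{p \<in> standard_simplex n. \<sigma> p \<in> U} \<inter> {p \<in> standard_simplex n. \<sigma> p \<in> V}
        = {p \<in> standard_simplex n. \<sigma> p \<in> U \<inter> V}" by auto
    ultimately show "openin (top_of_set (standard_simplex n)) {p \<in> standard_simplex n. \<sigma> p \<in> U \<inter> V}" by simp
  next
    fix \<K> n \<sigma>
    assume "\<forall>K\<in>\<K>. ?P K" "Pl n \<sigma>"
    then have "openin (top_of_set (standard_simplex n)) (\<Union>K\<in>\<K>. {p \<in> standard_simplex n. \<sigma> p \<in> K})"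
      by (intro openin_Union) auto
    moreover have "(\<Union>K\<in>\<K>. {p \<in> standard_simplex n. \<sigma> p \<in> K})
        = {p \<in> standard_simplex n. \<sigma> p \<in> \<Union>\<K>}" by auto
    ultimately show "openin (top_of_set (standard_simplex n)) {p \<in> standard_simplex n. \<sigma> p \<in> \<Union>\<K>}" by simp
  qed auto
  then show ?thesis
    unfolding plot_topology_def by (simp add: topology_inverse')
qed

text \<open>Only constants and reparametrisations are required, no gluing. Membership in the family
  can thus be defined by continuity of several components at once.\<close>

locale plot_space =
  fixes S :: "'a set" and Pl :: "nat \<Rightarrow> ((nat \<Rightarrow> real) \<Rightarrow> 'a) \<Rightarrow> bool"
  assumes plot_in: "Pl n \<sigma> \<Longrightarrow> p \<in> standard_simplex n \<Longrightarrow> \<sigma> p \<in> S"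
    and plot_const: "x \<in> S \<Longrightarrow> Pl n (\<lambda>_. x)"
    and plot_comp: "Pl n \<sigma> \<Longrightarrow> continuous_on (standard_simplex m) \<theta> \<Longrightarrow>
        (\<And>p. p \<in> standard_simplex m \<Longrightarrow> \<theta> p \<in> standard_simplex n) \<Longrightarrow> Pl m (\<lambda>p. \<sigma> (\<theta> p))"
begin

lemma topspace_plot [simp]: "topspace (plot_topology S Pl) = S"
proof
  show "topspace (plot_topology S Pl) \<subseteq> S"
    using openin_topspace[of "plot_topology S Pl"] unfolding openin_plot_topology by blast
  have "{p \<in> standard_simplex n. \<sigma> p \<in> S} = standard_simplex n" if "Pl n \<sigma>" for n \<sigma>
    using plot_in[OF that] by auto
  then have "openin (plot_topology S Pl) S"
    unfolding openin_plot_topology by simp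
  then show "S \<subseteq> topspace (plot_topology S Pl)" by (rule openin_subset)
qed

lemma plot_cm: "Pl n \<sigma> \<Longrightarrow> cm (standard_simplex n) (plot_topology S Pl) \<sigma>"
  unfolding continuous_map using plot_in by (auto simp: openin_plot_topology)

lemma delta_generated_plot: "delta_generated (plot_topology S Pl)"
  unfolding delta_generated_iff using plot_cm by (simp add: openin_plot_topology)

lemma continuous_map_from_plot:
  assumes "\<And>x. x \<in> S \<Longrightarrow> f x \<in> topspace Y"
    and "\<And>n \<sigma>. Pl n \<sigma> \<Longrightarrow> cm (standard_simplex n) Y (\<lambda>p. f (\<sigma> p))"
  shows "continuous_map (plot_topology S Pl) Y f"
  unfolding continuous_map
proof (intro conjI allI impI)
  fix U assume U: "openin Y U"
  have "openin (top_of_set (standard_simplex n)) {p \<in> standard_simplex n. \<sigma> p \<in> {x \<in> S. f x \<in> U}}"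
    if \<sigma>: "Pl n \<sigma>" for n \<sigma>
  proof -
    have "{p \<in> standard_simplex n. \<sigma> p \<in> {x \<in> S. f x \<in> U}} = {p \<in> standard_simplex n. f (\<sigma> p) \<in> U}"
      using plot_in[OF \<sigma>] by auto
    then show ?thesis
      using openin_continuous_map_preimage[OF assms(2)[OF \<sigma>] U] by simp
  qed
  then show "openin (plot_topology S Pl) {x \<in> topspace (plot_topology S Pl). f x \<in> U}"
    by (simp add: openin_plot_topology)
qed (use assms(1) in auto)

lemma continuous_map_into_plot:
  assumes Z: "delta_generated Z" and "\<And>z. z \<in> topspace Z \<Longrightarrow> f z \<in> S"
    and "\<And>n \<sigma>. cm (standard_simplex n) Z \<sigma> \<Longrightarrow> Pl n (\<lambda>p. f (\<sigma> p))"
  shows "continuous_map Z (plot_topology S Pl) f"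
  by (rule delta_generated_continuous[OF Z]) (use assms plot_cm in auto)

text \<open>The tube argument for products with the interval again, now with a compact neighbourhood
  in \<open>Z\<close> and with plots in place of all continuous simplices. Plots suffice because
  they determine the open sets of the first factor.\<close>

lemma continuous_map_plot_prod:
  assumes Z: "locally_compact_space Z" "Hausdorff_space Z"
    and x: "\<And>x. x \<in> S \<Longrightarrow> continuous_map Z Y (\<lambda>z. f (x, z))"
    and pl: "\<And>n \<tau>. Pl n \<tau> \<Longrightarrow> continuous_map (prod_topology (top_of_set (standard_simplex n)) Z) Y (\<lambda>(q, z). f (\<tau> q, z))"
  shows "continuous_map (prod_topology (plot_topology S Pl) Z) Y f"
  unfolding continuous_map
proof (intro conjI allI impI)
  let ?X = "plot_topology S Pl"
  show "f ` topspace (prod_topology ?X Z) \<subseteq> topspace Y"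
    using x continuous_map_image_subset_topspace by fastforce
  fix U assume U: "openin Y U"
  show "openin (prod_topology ?X Z) {xz \<in> topspace (prod_topology ?X Z). f xz \<in> U}"
    unfolding openin_prod_topology_alt
  proof (intro allI impI)
    fix x0 z0 assume "(x0, z0) \<in> {xz \<in> topspace (prod_topology ?X Z). f xz \<in> U}"
    then have x0: "x0 \<in> S" and z0: "z0 \<in> topspace Z" and fU: "f (x0, z0) \<in> U" by auto
    have "openin Z {z \<in> topspace Z. f (x0, z) \<in> U}"
      using openin_continuous_map_preimage[OF x[OF x0] U] .
    moreover have "neighbourhood_base_of (compactin Z) Z"
      using Z locally_compact_space_neighbourhood_base by blast
    ultimately obtain V K where VK: "openin Z V" "compactin Z K" "z0 \<in> V" "V \<subseteq> K"
      "K \<subseteq> {z \<in> topspace Z. f (x0, z) \<in> U}"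
      using z0 fU unfolding neighbourhood_base_of by (metis (no_types, lifting) mem_Collect_eq)
    define Om where "Om = {x \<in> S. \<forall>z\<in>K. f (x, z) \<in> U}"
    have "openin ?X Om"
      unfolding openin_plot_topology
    proof (intro conjI allI impI)
      fix n \<tau> assume \<tau>: "Pl n \<tau>"
      let ?S = "top_of_set (standard_simplex n)"
      define W where "W = {w \<in> topspace (prod_topology ?S Z). (case w of (q, z) \<Rightarrow> f (\<tau> q, z)) \<in> U}"
      have W: "openin (prod_topology ?S Z) W"
        unfolding W_def by (rule openin_continuous_map_preimage[OF pl[OF \<tau>] U])
      show "openin ?S {p \<in> standard_simplex n. \<tau> p \<in> Om}"
      proof (subst openin_subopen, intro ballI)
        fix p assume p: "p \<in> {p \<in> standard_simplex n. \<tau> p \<in> Om}"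
        have "{p} \<times> K \<subseteq> W" using p compactin_subset_topspace[OF VK(2)] by (auto simp: W_def Om_def)
        then obtain A B where AB: "openin ?S A" "p \<in> A" "K \<subseteq> B" "A \<times> B \<subseteq> W"
          using tube_lemma_right[OF W VK(2), of p] p by auto
        then have "A \<subseteq> {p \<in> standard_simplex n. \<tau> p \<in> Om}"
          using plot_in[OF \<tau>] openin_subset[OF AB(1)] by (auto simp: W_def Om_def subset_eq Ball_def)
        then show "\<exists>T. openin ?S T \<and> p \<in> T \<and> T \<subseteq> {p \<in> standard_simplex n. \<tau> p \<in> Om}"
          using AB by blast
      qed
    qed (auto simp: Om_def)
    moreover have "x0 \<in> Om" using x0 VK(5) by (auto simp: Om_def)
    moreover have "Om \<times> V \<subseteq> {xz \<in> topspace (prod_topology ?X Z). f xz \<in> U}"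
      using VK openin_subset[OF VK(1)] by (auto simp: Om_def)
    ultimately show "\<exists>A B. openin ?X A \<and> openin Z B \<and> x0 \<in> A \<and> z0 \<in> B \<and> A \<times> B \<subseteq> {xz \<in> topspace (prod_topology ?X Z). f xz \<in> U}"
      using VK by blast
  qed
qed

text \<open>The other half of the exponential law. Over a simplex of parameters the action is
  jointly continuous by the product criterion, and then subbasic sets of the compact-open topology
  have open preimages by the tube lemma. Enrichment is thereby reduced to a condition on a simplex
  and a plot over the same simplex.\<close>

lemma continuous_map_TOP:
  assumes P: "delta_generated P" and mem: "\<And>p. p \<in> topspace P \<Longrightarrow> \<Phi> p \<in> top_maps (plot_topology S Pl) Y"
    and pl: "\<And>n \<sigma> \<tau>. cm (standard_simplex n) P \<sigma> \<Longrightarrow> Pl n \<tau> \<Longrightarrow> cm (standard_simplex n) Y (\<lambda>p. \<Phi> (\<sigma> p) (\<tau> p))"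
  shows "continuous_map P (TOP (plot_topology S Pl) Y) \<Phi>"
proof (rule delta_generated_continuous[OF P])
  let ?X = "plot_topology S Pl"
  show "p \<in> topspace P \<Longrightarrow> \<Phi> p \<in> topspace (TOP ?X Y)" for p using mem by simp
  fix m \<sigma> assume \<sigma>: "cm (standard_simplex m) P \<sigma>"
  let ?D = "top_of_set (standard_simplex m)"
  have mem': "\<Phi> (\<sigma> p) \<in> top_maps ?X Y" if "p \<in> standard_simplex m" for p
    using cm_image[OF \<sigma> that] mem by blast
  have joint: "continuous_map (prod_topology ?X ?D) Y (\<lambda>(x, p). \<Phi> (\<sigma> p) x)"
  proof (rule continuous_map_plot_prod)
    show "locally_compact_space ?D"
      by (simp add: compact_imp_locally_compact_space compact_standard_simplex compact_space_subtopology)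
    show "Hausdorff_space ?D" by (simp add: Hausdorff_space_subtopology)
    show "cm (standard_simplex m) Y (\<lambda>z. case (x, z) of (x, p) \<Rightarrow> \<Phi> (\<sigma> p) x)" if "x \<in> S" for x
      using pl[OF \<sigma> plot_const[OF that]] by simp
    fix n \<tau> assume \<tau>: "Pl n \<tau>"
    \<comment> \<open>A product of two simplices is \<Delta>-generated, so the joint map may be
      tested on simplices; these pull the plot and the parameters back to one common simplex, as
      \<open>pl\<close> requires.\<close>
    have dg: "delta_generated (prod_topology (top_of_set (standard_simplex n)) ?D)"
      by (intro delta_generated_prod_simplex delta_generated_simplex)
    show "continuous_map (prod_topology (top_of_set (standard_simplex n)) ?D) Y
         (\<lambda>(q, z). case (\<tau> q, z) of (x, p) \<Rightarrow> \<Phi> (\<sigma> p) x)"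
    proof (rule delta_generated_continuous[OF dg])
      fix z assume "z \<in> topspace (prod_topology (top_of_set (standard_simplex n)) ?D)"
      then obtain q p where z: "z = (q, p)" "q \<in> standard_simplex n" "p \<in> standard_simplex m" by auto
      then show "(case z of (q, z) \<Rightarrow> case (\<tau> q, z) of (x, p) \<Rightarrow> \<Phi> (\<sigma> p) x) \<in> topspace Y"
        using mem'[of p] plot_in[OF \<tau>, of q] continuous_map_image_subset_topspace
        by (fastforce simp: top_maps_def)
    next
      fix k \<theta> assume "cm (standard_simplex k) (prod_topology (top_of_set (standard_simplex n)) ?D) \<theta>"
      then have \<theta>: "cm (standard_simplex k) (top_of_set (standard_simplex n)) (fst \<circ> \<theta>)"
        "cm (standard_simplex k) ?D (snd \<circ> \<theta>)" by (simp_all add: continuous_map_pairwise del: prod_topology_subtopology_eu)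
      have "Pl k (\<lambda>p. \<tau> (fst (\<theta> p)))"
        by (rule plot_comp[OF \<tau>]) (use \<theta>(1) in \<open>auto simp: o_def continuous_map_in_subtopology\<close>)
      moreover have "cm (standard_simplex k) P (\<lambda>p. \<sigma> (snd (\<theta> p)))"
        using continuous_map_compose[OF \<theta>(2) \<sigma>] by (simp add: o_def)
      ultimately show "cm (standard_simplex k) Y (\<lambda>p. case \<theta> p of (q, z) \<Rightarrow> case (\<tau> q, z) of (x, p) \<Rightarrow> \<Phi> (\<sigma> p) x)"
        using pl by (simp add: split_beta)
    qed
  qed
  show "cm (standard_simplex m) (TOP ?X Y) (\<lambda>p. \<Phi> (\<sigma> p))"
    unfolding TOP_def
  proof (rule continuous_map_into_kelleyfication[OF delta_generated_simplex])
    show "cm (standard_simplex m) (compact_open_topology ?X Y) (\<lambda>p. \<Phi> (\<sigma> p))"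
      unfolding compact_open_topology_def
    proof (rule continuous_on_generated_topo)
      fix B assume "B \<in> {{f \<in> top_maps ?X Y. f ` K \<subseteq> U} | K U. compactin ?X K \<and> openin Y U}"
      then obtain K U where B: "B = {f \<in> top_maps ?X Y. f ` K \<subseteq> U}" and K: "compactin ?X K" and U: "openin Y U"
        by blast
      define W where "W = {w \<in> topspace (prod_topology ?X ?D). (case w of (x, p) \<Rightarrow> \<Phi> (\<sigma> p) x) \<in> U}"
      have W: "openin (prod_topology ?X ?D) W"
        unfolding W_def by (rule openin_continuous_map_preimage[OF joint U])
      show "openin ?D ((\<lambda>p. \<Phi> (\<sigma> p)) -` B \<inter> topspace ?D)"
      proof (subst openin_subopen, intro ballI)
        fix p assume p: "p \<in> (\<lambda>p. \<Phi> (\<sigma> p)) -` B \<inter> topspace ?D"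
        have "K \<times> {p} \<subseteq> W" using p compactin_subset_topspace[OF K] by (auto simp: W_def B)
        then obtain A C where AC: "openin ?D C" "K \<subseteq> A" "p \<in> C" "A \<times> C \<subseteq> W"
          using tube_lemma_left[OF W K, of p] p by auto
        have "C \<subseteq> (\<lambda>p. \<Phi> (\<sigma> p)) -` B \<inter> topspace ?D"
          using AC(2,4) openin_subset[OF AC(1)] mem' by (auto simp: W_def B subset_eq Ball_def)
        then show "\<exists>T. openin ?D T \<and> p \<in> T \<and> T \<subseteq> (\<lambda>p. \<Phi> (\<sigma> p)) -` B \<inter> topspace ?D"
          using AC by blast
      qed
    next
      show "(\<lambda>p. \<Phi> (\<sigma> p)) ` topspace ?D \<subseteq> \<Union> {{f \<in> top_maps ?X Y. f ` K \<subseteq> U} | K U. compactin ?X K \<and> openin Y U}"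
        using topspace_compact_open[of ?X Y] mem'
        by (simp add: compact_open_topology_def topology_generated_by_topspace) blast
    qed
  qed
qed

end

section \<open>Cubes and lifting up to homotopy\<close>

declare continuous_on_coordinatewise_then_product [continuous_intros del]

primrec sup_norm :: "nat \<Rightarrow> (nat \<Rightarrow> real) \<Rightarrow> real" where
  "sup_norm 0 x = 0"
| "sup_norm (Suc n) x = max (sup_norm n x) \<bar>x n\<bar>"

lemma sup_norm_nonneg [simp]: "0 \<le> sup_norm n x"
  by (induction n) auto

lemma sup_norm_scale: "sup_norm n (\<lambda>i. c * x i) = \<bar>c\<bar> * sup_norm n x"
  by (induction n) (auto simp: abs_mult max_mult_distrib_left)

lemma sup_norm_divide: "sup_norm n (\<lambda>i. x i / c) = sup_norm n x / \<bar>c\<bar>"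
  using sup_norm_scale[of n "1 / c" x] by simp

lemma sup_norm_cong: "(\<And>i. i < n \<Longrightarrow> x i = y i) \<Longrightarrow> sup_norm n x = sup_norm n y"
  by (induction n) auto

lemma sup_norm_le_iff: "0 \<le> c \<Longrightarrow> sup_norm n x \<le> c \<longleftrightarrow> (\<forall>i<n. \<bar>x i\<bar> \<le> c)"
  by (induction n) (auto simp: less_Suc_eq)

lemma sup_norm_eq_1_iff: "sup_norm n x \<le> 1 \<Longrightarrow> sup_norm n x = 1 \<longleftrightarrow> (\<exists>i<n. \<bar>x i\<bar> = 1)"
  by (induction n) (auto simp: less_Suc_eq max_def)

lemma continuous_on_sup_norm [continuous_intros]:
  "continuous_on S f \<Longrightarrow> continuous_on S (\<lambda>z. sup_norm n (f z))"
proof (induction n)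
  case (Suc n)
  then show ?case
    by (auto intro!: continuous_intros intro: continuous_on_product_then_coordinatewise)
qed simp

text \<open>Coordinates from \<open>n\<close> on vanish, so cubes of all dimensions live in one
  type. With the sup norm, collars of the boundary have radial formulas.\<close>

definition cube :: "nat \<Rightarrow> (nat \<Rightarrow> real) set" where
  "cube n = {x. sup_norm n x \<le> 1 \<and> (\<forall>i\<ge>n. x i = 0)}"

definition cube_bd :: "nat \<Rightarrow> (nat \<Rightarrow> real) set" where
  "cube_bd n = {x \<in> cube n. sup_norm n x = 1}"

lemma cube_bd_cube: "x \<in> cube_bd n \<Longrightarrow> x \<in> cube n"
  by (simp add: cube_bd_def)

lemma cube_0: "cube 0 = {\<lambda>_. 0}" "cube_bd 0 = {}"
  by (auto simp: cube_def cube_bd_def)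

lemma zero_cube [simp]: "(\<lambda>_. 0) \<in> cube n"
  by (simp add: cube_def sup_norm_le_iff)

lemma compact_cube: "compact (cube n)"
proof -
  have "compactin (powertop_real UNIV) (PiE UNIV (\<lambda>i. if i < n then {-1..1} else {0}))"
    by (subst compactin_PiE) auto
  moreover have "PiE UNIV (\<lambda>i. if i < n then {-1..1} else {0}) = cube n"
    by (auto simp: cube_def sup_norm_le_iff PiE_iff abs_le_iff Ball_def split: if_splits)
  ultimately show ?thesis by (simp add: euclidean_product_topology)
qed

text \<open>Pairs that may replace a cube and its boundary: prisms over cubes and integer
  boxes.\<close>

definition is_cell :: "nat \<Rightarrow> 'b::topological_space set \<Rightarrow> 'b set \<Rightarrow> bool" where
  "is_cell n Q S \<longleftrightarrow> (\<exists>\<phi> \<psi>. homeomorphism (cube n) Q \<phi> \<psi> \<and> \<phi> ` cube_bd n = S)"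

lemma is_cellE:
  assumes "is_cell n Q S"
  obtains \<phi> \<psi> where "continuous_on (cube n) \<phi>" "continuous_on Q \<psi>"
    "\<And>x. x \<in> cube n \<Longrightarrow> \<phi> x \<in> Q" "\<And>x. x \<in> Q \<Longrightarrow> \<psi> x \<in> cube n"
    "\<And>x. x \<in> cube n \<Longrightarrow> \<psi> (\<phi> x) = x" "\<And>x. x \<in> Q \<Longrightarrow> \<phi> (\<psi> x) = x"
    "\<And>x. x \<in> cube_bd n \<Longrightarrow> \<phi> x \<in> S" "\<And>x. x \<in> S \<Longrightarrow> \<psi> x \<in> cube_bd n" "S \<subseteq> Q"
proof -
  obtain \<phi> \<psi> where h: "homeomorphism (cube n) Q \<phi> \<psi>" "\<phi> ` cube_bd n = S"
    using assms unfolding is_cell_def by blast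
  show thesis
    by (rule that[of \<phi> \<psi>]) (use h cube_bd_cube in \<open>auto simp: homeomorphism_def\<close>)
qed

lemma is_cellI:
  assumes "continuous_on (cube n) \<phi>" "continuous_on Q \<psi>"
    "\<And>x. x \<in> cube n \<Longrightarrow> \<phi> x \<in> Q" "\<And>x. x \<in> Q \<Longrightarrow> \<psi> x \<in> cube n"
    "\<And>x. x \<in> cube n \<Longrightarrow> \<psi> (\<phi> x) = x" "\<And>x. x \<in> Q \<Longrightarrow> \<phi> (\<psi> x) = x"
    "\<And>x. x \<in> cube_bd n \<Longrightarrow> \<phi> x \<in> S" "\<And>x. x \<in> S \<Longrightarrow> \<psi> x \<in> cube_bd n" "S \<subseteq> Q"
  shows "is_cell n Q S"
proof -
  have "homeomorphism (cube n) Q \<phi> \<psi>"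
    by (rule homeomorphismI) (use assms in auto)
  moreover have "x \<in> \<phi> ` cube_bd n" if "x \<in> S" for x
  proof (rule image_eqI)
    show "x = \<phi> (\<psi> x)" "\<psi> x \<in> cube_bd n" using that assms by auto
  qed
  then have "\<phi> ` cube_bd n = S" using assms(7) by blast
  ultimately show ?thesis unfolding is_cell_def by blast
qed

lemma is_cell_prod:
  "is_cell (Suc n) (cube n \<times> {0..1::real}) (cube_bd n \<times> {0..1} \<union> cube n \<times> {0, 1})"
proof (rule is_cellI)
  let ?\<phi> = "\<lambda>x. (\<lambda>i. if i < n then x i else 0 :: real, (x n + 1) / 2)"
  let ?\<psi> = "\<lambda>z i. if i = n then 2 * snd z - 1 else (fst z) i"
  show "continuous_on (cube (Suc n)) ?\<phi>"
    by (intro continuous_on_Pair continuous_on_coordinatewise_then_product) (auto intro!: continuous_intros)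
  show "continuous_on (cube n \<times> {0..1}) ?\<psi>"
    by (intro continuous_on_coordinatewise_then_product) (auto intro!: continuous_intros)
  have n1: "sup_norm n (\<lambda>i. if i < n then x i else 0) = sup_norm n x" for x by (rule sup_norm_cong) auto
  have n2: "sup_norm n (?\<psi> z) = sup_norm n (fst z)" for z by (rule sup_norm_cong) auto
  show "?\<phi> x \<in> cube n \<times> {0..1}" if "x \<in> cube (Suc n)" for x
    using that by (auto simp: cube_def n1)
  show "?\<psi> x \<in> cube (Suc n)" if "x \<in> cube n \<times> {0..1}" for x
    using that by (auto simp: cube_def n2)
  show "?\<psi> (?\<phi> x) = x" if "x \<in> cube (Suc n)" for x
    using that by (auto simp: cube_def fun_eq_iff field_simps)
  show "?\<phi> (?\<psi> x) = x" if "x \<in> cube n \<times> {0..1}" for x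
    using that by (cases x) (auto simp: cube_def fun_eq_iff)
  show "?\<phi> x \<in> cube_bd n \<times> {0..1} \<union> cube n \<times> {0, 1}" if "x \<in> cube_bd (Suc n)" for x
    using that by (auto simp: cube_def cube_bd_def n1 max_def abs_if split: if_splits)
  show "?\<psi> x \<in> cube_bd (Suc n)" if "x \<in> cube_bd n \<times> {0..1} \<union> cube n \<times> {0, 1}" for x
    using that by (auto simp: cube_def cube_bd_def n2 max_def abs_if split: if_splits)
  show "cube_bd n \<times> {0..1} \<union> cube n \<times> {0, 1} \<subseteq> cube n \<times> {0..1::real}"
    using cube_bd_cube by auto
qed

section \<open>Squares and their lifts up to homotopy\<close>

definition lifting_square :: "'b::topological_space set \<Rightarrow> 'b set \<Rightarrow> 'x topology \<Rightarrow> 'y topology \<Rightarrow> ('x \<Rightarrow> 'y)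
    \<Rightarrow> ('b \<Rightarrow> 'x) \<Rightarrow> ('b \<Rightarrow> 'y) \<Rightarrow> bool" where
  "lifting_square Q S X Y f u v \<longleftrightarrow> cm S X u \<and> cm Q Y v \<and> (\<forall>q\<in>S. f (u q) = v q)"

definition homotopy_lift :: "'b::topological_space set \<Rightarrow> 'b set \<Rightarrow> 'x topology \<Rightarrow> 'y topology \<Rightarrow> ('x \<Rightarrow> 'y)
    \<Rightarrow> ('b \<Rightarrow> 'x) \<Rightarrow> ('b \<Rightarrow> 'y) \<Rightarrow> bool" where
  "homotopy_lift Q S X Y f u v \<longleftrightarrow> (\<exists>h L. cm Q X h \<and> (\<forall>q\<in>S. h q = u q) \<and> cm (Q \<times> {0..1::real}) Y L \<and>
     (\<forall>q\<in>Q. L (q, 0) = f (h q) \<and> L (q, 1) = v q) \<and> (\<forall>q\<in>S. \<forall>t\<in>{0..1}. L (q, t) = v q))"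

definition weak_lifting :: "'x topology \<Rightarrow> 'y topology \<Rightarrow> ('x \<Rightarrow> 'y) \<Rightarrow> bool" where
  "weak_lifting X Y f \<longleftrightarrow> (\<forall>n u v. lifting_square (cube n) (cube_bd n) X Y f u v \<longrightarrow> homotopy_lift (cube n) (cube_bd n) X Y f u v)"

lemma homotopy_lift_cong:
  assumes "\<And>q. q \<in> S \<Longrightarrow> u q = u' q" "\<And>q. q \<in> Q \<Longrightarrow> v q = v' q" "S \<subseteq> Q"
    and "homotopy_lift Q S X Y f u v"
  shows "homotopy_lift Q S X Y f u' v'"
proof -
  have "\<forall>q\<in>S. v q = v' q" using assms(2,3) by auto
  then show ?thesis using assms unfolding homotopy_lift_def by (simp cong: ball_cong)
qed

text \<open>A one-sided inverse suffices: the lift and its homotopy are pulled back along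
  \<open>\<psi>\<close>, and \<open>\<phi> (\<psi> x) = x\<close> restores the original
  square.\<close>

lemma homotopy_lift_transfer:
  assumes "homotopy_lift Q S X Y f (\<lambda>x. u (\<phi> x)) (\<lambda>x. v (\<phi> x))"
    and "continuous_on Q' \<psi>" "\<And>x. x \<in> Q' \<Longrightarrow> \<psi> x \<in> Q" "\<And>x. x \<in> Q' \<Longrightarrow> \<phi> (\<psi> x) = x"
    and "\<And>x. x \<in> S' \<Longrightarrow> \<psi> x \<in> S" "S' \<subseteq> Q'"
  shows "homotopy_lift Q' S' X Y f u v"
proof -
  obtain h L where hL: "cm Q X h" "\<forall>q\<in>S. h q = u (\<phi> q)" "cm (Q \<times> {0..1::real}) Y L"
    "\<forall>q\<in>Q. L (q, 0) = f (h q) \<and> L (q, 1) = v (\<phi> q)" "\<forall>q\<in>S. \<forall>t\<in>{0..1}. L (q, t) = v (\<phi> q)"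
    using assms(1) unfolding homotopy_lift_def by blast
  have c: "continuous_on (Q' \<times> {0..1::real}) (\<lambda>z. (\<psi> (fst z), snd z))"
    by (intro continuous_intros continuous_on_compose2[OF assms(2)]) auto
  have "cm Q' X (\<lambda>x. h (\<psi> x))" using cm_compose[OF hL(1) assms(2,3)] .
  moreover have "cm (Q' \<times> {0..1::real}) Y (\<lambda>z. L (\<psi> (fst z), snd z))"
    by (rule cm_compose[OF hL(3) c]) (use assms(3) in auto)
  ultimately show ?thesis
    unfolding homotopy_lift_def using hL(2,4,5) assms(3-6)
    by (intro exI[of _ "\<lambda>x. h (\<psi> x)"] exI[of _ "\<lambda>z. L (\<psi> (fst z), snd z)"]) (auto simp: subset_eq)
qed

lemma homotopy_lift_cell_iff:
  assumes "is_cell n Q S" "\<And>u v. lifting_square (cube n) (cube_bd n) X Y f u v \<Longrightarrow> homotopy_lift (cube n) (cube_bd n) X Y f u v"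
    and "lifting_square Q S X Y f u v"
  shows "homotopy_lift Q S X Y f u v"
proof -
  obtain \<phi> \<psi> where p: "continuous_on (cube n) \<phi>" "continuous_on Q \<psi>"
    "\<And>x. x \<in> cube n \<Longrightarrow> \<phi> x \<in> Q" "\<And>x. x \<in> Q \<Longrightarrow> \<psi> x \<in> cube n"
    "\<And>x. x \<in> cube n \<Longrightarrow> \<psi> (\<phi> x) = x" "\<And>x. x \<in> Q \<Longrightarrow> \<phi> (\<psi> x) = x"
    "\<And>x. x \<in> cube_bd n \<Longrightarrow> \<phi> x \<in> S" "\<And>x. x \<in> S \<Longrightarrow> \<psi> x \<in> cube_bd n" "S \<subseteq> Q"
    by (rule is_cellE[OF assms(1)]; rule that)
  have "cm (cube_bd n) X (\<lambda>x. u (\<phi> x))" "cm (cube n) Y (\<lambda>x. v (\<phi> x))"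
    using assms(3) p(1,3,7) cube_bd_cube unfolding lifting_square_def
    by (auto intro!: cm_compose[of S X u] cm_compose[of Q Y v] intro: continuous_on_subset)
  then have "lifting_square (cube n) (cube_bd n) X Y f (\<lambda>x. u (\<phi> x)) (\<lambda>x. v (\<phi> x))"
    using assms(3) p(7) by (auto simp: lifting_square_def)
  then show ?thesis
    by (rule homotopy_lift_transfer[OF assms(2) p(2,4,6,8,9)])
qed

lemma weak_lifting_cell:
  "weak_lifting X Y f \<Longrightarrow> is_cell n Q S \<Longrightarrow> lifting_square Q S X Y f u v \<Longrightarrow> homotopy_lift Q S X Y f u v"
  using homotopy_lift_cell_iff weak_lifting_def by blast

lemma cm_concat:
  assumes "cm (Q \<times> {0..1::real}) Y A" "cm (Q \<times> {0..1::real}) Y B" "\<And>q. q \<in> Q \<Longrightarrow> A (q, 1) = B (q, 0)"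
  shows "cm (Q \<times> {0..1::real}) Y (\<lambda>z. if snd z \<le> 1/2 then A (fst z, 2 * snd z) else B (fst z, 2 * snd z - 1))"
proof (rule cm_If_le)
  show "cm {z \<in> Q \<times> {0..1}. snd z \<le> 1/2} Y (\<lambda>z. A (fst z, 2 * snd z))"
    by (rule cm_compose[OF assms(1)]) (auto intro!: continuous_intros)
  show "cm {z \<in> Q \<times> {0..1}. 1/2 \<le> snd z} Y (\<lambda>z. B (fst z, 2 * snd z - 1))"
    by (rule cm_compose[OF assms(2)]) (auto intro!: continuous_intros)
  show "A (fst x, 2 * snd x) = B (fst x, 2 * snd x - 1)" if "x \<in> Q \<times> {0..1}" "snd x = 1/2" for x
    unfolding that(2) using assms(3)[of "fst x"] that(1) by auto
qed (auto intro!: continuous_intros)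

text \<open>Enlarges the inner cube of radius \<open>c\<close> to the whole cube and pushes the
  collar outside it radially onto the boundary. It serves to trade a collar for a time
  parameter.\<close>

definition shrink :: "nat \<Rightarrow> real \<Rightarrow> (nat \<Rightarrow> real) \<Rightarrow> nat \<Rightarrow> real" where
  "shrink n c y = (\<lambda>i. y i / max c (sup_norm n y))"

lemma continuous_on_shrink:
  assumes "continuous_on S c" "continuous_on S y" "\<And>z. z \<in> S \<Longrightarrow> c z > 0"
  shows "continuous_on S (\<lambda>z. shrink n (c z) (y z))"
  unfolding shrink_def
proof (rule continuous_on_coordinatewise_then_product)
  fix i
  have "continuous_on S (\<lambda>x. y x i)" by (rule continuous_on_product_then_coordinatewise[OF assms(2)])
  moreover have "\<forall>x\<in>S. max (c x) (sup_norm n (y x)) \<noteq> 0"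
    using assms(3) by (metis less_max_iff_disj less_numeral_extra(3))
  ultimately show "continuous_on S (\<lambda>z. y z i / max (c z) (sup_norm n (y z)))"
    by (intro continuous_on_divide continuous_on_max continuous_on_sup_norm assms)
qed

lemma shrink_cube: "y \<in> cube n \<Longrightarrow> c > 0 \<Longrightarrow> shrink n c y \<in> cube n"
  by (auto simp: shrink_def cube_def sup_norm_divide divide_le_eq max_def)

lemma shrink_cube_bd: "y \<in> cube n \<Longrightarrow> c > 0 \<Longrightarrow> c \<le> sup_norm n y \<Longrightarrow> shrink n c y \<in> cube_bd n"
  using shrink_cube[of y n c] by (auto simp: cube_bd_def shrink_def sup_norm_divide max_def)

lemma shrink_id: "y \<in> cube n \<Longrightarrow> shrink n 1 y = y"
  by (auto simp: shrink_def cube_def max_def)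

lemma shrink_cube_bd_id: "y \<in> cube_bd n \<Longrightarrow> c \<le> 1 \<Longrightarrow> shrink n c y = y"
  by (auto simp: shrink_def cube_bd_def max_def)

lemma sup_norm_le1: "y \<in> cube n \<Longrightarrow> sup_norm n y \<le> 1"
  by (simp add: cube_def)

text \<open>The solution for time 1 is placed on the inner cube of radius 1/2, and the collar around
  it runs \<open>U\<close> from time 1 at the inner edge back to time 0 at the boundary.\<close>

lemma homotopy_lift_homotopy_cube:
  assumes f: "continuous_map X Y f"
    and U: "cm (cube_bd n \<times> {0..1::real}) X U" and V: "cm (cube n \<times> {0..1::real}) Y V"
    and UV: "\<And>q t. q \<in> cube_bd n \<Longrightarrow> t \<in> {0..1} \<Longrightarrow> f (U (q, t)) = V (q, t)"
    and s: "homotopy_lift (cube n) (cube_bd n) X Y f (\<lambda>q. U (q, 1)) (\<lambda>q. V (q, 1))"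
  shows "homotopy_lift (cube n) (cube_bd n) X Y f (\<lambda>q. U (q, 0)) (\<lambda>q. V (q, 0))"
proof -
  obtain h L where h: "cm (cube n) X h" and hU: "\<And>q. q \<in> cube_bd n \<Longrightarrow> h q = U (q, 1)"
    and L: "cm (cube n \<times> {0..1::real}) Y L" and L01: "\<And>q. q \<in> cube n \<Longrightarrow> L (q, 0) = f (h q) \<and> L (q, 1) = V (q, 1)"
    and Lb: "\<And>q t. q \<in> cube_bd n \<Longrightarrow> t \<in> {0..1} \<Longrightarrow> L (q, t) = V (q, 1)"
    using s unfolding homotopy_lift_def by blast
  let ?r = "\<lambda>y. shrink n (1/2) y"
  define h' where "h' = (\<lambda>y. if sup_norm n y \<le> 1/2 then h (?r y) else U (?r y, 2 - 2 * sup_norm n y))"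
  \<comment> \<open>First half of the homotopy: \<open>L\<close> on the inner cube, with the collar
    held still.\<close>
  define A where "A = (\<lambda>z. if sup_norm n (fst z) \<le> 1/2 then L (?r (fst z), snd z) else V (?r (fst z), 2 - 2 * sup_norm n (fst z)))"
  \<comment> \<open>Second half: the inner cube grows to radius 1 while the time is capped by
    \<open>1 - snd z\<close>; at the end the collar has vanished and \<open>V\<close> stands at time
    0.\<close>
  define B where "B = (\<lambda>z. V (shrink n ((1 + snd z)/2) (fst z), min (1 - snd z) (2 - 2 * sup_norm n (fst z))))"
  have h': "cm (cube n) X h'"
    unfolding h'_def
  proof (rule cm_If_le)
    show "cm {x \<in> cube n. sup_norm n x \<le> 1/2} X (\<lambda>y. h (?r y))"
      by (rule cm_compose[OF h continuous_on_shrink]) (auto intro!: continuous_intros shrink_cube)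
    show "cm {x \<in> cube n. 1/2 \<le> sup_norm n x} X (\<lambda>y. U (?r y, 2 - 2 * sup_norm n y))"
      by (rule cm_compose[OF U]) (auto intro!: continuous_intros continuous_on_shrink shrink_cube_bd sup_norm_le1)
    show "h (?r x) = U (?r x, 2 - 2 * sup_norm n x)" if "x \<in> cube n" "sup_norm n x = 1/2" for x
      unfolding that(2) using hU[OF shrink_cube_bd[of x n "1/2"]] that by simp
  qed (auto intro!: continuous_intros)
  have A: "cm (cube n \<times> {0..1}) Y A"
    unfolding A_def
  proof (rule cm_If_le)
    show "cm {x \<in> cube n \<times> {0..1}. sup_norm n (fst x) \<le> 1/2} Y (\<lambda>z. L (?r (fst z), snd z))"
      by (rule cm_compose[OF L]) (auto intro!: continuous_intros continuous_on_shrink shrink_cube)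
    show "cm {x \<in> cube n \<times> {0..1}. 1/2 \<le> sup_norm n (fst x)} Y (\<lambda>z. V (?r (fst z), 2 - 2 * sup_norm n (fst z)))"
      by (rule cm_compose[OF V]) (auto intro!: continuous_intros continuous_on_shrink shrink_cube sup_norm_le1)
    show "L (?r (fst x), snd x) = V (?r (fst x), 2 - 2 * sup_norm n (fst x))"
      if "x \<in> cube n \<times> {0..1}" "sup_norm n (fst x) = 1/2" for x
      unfolding that(2) using Lb[OF shrink_cube_bd[of "fst x" n "1/2"], of "snd x"] that by auto
  qed (auto intro!: continuous_intros)
  have B: "cm (cube n \<times> {0..1}) Y B"
    unfolding B_def
    by (rule cm_compose[OF V])
      (auto intro!: continuous_intros continuous_on_shrink continuous_on_min shrink_cube sup_norm_le1 simp: min_le_iff_disj)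
  define K where "K = (\<lambda>z. if snd z \<le> 1/2 then A (fst z, 2 * snd z) else B (fst z, 2 * snd z - 1))"
  have AB: "A (q, 1) = B (q, 0)" if q: "q \<in> cube n" for q
    using L01[OF shrink_cube[OF q, of "1/2"]] by (auto simp: A_def B_def min_def)
  have K: "cm (cube n \<times> {0..1}) Y K"
    unfolding K_def by (rule cm_concat[OF A B AB])
  show ?thesis
    unfolding homotopy_lift_def
  proof (intro exI conjI ballI)
    show "cm (cube n) X h'" by (rule h')
    show "cm (cube n \<times> {0..1}) Y K" by (rule K)
    show "h' q = U (q, 0)" if "q \<in> cube_bd n" for q
      using that shrink_cube_bd_id[OF that, of "1/2"] by (simp add: h'_def cube_bd_def)
    show "K (q, 0) = f (h' q)" if q: "q \<in> cube n" for q
      using L01[OF shrink_cube[OF q, of "1/2"]] UV[OF shrink_cube_bd[OF q, of "1/2"], of "2 - 2 * sup_norm n q"] sup_norm_le1[OF q]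
      by (auto simp: K_def A_def h'_def)
    show "K (q, 1) = V (q, 0)" if q: "q \<in> cube n" for q
      using shrink_id[OF q] sup_norm_le1[OF q] by (simp add: K_def B_def)
    show "K (q, t) = V (q, 0)" if q: "q \<in> cube_bd n" and t: "t \<in> {0..1}" for q t
      using q t shrink_cube_bd_id[OF q] by (auto simp: K_def A_def B_def cube_bd_def)
  qed
qed

lemma homotopy_lift_homotopy:
  assumes c: "is_cell n Q S" and f: "continuous_map X Y f"
    and U: "cm (S \<times> {0..1::real}) X U" and V: "cm (Q \<times> {0..1::real}) Y V"
    and UV: "\<And>q t. q \<in> S \<Longrightarrow> t \<in> {0..1} \<Longrightarrow> f (U (q, t)) = V (q, t)"
    and s: "homotopy_lift Q S X Y f (\<lambda>q. U (q, 1)) (\<lambda>q. V (q, 1))"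
  shows "homotopy_lift Q S X Y f (\<lambda>q. U (q, 0)) (\<lambda>q. V (q, 0))"
proof -
  obtain \<phi> \<psi> where p: "continuous_on (cube n) \<phi>" "continuous_on Q \<psi>"
    "\<And>x. x \<in> cube n \<Longrightarrow> \<phi> x \<in> Q" "\<And>x. x \<in> Q \<Longrightarrow> \<psi> x \<in> cube n"
    "\<And>x. x \<in> cube n \<Longrightarrow> \<psi> (\<phi> x) = x" "\<And>x. x \<in> Q \<Longrightarrow> \<phi> (\<psi> x) = x"
    "\<And>x. x \<in> cube_bd n \<Longrightarrow> \<phi> x \<in> S" "\<And>x. x \<in> S \<Longrightarrow> \<psi> x \<in> cube_bd n" "S \<subseteq> Q"
    by (rule is_cellE[OF c]; rule that)
  have b: "cube_bd n \<subseteq> cube n" using cube_bd_cube by auto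
  let ?U = "\<lambda>z. U (\<phi> (fst z), snd z)" let ?V = "\<lambda>z. V (\<phi> (fst z), snd z)"
  have "homotopy_lift (cube n) (cube_bd n) X Y f (\<lambda>q. ?U (q, 0)) (\<lambda>q. ?V (q, 0))"
  proof (rule homotopy_lift_homotopy_cube[OF f])
    show "cm (cube_bd n \<times> {0..1}) X ?U"
      by (rule cm_compose[OF U]) (auto intro!: continuous_intros p(7) continuous_on_compose2[OF p(1)] cube_bd_cube)
    show "cm (cube n \<times> {0..1}) Y ?V"
      by (rule cm_compose[OF V]) (auto intro!: continuous_intros p(3) continuous_on_compose2[OF p(1)])
    show "f (?U (q, t)) = ?V (q, t)" if "q \<in> cube_bd n" "t \<in> {0..1}" for q t
      using UV p(7) that by simp
    have "homotopy_lift (cube n) (cube_bd n) X Y f (\<lambda>q. U (\<phi> q, 1)) (\<lambda>q. V (\<phi> q, 1))"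
    proof (rule homotopy_lift_transfer[of Q S X Y f "\<lambda>q. U (\<phi> q, 1)" \<psi> "\<lambda>q. V (\<phi> q, 1)" "cube n" \<phi> "cube_bd n"])
      show "homotopy_lift Q S X Y f (\<lambda>x. U (\<phi> (\<psi> x), 1)) (\<lambda>x. V (\<phi> (\<psi> x), 1))"
        by (rule homotopy_lift_cong[OF _ _ p(9) s]) (use p(6,9) in auto)
    qed (use p b in auto)
    then show "homotopy_lift (cube n) (cube_bd n) X Y f (\<lambda>q. ?U (q, 1)) (\<lambda>q. ?V (q, 1))" by simp
  qed
  then show ?thesis
    using homotopy_lift_transfer[of "cube n" "cube_bd n" X Y f "\<lambda>q. U (q, 0)" \<phi> "\<lambda>q. V (q, 0)" Q \<psi> S] p by simp
qed

text \<open>A homotopy prescribed on the boundary by \<open>G\<close> replaces the stationary one.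
  Lifting face by face needs this, as the homotopies on lower faces are already fixed.\<close>

definition extending_lift :: "'b::topological_space set \<Rightarrow> 'b set \<Rightarrow> 'x topology \<Rightarrow> 'y topology \<Rightarrow> ('x \<Rightarrow> 'y)
    \<Rightarrow> ('b \<Rightarrow> 'x) \<Rightarrow> ('b \<times> real \<Rightarrow> 'y) \<Rightarrow> ('b \<Rightarrow> 'y) \<Rightarrow> bool" where
  "extending_lift Q S X Y f u G v \<longleftrightarrow> (\<exists>h W. cm Q X h \<and> (\<forall>q\<in>S. h q = u q) \<and> cm (Q \<times> {0..1::real}) Y W \<and>
     (\<forall>q\<in>Q. W (q, 0) = f (h q) \<and> W (q, 1) = v q) \<and> (\<forall>q\<in>S. \<forall>t\<in>{0..1}. W (q, t) = G (q, t)))"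

text \<open>The homotopy \<open>G\<close> is absorbed into a collar, which makes the square strictly
  commutative; after lifting, it is moved out of the collar into the time direction.\<close>

lemma weak_lifting_extending_lift_cube:
  assumes w: "weak_lifting X Y f" and f: "continuous_map X Y f"
    and u: "cm (cube_bd n) X u" and v: "cm (cube n) Y v" and G: "cm (cube_bd n \<times> {0..1::real}) Y G"
    and G0: "\<And>q. q \<in> cube_bd n \<Longrightarrow> G (q, 0) = f (u q)" and G1: "\<And>q. q \<in> cube_bd n \<Longrightarrow> G (q, 1) = v q"
  shows "extending_lift (cube n) (cube_bd n) X Y f u G v"
proof -
  let ?r = "\<lambda>y. shrink n (1/2) y"
  \<comment> \<open>\<open>v\<close> on the inner cube, and on the collar \<open>G\<close> from time
    1 at the inner edge to time 0 at the boundary, where it equals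
    \<open>f \<circ> u\<close>.\<close>
  define v' where "v' = (\<lambda>y. if sup_norm n y \<le> 1/2 then v (?r y) else G (?r y, 2 - 2 * sup_norm n y))"
  have v': "cm (cube n) Y v'"
    unfolding v'_def
  proof (rule cm_If_le)
    show "cm {x \<in> cube n. sup_norm n x \<le> 1/2} Y (\<lambda>y. v (?r y))"
      by (rule cm_compose[OF v continuous_on_shrink]) (auto intro!: continuous_intros shrink_cube)
    show "cm {x \<in> cube n. 1/2 \<le> sup_norm n x} Y (\<lambda>y. G (?r y, 2 - 2 * sup_norm n y))"
      by (rule cm_compose[OF G]) (auto intro!: continuous_intros continuous_on_shrink shrink_cube_bd sup_norm_le1)
    show "v (?r x) = G (?r x, 2 - 2 * sup_norm n x)" if "x \<in> cube n" "sup_norm n x = 1/2" for x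
      unfolding that(2) using G1[OF shrink_cube_bd[of x n "1/2"]] that by simp
  qed (auto intro!: continuous_intros)
  have v'b: "v' q = f (u q)" if "q \<in> cube_bd n" for q
    using that shrink_cube_bd_id[OF that, of "1/2"] G0[OF that] by (simp add: v'_def cube_bd_def)
  have "lifting_square (cube n) (cube_bd n) X Y f u v'"
    using u v' v'b by (simp add: lifting_square_def)
  then have "homotopy_lift (cube n) (cube_bd n) X Y f u v'" using w by (simp add: weak_lifting_def)
  then obtain h L where h: "cm (cube n) X h" and hu: "\<And>q. q \<in> cube_bd n \<Longrightarrow> h q = u q"
    and L: "cm (cube n \<times> {0..1::real}) Y L" and L01: "\<And>q. q \<in> cube n \<Longrightarrow> L (q, 0) = f (h q) \<and> L (q, 1) = v' q"
    and Lb: "\<And>q t. q \<in> cube_bd n \<Longrightarrow> t \<in> {0..1} \<Longrightarrow> L (q, t) = v' q"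
    unfolding homotopy_lift_def by blast
  \<comment> \<open>Rescaling leads from \<open>v'\<close> to its restriction to the inner cube,
    which is \<open>v\<close>; a boundary point crosses the collar and so traverses exactly
    \<open>G\<close>.\<close>
  define B where "B = (\<lambda>z. v' (\<lambda>i. (1 - snd z / 2) * fst z i))"
  have sc: "(\<lambda>i. (1 - s/2) * y i) \<in> cube n" if "y \<in> cube n" "s \<in> {0..1}" for y and s :: real
    using that mult_mono[of "1 - s/2" 1 "sup_norm n y" 1] by (auto simp: cube_def sup_norm_scale)
  have B: "cm (cube n \<times> {0..1}) Y B"
    unfolding B_def
    by (rule cm_compose[OF v']) (auto intro!: continuous_intros continuous_on_coordinatewise_then_product sc)
  have B0: "B (q, 0) = v' q" for q by (simp add: B_def)
  have B1: "B (q, 1) = v q" if "q \<in> cube n" for q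
  proof -
    have n: "sup_norm n (\<lambda>i. q i / 2) = sup_norm n q / 2" by (simp add: sup_norm_divide)
    then have "max (1/2) (sup_norm n (\<lambda>i. q i / 2)) = 1/2" using sup_norm_le1[OF that] by simp
    then have "?r (\<lambda>i. q i / 2) = q" by (simp add: shrink_def)
    then show ?thesis using n sup_norm_le1[OF that] by (simp add: B_def v'_def)
  qed
  have Bb: "B (q, t) = G (q, t)" if q: "q \<in> cube_bd n" and t: "t \<in> {0..1}" for q t
  proof -
    have n: "sup_norm n (\<lambda>i. (1 - t/2) * q i) = 1 - t/2" using q t by (simp add: sup_norm_scale cube_bd_def)
    then have r: "?r (\<lambda>i. (1 - t/2) * q i) = q" using t by (auto simp: shrink_def max_def)
    show ?thesis using t n r G1[OF q] by (auto simp: B_def v'_def)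
  qed
  \<comment> \<open>\<open>L\<close> followed by \<open>B\<close> has the right ends, but on the
    boundary it first waits and then runs \<open>G\<close> at double speed.\<close>
  define W' where "W' = (\<lambda>z. if snd z \<le> 1/2 then L (fst z, 2 * snd z) else B (fst z, 2 * snd z - 1))"
  have W': "cm (cube n \<times> {0..1}) Y W'"
    unfolding W'_def by (rule cm_concat[OF L B]) (use L01 B0 in auto)
  have W'0: "W' (q, 0) = f (h q)" "W' (q, 1) = v q" if "q \<in> cube n" for q
    using L01[OF that] B1[OF that] by (auto simp: W'_def)
  have W'b: "W' (q, t) = G (q, max 0 (2 * t - 1))" if q: "q \<in> cube_bd n" and t: "t \<in> {0..1}" for q t
  proof (cases "2 * t \<le> 1")
    case True
    then have "max 0 (2 * t - 1) = 0" by simp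
    then show ?thesis using Lb[OF q, of "2 * t"] True t v'b[OF q] G0[OF q] by (simp add: W'_def)
  next
    case False
    then show ?thesis using Bb[OF q, of "2 * t - 1"] t by (simp add: W'_def)
  qed
  \<comment> \<open>A collar shrinking to width 0 corrects the speed: between its inner edge at
    radius \<open>(1 + t)/2\<close> and the boundary, the time of \<open>G\<close> passes from
    \<open>max 0 (2 * t - 1)\<close> to \<open>t\<close>.\<close>
  let ?R = "\<lambda>z. shrink n ((1 + snd z)/2) (fst z)"
  define W where "W = (\<lambda>z. if sup_norm n (fst z) \<le> (1 + snd z)/2 then W' (?R z, snd z)
      else G (?R z, max 0 (snd z + 2 * sup_norm n (fst z) - 2)))"
  define h' where "h' = (\<lambda>y. if sup_norm n y \<le> 1/2 then h (?r y) else u (?r y))"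
  have h': "cm (cube n) X h'"
    unfolding h'_def
  proof (rule cm_If_le)
    show "cm {x \<in> cube n. sup_norm n x \<le> 1/2} X (\<lambda>y. h (?r y))"
      by (rule cm_compose[OF h continuous_on_shrink]) (auto intro!: continuous_intros shrink_cube)
    show "cm {x \<in> cube n. 1/2 \<le> sup_norm n x} X (\<lambda>y. u (?r y))"
      by (rule cm_compose[OF u]) (auto intro!: continuous_intros continuous_on_shrink shrink_cube_bd)
    show "h (?r x) = u (?r x)" if "x \<in> cube n" "sup_norm n x = 1/2" for x
      using hu[OF shrink_cube_bd[of x n "1/2"]] that by simp
  qed (auto intro!: continuous_intros)
  have W: "cm (cube n \<times> {0..1}) Y W"
    unfolding W_def
  proof (rule cm_If_le)
    show "cm {x \<in> cube n \<times> {0..1}. sup_norm n (fst x) \<le> (1 + snd x) / 2} Y (\<lambda>z. W' (?R z, snd z))"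
      by (rule cm_compose[OF W']) (auto intro!: continuous_intros continuous_on_shrink shrink_cube)
    show "cm {x \<in> cube n \<times> {0..1}. (1 + snd x) / 2 \<le> sup_norm n (fst x)} Y (\<lambda>z. G (?R z, max 0 (snd z + 2 * sup_norm n (fst z) - 2)))"
    proof (rule cm_compose[OF G])
      show "continuous_on {x \<in> cube n \<times> {0..1}. (1 + snd x) / 2 \<le> sup_norm n (fst x)} (\<lambda>x. (?R x, max 0 (snd x + 2 * sup_norm n (fst x) - 2)))"
        by (auto intro!: continuous_intros continuous_on_shrink continuous_on_max)
      fix z assume "z \<in> {x \<in> cube n \<times> {0..1}. (1 + snd x) / 2 \<le> sup_norm n (fst x)}"
      then show "(?R z, max 0 (snd z + 2 * sup_norm n (fst z) - 2)) \<in> cube_bd n \<times> {0..1}"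
        using sup_norm_le1[of "fst z" n] by (auto intro!: shrink_cube_bd)
    qed
    show "W' (?R x, snd x) = G (?R x, max 0 (snd x + 2 * sup_norm n (fst x) - 2))"
      if "x \<in> cube n \<times> {0..1}" "sup_norm n (fst x) = (1 + snd x) / 2" for x
    proof -
      have "?R x \<in> cube_bd n" using that by (auto intro!: shrink_cube_bd)
      moreover have "snd x + 2 * sup_norm n (fst x) - 2 = 2 * snd x - 1" using that(2) by (simp add: field_simps)
      ultimately show ?thesis using W'b[of "?R x" "snd x"] that(1) by auto
    qed
  qed (auto intro!: continuous_intros)
  show ?thesis
    unfolding extending_lift_def
  proof (intro exI conjI ballI)
    show "cm (cube n) X h'" "cm (cube n \<times> {0..1}) Y W" by (rule h' W)+
    show "h' q = u q" if "q \<in> cube_bd n" for q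
      using that shrink_cube_bd_id[OF that, of "1/2"] by (simp add: h'_def cube_bd_def)
    show "W (q, 0) = f (h' q)" if q: "q \<in> cube n" for q
      using W'0[OF shrink_cube[OF q, of "1/2"]] G0[OF shrink_cube_bd[OF q, of "1/2"]] sup_norm_le1[OF q]
      by (auto simp: W_def h'_def max_def)
    show "W (q, 1) = v q" if q: "q \<in> cube n" for q
      using shrink_id[OF q] sup_norm_le1[OF q] W'0[OF q] by (simp add: W_def)
    show "W (q, t) = G (q, t)" if q: "q \<in> cube_bd n" and t: "t \<in> {0..1}" for q t
      using shrink_cube_bd_id[OF q, of "(1 + t)/2"] q t G1[OF q] W'0[OF cube_bd_cube[OF q]] by (auto simp: W_def cube_bd_def)
  qed
qed

lemma weak_lifting_extending_lift:
  assumes c: "is_cell n Q S" and w: "weak_lifting X Y f" and f: "continuous_map X Y f"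
    and u: "cm S X u" and v: "cm Q Y v" and G: "cm (S \<times> {0..1::real}) Y G"
    and G0: "\<And>q. q \<in> S \<Longrightarrow> G (q, 0) = f (u q)" and G1: "\<And>q. q \<in> S \<Longrightarrow> G (q, 1) = v q"
  shows "extending_lift Q S X Y f u G v"
proof -
  obtain \<phi> \<psi> where p: "continuous_on (cube n) \<phi>" "continuous_on Q \<psi>"
    "\<And>x. x \<in> cube n \<Longrightarrow> \<phi> x \<in> Q" "\<And>x. x \<in> Q \<Longrightarrow> \<psi> x \<in> cube n"
    "\<And>x. x \<in> cube n \<Longrightarrow> \<psi> (\<phi> x) = x" "\<And>x. x \<in> Q \<Longrightarrow> \<phi> (\<psi> x) = x"
    "\<And>x. x \<in> cube_bd n \<Longrightarrow> \<phi> x \<in> S" "\<And>x. x \<in> S \<Longrightarrow> \<psi> x \<in> cube_bd n" "S \<subseteq> Q"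
    by (rule is_cellE[OF c]; rule that)
  have b: "cube_bd n \<subseteq> cube n" using cube_bd_cube by auto
  let ?G = "\<lambda>z. G (\<phi> (fst z), snd z)"
  have "extending_lift (cube n) (cube_bd n) X Y f (\<lambda>q. u (\<phi> q)) ?G (\<lambda>q. v (\<phi> q))"
  proof (rule weak_lifting_extending_lift_cube[OF w f])
    show "cm (cube_bd n \<times> {0..1}) Y ?G"
      by (rule cm_compose[OF G]) (auto intro!: continuous_intros p(7) continuous_on_compose2[OF p(1)] cube_bd_cube)
    show "cm (cube_bd n) X (\<lambda>q. u (\<phi> q))"
      by (rule cm_compose[OF u continuous_on_subset[OF p(1) b] p(7)])
    show "cm (cube n) Y (\<lambda>q. v (\<phi> q))"
      by (rule cm_compose[OF v p(1,3)])
  qed (use p(7) G0 G1 in auto)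
  then obtain h W where hW: "cm (cube n) X h" "\<forall>q\<in>cube_bd n. h q = u (\<phi> q)" "cm (cube n \<times> {0..1::real}) Y W"
    "\<forall>q\<in>cube n. W (q, 0) = f (h q) \<and> W (q, 1) = v (\<phi> q)" "\<forall>q\<in>cube_bd n. \<forall>t\<in>{0..1}. W (q, t) = G (\<phi> q, t)"
    unfolding extending_lift_def fst_conv snd_conv by blast
  have "cm Q X (\<lambda>x. h (\<psi> x))" by (rule cm_compose[OF hW(1) p(2,4)])
  moreover have "cm (Q \<times> {0..1::real}) Y (\<lambda>z. W (\<psi> (fst z), snd z))"
    by (rule cm_compose[OF hW(3)]) (auto intro!: continuous_intros p(4) continuous_on_compose2[OF p(2)])
  ultimately show ?thesis
    unfolding extending_lift_def using hW(2,4,5) p(4,6,8,9)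
    by (intro exI[of _ "\<lambda>x. h (\<psi> x)"] exI[of _ "\<lambda>z. W (\<psi> (fst z), snd z)"]) (auto simp: subset_eq)
qed

section \<open>Weak equivalences in terms of maps out of cubes\<close>

definition pointed_maps :: "'b::topological_space set \<Rightarrow> 'b set \<Rightarrow> 'x topology \<Rightarrow> 'x \<Rightarrow> ('b \<Rightarrow> 'x) set" where
  "pointed_maps Q S X x = {\<gamma>. cm Q X \<gamma> \<and> (\<forall>q\<in>S. \<gamma> q = x)}"

definition rel_homotopic :: "'b::topological_space set \<Rightarrow> 'b set \<Rightarrow> 'x topology \<Rightarrow> 'x \<Rightarrow> ('b \<Rightarrow> 'x) \<Rightarrow> ('b \<Rightarrow> 'x) \<Rightarrow> bool" where
  "rel_homotopic Q S X x \<gamma> \<delta> \<longleftrightarrow> (\<exists>H. cm (Q \<times> {0..1::real}) X H \<and> (\<forall>q\<in>Q. H (q, 0) = \<gamma> q \<and> H (q, 1) = \<delta> q) \<and>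
     (\<forall>q\<in>S. \<forall>t\<in>{0..1}. H (q, t) = x))"

text \<open>Bijectivity on homotopy groups in terms of representatives, with the sphere replaced by
  the cube relative to its boundary. For \<open>n = 0\<close> the boundary is empty, so the clauses
  speak of path components.\<close>

definition cube_weq :: "'x topology \<Rightarrow> 'y topology \<Rightarrow> ('x \<Rightarrow> 'y) \<Rightarrow> bool" where
  "cube_weq X Y f \<longleftrightarrow> (topspace X = {} \<longrightarrow> topspace Y = {}) \<and> (\<forall>n. \<forall>x\<in>topspace X.
     (\<forall>\<delta>\<in>pointed_maps (cube n) (cube_bd n) Y (f x). \<exists>\<gamma>\<in>pointed_maps (cube n) (cube_bd n) X x.
        rel_homotopic (cube n) (cube_bd n) Y (f x) (\<lambda>q. f (\<gamma> q)) \<delta>) \<and>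
     (\<forall>\<gamma>\<in>pointed_maps (cube n) (cube_bd n) X x. \<forall>\<gamma>'\<in>pointed_maps (cube n) (cube_bd n) X x.
        rel_homotopic (cube n) (cube_bd n) Y (f x) (\<lambda>q. f (\<gamma> q)) (\<lambda>q. f (\<gamma>' q)) \<longrightarrow> rel_homotopic (cube n) (cube_bd n) X x \<gamma> \<gamma>'))"

text \<open>Surjectivity is lifting with constant data on the boundary. Injectivity is lifting for
  the cube of one dimension more, whose boundary carries the two maps on the ends and the constant
  on the sides. The cube of dimension 0 takes care of an empty source.\<close>

lemma weak_lifting_imp_cube_weq:
  assumes w: "weak_lifting X Y f"
  shows "cube_weq X Y f"
  unfolding cube_weq_def
proof (intro conjI allI ballI impI)
  assume X: "topspace X = {}"
  show "topspace Y = {}"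
  proof (rule ccontr)
    assume "topspace Y \<noteq> {}"
    then obtain y where "y \<in> topspace Y" by blast
    then have "lifting_square (cube 0) (cube_bd 0) X Y f undefined (\<lambda>_. y)" by (simp add: lifting_square_def cube_0)
    then have "homotopy_lift (cube 0) (cube_bd 0) X Y f undefined (\<lambda>_. y)" using w by (simp add: weak_lifting_def)
    then obtain h where "cm (cube 0) X h" unfolding homotopy_lift_def by blast
    then have "h (\<lambda>_. 0) \<in> topspace X" by (rule cm_image) simp
    then show False using X by simp
  qed
next
  fix n x \<delta> assume x: "x \<in> topspace X" and \<delta>: "\<delta> \<in> pointed_maps (cube n) (cube_bd n) Y (f x)"
  then have "lifting_square (cube n) (cube_bd n) X Y f (\<lambda>_. x) \<delta>" by (simp add: lifting_square_def pointed_maps_def)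
  then have "homotopy_lift (cube n) (cube_bd n) X Y f (\<lambda>_. x) \<delta>" using w by (simp add: weak_lifting_def)
  then show "\<exists>\<gamma>\<in>pointed_maps (cube n) (cube_bd n) X x. rel_homotopic (cube n) (cube_bd n) Y (f x) (\<lambda>q. f (\<gamma> q)) \<delta>"
    using \<delta> unfolding homotopy_lift_def rel_homotopic_def pointed_maps_def by fastforce
next
  fix n x \<gamma> \<gamma>' assume x: "x \<in> topspace X"
    and \<gamma>: "\<gamma> \<in> pointed_maps (cube n) (cube_bd n) X x" "\<gamma>' \<in> pointed_maps (cube n) (cube_bd n) X x"
    and "rel_homotopic (cube n) (cube_bd n) Y (f x) (\<lambda>q. f (\<gamma> q)) (\<lambda>q. f (\<gamma>' q))"
  then obtain H where H: "cm (cube n \<times> {0..1::real}) Y H"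
    "\<And>q. q \<in> cube n \<Longrightarrow> H (q, 0) = f (\<gamma> q) \<and> H (q, 1) = f (\<gamma>' q)"
    "\<And>q t. q \<in> cube_bd n \<Longrightarrow> t \<in> {0..1} \<Longrightarrow> H (q, t) = f x"
    unfolding rel_homotopic_def by blast
  let ?S = "cube_bd n \<times> {0..1} \<union> cube n \<times> {0, 1::real}"
  \<comment> \<open>The test at 1/2 separates the two end faces; on the sides both branches are
    constant at \<open>x\<close>.\<close>
  define u where "u = (\<lambda>z::(nat\<Rightarrow>real)\<times>real. if snd z \<le> 1/2 then \<gamma> (fst z) else \<gamma>' (fst z))"
  have g: "cm (cube n) X \<gamma>" "cm (cube n) X \<gamma>'" "\<And>q. q \<in> cube_bd n \<Longrightarrow> \<gamma> q = x" "\<And>q. q \<in> cube_bd n \<Longrightarrow> \<gamma>' q = x"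
    using \<gamma> by (auto simp: pointed_maps_def)
  have "cm ?S X u"
    unfolding u_def
  proof (rule cm_If_le)
    show "cm {z \<in> ?S. snd z \<le> 1/2} X (\<lambda>z. \<gamma> (fst z))"
      by (rule cm_compose[OF g(1)]) (auto intro!: continuous_intros dest: cube_bd_cube)
    show "cm {z \<in> ?S. 1/2 \<le> snd z} X (\<lambda>z. \<gamma>' (fst z))"
      by (rule cm_compose[OF g(2)]) (auto intro!: continuous_intros dest: cube_bd_cube)
  qed (use g(3,4) in \<open>auto intro!: continuous_intros\<close>)
  moreover have "f (u z) = H z" if "z \<in> ?S" for z
    using that H(2)[of "fst z"] H(3)[of "fst z" "snd z"] g(3,4)[of "fst z"] by (auto simp: u_def)
  ultimately have "lifting_square (cube n \<times> {0..1}) ?S X Y f u H"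
    using H(1) by (simp add: lifting_square_def)
  then have "homotopy_lift (cube n \<times> {0..1}) ?S X Y f u H"
    by (rule weak_lifting_cell[OF w is_cell_prod])
  then obtain h where "cm (cube n \<times> {0..1::real}) X h" "\<forall>z\<in>?S. h z = u z" unfolding homotopy_lift_def by blast
  then show "rel_homotopic (cube n) (cube_bd n) X x \<gamma> \<gamma>'"
    unfolding rel_homotopic_def using g(3,4) by (intro exI[of _ h]) (auto simp: u_def)
qed

lemma cube_weq_cell_surj:
  assumes c: "is_cell n Q S" and w: "cube_weq X Y f" and x: "x \<in> topspace X" and \<delta>: "\<delta> \<in> pointed_maps Q S Y (f x)"
  obtains \<gamma> where "\<gamma> \<in> pointed_maps Q S X x" "rel_homotopic Q S Y (f x) (\<lambda>q. f (\<gamma> q)) \<delta>"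
proof -
  obtain \<phi> \<psi> where p: "continuous_on (cube n) \<phi>" "continuous_on Q \<psi>"
    "\<And>x. x \<in> cube n \<Longrightarrow> \<phi> x \<in> Q" "\<And>x. x \<in> Q \<Longrightarrow> \<psi> x \<in> cube n"
    "\<And>x. x \<in> cube n \<Longrightarrow> \<psi> (\<phi> x) = x" "\<And>x. x \<in> Q \<Longrightarrow> \<phi> (\<psi> x) = x"
    "\<And>x. x \<in> cube_bd n \<Longrightarrow> \<phi> x \<in> S" "\<And>x. x \<in> S \<Longrightarrow> \<psi> x \<in> cube_bd n" "S \<subseteq> Q"
    by (rule is_cellE[OF c]; rule that)
  have d: "cm Q Y \<delta>" "\<forall>q\<in>S. \<delta> q = f x" using \<delta> by (auto simp: pointed_maps_def)
  have "(\<lambda>q. \<delta> (\<phi> q)) \<in> pointed_maps (cube n) (cube_bd n) Y (f x)"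
    using p(7) d(2) cm_compose[OF d(1) p(1,3)] by (auto simp: pointed_maps_def)
  then obtain \<gamma> where g: "\<gamma> \<in> pointed_maps (cube n) (cube_bd n) X x" "rel_homotopic (cube n) (cube_bd n) Y (f x) (\<lambda>q. f (\<gamma> q)) (\<lambda>q. \<delta> (\<phi> q))"
    using w x unfolding cube_weq_def by blast
  then obtain H where H: "cm (cube n \<times> {0..1::real}) Y H"
    "\<And>q. q \<in> cube n \<Longrightarrow> H (q, 0) = f (\<gamma> q) \<and> H (q, 1) = \<delta> (\<phi> q)"
    "\<And>q t. q \<in> cube_bd n \<Longrightarrow> t \<in> {0..1} \<Longrightarrow> H (q, t) = f x"
    unfolding rel_homotopic_def by blast
  show thesis
  proof (rule that[of "\<lambda>q. \<gamma> (\<psi> q)"])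
    have "cm (cube n) X \<gamma>" "\<forall>q\<in>cube_bd n. \<gamma> q = x" using g(1) by (auto simp: pointed_maps_def)
    then show "(\<lambda>q. \<gamma> (\<psi> q)) \<in> pointed_maps Q S X x"
      using p(8) cm_compose[OF _ p(2,4)] by (auto simp: pointed_maps_def)
    have "cm (Q \<times> {0..1::real}) Y (\<lambda>z. H (\<psi> (fst z), snd z))"
      by (rule cm_compose[OF H(1)]) (auto intro!: continuous_intros p(4) continuous_on_compose2[OF p(2)])
    then show "rel_homotopic Q S Y (f x) (\<lambda>q. f (\<gamma> (\<psi> q))) \<delta>"
      unfolding rel_homotopic_def using H(2,3) p(4,6,8) by (intro exI[of _ "\<lambda>z. H (\<psi> (fst z), snd z)"]) auto
  qed
qed

text \<open>With constant data on all faces except the bottom, \<open>v\<close> is a null-homotopy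
  of the image of the bottom map. Injectivity yields a null-homotopy \<open>U\<close> in
  \<open>X\<close>; the difference between \<open>f \<circ> U\<close> and \<open>v\<close> is a
  class in the next dimension, and surjectivity allows \<open>U\<close> to be corrected by
  it.\<close>

lemma cube_weq_homotopy_lift_special:
  assumes w: "cube_weq X Y f" and f: "continuous_map X Y f"
    and s: "lifting_square (cube n \<times> {0..1::real}) (cube_bd n \<times> {0..1} \<union> cube n \<times> {0, 1}) X Y f u v"
    and J: "\<And>q t. q \<in> cube n \<Longrightarrow> t \<in> {0..1} \<Longrightarrow> q \<in> cube_bd n \<or> t = 1 \<Longrightarrow> u (q, t) = x"
  shows "homotopy_lift (cube n \<times> {0..1::real}) (cube_bd n \<times> {0..1} \<union> cube n \<times> {0, 1}) X Y f u v"
proof -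
  let ?Q = "cube n \<times> {0..1::real}" let ?S = "cube_bd n \<times> {0..1} \<union> cube n \<times> {0, 1::real}"
  have u: "cm ?S X u" and v: "cm ?Q Y v" and uv: "\<And>q. q \<in> ?S \<Longrightarrow> f (u q) = v q" using s by (auto simp: lifting_square_def)
  have x: "x \<in> topspace X" using cm_image[OF u, of "((\<lambda>_. 0), 1)"] J[of "\<lambda>_. 0" 1] by auto
  define \<gamma>0 where "\<gamma>0 = (\<lambda>q. u (q, 0))"
  have \<gamma>0: "\<gamma>0 \<in> pointed_maps (cube n) (cube_bd n) X x"
    unfolding pointed_maps_def \<gamma>0_def using J cube_bd_cube by (auto intro!: cm_compose[OF u] continuous_intros)
  have "rel_homotopic (cube n) (cube_bd n) Y (f x) (\<lambda>q. f (\<gamma>0 q)) (\<lambda>q. f x)"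
    unfolding rel_homotopic_def
  proof (intro exI[of _ v] conjI ballI v)
    fix q :: "nat \<Rightarrow> real" assume q: "q \<in> cube n"
    show "v (q, 0) = f (\<gamma>0 q)" "v (q, 1) = f x"
      using uv[of "(q, 0)"] uv[of "(q, 1)"] J[of q 1] q by (auto simp: \<gamma>0_def)
  next
    fix q :: "nat \<Rightarrow> real" and t :: real assume "q \<in> cube_bd n" "t \<in> {0..1}"
    then show "v (q, t) = f x" using uv[of "(q, t)"] J[of q t] cube_bd_cube[of q] by auto
  qed
  moreover have "(\<lambda>_. x) \<in> pointed_maps (cube n) (cube_bd n) X x" using x by (simp add: pointed_maps_def)
  ultimately have "rel_homotopic (cube n) (cube_bd n) X x \<gamma>0 (\<lambda>_. x)"
    using w[unfolded cube_weq_def, THEN conjunct2, rule_format, OF x, THEN conjunct2, rule_format, OF \<gamma>0] by simp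
  then obtain U where U: "cm ?Q X U" and U0: "\<And>q. q \<in> cube n \<Longrightarrow> U (q, 0) = u (q, 0)"
    and U1: "\<And>q. q \<in> cube n \<Longrightarrow> U (q, 1) = x" and Ub: "\<And>q t. q \<in> cube_bd n \<Longrightarrow> t \<in> {0..1} \<Longrightarrow> U (q, t) = x"
    unfolding rel_homotopic_def \<gamma>0_def by blast
  \<comment> \<open>The homotopy \<open>f \<circ> U\<close>, run backwards, followed by \<open>v\<close>.\<close>
  define w' where "w' = (\<lambda>z. if snd z \<le> 0 then f (U (fst z, - snd z)) else v z)"
  have w': "cm (cube n \<times> {-1..1::real}) Y w'"
    unfolding w'_def
  proof (rule cm_If_le)
    show "cm {z \<in> cube n \<times> {-1..1}. snd z \<le> 0} Y (\<lambda>z. f (U (fst z, - snd z)))"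
      by (rule cm_compose[OF cm_post[OF U f]]) (auto intro!: continuous_intros)
    show "cm {z \<in> cube n \<times> {-1..1}. 0 \<le> snd z} Y v"
      by (rule cm_subset[OF v]) auto
  qed (use uv U0 in \<open>auto intro!: continuous_intros\<close>)
  have v1: "v (q, 1) = f x" if "q \<in> cube n" for q using uv[of "(q, 1)"] J[of q 1] that by auto
  have vb: "v (q, t) = f x" if "q \<in> cube_bd n" "t \<in> {0..1}" for q t
    using uv[of "(q, t)"] J[of q t] that cube_bd_cube[of q] by auto
  have v0: "v (q, 0) = f (u (q, 0))" if "q \<in> cube n" for q using uv[of "(q, 0)"] that by auto
  have w'b: "w' (q, t) = f x" if "q \<in> cube_bd n" "t \<in> {-1..1}" for q t
    using that Ub[of q "-t"] vb[of q t] by (auto simp: w'_def)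
  have w'1: "w' (q, 1) = f x" "w' (q, -1) = f x" if "q \<in> cube n" for q
    using v1[OF that] U1[OF that] by (auto simp: w'_def)
  define d where "d = (\<lambda>z::(nat\<Rightarrow>real)\<times>real. w' (fst z, 2 * snd z - 1))"
  have d: "d \<in> pointed_maps ?Q ?S Y (f x)"
    unfolding pointed_maps_def d_def using w'b w'1
    by (auto intro!: cm_compose[OF w'] continuous_intros)
  obtain \<gamma> where \<gamma>: "\<gamma> \<in> pointed_maps ?Q ?S X x" "rel_homotopic ?Q ?S Y (f x) (\<lambda>q. f (\<gamma> q)) d"
    by (rule cube_weq_cell_surj[OF is_cell_prod w x d])
  then obtain E where E: "cm (?Q \<times> {0..1::real}) Y E"
    and E01: "\<And>q. q \<in> ?Q \<Longrightarrow> E (q, 0) = f (\<gamma> q) \<and> E (q, 1) = d q"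
    and Eb: "\<And>q t. q \<in> ?S \<Longrightarrow> t \<in> {0..1} \<Longrightarrow> E (q, t) = f x"
    unfolding rel_homotopic_def by blast
  have g: "cm ?Q X \<gamma>" "\<And>q. q \<in> ?S \<Longrightarrow> \<gamma> q = x" using \<gamma>(1) by (auto simp: pointed_maps_def)
  define h where "h = (\<lambda>z. if snd z \<le> 1/2 then U (fst z, 2 * snd z) else \<gamma> (fst z, 2 * snd z - 1))"
  have h: "cm ?Q X h"
    unfolding h_def by (rule cm_concat[OF U g(1)]) (use U1 g(2) in auto)
  define A where "A = (\<lambda>z::((nat\<Rightarrow>real)\<times>real)\<times>real. if snd (fst z) \<le> 1/2 then f (U (fst (fst z), 2 * snd (fst z)))
      else E ((fst (fst z), 2 * snd (fst z) - 1), snd z))"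
  have A: "cm (?Q \<times> {0..1}) Y A"
    unfolding A_def
  proof (rule cm_If_le)
    show "cm {z \<in> ?Q \<times> {0..1}. snd (fst z) \<le> 1/2} Y (\<lambda>z. f (U (fst (fst z), 2 * snd (fst z))))"
      by (rule cm_compose[OF cm_post[OF U f]]) (auto intro!: continuous_intros)
    show "cm {z \<in> ?Q \<times> {0..1}. 1/2 \<le> snd (fst z)} Y (\<lambda>z. E ((fst (fst z), 2 * snd (fst z) - 1), snd z))"
      by (rule cm_compose[OF E]) (auto intro!: continuous_intros)
    show "f (U (fst (fst z), 2 * snd (fst z))) = E ((fst (fst z), 2 * snd (fst z) - 1), snd z)"
      if z: "z \<in> ?Q \<times> {0..1}" and z2: "snd (fst z) = 1/2" for z
      unfolding z2 using z U1 Eb by auto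
  qed (auto intro!: continuous_intros)
  \<comment> \<open>The image of \<open>h\<close> is, up to the homotopy \<open>E\<close>, the path
    \<open>\<kappa>\<close> through the doubled interval: from 0 down to -1, then up to 1. It is
    affinely homotopic to the identity with fixed ends, which cancels \<open>f \<circ> U\<close>
    against its reverse.\<close>
  define \<kappa> where "\<kappa> = (\<lambda>t::real. max (-2 * t) (4 * t - 3))"
  define B where "B = (\<lambda>z::((nat\<Rightarrow>real)\<times>real)\<times>real. w' (fst (fst z), (1 - snd z) * \<kappa> (snd (fst z)) + snd z * snd (fst z)))"
  have kap: "\<kappa> t \<in> {-1..1}" if "t \<in> {0..1}" for t using that by (auto simp: \<kappa>_def)
  have conv: "(1 - s) * a + s * b \<in> {-1..1}" if "s \<in> {0..1}" "a \<in> {-1..1}" "b \<in> {-1..1}" for s a b :: real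
    using convexD_alt[OF convex_real_interval(5)[of "-1" 1] that(2,3), of s] that(1) by simp
  have Bm: "(1 - s) * \<kappa> t + s * t \<in> {-1..1}" if "s \<in> {0..1}" "t \<in> {0..1}" for s t
    using conv[OF that(1) kap[OF that(2)], of t] that by auto
  have B: "cm (?Q \<times> {0..1}) Y B"
    unfolding B_def
  proof (rule cm_compose[OF w'])
    show "continuous_on (?Q \<times> {0..1}) (\<lambda>z. (fst (fst z), (1 - snd z) * \<kappa> (snd (fst z)) + snd z * snd (fst z)))"
      unfolding \<kappa>_def by (intro continuous_intros continuous_on_max)
  qed (use Bm in auto)
  define L where "L = (\<lambda>z. if snd z \<le> 1/2 then A (fst z, 2 * snd z) else B (fst z, 2 * snd z - 1))"
  have AB: "A (q, 1) = B (q, 0)" if q: "q \<in> ?Q" for q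
  proof -
    obtain y t where yt: "q = (y, t)" "y \<in> cube n" "t \<in> {0..1}" using q by auto
    show ?thesis
    proof (cases "t \<le> 1/2")
      case True
      then have "\<kappa> t = - 2 * t" by (simp add: \<kappa>_def max_def)
      then show ?thesis using True yt v0 U0[of y] by (auto simp: A_def B_def w'_def)
    next
      case False
      then have "\<kappa> t = 4 * t - 3" by (simp add: \<kappa>_def max_def)
      then show ?thesis using False yt E01[of "(y, 2 * t - 1)"] by (auto simp: A_def B_def d_def)
    qed
  qed
  have L: "cm (?Q \<times> {0..1}) Y L"
    unfolding L_def by (rule cm_concat[OF A B AB])
  show ?thesis
    unfolding homotopy_lift_def
  proof (intro exI conjI ballI)
    show "cm ?Q X h" "cm (?Q \<times> {0..1}) Y L" by (rule h L)+
    show hu: "h q = u q" if "q \<in> ?S" for q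
    proof -
      have "u q = x \<or> (\<exists>y\<in>cube n. q = (y, 0))" 
        using that J[of "fst q" "snd q"] cube_bd_cube[of "fst q"] by auto
      moreover have "h q = x" if "fst q \<in> cube_bd n \<or> snd q = 1"
        using that \<open>q \<in> ?S\<close> Ub[of "fst q" "2 * snd q"] g(2)[of "(fst q, 2 * snd q - 1)"] by (auto simp: h_def)
      moreover have "u q = x" if "fst q \<in> cube_bd n \<or> snd q = 1"
        using that \<open>q \<in> ?S\<close> J[of "fst q" "snd q"] cube_bd_cube[of "fst q"] by auto
      moreover have "h q = u q" if "snd q = 0" using that \<open>q \<in> ?S\<close> cube_bd_cube[of "fst q"] U0[of "fst q"] by (cases q) (auto simp: h_def)
      ultimately show ?thesis using that by auto
    qed
    show "L (q, 0) = f (h q)" if "q \<in> ?Q" for q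
      using that E01[of "(fst q, 2 * snd q - 1)"] by (auto simp: L_def A_def h_def)
    show "L (q, 1) = v q" if "q \<in> ?Q" for q
      using that U0[of "fst q"] v0[of "fst q"] by (cases q) (auto simp: L_def B_def w'_def)
    show "L (q, t) = v q" if q: "q \<in> ?S" and t: "t \<in> {0..1}" for q t
    proof -
      consider (b) "fst q \<in> cube_bd n" "snd q \<in> {0..1}" | (0) y where "y \<in> cube n" "q = (y, 0)" | (1) y where "y \<in> cube n" "q = (y, 1)"
        using q by (cases q) auto
      then show ?thesis
      proof cases
        case b
        have "A (q, s) = f x" if "s \<in> {0..1}" for s
          using that b Ub[of "fst q" "2 * snd q"] Eb[of "(fst q, 2 * snd q - 1)" s] by (auto simp: A_def)
        moreover have "B (q, s) = f x" if "s \<in> {0..1}" for s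
          using w'b[OF b(1) Bm[OF that b(2)]] by (simp add: B_def)
        ultimately show ?thesis using t vb[OF b] by (auto simp: L_def)
      next
        case 0
        then show ?thesis using t U0[of y] v0[of y] by (auto simp: L_def A_def B_def \<kappa>_def w'_def)
      next
        case 1
        have "A (q, s) = f x" if "s \<in> {0..1}" for s using that 1 Eb[of "(y, 1)" s] by (simp add: A_def)
        moreover have "B (q, s) = f x" if "s \<in> {0..1}" for s using w'1[OF 1(1)] 1 by (simp add: B_def \<kappa>_def)
        ultimately show ?thesis using t v1[OF 1(1)] 1 by (auto simp: L_def)
      qed
    qed
  qed
qed

text \<open>A homotopy of pairs collapses all faces but the bottom, which brings a square into the
  special form of the preceding lemma; solvability is invariant under such homotopies. In dimension
  0 the condition on empty sources supplies the base point.\<close>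

lemma cube_weq_imp_weak_lifting:
  assumes w: "cube_weq X Y f" and f: "continuous_map X Y f"
  shows "weak_lifting X Y f"
  unfolding weak_lifting_def
proof (intro allI impI)
  fix n u v assume s: "lifting_square (cube n) (cube_bd n) X Y f u v"
  show "homotopy_lift (cube n) (cube_bd n) X Y f u v"
  proof (cases n)
    case 0
    have v: "cm (cube 0) Y v" using s 0 by (simp add: lifting_square_def)
    then have "v (\<lambda>_. 0) \<in> topspace Y" by (rule cm_image) simp
    then obtain x where x: "x \<in> topspace X" using w unfolding cube_weq_def by blast
    have "v \<in> pointed_maps (cube 0) (cube_bd 0) Y (f x)" using v by (simp add: pointed_maps_def cube_0)
    then obtain \<gamma> where "\<gamma> \<in> pointed_maps (cube 0) (cube_bd 0) X x" "rel_homotopic (cube 0) (cube_bd 0) Y (f x) (\<lambda>q. f (\<gamma> q)) v"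
      using w x unfolding cube_weq_def by blast
    then show ?thesis
      unfolding 0 homotopy_lift_def rel_homotopic_def pointed_maps_def cube_0(2) by auto
  next
    case (Suc m)
    let ?Q = "cube m \<times> {0..1::real}" let ?S = "cube_bd m \<times> {0..1} \<union> cube m \<times> {0, 1::real}"
    have main: "homotopy_lift ?Q ?S X Y f u v" if s: "lifting_square ?Q ?S X Y f u v" for u v
    proof -
      have u: "cm ?S X u" and v: "cm ?Q Y v" and uv: "\<And>q. q \<in> ?S \<Longrightarrow> f (u q) = v q" using s by (auto simp: lifting_square_def)
      \<comment> \<open>A homotopy of maps of pairs from the identity to a map sending all faces but one to a point.\<close>
      define p where "p = (\<lambda>y s. shrink m (1 / (1 + s)) y)"
      define t1 where "t1 = (\<lambda>y t s. max t ((1 + s) * sup_norm m y - 1))"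
      \<comment> \<open>At \<open>s = 1\<close> the sides are reached at radius 1/2 and the height
        \<open>t1\<close> climbs along the collar, to 1 on the old sides. Doubling it gains time:
        while \<open>t1\<close> exceeds 1/2, the point slides in the top face to its centre, which
        becomes the image of all faces but the bottom.\<close>
      define \<psi> where "\<psi> = (\<lambda>z::((nat\<Rightarrow>real)\<times>real)\<times>real. let y = fst (fst z); t = snd (fst z); s = snd z in
        (\<lambda>i. (1 - s * max 0 ((1 + s) * t1 y t s - 1)) * p y s i, min 1 ((1 + s) * t1 y t s)))"
      have cp: "continuous_on (?Q \<times> {0..1}) (\<lambda>z. p (fst (fst z)) (snd z))"
        unfolding p_def by (rule continuous_on_shrink) (auto intro!: continuous_intros)
      have ct: "continuous_on (?Q \<times> {0..1}) (\<lambda>z. t1 (fst (fst z)) (snd (fst z)) (snd z))"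
        unfolding t1_def by (intro continuous_intros continuous_on_max)
      have c\<psi>: "continuous_on (?Q \<times> {0..1}) \<psi>"
        unfolding \<psi>_def Let_def
        by (intro continuous_intros continuous_on_max continuous_on_min continuous_on_coordinatewise_then_product ct
            continuous_on_product_then_coordinatewise[OF cp])
      have p: "p y s \<in> cube m" if "y \<in> cube m" "s \<in> {0..1}" for y s
        unfolding p_def using that by (intro shrink_cube) auto
      have t1: "t1 y t s \<in> {0..1}" if "y \<in> cube m" "s \<in> {0..1}" "t \<in> {0..1}" for y t s
      proof -
        have "(1 + s) * sup_norm m y \<le> (1 + 1) * 1" using that sup_norm_le1[OF that(1)] by (intro mult_mono) auto
        then show ?thesis using that by (auto simp: t1_def)
      qed
      have scale: "0 \<le> 1 - s * max 0 ((1 + s) * r - 1)" "1 - s * max 0 ((1 + s) * r - 1) \<le> 1"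
        if "s \<in> {0..1}" "r \<in> {0..1}" for s r :: real
      proof -
        have "(1 + s) * r \<le> (1 + 1) * 1" using that by (intro mult_mono) auto
        then have "s * max 0 ((1 + s) * r - 1) \<le> 1 * 1" using that by (intro mult_mono) auto
        then show "0 \<le> 1 - s * max 0 ((1 + s) * r - 1)" by simp
        show "1 - s * max 0 ((1 + s) * r - 1) \<le> 1" using that by simp
      qed
      have scube: "(\<lambda>i. c * y i) \<in> cube m" if "y \<in> cube m" "0 \<le> c" "c \<le> 1" for c y
        using that mult_mono[of c 1 "sup_norm m y" 1] by (auto simp: cube_def sup_norm_scale)
      have \<psi>Q: "\<psi> z \<in> ?Q" if zz: "z \<in> ?Q \<times> {0..1}" for z
      proof -
        obtain y t s where z: "z = ((y, t), s)" "y \<in> cube m" "t \<in> {0..1}" "s \<in> {0..1}"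
          using zz by (cases z, cases "fst z") auto
        have "(\<lambda>i. (1 - s * max 0 ((1 + s) * t1 y t s - 1)) * p y s i) \<in> cube m"
          using z by (intro scube p scale t1)
        then show ?thesis using t1[OF z(2,4,3)] z by (auto simp: \<psi>_def Let_def)
      qed
      \<comment> \<open>A point whose height overshoots goes to the top face, one in the collar to a
        side, and any other boundary point comes from the bottom and stays there.\<close>
      have \<psi>S: "\<psi> z \<in> ?S" if zz: "z \<in> ?S \<times> {0..1}" for z
      proof -
        obtain y t s where z: "z = ((y, t), s)" "(y, t) \<in> ?S" "y \<in> cube m" "t \<in> {0..1}" "s \<in> {0..1}"
          using zz cube_bd_cube by (cases z, cases "fst z") auto
        have in_Q: "\<psi> z \<in> ?Q" using z by (intro \<psi>Q) auto
        show ?thesis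
        proof (cases "1 \<le> (1 + s) * t1 y t s")
          case True
          then have "snd (\<psi> z) = 1" by (simp add: z \<psi>_def Let_def)
          then show ?thesis using in_Q by (cases "\<psi> z") auto
        next
          case False
          then have f1: "fst (\<psi> z) = p y s" by (simp add: z \<psi>_def Let_def)
          show ?thesis
          proof (cases "1 / (1 + s) \<le> sup_norm m y")
            case True
            then have "p y s \<in> cube_bd m" unfolding p_def using z by (intro shrink_cube_bd) auto
            then show ?thesis using in_Q f1 by (cases "\<psi> z") auto
          next
            case n: False
            then have "(1 + s) * sup_norm m y < 1" using z by (simp add: field_simps)
            moreover have "y \<notin> cube_bd m" using n z by (auto simp: cube_bd_def divide_le_eq)
            moreover have "t \<noteq> 1" 
            proof
              assume "t = 1"
              then have "1 \<le> t1 y t s" by (simp add: t1_def)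
              then have "1 * 1 \<le> (1 + s) * t1 y t s" using z by (intro mult_mono) auto
              then show False using False by simp
            qed
            ultimately have "t1 y t s = 0" using z by (auto simp: t1_def)
            then have "snd (\<psi> z) = 0" by (simp add: z \<psi>_def Let_def)
            then show ?thesis using in_Q by (cases "\<psi> z") auto
          qed
        qed
      qed
      have \<psi>0: "\<psi> (q, 0) = q" if "q \<in> ?Q" for q
        using that sup_norm_le1[of "fst q" m] by (cases q) (auto simp: \<psi>_def Let_def p_def t1_def shrink_id)
      define x where "x = u (\<lambda>_. 0, 1)"
      have SQ: "?S \<subseteq> ?Q" using cube_bd_cube by auto
      have "homotopy_lift ?Q ?S X Y f (\<lambda>q. u (\<psi> (q, 0))) (\<lambda>q. v (\<psi> (q, 0)))"
      proof (rule homotopy_lift_homotopy[OF is_cell_prod f, where U = "\<lambda>z. u (\<psi> z)" and V = "\<lambda>z. v (\<psi> z)"])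
        show U: "cm (?S \<times> {0..1}) X (\<lambda>z. u (\<psi> z))"
          by (rule cm_compose[OF u continuous_on_subset[OF c\<psi>] \<psi>S]) (use cube_bd_cube in auto)
        show V: "cm (?Q \<times> {0..1}) Y (\<lambda>z. v (\<psi> z))"
          by (rule cm_compose[OF v c\<psi> \<psi>Q])
        show UV: "f (u (\<psi> (q, t))) = v (\<psi> (q, t))" if "q \<in> ?S" "t \<in> {0..1}" for q t
          using uv[OF \<psi>S[of "(q, t)"]] that by auto
        show "homotopy_lift ?Q ?S X Y f (\<lambda>q. u (\<psi> (q, 1))) (\<lambda>q. v (\<psi> (q, 1)))"
        proof (rule cube_weq_homotopy_lift_special[OF w f])
          have "cm ?S X (\<lambda>q. u (\<psi> (q, 1)))" "cm ?Q Y (\<lambda>q. v (\<psi> (q, 1)))"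
            by (rule cm_compose[OF U], auto intro!: continuous_intros) (rule cm_compose[OF V], auto intro!: continuous_intros)
          then show "lifting_square ?Q ?S X Y f (\<lambda>q. u (\<psi> (q, 1))) (\<lambda>q. v (\<psi> (q, 1)))"
            using UV by (simp add: lifting_square_def)
          fix q and t :: real assume q: "q \<in> cube m" and t: "t \<in> {0..1}" and "q \<in> cube_bd m \<or> t = 1"
          then have "t1 q t 1 = 1" using sup_norm_le1[OF q] by (auto simp: t1_def cube_bd_def)
          then have "\<psi> ((q, t), 1) = (\<lambda>_. 0, 1)" by (simp add: \<psi>_def Let_def)
          then show "u (\<psi> ((q, t), 1)) = x" by (simp add: x_def)
        qed
      qed
      then show ?thesis
        by (rule homotopy_lift_cong[OF _ _ SQ, rotated 2]) (use SQ \<psi>0 in \<open>auto simp: subset_eq\<close>)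
    qed
    obtain \<phi> \<psi> where p: "continuous_on (cube (Suc m)) \<phi>" "continuous_on ?Q \<psi>"
      "\<And>x. x \<in> cube (Suc m) \<Longrightarrow> \<phi> x \<in> ?Q" "\<And>x. x \<in> ?Q \<Longrightarrow> \<psi> x \<in> cube (Suc m)"
      "\<And>x. x \<in> cube (Suc m) \<Longrightarrow> \<psi> (\<phi> x) = x" "\<And>x. x \<in> ?Q \<Longrightarrow> \<phi> (\<psi> x) = x"
      "\<And>x. x \<in> cube_bd (Suc m) \<Longrightarrow> \<phi> x \<in> ?S" "\<And>x. x \<in> ?S \<Longrightarrow> \<psi> x \<in> cube_bd (Suc m)" "?S \<subseteq> ?Q"
      by (rule is_cellE[OF is_cell_prod[of m]]; rule that)
    have u: "cm (cube_bd n) X u" and v: "cm (cube n) Y v" and uv: "\<And>q. q \<in> cube_bd n \<Longrightarrow> f (u q) = v q" using s by (auto simp: lifting_square_def)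
    have "lifting_square ?Q ?S X Y f (\<lambda>z. u (\<psi> z)) (\<lambda>z. v (\<psi> z))"
      unfolding lifting_square_def
    proof (intro conjI ballI)
      show "cm ?S X (\<lambda>z. u (\<psi> z))"
        by (rule cm_compose[OF u continuous_on_subset[OF p(2,9)]]) (use p(8) Suc in blast)
      show "cm ?Q Y (\<lambda>z. v (\<psi> z))"
        by (rule cm_compose[OF v p(2)]) (use p(4) Suc in blast)
    qed (use uv p(8) Suc in blast)
    then have "homotopy_lift ?Q ?S X Y f (\<lambda>z. u (\<psi> z)) (\<lambda>z. v (\<psi> z))" by (rule main)
    then show ?thesis
      unfolding Suc by (rule homotopy_lift_transfer[OF _ p(1,3,5,7)]) (use cube_bd_cube in auto)
  qed
qed

section \<open>The sphere as a cube with collapsed boundary\<close>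

definition unit_sphere :: "nat \<Rightarrow> (nat \<Rightarrow> real) set" where
  "unit_sphere n = {x. (\<Sum>i\<le>n. x i ^ 2) = 1 \<and> (\<forall>i>n. x i = 0)}"

lemma nsphere_eq: "nsphere n = top_of_set (unit_sphere n)"
  by (simp add: nsphere unit_sphere_def euclidean_product_topology)

definition l2norm :: "nat \<Rightarrow> (nat \<Rightarrow> real) \<Rightarrow> real" where
  "l2norm n x = sqrt (\<Sum>i<n. x i ^ 2)"

lemma l2norm_nonneg [simp]: "0 \<le> l2norm n x" by (simp add: l2norm_def sum_nonneg)

lemma l2norm_sq: "(l2norm n x)\<^sup>2 = (\<Sum>i<n. x i ^ 2)"
  by (simp add: l2norm_def sum_nonneg)

lemma abs_le_l2norm: "i < n \<Longrightarrow> \<bar>x i\<bar> \<le> l2norm n x"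
  unfolding l2norm_def by (rule real_le_rsqrt) (auto intro: member_le_sum[of i "{..<n}" "\<lambda>i. x i ^ 2"])

lemma sup_norm_le_l2norm: "sup_norm n x \<le> l2norm n x"
  by (simp add: sup_norm_le_iff abs_le_l2norm)

lemma l2norm_cong: "(\<And>i. i < n \<Longrightarrow> x i = y i) \<Longrightarrow> l2norm n x = l2norm n y"
  by (simp add: l2norm_def)

lemma l2norm_scale: "l2norm n (\<lambda>i. c * x i) = \<bar>c\<bar> * l2norm n x"
  by (simp add: l2norm_def power_mult_distrib real_sqrt_mult flip: sum_distrib_left)

lemma sup_norm_0_iff: "sup_norm n x = 0 \<longleftrightarrow> (\<forall>i<n. x i = 0)"
  using sup_norm_le_iff[of 0 n x] sup_norm_nonneg[of n x] by (auto simp: order_antisym)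

lemma l2norm_0_iff: "l2norm n x = 0 \<longleftrightarrow> (\<forall>i<n. x i = 0)"
  using abs_le_l2norm[of _ n x] by (auto simp: l2norm_def)

lemma continuous_on_l2norm [continuous_intros]:
  "continuous_on S (\<lambda>x. l2norm n x)"
  unfolding l2norm_def by (intro continuous_intros)

text \<open>The radial homeomorphism from the cube to the disc.\<close>

definition radial :: "nat \<Rightarrow> (nat \<Rightarrow> real) \<Rightarrow> nat \<Rightarrow> real" where
  "radial n x i = (if i < n then x i * (sup_norm n x / l2norm n x) else 0)"

lemma l2norm_radial: "l2norm n (radial n x) = sup_norm n x"
proof -
  have "l2norm n (radial n x) = l2norm n (\<lambda>i. (sup_norm n x / l2norm n x) * x i)"
    by (rule l2norm_cong) (simp add: radial_def mult.commute)
  also have "\<dots> = sup_norm n x / l2norm n x * l2norm n x" unfolding l2norm_scale by simp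
  also have "\<dots> = sup_norm n x" using l2norm_0_iff[of n x] sup_norm_0_iff[of n x] by (cases "l2norm n x = 0") auto
  finally show ?thesis .
qed

text \<open>The division by the Euclidean norm is critical only where that norm vanishes. There the
  quotient of the two norms is at most 1, so \<open>x i\<close> squeezes the value to 0.\<close>

lemma continuous_on_radial: "continuous_on S (\<lambda>x. radial n x i)"
proof (cases "i < n")
  case True
  have "continuous_on UNIV (\<lambda>x. radial n x i)"
    unfolding continuous_on_eq_continuous_at[OF open_UNIV]
  proof
    fix a :: "nat \<Rightarrow> real"
    have c: "isCont (\<lambda>x. sup_norm n x) a" "isCont (\<lambda>x. l2norm n x) a" "isCont (\<lambda>x. x i) a"
      by (rule continuous_on_eq_continuous_at[OF open_UNIV, THEN iffD1, rule_format];
          intro continuous_intros UNIV_I)+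
    show "isCont (\<lambda>x. radial n x i) a"
    proof (cases "l2norm n a = 0")
      case False
      then show ?thesis unfolding radial_def using True c by (auto intro!: continuous_intros)
    next
      case z: True
      then have ai: "a i = 0" using True by (simp add: l2norm_0_iff)
      have "((\<lambda>x. x i) \<longlongrightarrow> 0) (at a)" using c(3) ai by (simp add: isCont_def)
      then have "((\<lambda>x. \<bar>x i\<bar>) \<longlongrightarrow> 0) (at a)" by (rule tendsto_rabs_zero)
      moreover have "\<bar>radial n x i\<bar> \<le> \<bar>x i\<bar>" for x
      proof -
        have "sup_norm n x / l2norm n x \<le> 1"
        proof (cases "l2norm n x = 0")
          case False
          then have "0 < l2norm n x" using l2norm_nonneg[of n x] by (simp only: order.order_iff_strict) auto
          then show ?thesis using sup_norm_le_l2norm[of n x] by simp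
        qed simp
        then have "\<bar>x i\<bar> * (sup_norm n x / l2norm n x) \<le> \<bar>x i\<bar> * 1" by (intro mult_left_mono) auto
        then show ?thesis using True by (simp add: radial_def abs_mult)
      qed
      ultimately have "((\<lambda>x. radial n x i) \<longlongrightarrow> 0) (at a)"
        by (intro Lim_null_comparison[where f = "\<lambda>x. radial n x i" and g = "\<lambda>x. \<bar>x i\<bar>"]) (auto intro: always_eventually)
      then show ?thesis using ai True by (simp add: isCont_def radial_def)
    qed
  qed
  then show ?thesis using continuous_on_subset by blast
qed (simp add: radial_def)

text \<open>
  Collapses the boundary of the cube to the base point.  Writing \<open>r\<close> for the norm, the norm of
  \<open>radial n x\<close> is \<open>r\<close> too, and \<open>(2 r\<^sup>2 - 1)\<^sup>2 + 4 (1 - r\<^sup>2) r\<^sup>2 = 1\<close>.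
\<close>

definition cube_to_sphere :: "nat \<Rightarrow> (nat \<Rightarrow> real) \<Rightarrow> nat \<Rightarrow> real" where
  "cube_to_sphere n x i = (if i = 0 then 2 * (sup_norm n x)\<^sup>2 - 1 else if i \<le> n then 2 * sqrt (1 - (sup_norm n x)\<^sup>2) * radial n x (i - 1) else 0)"

lemma continuous_on_cube_to_sphere: "continuous_on S (cube_to_sphere n)"
proof (rule continuous_on_coordinatewise_then_product)
  fix i
  show "continuous_on S (\<lambda>x. cube_to_sphere n x i)"
    unfolding cube_to_sphere_def by (intro continuous_intros continuous_on_radial)
qed

lemma sum_sq_shift: "(\<Sum>i\<le>n. (x i)\<^sup>2) = (x 0)\<^sup>2 + (\<Sum>i<n. (x (Suc i))\<^sup>2)" for x :: "nat \<Rightarrow> real"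
  unfolding lessThan_Suc_atMost[symmetric] by (rule sum.lessThan_Suc_shift)

lemma cube_to_sphere_unit_sphere: assumes "x \<in> cube n" shows "cube_to_sphere n x \<in> unit_sphere n"
proof -
  define r where "r = sup_norm n x"
  have r: "0 \<le> r" "r \<le> 1" using sup_norm_le1[OF assms] by (auto simp: r_def)
  then have r2: "r\<^sup>2 \<le> 1" by (simp add: power_le_one)
  have "(\<Sum>i<n. (cube_to_sphere n x (Suc i))\<^sup>2) = (\<Sum>i<n. (4 * (1 - r\<^sup>2)) * (radial n x i)\<^sup>2)"
    using r2 by (intro sum.cong) (auto simp: cube_to_sphere_def r_def power_mult_distrib)
  also have "\<dots> = 4 * (1 - r\<^sup>2) * r\<^sup>2"
    using l2norm_sq[of n "radial n x"] by (simp add: l2norm_radial r_def flip: sum_distrib_left)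
  finally have "(\<Sum>i\<le>n. (cube_to_sphere n x i)\<^sup>2) = (2 * r\<^sup>2 - 1)\<^sup>2 + 4 * (1 - r\<^sup>2) * r\<^sup>2"
    by (simp add: sum_sq_shift cube_to_sphere_def r_def)
  also have "\<dots> = 1" by (simp add: power2_eq_square algebra_simps)
  finally show ?thesis by (auto simp: unit_sphere_def cube_to_sphere_def)
qed

lemma cube_to_sphere_cube_bd: "x \<in> cube_bd n \<Longrightarrow> cube_to_sphere n x = sphere_base"
  by (auto simp: cube_to_sphere_def cube_bd_def sphere_base_def)

text \<open>Coordinate 0 determines the sup norm, and the others determine the radial image unless
  their common factor vanishes, which happens exactly on the boundary. Points with equal radial
  images differ by a positive scalar, and equal sup norms make it 1.\<close>

lemma cube_to_sphere_inj:
  assumes x: "x \<in> cube n" and y: "y \<in> cube n" and eq: "cube_to_sphere n x = cube_to_sphere n y"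
  shows "x = y \<or> x \<in> cube_bd n \<and> y \<in> cube_bd n"
proof -
  have "(sup_norm n x)\<^sup>2 = (sup_norm n y)\<^sup>2" using fun_cong[OF eq, of 0] by (simp add: cube_to_sphere_def)
  then have r: "sup_norm n x = sup_norm n y" by simp
  show ?thesis
  proof (cases "sup_norm n x = 1")
    case True
    then show ?thesis using x y r by (simp add: cube_bd_def)
  next
    case False
    then have "(sup_norm n x)\<^sup>2 \<noteq> 1" by (simp add: power2_eq_1_iff) (use sup_norm_nonneg[of n x] in linarith)
    then have k: "radial n x i = radial n y i" if "i < n" for i
      using that fun_cong[OF eq, of "Suc i"] r by (simp add: cube_to_sphere_def)
    have x0: "x i = 0 \<and> y i = 0" if "i \<ge> n" for i using x y that by (simp add: cube_def)
    show ?thesis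
    proof (cases "sup_norm n x = 0")
      case True
      then have "x i = y i" for i using sup_norm_0_iff[of n x] sup_norm_0_iff[of n y] r x0[of i] by (cases "i < n") auto
      then show ?thesis by auto
    next
      case pos: False
      then have l: "l2norm n x > 0" "l2norm n y > 0"
        using sup_norm_le_l2norm[of n x] sup_norm_le_l2norm[of n y] sup_norm_nonneg[of n x] r by linarith+
      define c where "c = l2norm n x / l2norm n y"
      have c: "c > 0" using l by (simp add: c_def)
      have xy: "x i = c * y i" if "i < n" for i
      proof -
        have "(x i / l2norm n x) * sup_norm n y = (y i / l2norm n y) * sup_norm n y" using k[OF that] that r by (simp add: radial_def)
        then have "x i / l2norm n x = y i / l2norm n y" using pos unfolding r by (subst (asm) mult_right_cancel) auto
        then show ?thesis using l by (simp add: c_def field_simps)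
      qed
      have "sup_norm n x = sup_norm n (\<lambda>i. c * y i)" by (rule sup_norm_cong) (use xy in auto)
      then have "c = 1" using c pos r by (simp add: sup_norm_scale)
      then have "x i = y i" for i using xy[of i] x0[of i] by (cases "i < n") auto
      then show ?thesis by auto
    qed
  qed
qed

lemma cube_to_sphere_surj:
  assumes s: "s \<in> unit_sphere n" "s \<noteq> sphere_base"
  obtains x where "x \<in> cube n" "cube_to_sphere n x = s"
proof -
  have sum1: "(s 0)\<^sup>2 + (\<Sum>i<n. (s (Suc i))\<^sup>2) = 1" and s0: "\<And>i. i > n \<Longrightarrow> s i = 0"
    using s(1) sum_sq_shift[of s n] by (auto simp: unit_sphere_def)
  have "(\<Sum>i<n. (s (Suc i))\<^sup>2) \<ge> 0" by (simp add: sum_nonneg)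
  then have "(s 0)\<^sup>2 \<le> 1" using sum1 by linarith
  then have a: "-1 \<le> s 0" "s 0 \<le> 1" by (auto simp: abs_square_le_1 abs_le_iff)
  have "s 0 \<noteq> 1"
  proof
    assume "s 0 = 1"
    then have "(\<Sum>i<n. (s (Suc i))\<^sup>2) = 0" using sum1 by simp
    then have z: "s (Suc i) = 0" if "i < n" for i using that by (simp add: sum_nonneg_eq_0_iff)
    have "s i = sphere_base i" for i
      using \<open>s 0 = 1\<close> z[of "i - 1"] s0[of i] by (cases "i = 0"; cases "i \<le> n") (auto simp: sphere_base_def)
    then show False using s(2) by blast
  qed
  then have a1: "s 0 < 1" using a by simp
  \<comment> \<open>The radius solves \<open>s 0 = 2 * r\<^sup>2 - 1\<close>.\<close>
  define r where "r = sqrt ((1 + s 0) / 2)"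
  have r2: "r\<^sup>2 = (1 + s 0) / 2" using a by (simp add: r_def)
  have r: "0 \<le> r" unfolding r_def using a by (intro real_sqrt_ge_zero) simp
  have q: "1 - r\<^sup>2 = (1 - s 0)/2" "1 - r\<^sup>2 > 0" using r2 a1 by (simp_all add: field_simps)
  define y where "y = (\<lambda>i. if i < n then s (Suc i) / (2 * sqrt (1 - r\<^sup>2)) else 0)"
  have "(\<Sum>i<n. (y i)\<^sup>2) = (\<Sum>i<n. (s (Suc i))\<^sup>2 / (4 * (1 - r\<^sup>2)))"
    using q(2) by (intro sum.cong) (auto simp: y_def power_divide power_mult_distrib)
  also have "\<dots> = (1 - (s 0)\<^sup>2) / (4 * (1 - r\<^sup>2))" using sum1 by (simp flip: sum_divide_distrib)
  also have "\<dots> = r\<^sup>2" using q a1 unfolding q(1) r2 by (simp add: field_simps power2_eq_square)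
  finally have ly: "l2norm n y = r" using r by (simp add: l2norm_def)
  \<comment> \<open>Undoes \<open>radial\<close>: the direction of \<open>y\<close>, with sup norm
    \<open>r\<close>. If \<open>y\<close> vanishes, so does \<open>r\<close>, and the formula gives
    the zero vector.\<close>
  define x where "x = (\<lambda>i. (r / sup_norm n y) * y i)"
  have nx: "sup_norm n x = r"
  proof (cases "sup_norm n y = 0")
    case True
    then have "r = 0" using ly sup_norm_0_iff[of n y] l2norm_0_iff[of n y] by simp
    then show ?thesis by (simp add: x_def sup_norm_0_iff)
  next
    case False
    then show ?thesis using r unfolding x_def sup_norm_scale by simp
  qed
  have "r\<^sup>2 \<le> 1\<^sup>2" using q by simp
  then have "r \<le> 1" by (rule power2_le_imp_le) simp
  then have xc: "x \<in> cube n" using nx by (auto simp: cube_def x_def y_def)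
  have rkx: "radial n x i = y i" if "i < n" for i
  proof (cases "sup_norm n y = 0")
    case True
    then show ?thesis using that by (simp add: radial_def x_def sup_norm_0_iff)
  next
    case False
    have lx: "l2norm n x = r * r / sup_norm n y" using r unfolding x_def l2norm_scale ly by simp
    have "r \<noteq> 0" using False ly sup_norm_0_iff[of n y] l2norm_0_iff[of n y] by auto
    then show ?thesis using False that by (simp add: radial_def nx lx) (simp add: x_def)
  qed
  have "cube_to_sphere n x i = s i" for i
  proof (cases "i = 0 \<or> i > n")
    case True
    then show ?thesis using s0[of i] by (auto simp: cube_to_sphere_def nx r2 field_simps)
  next
    case False
    then obtain j where "i = Suc j" "j < n" by (cases i) auto
    then show ?thesis using rkx[of j] q(2) by (simp add: cube_to_sphere_def nx y_def)
  qed
  then show thesis using that xc by blast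
qed

lemma sphere_base_unit_sphere: "sphere_base \<in> unit_sphere n"
  by (simp add: unit_sphere_def sphere_base_def power2_eq_square if_distrib[where f = "\<lambda>x. x * _"] cong: if_cong)

text \<open>A set-theoretic section of the collapse away from the base point, where preimages are
  unique. Continuity of maps on the sphere comes from compactness of the cube.\<close>

definition sphere_to_cube :: "nat \<Rightarrow> (nat \<Rightarrow> real) \<Rightarrow> nat \<Rightarrow> real" where
  "sphere_to_cube n s = (SOME x. x \<in> cube n \<and> cube_to_sphere n x = s)"

lemma sphere_to_cube: "s \<in> unit_sphere n \<Longrightarrow> s \<noteq> sphere_base \<Longrightarrow> sphere_to_cube n s \<in> cube n \<and> cube_to_sphere n (sphere_to_cube n s) = s"
proof -
  assume "s \<in> unit_sphere n" "s \<noteq> sphere_base"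
  then obtain x where "x \<in> cube n \<and> cube_to_sphere n x = s" by (meson cube_to_sphere_surj)
  then show ?thesis unfolding sphere_to_cube_def by (rule someI[where P = "\<lambda>x. x \<in> cube n \<and> cube_to_sphere n x = s"])
qed

lemma cube_to_sphere_base_iff: assumes "x \<in> cube n" shows "cube_to_sphere n x = sphere_base \<longleftrightarrow> x \<in> cube_bd n"
proof
  assume "cube_to_sphere n x = sphere_base"
  then have "cube_to_sphere n x 0 = 1" by (simp add: sphere_base_def)
  then have "(sup_norm n x)\<^sup>2 = 1" by (simp add: cube_to_sphere_def)
  then show "x \<in> cube_bd n" using assms sup_norm_nonneg[of n x] by (auto simp: cube_bd_def power2_eq_1_iff)
qed (rule cube_to_sphere_cube_bd)

definition descend :: "nat \<Rightarrow> 'x \<Rightarrow> ((nat \<Rightarrow> real) \<times> real \<Rightarrow> 'x) \<Rightarrow> (nat \<Rightarrow> real) \<times> real \<Rightarrow> 'x" where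
  "descend n x H = (\<lambda>(s, t). if s = sphere_base then x else H (sphere_to_cube n s, t))"

lemma descend_cube_to_sphere:
  assumes "\<And>q t. q \<in> cube_bd n \<Longrightarrow> t \<in> {0..1} \<Longrightarrow> H (q, t) = x" "q \<in> cube n" "t \<in> {0..1}"
  shows "descend n x H (cube_to_sphere n q, t) = H (q, t)"
proof (cases "q \<in> cube_bd n")
  case True
  then show ?thesis using assms by (simp add: descend_def cube_to_sphere_cube_bd)
next
  case False
  then have ne: "cube_to_sphere n q \<noteq> sphere_base" using cube_to_sphere_base_iff assms(2) by blast
  then have "sphere_to_cube n (cube_to_sphere n q) = q"
    using sphere_to_cube[OF cube_to_sphere_unit_sphere[OF assms(2)] ne] cube_to_sphere_inj[OF _ assms(2)] False by blast
  then show ?thesis using ne by (simp add: descend_def)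
qed

text \<open>The preimage of a closed set is the image of a compact part of the cylinder under the
  collapse, possibly enlarged by the line over the base point; hence it is compact and therefore
  closed.\<close>

lemma descend_cm:
  assumes H: "cm (cube n \<times> {0..1::real}) X H" and b: "\<And>q t. q \<in> cube_bd n \<Longrightarrow> t \<in> {0..1} \<Longrightarrow> H (q, t) = x"
    and x: "x \<in> topspace X"
  shows "cm (unit_sphere n \<times> {0..1}) X (descend n x H)"
  unfolding continuous_map_closedin
proof (intro conjI allI impI)
  have "descend n x H (s, t) \<in> topspace X" if "s \<in> unit_sphere n" "t \<in> {0..1}" for s t
    using cm_image[OF H, of "(sphere_to_cube n s, t)"] sphere_to_cube[of s n] x that by (auto simp: descend_def)
  then show "descend n x H \<in> topspace (top_of_set (unit_sphere n \<times> {0..1})) \<rightarrow> topspace X"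
    by auto
  fix C assume C: "closedin X C"
  let ?D = "cube n \<times> {0..1::real}" let ?q = "\<lambda>z. (cube_to_sphere n (fst z), snd z)"
  have "closedin (top_of_set ?D) {z \<in> ?D. H z \<in> C}"
    using closedin_continuous_map_preimage[OF H C] by simp
  moreover have "compact ?D" by (intro compact_Times compact_cube) simp
  ultimately have "compact {z \<in> ?D. H z \<in> C}" using closedin_compact by blast
  then have cl: "compact (?q ` {z \<in> ?D. H z \<in> C})"
  proof (rule compact_continuous_image[rotated])
    show "continuous_on {z \<in> ?D. H z \<in> C} ?q"
      by (intro continuous_intros continuous_on_compose2[OF continuous_on_cube_to_sphere[of UNIV n]]) auto
  qed
  \<comment> \<open>The line over the base point is added by hand: for \<open>n = 0\<close> the
    boundary is empty and the base point is not in the image of the cube.\<close>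
  define B where "B = (if x \<in> C then {sphere_base} \<times> {0..1::real} else {})"
  have "compact B" by (auto simp: B_def intro!: compact_Times)
  with cl have "closed (?q ` {z \<in> ?D. H z \<in> C} \<union> B)" by (intro compact_imp_closed compact_Un)
  moreover have "{z \<in> topspace (top_of_set (unit_sphere n \<times> {0..1})). descend n x H z \<in> C}
      = ?q ` {z \<in> ?D. H z \<in> C} \<union> B"
  proof (intro equalityI subsetI)
    fix z assume z: "z \<in> {z \<in> topspace (top_of_set (unit_sphere n \<times> {0..1})). descend n x H z \<in> C}"
    show "z \<in> ?q ` {z \<in> ?D. H z \<in> C} \<union> B"
    proof (cases "fst z = sphere_base")
      case True
      then show ?thesis using z by (cases z) (auto simp: descend_def B_def)
    next
      case False
      have "z = ?q (sphere_to_cube n (fst z), snd z)" "(sphere_to_cube n (fst z), snd z) \<in> {z \<in> ?D. H z \<in> C}"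
        using z False sphere_to_cube[of "fst z" n] by (cases z; auto simp: descend_def)+
      then show ?thesis by blast
    qed
  next
    fix z assume "z \<in> ?q ` {z \<in> ?D. H z \<in> C} \<union> B"
    then show "z \<in> {z \<in> topspace (top_of_set (unit_sphere n \<times> {0..1})). descend n x H z \<in> C}"
    proof
      assume "z \<in> ?q ` {z \<in> ?D. H z \<in> C}"
      then show ?thesis using cube_to_sphere_unit_sphere descend_cube_to_sphere[of n H x, OF b] by auto
    next
      assume "z \<in> B"
      then show ?thesis by (auto simp: B_def descend_def sphere_base_unit_sphere split: if_splits)
    qed
  qed
  ultimately show "closedin (top_of_set (unit_sphere n \<times> {0..1})) {z \<in> topspace (top_of_set (unit_sphere n \<times> {0..1})). descend n x H z \<in> C}"
    by (simp add: closed_subset subset_iff) (metis (no_types, lifting) closed_subset mem_Collect_eq subsetI)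
qed

lemma sphere_maps_cube:
  assumes "\<gamma> \<in> sphere_maps n X x"
  shows "(\<lambda>q. \<gamma> (cube_to_sphere n q)) \<in> pointed_maps (cube n) (cube_bd n) X x"
  using assms cm_compose[of "unit_sphere n" X \<gamma> "cube n" "cube_to_sphere n", OF _ continuous_on_cube_to_sphere cube_to_sphere_unit_sphere]
  by (auto simp: sphere_maps_def pointed_maps_def nsphere_eq cube_to_sphere_cube_bd)

lemma sphere_maps_in: "\<gamma> \<in> sphere_maps n X x \<Longrightarrow> x \<in> topspace X"
  using cm_image[OF _ sphere_base_unit_sphere] by (fastforce simp: sphere_maps_def nsphere_eq)

text \<open>A pointed map is treated as a constant homotopy, so that descent of homotopies covers
  it.\<close>

lemma cube_sphere_maps:
  assumes d: "\<delta> \<in> pointed_maps (cube n) (cube_bd n) X x" and x: "x \<in> topspace X"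
  obtains \<gamma> where "\<gamma> \<in> sphere_maps n X x" "\<And>q. q \<in> cube n \<Longrightarrow> \<gamma> (cube_to_sphere n q) = \<delta> q"
proof -
  define H where "H = (\<lambda>z::(nat\<Rightarrow>real)\<times>real. \<delta> (fst z))"
  have H: "cm (cube n \<times> {0..1::real}) X H" "\<And>q t. q \<in> cube_bd n \<Longrightarrow> t \<in> {0..1} \<Longrightarrow> H (q, t) = x"
    unfolding H_def using d by (auto simp: pointed_maps_def intro!: cm_compose[of "cube n"] continuous_intros)
  show thesis
  proof (rule that[of "\<lambda>s. descend n x H (s, 0)"])
    show "(\<lambda>s. descend n x H (s, 0)) \<in> sphere_maps n X x"
    proof -
      have "cm (unit_sphere n) X (\<lambda>s. descend n x H (s, 0))"
        by (rule cm_compose[OF descend_cm[OF H x]]) (auto intro!: continuous_intros)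
      then show ?thesis by (simp add: sphere_maps_def nsphere_eq) (simp add: descend_def)
    qed
    show "descend n x H (cube_to_sphere n q, 0) = \<delta> q" if "q \<in> cube n" for q
      using descend_cube_to_sphere[of n H x q 0, OF H(2) that] by (simp add: H_def)
  qed
qed

lemma sphere_homotopy_iff:
  assumes g: "\<gamma> \<in> sphere_maps n X x" "\<delta> \<in> sphere_maps n X x"
  shows "(\<gamma>, \<delta>) \<in> sphere_homotopy n X x \<longleftrightarrow> rel_homotopic (cube n) (cube_bd n) X x (\<lambda>q. \<gamma> (cube_to_sphere n q)) (\<lambda>q. \<delta> (cube_to_sphere n q))"
proof
  assume "(\<gamma>, \<delta>) \<in> sphere_homotopy n X x"
  then obtain h where h: "cm ({0..1::real} \<times> unit_sphere n) X h" "\<And>s. h (0, s) = \<gamma> s" "\<And>s. h (1, s) = \<delta> s"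
    "\<And>t. t \<in> {0..1} \<Longrightarrow> h (t, sphere_base) = x"
    unfolding sphere_homotopy_def homotopic_with_def by (auto simp: nsphere_eq)
  have "cm (cube n \<times> {0..1::real}) X (\<lambda>z. h (snd z, cube_to_sphere n (fst z)))"
    by (rule cm_compose[OF h(1)])
      (auto intro!: continuous_intros continuous_on_compose2[OF continuous_on_cube_to_sphere[of UNIV n]] cube_to_sphere_unit_sphere)
  then show "rel_homotopic (cube n) (cube_bd n) X x (\<lambda>q. \<gamma> (cube_to_sphere n q)) (\<lambda>q. \<delta> (cube_to_sphere n q))"
    unfolding rel_homotopic_def using h(2-4) by (intro exI[of _ "\<lambda>z. h (snd z, cube_to_sphere n (fst z))"]) (auto simp: cube_to_sphere_cube_bd)
next
  assume "rel_homotopic (cube n) (cube_bd n) X x (\<lambda>q. \<gamma> (cube_to_sphere n q)) (\<lambda>q. \<delta> (cube_to_sphere n q))"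
  then obtain H where H: "cm (cube n \<times> {0..1::real}) X H"
    "\<And>q. q \<in> cube n \<Longrightarrow> H (q, 0) = \<gamma> (cube_to_sphere n q) \<and> H (q, 1) = \<delta> (cube_to_sphere n q)"
    "\<And>q t. q \<in> cube_bd n \<Longrightarrow> t \<in> {0..1} \<Longrightarrow> H (q, t) = x"
    unfolding rel_homotopic_def by blast
  have x: "x \<in> topspace X" by (rule sphere_maps_in[OF g(1)])
  have gb: "\<gamma> sphere_base = x" "\<delta> sphere_base = x" using g by (auto simp: sphere_maps_def)
  \<comment> \<open>\<open>homotopic_with\<close> prescribes the ends at every argument, also off
    the sphere, hence the extra cases.\<close>
  define h where "h = (\<lambda>(t, s). if s \<in> unit_sphere n then descend n x H (s, t) else if t = 0 then \<gamma> s else \<delta> s)"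
  have "cm ({0..1::real} \<times> unit_sphere n) X (\<lambda>z. descend n x H (snd z, fst z))"
    by (rule cm_compose[OF descend_cm[OF H(1,3) x]]) (auto intro!: continuous_intros)
  then have "cm ({0..1::real} \<times> unit_sphere n) X h"
    by (rule cm_cong) (auto simp: h_def)
  moreover have "h (0, s) = \<gamma> s \<and> h (1, s) = \<delta> s" for s
  proof (cases "s \<in> unit_sphere n \<and> s \<noteq> sphere_base")
    case True
    then show ?thesis using sphere_to_cube[of s n] H(2)[of "sphere_to_cube n s"] by (simp add: h_def descend_def)
  next
    case False
    then show ?thesis using gb by (auto simp: h_def descend_def)
  qed
  moreover have "h (t, sphere_base) = x" for t by (simp add: h_def descend_def sphere_base_unit_sphere)
  ultimately have "homotopic_with (\<lambda>\<epsilon>. \<epsilon> sphere_base = x) (nsphere n) X \<gamma> \<delta>"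
    unfolding homotopic_with_def by (intro exI[of _ h]) (simp add: nsphere_eq)
  then show "(\<gamma>, \<delta>) \<in> sphere_homotopy n X x"
    using g by (simp add: sphere_homotopy_def)
qed

section \<open>Homotopy groups in terms of representatives\<close>

lemma equiv_sphere_homotopy: "equiv (sphere_maps n X x) (sphere_homotopy n X x)"
proof (rule equivI)
  show "sphere_homotopy n X x \<subseteq> sphere_maps n X x \<times> sphere_maps n X x"
    by (auto simp: sphere_homotopy_def)
  show "refl_on (sphere_maps n X x) (sphere_homotopy n X x)"
    by (auto simp: refl_on_def sphere_homotopy_def sphere_maps_def)
  show "sym (sphere_homotopy n X x)"
    by (auto simp: sym_def sphere_homotopy_def intro: homotopic_with_symD)
  show "trans (sphere_homotopy n X x)"
    by (auto simp: trans_def sphere_homotopy_def intro: homotopic_with_trans)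
qed

text \<open>Composition with \<open>f\<close> respects homotopy, so the induced map sends the class
  of a representative to the class of its composite; the classes can be eliminated.\<close>

lemma homotopy_group_bij_iff:
  assumes f: "continuous_map X Y f"
  shows "bij_betw (homotopy_group_map n Y f x) (homotopy_group n X x) (homotopy_group n Y (f x)) \<longleftrightarrow>
    (\<forall>\<delta>\<in>sphere_maps n Y (f x). \<exists>\<gamma>\<in>sphere_maps n X x. (f \<circ> \<gamma>, \<delta>) \<in> sphere_homotopy n Y (f x)) \<and>
    (\<forall>\<gamma>\<in>sphere_maps n X x. \<forall>\<gamma>'\<in>sphere_maps n X x. (f \<circ> \<gamma>, f \<circ> \<gamma>') \<in> sphere_homotopy n Y (f x) \<longrightarrow>
        (\<gamma>, \<gamma>') \<in> sphere_homotopy n X x)" (is "?L \<longleftrightarrow> ?S \<and> ?I")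
proof -
  let ?MX = "sphere_maps n X x" let ?MY = "sphere_maps n Y (f x)"
  let ?RX = "sphere_homotopy n X x" let ?RY = "sphere_homotopy n Y (f x)"
  let ?F = "homotopy_group_map n Y f x"
  have eX: "equiv ?MX ?RX" and eY: "equiv ?MY ?RY" by (rule equiv_sphere_homotopy)+
  have fm: "f \<circ> \<gamma> \<in> ?MY" if "\<gamma> \<in> ?MX" for \<gamma>
    using that f by (auto simp: sphere_maps_def intro: continuous_map_compose)
  have fR: "(f \<circ> \<gamma>, f \<circ> \<delta>) \<in> ?RY" if "(\<gamma>, \<delta>) \<in> ?RX" for \<gamma> \<delta>
    using that f fm unfolding sphere_homotopy_def
    by (auto intro: homotopic_with_compose_continuous_map_left)
  have Fc: "?F (?RX `` {\<gamma>}) = ?RY `` {f \<circ> \<gamma>}" if g: "\<gamma> \<in> ?MX" for \<gamma>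
  proof -
    have "(\<gamma>, \<gamma>) \<in> ?RX" using eX g by (meson equivE refl_onD)
    moreover have "?RY `` {f \<circ> \<delta>} = ?RY `` {f \<circ> \<gamma>}" if "(\<gamma>, \<delta>) \<in> ?RX" for \<delta>
      using equiv_class_eq[OF eY fR[OF that]] by simp
    ultimately show ?thesis unfolding homotopy_group_map_def by blast
  qed
  have hg1: "homotopy_group n X x = (\<lambda>\<gamma>. ?RX `` {\<gamma>}) ` ?MX"
    unfolding homotopy_group_def by (auto simp: quotient_def)
  have e1: "?RX `` {\<gamma>} = ?RX `` {\<gamma>'} \<longleftrightarrow> (\<gamma>, \<gamma>') \<in> ?RX" if "\<gamma> \<in> ?MX" "\<gamma>' \<in> ?MX" for \<gamma> \<gamma>'
    using eq_equiv_class_iff[OF eX that] .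
  have e2: "?RY `` {\<gamma>} = ?RY `` {\<gamma>'} \<longleftrightarrow> (\<gamma>, \<gamma>') \<in> ?RY" if "\<gamma> \<in> ?MY" "\<gamma>' \<in> ?MY" for \<gamma> \<gamma>'
    using eq_equiv_class_iff[OF eY that] .
  have "inj_on ?F (homotopy_group n X x) \<longleftrightarrow> ?I"
    unfolding inj_on_def hg1 ball_simps(9) by (simp add: Fc e1 e2 fm)
  moreover have "?F ` homotopy_group n X x = homotopy_group n Y (f x) \<longleftrightarrow> ?S"
  proof -
    have A: "?F ` homotopy_group n X x = (\<lambda>\<gamma>. ?RY `` {f \<circ> \<gamma>}) ` ?MX"
      unfolding hg1 image_image using Fc by (rule image_cong[OF refl])
    have B: "homotopy_group n Y (f x) = (\<lambda>\<delta>. ?RY `` {\<delta>}) ` ?MY"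
      unfolding homotopy_group_def by (auto simp: quotient_def)
    have "?F ` homotopy_group n X x \<subseteq> homotopy_group n Y (f x)"
      unfolding A B using fm by blast
    then have "?F ` homotopy_group n X x = homotopy_group n Y (f x) \<longleftrightarrow>
        homotopy_group n Y (f x) \<subseteq> ?F ` homotopy_group n X x" by blast
    also have "\<dots> \<longleftrightarrow> (\<forall>\<delta>\<in>?MY. \<exists>\<gamma>\<in>?MX. ?RY `` {\<delta>} = ?RY `` {f \<circ> \<gamma>})"
      unfolding A B image_subset_iff image_iff ..
    also have "\<dots> \<longleftrightarrow> ?S" using e2 fm by (simp add: eq_commute cong: bex_cong)
    finally show ?thesis .
  qed
  ultimately show ?thesis unfolding bij_betw_def by blast
qed

lemma rel_homotopic_cong:
  assumes "\<And>q. q \<in> Q \<Longrightarrow> \<gamma> q = \<gamma>' q" "\<And>q. q \<in> Q \<Longrightarrow> \<delta> q = \<delta>' q"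
  shows "rel_homotopic Q S X x \<gamma> \<delta> \<longleftrightarrow> rel_homotopic Q S X x \<gamma>' \<delta>'"
  unfolding rel_homotopic_def using assms by simp

text \<open>Precomposition with the collapse \<open>cube_to_sphere\<close> matches pointed maps on
  the sphere with those on the cube, and likewise their homotopies.\<close>

lemma weak_homotopy_equivalence_iff_cube_weq:
  "weak_homotopy_equivalence X Y f \<longleftrightarrow> continuous_map X Y f \<and> cube_weq X Y f"
proof (cases "continuous_map X Y f")
  case True
  have fx: "f x \<in> topspace Y" if "x \<in> topspace X" for x
    using that True continuous_map_image_subset_topspace by fastforce
  have fm: "f \<circ> \<gamma> \<in> sphere_maps n Y (f x)" if "\<gamma> \<in> sphere_maps n X x" for \<gamma> n x
    using that True by (auto simp: sphere_maps_def intro: continuous_map_compose)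
  have "bij_betw (homotopy_group_map n Y f x) (homotopy_group n X x) (homotopy_group n Y (f x)) \<longleftrightarrow>
     (\<forall>\<delta>\<in>pointed_maps (cube n) (cube_bd n) Y (f x). \<exists>\<gamma>\<in>pointed_maps (cube n) (cube_bd n) X x.
        rel_homotopic (cube n) (cube_bd n) Y (f x) (\<lambda>q. f (\<gamma> q)) \<delta>) \<and>
     (\<forall>\<gamma>\<in>pointed_maps (cube n) (cube_bd n) X x. \<forall>\<gamma>'\<in>pointed_maps (cube n) (cube_bd n) X x.
        rel_homotopic (cube n) (cube_bd n) Y (f x) (\<lambda>q. f (\<gamma> q)) (\<lambda>q. f (\<gamma>' q)) \<longrightarrow> rel_homotopic (cube n) (cube_bd n) X x \<gamma> \<gamma>')"
    (is "_ \<longleftrightarrow> ?S \<and> ?I") if x: "x \<in> topspace X" for n x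
  proof -
    have rel: "(f \<circ> \<gamma>, \<delta>) \<in> sphere_homotopy n Y (f x) \<longleftrightarrow>
        rel_homotopic (cube n) (cube_bd n) Y (f x) (\<lambda>q. f (\<gamma> (cube_to_sphere n q))) (\<lambda>q. \<delta> (cube_to_sphere n q))"
      if "\<gamma> \<in> sphere_maps n X x" "\<delta> \<in> sphere_maps n Y (f x)" for \<gamma> \<delta>
      using sphere_homotopy_iff[OF fm[OF that(1)] that(2)] by (simp add: o_def)
    have S: "(\<forall>\<delta>\<in>sphere_maps n Y (f x). \<exists>\<gamma>\<in>sphere_maps n X x. (f \<circ> \<gamma>, \<delta>) \<in> sphere_homotopy n Y (f x)) \<longleftrightarrow> ?S"
    proof (intro iffI ballI)
      fix \<delta> assume *: "\<forall>\<delta>\<in>sphere_maps n Y (f x). \<exists>\<gamma>\<in>sphere_maps n X x. (f \<circ> \<gamma>, \<delta>) \<in> sphere_homotopy n Y (f x)"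
        and "\<delta> \<in> pointed_maps (cube n) (cube_bd n) Y (f x)"
      then obtain \<delta>' where d: "\<delta>' \<in> sphere_maps n Y (f x)" "\<And>q. q \<in> cube n \<Longrightarrow> \<delta>' (cube_to_sphere n q) = \<delta> q"
        using cube_sphere_maps fx x by metis
      then obtain \<gamma> where g: "\<gamma> \<in> sphere_maps n X x" "(f \<circ> \<gamma>, \<delta>') \<in> sphere_homotopy n Y (f x)" using * by blast
      then have "rel_homotopic (cube n) (cube_bd n) Y (f x) (\<lambda>q. f (\<gamma> (cube_to_sphere n q))) (\<lambda>q. \<delta>' (cube_to_sphere n q))" using rel d(1) by blast
      then have "rel_homotopic (cube n) (cube_bd n) Y (f x) (\<lambda>q. f (\<gamma> (cube_to_sphere n q))) \<delta>"
        using d(2) by (simp cong: rel_homotopic_cong)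
      then show "\<exists>\<gamma>\<in>pointed_maps (cube n) (cube_bd n) X x. rel_homotopic (cube n) (cube_bd n) Y (f x) (\<lambda>q. f (\<gamma> q)) \<delta>"
        using sphere_maps_cube[OF g(1)] by (rule rev_bexI[rotated])
    next
      fix \<delta> assume *: ?S and d: "\<delta> \<in> sphere_maps n Y (f x)"
      obtain \<gamma> where g: "\<gamma> \<in> pointed_maps (cube n) (cube_bd n) X x" "rel_homotopic (cube n) (cube_bd n) Y (f x) (\<lambda>q. f (\<gamma> q)) (\<lambda>q. \<delta> (cube_to_sphere n q))"
        using bspec[OF * sphere_maps_cube[OF d]] by blast
      obtain \<gamma>' where g': "\<gamma>' \<in> sphere_maps n X x" "\<And>q. q \<in> cube n \<Longrightarrow> \<gamma>' (cube_to_sphere n q) = \<gamma> q"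
        using cube_sphere_maps[OF g(1) x] by metis
      have "rel_homotopic (cube n) (cube_bd n) Y (f x) (\<lambda>q. f (\<gamma>' (cube_to_sphere n q))) (\<lambda>q. \<delta> (cube_to_sphere n q))"
        using g(2) g'(2) by (simp cong: rel_homotopic_cong)
      then show "\<exists>\<gamma>\<in>sphere_maps n X x. (f \<circ> \<gamma>, \<delta>) \<in> sphere_homotopy n Y (f x)"
        using rel[OF g'(1) d] g'(1) by blast
    qed
    have I: "(\<forall>\<gamma>\<in>sphere_maps n X x. \<forall>\<gamma>'\<in>sphere_maps n X x. (f \<circ> \<gamma>, f \<circ> \<gamma>') \<in> sphere_homotopy n Y (f x) \<longrightarrow>
        (\<gamma>, \<gamma>') \<in> sphere_homotopy n X x) \<longleftrightarrow> ?I"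
    proof (intro iffI ballI impI)
      fix \<gamma> \<gamma>' assume *: "\<forall>\<gamma>\<in>sphere_maps n X x. \<forall>\<gamma>'\<in>sphere_maps n X x. (f \<circ> \<gamma>, f \<circ> \<gamma>') \<in> sphere_homotopy n Y (f x) \<longrightarrow>
        (\<gamma>, \<gamma>') \<in> sphere_homotopy n X x"
        and g: "\<gamma> \<in> pointed_maps (cube n) (cube_bd n) X x" "\<gamma>' \<in> pointed_maps (cube n) (cube_bd n) X x"
        and h: "rel_homotopic (cube n) (cube_bd n) Y (f x) (\<lambda>q. f (\<gamma> q)) (\<lambda>q. f (\<gamma>' q))"
      obtain a where a: "a \<in> sphere_maps n X x" "\<And>q. q \<in> cube n \<Longrightarrow> a (cube_to_sphere n q) = \<gamma> q"
        using cube_sphere_maps[OF g(1) x] by metis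
      obtain a' where a': "a' \<in> sphere_maps n X x" "\<And>q. q \<in> cube n \<Longrightarrow> a' (cube_to_sphere n q) = \<gamma>' q"
        using cube_sphere_maps[OF g(2) x] by metis
      have "(f \<circ> a, f \<circ> a') \<in> sphere_homotopy n Y (f x)"
        using rel[OF a(1) fm[OF a'(1)]] h a(2) a'(2) by (simp cong: rel_homotopic_cong)
      then have "(a, a') \<in> sphere_homotopy n X x" using * a(1) a'(1) by blast
      then show "rel_homotopic (cube n) (cube_bd n) X x \<gamma> \<gamma>'"
        using sphere_homotopy_iff[OF a(1) a'(1)] a(2) a'(2) by (simp cong: rel_homotopic_cong)
    next
      fix \<gamma> \<gamma>' assume *: ?I and g: "\<gamma> \<in> sphere_maps n X x" "\<gamma>' \<in> sphere_maps n X x"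
        and h: "(f \<circ> \<gamma>, f \<circ> \<gamma>') \<in> sphere_homotopy n Y (f x)"
      have "rel_homotopic (cube n) (cube_bd n) Y (f x) (\<lambda>q. f (\<gamma> (cube_to_sphere n q))) (\<lambda>q. f (\<gamma>' (cube_to_sphere n q)))"
        using rel[OF g(1) fm[OF g(2)]] h by simp
      then have "rel_homotopic (cube n) (cube_bd n) X x (\<lambda>q. \<gamma> (cube_to_sphere n q)) (\<lambda>q. \<gamma>' (cube_to_sphere n q))"
        using *[rule_format, OF sphere_maps_cube[OF g(1)] sphere_maps_cube[OF g(2)]] by simp
      then show "(\<gamma>, \<gamma>') \<in> sphere_homotopy n X x" using sphere_homotopy_iff[OF g] by simp
    qed
    show ?thesis unfolding homotopy_group_bij_iff[OF True] S I ..
  qed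
  then show ?thesis
    unfolding weak_homotopy_equivalence_def cube_weq_def using True by simp
qed (simp add: weak_homotopy_equivalence_def)

lemma weak_homotopy_equivalence_iff_weak_lifting:
  "weak_homotopy_equivalence X Y f \<longleftrightarrow> continuous_map X Y f \<and> weak_lifting X Y f"
  using weak_homotopy_equivalence_iff_cube_weq cube_weq_imp_weak_lifting weak_lifting_imp_cube_weq by metis

section \<open>Relative homotopy lifting\<close>

definition closed_disc :: "nat \<Rightarrow> (nat \<Rightarrow> real) set" where
  "closed_disc n = {x. (\<Sum>i<n. x i ^ 2) \<le> 1 \<and> (\<forall>i\<ge>n. x i = 0)}"

lemma disc_eq: "disc n = top_of_set (closed_disc n)"
  by (simp add: disc_def closed_disc_def Euclidean_space_def subtopology_subtopology euclidean_product_topology Collect_conj_eq Int_commute)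

text \<open>Serre fibrations are tested on Euclidean discs. Scaling by \<open>1 / (n + 1)\<close>
  puts the cube into the unit disc, as \<open>n\<close> squares of size at most
  \<open>1 / (n + 1)\<^sup>2\<close> sum to at most 1; scaling back and clipping each coordinate is
  a retraction.\<close>

lemma cube_retract_of_disc:
  obtains r s where "continuous_on (closed_disc n) r" "continuous_on (cube n) s"
    "\<And>x. x \<in> closed_disc n \<Longrightarrow> r x \<in> cube n" "\<And>x. x \<in> cube n \<Longrightarrow> s x \<in> closed_disc n" "\<And>x. x \<in> cube n \<Longrightarrow> r (s x) = x"
proof
  let ?r = "\<lambda>x i. max (-1) (min 1 ((real n + 1) * x i))"
  let ?s = "\<lambda>x i. x i / (real n + 1) :: real"
  show "continuous_on (closed_disc n) ?r"
    by (intro continuous_on_coordinatewise_then_product continuous_intros continuous_on_max continuous_on_min)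
  show "continuous_on (cube n) ?s"
    by (intro continuous_on_coordinatewise_then_product continuous_intros) auto
  show "?r x \<in> cube n" if "x \<in> closed_disc n" for x
    using that by (auto simp: cube_def closed_disc_def sup_norm_le_iff)
  show "?s x \<in> closed_disc n" if "x \<in> cube n" for x
  proof -
    have "\<bar>x i\<bar> \<le> 1" if "i < n" for i using \<open>x \<in> cube n\<close> that by (auto simp: cube_def sup_norm_le_iff)
    then have x2: "(x i)\<^sup>2 \<le> 1" if "i < n" for i using that by (simp add: abs_square_le_1)
    have "(\<Sum>i<n. (?s x i)\<^sup>2) = (\<Sum>i<n. (x i)\<^sup>2) / (real n + 1)\<^sup>2"
      by (simp add: power_divide flip: sum_divide_distrib)
    also have "\<dots> \<le> real n / (real n + 1)\<^sup>2"
      using sum_mono[of "{..<n}" "\<lambda>i. (x i)\<^sup>2" "\<lambda>_. 1"] x2 by (intro divide_right_mono) auto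
    also have "\<dots> \<le> 1" by (simp add: divide_le_eq power2_eq_square algebra_simps)
    finally show ?thesis using that by (auto simp: closed_disc_def cube_def)
  qed
  show "?r (?s x) = x" if "x \<in> cube n" for x
  proof
    fix i
    show "?r (?s x) i = x i"
      using that by (cases "i < n") (auto simp: cube_def sup_norm_le_iff abs_le_iff)
  qed
qed

lemma Serre_fibration_cell:
  assumes p: "Serre_fibration X Y p" and c: "is_cell n Q S"
    and g: "cm Q X g" and G: "cm (Q \<times> {0..1::real}) Y G" and pg: "\<And>q. q \<in> Q \<Longrightarrow> p (g q) = G (q, 0)"
  obtains K where "cm (Q \<times> {0..1::real}) X K" "\<And>q. q \<in> Q \<Longrightarrow> K (q, 0) = g q"
    "\<And>q t. q \<in> Q \<Longrightarrow> t \<in> {0..1} \<Longrightarrow> p (K (q, t)) = G (q, t)"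
proof -
  obtain \<phi> \<psi> where c: "continuous_on (cube n) \<phi>" "continuous_on Q \<psi>"
    "\<And>x. x \<in> cube n \<Longrightarrow> \<phi> x \<in> Q" "\<And>x. x \<in> Q \<Longrightarrow> \<psi> x \<in> cube n"
    "\<And>x. x \<in> cube n \<Longrightarrow> \<psi> (\<phi> x) = x" "\<And>x. x \<in> Q \<Longrightarrow> \<phi> (\<psi> x) = x"
    "\<And>x. x \<in> cube_bd n \<Longrightarrow> \<phi> x \<in> S" "\<And>x. x \<in> S \<Longrightarrow> \<psi> x \<in> cube_bd n" "S \<subseteq> Q"
    by (rule is_cellE[OF c]; rule that)
  obtain r s where rs: "continuous_on (closed_disc n) r" "continuous_on (cube n) s"
    "\<And>x. x \<in> closed_disc n \<Longrightarrow> r x \<in> cube n" "\<And>x. x \<in> cube n \<Longrightarrow> s x \<in> closed_disc n" "\<And>x. x \<in> cube n \<Longrightarrow> r (s x) = x"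
    by (rule cube_retract_of_disc; rule that)
  let ?r = "\<lambda>x. \<phi> (r x)" let ?s = "\<lambda>x. s (\<psi> x)"
  have cr: "continuous_on (closed_disc n) ?r" by (rule continuous_on_compose2[OF c(1) rs(1)]) (use rs(3) in auto)
  have cs: "continuous_on Q ?s" by (rule continuous_on_compose2[OF rs(2) c(2)]) (use c(4) in auto)
  have "cm (closed_disc n) X (\<lambda>x. g (?r x))" by (rule cm_compose[OF g cr]) (use rs(3) c(3) in auto)
  moreover have "cm (closed_disc n \<times> {0..1}) Y (\<lambda>z. G (?r (fst z), snd z))"
    by (rule cm_compose[OF G]) (auto intro!: continuous_intros continuous_on_compose2[OF cr] c(3) rs(3))
  moreover have "\<forall>x\<in>closed_disc n. p (g (?r x)) = G (?r (fst (x, 0::real)), snd (x, 0))" using pg rs(3) c(3) by auto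
  ultimately obtain k where k: "cm (closed_disc n \<times> {0..1::real}) X k" "\<forall>x\<in>closed_disc n. k (x, 0) = g (?r x)"
    "\<forall>x\<in>closed_disc n. \<forall>t\<in>{0..1}. p (k (x, t)) = G (?r (fst (x, t)), snd (x, t))"
    using p[unfolded Serre_fibration_def disc_eq, THEN conjunct2, rule_format, of n "\<lambda>x. g (?r x)" "\<lambda>z. G (?r (fst z), snd z)"]
    by (auto simp del: fst_conv snd_conv)
  show thesis
  proof (rule that[of "\<lambda>z. k (?s (fst z), snd z)"])
    show "cm (Q \<times> {0..1}) X (\<lambda>z. k (?s (fst z), snd z))"
      by (rule cm_compose[OF k(1)]) (auto intro!: continuous_intros continuous_on_compose2[OF cs] c(4) rs(4))
  qed (use k(2,3) c(4,6) rs(4,5) in auto)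
qed

text \<open>Each point is joined to its projection onto the bottom and sides by a track. The tracks
  are lifted starting with \<open>g\<close>, and the lift is read off when the track arrives at the
  given point. On the bottom and sides this time is 0, so \<open>g\<close> is kept exactly.\<close>

lemma relative_homotopy_lifting:
  assumes p: "Serre_fibration X Y p"
    and g: "cm (cube n \<times> {0} \<union> cube_bd n \<times> {0..1::real}) X g" and G: "cm (cube n \<times> {0..1::real}) Y G"
    and pg: "\<And>z. z \<in> cube n \<times> {0} \<union> cube_bd n \<times> {0..1::real} \<Longrightarrow> p (g z) = G z"
  obtains K where "cm (cube n \<times> {0..1::real}) X K"
    "\<And>z. z \<in> cube n \<times> {0} \<union> cube_bd n \<times> {0..1::real} \<Longrightarrow> K z = g z"
    "\<And>z. z \<in> cube n \<times> {0..1::real} \<Longrightarrow> p (K z) = G z"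
proof -
  let ?Q = "cube n \<times> {0..1::real}" let ?J = "cube n \<times> {0} \<union> cube_bd n \<times> {0..1::real}"
  \<comment> \<open>Scaling from the point \<open>(0, 2)\<close> above the cube by the factor \<open>c z\<close> projects \<open>z\<close> onto \<open>?J\<close>;
      the factor \<open>l z s\<close> moves back to \<open>z\<close>, which is reached at \<open>s = c z - 1\<close>.\<close>
  define c where "c = (\<lambda>z::(nat\<Rightarrow>real)\<times>real. 1 / max (sup_norm n (fst z)) ((2 - snd z)/2))"
  define l where "l = (\<lambda>z s. max 1 (c z - s))"
  define m where "m = (\<lambda>z s. (\<lambda>i. l z s * fst z i, 2 - l z s * (2 - snd z)))"
  have pos: "max (sup_norm n (fst z)) ((2 - snd z)/2) > 0" if "z \<in> ?Q" for z
    using that by (auto simp: less_max_iff_disj)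
  have c1: "1 \<le> c z" and c2: "c z \<le> 2" if "z \<in> ?Q" for z
  proof -
    have "max (sup_norm n (fst z)) ((2 - snd z)/2) \<le> 1" using that by (auto simp: cube_def)
    then show "1 \<le> c z" using pos[OF that] by (simp add: c_def)
    have "1/2 \<le> max (sup_norm n (fst z)) ((2 - snd z)/2)" using that by (auto simp: le_max_iff_disj)
    then show "c z \<le> 2" using pos[OF that] by (simp add: c_def divide_le_eq)
  qed
  have cn: "c z * sup_norm n (fst z) \<le> 1" "c z * (2 - snd z) \<le> 2" if "z \<in> ?Q" for z
  proof -
    have "2 - snd z \<le> 2 * M" if "(2 - snd z)/2 \<le> M" for M using that by simp
    note this[OF max.cobounded2]
    then have "2 - snd z \<le> 2 * max (sup_norm n (fst z)) ((2 - snd z)/2)" .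
    then show "c z * sup_norm n (fst z) \<le> 1" "c z * (2 - snd z) \<le> 2"
      using pos[OF that] by (auto simp: c_def divide_le_eq)
  qed
  have cJ: "c z * sup_norm n (fst z) = 1 \<or> c z * (2 - snd z) = 2" if "z \<in> ?Q" for z
    using pos[OF that] by (auto simp: c_def max_def field_simps)
  have cJ1: "c z = 1" if "z \<in> ?J" for z
    using that by (auto simp: c_def cube_bd_def cube_def max_def)
  have JQ: "?J \<subseteq> ?Q" using cube_bd_cube by auto
  have lb: "1 \<le> l z s" "l z s \<le> c z" if "z \<in> ?Q" "s \<in> {0..1}" for z s
    using c1[OF that(1)] that(2) by (auto simp: l_def)
  have mQ: "m z s \<in> ?Q" if z: "z \<in> ?Q" and s: "s \<in> {0..1}" for z s
  proof -
    have "l z s * sup_norm n (fst z) \<le> c z * sup_norm n (fst z)" "l z s * (2 - snd z) \<le> c z * (2 - snd z)"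
      using lb[OF z s] z by (auto intro!: mult_right_mono)
    moreover have "1 * 1 \<le> l z s * (2 - snd z)" using lb[OF z s] z by (intro mult_mono) auto
    then have "1 \<le> l z s * (2 - snd z)" by simp
    ultimately show ?thesis using cn[OF z] lb[OF z s] z by (auto simp: m_def cube_def sup_norm_scale)
  qed
  have m0: "m z 0 \<in> ?J" if z: "z \<in> ?Q" for z
  proof -
    have l0: "l z 0 = c z" using c1[OF z] by (simp add: l_def)
    have "fst (m z 0) \<in> cube n" "snd (m z 0) \<in> {0..1}" using mQ[OF z, of 0] by auto
    moreover have "sup_norm n (fst (m z 0)) = 1 \<or> snd (m z 0) = 0"
      using cJ[OF z] c1[OF z] by (auto simp: m_def l0 sup_norm_scale)
    ultimately show ?thesis by (cases "m z 0") (auto simp: cube_bd_def)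
  qed
  have m1: "m z (c z - 1) = z" if "z \<in> ?Q" for z
    by (simp add: m_def l_def)
  have ccont: "continuous_on ?Q c"
    unfolding c_def using pos by (intro continuous_intros continuous_on_max) (auto simp: less_le)
  have lcont: "continuous_on (?Q \<times> {0..1}) (\<lambda>w. l (fst w) (snd w))"
    unfolding l_def by (intro continuous_intros continuous_on_max continuous_on_compose2[OF ccont]) auto
  have mcont: "continuous_on (?Q \<times> {0..1}) (\<lambda>w. m (fst w) (snd w))"
    unfolding m_def
    by (intro continuous_on_Pair continuous_on_coordinatewise_then_product continuous_intros lcont continuous_on_compose2[OF continuous_on_coordinate(2)]) auto
  have m0cont: "continuous_on ?Q (\<lambda>z. m z 0)"
  proof -
    have "continuous_on ?Q (\<lambda>z. (z, 0::real))" "(\<lambda>z. (z, 0::real)) ` ?Q \<subseteq> ?Q \<times> {0..1}"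
      by (intro continuous_intros) auto
    from continuous_on_compose2[OF mcont this] show ?thesis by simp
  qed
  have A1: "cm ?Q X (\<lambda>z. g (m z 0))" by (rule cm_compose[OF g m0cont m0])
  have A2: "cm (?Q \<times> {0..1}) Y (\<lambda>w. G (m (fst w) (snd w)))"
    by (rule cm_compose[OF G mcont]) (use mQ in auto)
  have A3: "p (g (m z 0)) = G (m (fst (z, 0)) (snd (z, 0)))" if "z \<in> ?Q" for z using pg[OF m0[OF that]] by simp
  obtain K where K: "cm (?Q \<times> {0..1::real}) X K" "\<And>z. z \<in> ?Q \<Longrightarrow> K (z, 0) = g (m z 0)"
    "\<And>z s. z \<in> ?Q \<Longrightarrow> s \<in> {0..1} \<Longrightarrow> p (K (z, s)) = G (m (fst (z, s)) (snd (z, s)))"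
    by (rule Serre_fibration_cell[OF p is_cell_prod A1 A2]; (rule A3 that; assumption)?)
  show thesis
  proof (rule that[of "\<lambda>z. K (z, c z - 1)"])
    show "cm ?Q X (\<lambda>z. K (z, c z - 1))"
      by (rule cm_compose[OF K(1)]) (auto intro!: continuous_intros ccont simp: c1 c2 algebra_simps)
    show "K (z, c z - 1) = g z" if "z \<in> ?J" for z
      using cJ1[OF that] K(2)[of z] m1[of z] that JQ by auto
    show "p (K (z, c z - 1)) = G z" if "z \<in> ?Q" for z
      using K(3)[OF that, of "c z - 1"] c1[OF that] c2[OF that] m1[OF that] by simp
  qed
qed

text \<open>The square is solved in the base, and the homotopy found there is lifted through the
  fibration relative to the boundary. Its end lies over the solution in \<open>C\<close>, so both
  together give a map into \<open>D\<close>. Only maps out of cubes enter: \<open>ex\<close> and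
  \<open>inj\<close> take the place of a description of \<open>D\<close> as a space of
  pairs.\<close>

lemma weak_lifting_pullback:
  assumes p: "Serre_fibration B A p" and w: "weak_lifting C A w"
    and i: "continuous_map D B i" and j: "continuous_map D C j" and pij: "\<And>d. d \<in> topspace D \<Longrightarrow> p (i d) = w (j d)"
    and ex: "\<And>n \<beta> \<gamma>. cm (cube n) B \<beta> \<Longrightarrow> cm (cube n) C \<gamma> \<Longrightarrow> \<forall>q\<in>cube n. p (\<beta> q) = w (\<gamma> q) \<Longrightarrow>
       \<exists>k. cm (cube n) D k \<and> (\<forall>q\<in>cube n. i (k q) = \<beta> q \<and> j (k q) = \<gamma> q)"
    and inj: "\<And>d d'. d \<in> topspace D \<Longrightarrow> d' \<in> topspace D \<Longrightarrow> i d = i d' \<Longrightarrow> j d = j d' \<Longrightarrow> d = d'"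
  shows "weak_lifting D B i"
  unfolding weak_lifting_def
proof (intro allI impI)
  fix n u v assume s: "lifting_square (cube n) (cube_bd n) D B i u v"
  have u: "cm (cube_bd n) D u" and v: "cm (cube n) B v" and uv: "\<And>q. q \<in> cube_bd n \<Longrightarrow> i (u q) = v q"
    using s by (auto simp: lifting_square_def)
  have pc: "continuous_map B A p" using p by (simp add: Serre_fibration_def)
  have ud: "u q \<in> topspace D" if "q \<in> cube_bd n" for q using cm_image[OF u that] .
  have "lifting_square (cube n) (cube_bd n) C A w (\<lambda>q. j (u q)) (\<lambda>q. p (v q))"
    using cm_post[OF u j] cm_post[OF v pc] pij[OF ud] uv by (simp add: lifting_square_def)
  then have "homotopy_lift (cube n) (cube_bd n) C A w (\<lambda>q. j (u q)) (\<lambda>q. p (v q))" using w by (simp add: weak_lifting_def)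
  then obtain h L where h: "cm (cube n) C h" "\<And>q. q \<in> cube_bd n \<Longrightarrow> h q = j (u q)"
    and L: "cm (cube n \<times> {0..1::real}) A L" "\<And>q. q \<in> cube n \<Longrightarrow> L (q, 0) = w (h q) \<and> L (q, 1) = p (v q)"
      "\<And>q t. q \<in> cube_bd n \<Longrightarrow> t \<in> {0..1} \<Longrightarrow> L (q, t) = p (v q)"
    unfolding homotopy_lift_def by blast
  let ?J = "cube n \<times> {0} \<union> cube_bd n \<times> {0..1::real}"
  \<comment> \<open>Time is reversed so that the lift starts at \<open>v\<close> and ends over
    \<open>w \<circ> h\<close>.\<close>
  have G: "cm (cube n \<times> {0..1::real}) A (\<lambda>z. L (fst z, 1 - snd z))"
    by (rule cm_compose[OF L(1)]) (auto intro!: continuous_intros)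
  have g: "cm ?J B (\<lambda>z. v (fst z))"
    by (rule cm_compose[OF v]) (auto intro!: continuous_intros dest: cube_bd_cube)
  obtain K where K: "cm (cube n \<times> {0..1::real}) B K" "\<And>z. z \<in> ?J \<Longrightarrow> K z = v (fst z)"
    "\<And>z. z \<in> cube n \<times> {0..1::real} \<Longrightarrow> p (K z) = L (fst z, 1 - snd z)"
  proof (rule relative_homotopy_lifting[OF p g G])
    show "p (v (fst z)) = L (fst z, 1 - snd z)" if "z \<in> ?J" for z
      using that L(2)[of "fst z"] L(3)[of "fst z" "1 - snd z"] by auto
  qed (rule that)
  have v': "cm (cube n) B (\<lambda>q. K (q, 1))"
    by (rule cm_compose[OF K(1)]) (auto intro!: continuous_intros)
  have "\<forall>q\<in>cube n. p (K (q, 1)) = w (h q)" using K(3) L(2) by auto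
  then obtain k where k: "cm (cube n) D k" "\<And>q. q \<in> cube n \<Longrightarrow> i (k q) = K (q, 1) \<and> j (k q) = h q"
    using ex[OF v' h(1)] by blast
  have ku: "k q = u q" if q: "q \<in> cube_bd n" for q
  proof (rule inj)
    show "k q \<in> topspace D" using cm_image[OF k(1)] cube_bd_cube[OF q] by blast
    show "u q \<in> topspace D" using ud[OF q] .
  qed (use k(2)[OF cube_bd_cube[OF q]] K(2)[of "(q, 1)"] uv[OF q] h(2)[OF q] q in auto)
  show "homotopy_lift (cube n) (cube_bd n) D B i u v"
    unfolding homotopy_lift_def
  proof (intro exI conjI ballI)
    show "cm (cube n) D k" by (rule k(1))
    show "cm (cube n \<times> {0..1::real}) B (\<lambda>z. K (fst z, 1 - snd z))"
      by (rule cm_compose[OF K(1)]) (auto intro!: continuous_intros)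
  qed (use ku k(2) K(2) in auto)
qed

section \<open>Integer boxes and excision\<close>

definition ibox_le :: "nat \<Rightarrow> (nat \<Rightarrow> int) \<Rightarrow> (nat \<Rightarrow> int) \<Rightarrow> bool" where
  "ibox_le n l r \<longleftrightarrow> (\<forall>i<n. l i \<le> r i) \<and> (\<forall>i\<ge>n. l i = 0 \<and> r i = 0)"

definition ibox :: "(nat \<Rightarrow> int) \<Rightarrow> (nat \<Rightarrow> int) \<Rightarrow> (nat \<Rightarrow> real) set" where
  "ibox l r = {x. \<forall>i. real_of_int (l i) \<le> x i \<and> x i \<le> real_of_int (r i)}"

text \<open>The boundary relative to the nondegenerate directions. Sides of length 0 are allowed, so
  every face of a box is again a box and bisection stays within one notion.\<close>

definition ibox_bd :: "(nat \<Rightarrow> int) \<Rightarrow> (nat \<Rightarrow> int) \<Rightarrow> (nat \<Rightarrow> real) set" where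
  "ibox_bd l r = {x \<in> ibox l r. \<exists>i. l i < r i \<and> (x i = l i \<or> x i = r i)}"

lemma ibox_leD: "ibox_le n l r \<Longrightarrow> l i \<le> r i" "ibox_le n l r \<Longrightarrow> l i < r i \<Longrightarrow> i < n"
  unfolding ibox_le_def by (metis le_less_linear order_refl) (metis le_less_linear less_irrefl)

lemma iboxI: "(\<And>i. real_of_int (l i) \<le> x i) \<Longrightarrow> (\<And>i. x i \<le> real_of_int (r i)) \<Longrightarrow> x \<in> ibox l r"
  by (simp add: ibox_def)

lemma iboxD: assumes "x \<in> ibox l r" shows "real_of_int (l i) \<le> x i" "x i \<le> real_of_int (r i)"
  using assms by (simp_all add: ibox_def)

lemma ibox_mono: assumes "\<And>i. l' i \<le> l i" "\<And>i. r i \<le> r' i" shows "ibox l r \<subseteq> ibox l' r'"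
proof
  fix x assume x: "x \<in> ibox l r"
  show "x \<in> ibox l' r'"
  proof (rule iboxI)
    fix i
    have "real_of_int (l' i) \<le> l i" "real_of_int (r i) \<le> r' i" using assms by auto
    then show "real_of_int (l' i) \<le> x i" "x i \<le> real_of_int (r' i)" using iboxD[OF x, of i] by linarith+
  qed
qed

lemma ibox_eq: assumes "x \<in> ibox l r" "l i = r i" shows "x i = real_of_int (l i)"
  using iboxD[OF assms(1), of i] assms(2) by simp

lemma ibox_bd_box: "ibox_bd l r \<subseteq> ibox l r"
  by (auto simp: ibox_bd_def)

lemma closed_box: "closed (ibox l r)"
  unfolding ibox_def
  by (intro closed_Collect_all closed_Collect_conj closed_Collect_le continuous_intros)

lemma closed_ibox_bd:
  assumes "ibox_le n l r" shows "closed (ibox_bd l r)"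
proof -
  have "ibox_bd l r = (\<Union>i\<in>{i. i < n \<and> l i < r i}. ibox l r \<inter> ({x. x i = l i} \<union> {x. x i = r i}))"
    using ibox_leD(2)[OF assms] by (auto simp: ibox_bd_def)
  moreover have c: "closed (ibox l r \<inter> ({x. x i = l i} \<union> {x. x i = r i}))" for i
    by (intro closed_Int closed_Un closed_box closed_Collect_eq continuous_intros)
  moreover have "closed (\<Union>i\<in>{i. i < n \<and> l i < r i}. ibox l r \<inter> ({x. x i = l i} \<union> {x. x i = r i}))"
    by (rule closed_UN) (use c in auto)
  ultimately show ?thesis by simp
qed

text \<open>The coordinates with positive side length are enumerated by \<open>e\<close>; their
  number is the dimension of the cell, and the others are constant on the box.\<close>

lemma is_cell_box:
  assumes b: "ibox_le n l r"
  obtains d where "is_cell d (ibox l r) (ibox_bd l r)"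
proof -
  define S where "S = {i. l i < r i}"
  have fS: "finite S" using ibox_leD(2)[OF b] by (auto simp: S_def intro: finite_subset[of _ "{..<n}"])
  define d where "d = card S"
  obtain e where e: "bij_betw e S {..<d}"
    using fS ex_bij_betw_finite_nat[of S] by (auto simp: d_def atLeast0LessThan)
  define e' where "e' = inv_into S e"
  have ee: "e i < d" "e' (e i) = i" if "i \<in> S" for i
    using e that by (auto simp: e'_def bij_betw_def)
  have e'e: "e' k \<in> S" "e (e' k) = k" if "k < d" for k
    using e that by (auto simp: e'_def bij_betw_def inv_into_into f_inv_into_f)
  define lr where "lr = (\<lambda>i. real_of_int (r i - l i))"
  have lr: "lr i > 0" if "i \<in> S" for i using that by (simp add: lr_def S_def)
  define \<phi> :: "(nat \<Rightarrow> real) \<Rightarrow> nat \<Rightarrow> real" where "\<phi> = (\<lambda>(x::nat\<Rightarrow>real) i. if i \<in> S then (l i + r i + lr i * x (e i)) / 2 else real_of_int (l i))"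
  define \<psi> :: "(nat \<Rightarrow> real) \<Rightarrow> nat \<Rightarrow> real" where "\<psi> = (\<lambda>(y::nat\<Rightarrow>real) k. if k < d then (2 * y (e' k) - l (e' k) - r (e' k)) / lr (e' k) else 0)"
  have lrS: "l i = r i" if "i \<notin> S" for i using ibox_leD(1)[OF b, of i] that by (auto simp: S_def)
  have abs1: "\<bar>\<psi> y k\<bar> \<le> 1" if "y \<in> ibox l r" "k < d" for y and k
  proof -
    have "l (e' k) \<le> y (e' k)" "y (e' k) \<le> r (e' k)" using that(1) by (auto simp: ibox_def)
    then have "\<bar>2 * y (e' k) - l (e' k) - r (e' k)\<bar> \<le> lr (e' k)" by (auto simp: lr_def abs_le_iff)
    then show ?thesis using that(2) lr[OF e'e(1)[OF that(2)]] by (simp add: \<psi>_def divide_le_eq_1)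
  qed
  have \<psi>c: "\<psi> y \<in> cube d" if "y \<in> ibox l r" for y
    using abs1[OF that] by (auto simp: cube_def sup_norm_le_iff) (simp add: \<psi>_def)
  have \<phi>b: "\<phi> x \<in> ibox l r" if "x \<in> cube d" for x
  proof -
    have "real_of_int (l i) \<le> \<phi> x i \<and> \<phi> x i \<le> real_of_int (r i)" for i
    proof (cases "i \<in> S")
      case True
      have "\<bar>x (e i)\<bar> \<le> 1" using that ee(1)[OF True] by (auto simp: cube_def sup_norm_le_iff)
      then have "\<bar>lr i * x (e i)\<bar> \<le> lr i * 1" using lr[OF True] by (simp add: abs_mult)
      then show ?thesis using True by (simp add: \<phi>_def lr_def abs_le_iff)
    qed (simp add: \<phi>_def lrS)
    then show ?thesis by (simp add: ibox_def)
  qed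
  have \<psi>\<phi>: "\<psi> (\<phi> x) = x" if "x \<in> cube d" for x
  proof
    fix k show "\<psi> (\<phi> x) k = x k"
      using that e'e[of k] lr[of "e' k"] by (cases "k < d") (auto simp: \<psi>_def \<phi>_def cube_def field_simps)
  qed
  have \<phi>\<psi>: "\<phi> (\<psi> y) = y" if "y \<in> ibox l r" for y
  proof
    fix i show "\<phi> (\<psi> y) i = y i"
    proof (cases "i \<in> S")
      case True
      then show ?thesis using ee[OF True] lr[OF True] by (simp add: \<psi>_def \<phi>_def)
    next
      case False
      then show ?thesis using that lrS[OF False] by (simp add: \<phi>_def ibox_def) (metis antisym)
    qed
  qed
  have ends: "\<bar>\<psi> y k\<bar> = 1 \<longleftrightarrow> y (e' k) = l (e' k) \<or> y (e' k) = r (e' k)" if "k < d" for y k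
  proof -
    have "\<bar>\<psi> y k\<bar> = 1 \<longleftrightarrow> \<psi> y k = 1 \<or> \<psi> y k = - 1" by (auto simp: abs_if)
    also have "\<dots> \<longleftrightarrow> y (e' k) = r (e' k) \<or> y (e' k) = l (e' k)"
      using that lr[OF e'e(1)[OF that]] by (auto simp: \<psi>_def divide_eq_eq lr_def)
    finally show ?thesis by blast
  qed
  have cube_bd\<psi>: "\<psi> y \<in> cube_bd d \<longleftrightarrow> y \<in> ibox_bd l r" if y: "y \<in> ibox l r" for y
  proof -
    have "\<psi> y \<in> cube_bd d \<longleftrightarrow> (\<exists>k<d. \<bar>\<psi> y k\<bar> = 1)"
      using sup_norm_eq_1_iff[OF sup_norm_le1[OF \<psi>c[OF y]]] \<psi>c[OF y] by (simp add: cube_bd_def)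
    also have "\<dots> \<longleftrightarrow> (\<exists>k<d. y (e' k) = l (e' k) \<or> y (e' k) = r (e' k))" using ends by auto
    also have "\<dots> \<longleftrightarrow> (\<exists>i\<in>S. y i = l i \<or> y i = r i)" using e'e(1) ee by metis
    also have "\<dots> \<longleftrightarrow> y \<in> ibox_bd l r" using y by (auto simp: ibox_bd_def S_def)
    finally show ?thesis .
  qed
  have "is_cell d (ibox l r) (ibox_bd l r)"
  proof (rule is_cellI[of _ \<phi> _ \<psi>])
    show "continuous_on (cube d) \<phi>" unfolding \<phi>_def by (intro continuous_on_coordinatewise_then_product) (auto intro!: continuous_intros)
    show "continuous_on (ibox l r) \<psi>" unfolding \<psi>_def
      by (intro continuous_on_coordinatewise_then_product continuous_intros) (use lr e'e in \<open>auto simp: less_le\<close>)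
    show "\<phi> x \<in> ibox_bd l r" if "x \<in> cube_bd d" for x
      using cube_bd\<psi>[OF \<phi>b[OF cube_bd_cube[OF that]]] \<psi>\<phi>[OF cube_bd_cube[OF that]] that by simp
    show "\<psi> x \<in> cube_bd d" if "x \<in> ibox_bd l r" for x using cube_bd\<psi> that ibox_bd_box by blast
  qed (use \<phi>b \<psi>c \<psi>\<phi> \<phi>\<psi> ibox_bd_box in auto)
  then show thesis by (rule that)
qed

text \<open>
  An extension problem for boxes that is local for finite closed covers is solved by bisection:
  first extend to the cutting face, then to the two halves.
\<close>

lemma ibox_extend:
  fixes adm :: "(nat \<Rightarrow> real) set \<Rightarrow> ((nat \<Rightarrow> real) \<Rightarrow> 'e) \<Rightarrow> bool"
  assumes cong: "\<And>S e e'. adm S e \<Longrightarrow> (\<And>x. x \<in> S \<Longrightarrow> e x = e' x) \<Longrightarrow> adm S e'"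
    and mono: "\<And>S S' e. adm S e \<Longrightarrow> S' \<subseteq> S \<Longrightarrow> adm S' e"
    and glue: "\<And>S S' e. closed S \<Longrightarrow> closed S' \<Longrightarrow> adm S e \<Longrightarrow> adm S' e \<Longrightarrow> adm (S \<union> S') e"
    and unit: "\<And>l r e. ibox_le n l r \<Longrightarrow> (\<forall>i. Lo i \<le> l i \<and> r i \<le> Hi i) \<Longrightarrow> (\<forall>i. r i \<le> l i + 1) \<Longrightarrow> adm (ibox_bd l r) e \<Longrightarrow>
        \<exists>e'. adm (ibox l r) e' \<and> (\<forall>x\<in>ibox_bd l r. e' x = e x)"
    and b: "ibox_le n l r" "\<forall>i. Lo i \<le> l i \<and> r i \<le> Hi i" and e: "adm (ibox_bd l r) e"
  shows "\<exists>e'. adm (ibox l r) e' \<and> (\<forall>x\<in>ibox_bd l r. e' x = e x)"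
  using b e
proof (induction "\<Sum>i<n. nat (r i - l i)" arbitrary: l r e rule: less_induct)
  case less
  note b = less.prems(1) and LH = less.prems(2) and e = less.prems(3)
  show ?case
  proof (cases "\<forall>i. r i \<le> l i + 1")
    case True
    then show ?thesis using unit[OF b LH True e] by blast
  next
    case False
    then obtain j where j: "l j + 1 < r j" by (metis not_less)
    \<comment> \<open>Both halves have smaller total side length, and so has the cutting face, whose
      side in direction \<open>j\<close> has length 0.\<close>
    define m where "m = l j + 1"
    have jm: "l j < m" "m < r j" using j by (auto simp: m_def)
    have jn: "j < n" using ibox_leD(2)[OF b, of j] j by simp
    let ?r1 = "r(j := m)" and ?l2norm = "l(j := m)"
    have b1: "ibox_le n l ?r1" and b2: "ibox_le n ?l2norm r" and b3: "ibox_le n ?l2norm ?r1"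
      using b jm jn by (auto simp: ibox_le_def)
    have lohi: "Lo j \<le> m" "m \<le> Hi j" using spec[OF LH, of j] jm by linarith+
    have LH': "\<forall>i. Lo i \<le> l i \<and> ?r1 i \<le> Hi i" "\<forall>i. Lo i \<le> ?l2norm i \<and> r i \<le> Hi i" "\<forall>i. Lo i \<le> ?l2norm i \<and> ?r1 i \<le> Hi i"
      using LH lohi by auto
    have ms: "(\<Sum>i<n. nat (?r1 i - l i)) < (\<Sum>i<n. nat (r i - l i))"
      "(\<Sum>i<n. nat (r i - ?l2norm i)) < (\<Sum>i<n. nat (r i - l i))"
      "(\<Sum>i<n. nat (?r1 i - ?l2norm i)) < (\<Sum>i<n. nat (r i - l i))"
      using jm jn by (auto intro!: sum_strict_mono_ex1 bexI[of _ j])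
    have mr: "real_of_int (l j) < m" "m < real_of_int (r j)" using jm by auto
    have bx: "x \<in> ibox l ?r1 \<longleftrightarrow> x \<in> ibox l r \<and> x j \<le> m" "x \<in> ibox ?l2norm r \<longleftrightarrow> x \<in> ibox l r \<and> m \<le> x j"
      "x \<in> ibox ?l2norm ?r1 \<longleftrightarrow> x \<in> ibox l r \<and> x j = m" for x :: "nat \<Rightarrow> real"
    proof -
      have *: "x \<in> ibox l' r' \<longleftrightarrow> (\<forall>i. i \<noteq> j \<longrightarrow> real_of_int (l' i) \<le> x i \<and> x i \<le> real_of_int (r' i)) \<and>
          real_of_int (l' j) \<le> x j \<and> x j \<le> real_of_int (r' j)" for l' r' unfolding ibox_def mem_Collect_eq by metis
      show "x \<in> ibox l ?r1 \<longleftrightarrow> x \<in> ibox l r \<and> x j \<le> m" "x \<in> ibox ?l2norm r \<longleftrightarrow> x \<in> ibox l r \<and> m \<le> x j"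
        "x \<in> ibox ?l2norm ?r1 \<longleftrightarrow> x \<in> ibox l r \<and> x j = m"
        using mr unfolding * by auto
    qed
    define E where "E = (\<lambda>x::nat\<Rightarrow>real. \<exists>i. i \<noteq> j \<and> l i < r i \<and> (x i = l i \<or> x i = r i))"
    have bb: "x \<in> ibox_bd l' r' \<longleftrightarrow> x \<in> ibox l' r' \<and> (E x \<or> l' j < r' j \<and> (x j = l' j \<or> x j = r' j))"
      if "\<forall>i. i \<noteq> j \<longrightarrow> l' i = l i \<and> r' i = r i" for x :: "nat \<Rightarrow> real" and l' r'
      unfolding ibox_bd_def E_def using that by (simp, metis)
    have bbs: "x \<in> ibox_bd l r \<longleftrightarrow> x \<in> ibox l r \<and> (E x \<or> x j = l j \<or> x j = r j)"
      "x \<in> ibox_bd l ?r1 \<longleftrightarrow> x \<in> ibox l r \<and> x j \<le> m \<and> (E x \<or> x j = l j \<or> x j = m)"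
      "x \<in> ibox_bd ?l2norm r \<longleftrightarrow> x \<in> ibox l r \<and> m \<le> x j \<and> (E x \<or> x j = m \<or> x j = r j)"
      "x \<in> ibox_bd ?l2norm ?r1 \<longleftrightarrow> x \<in> ibox l r \<and> x j = m \<and> E x" for x :: "nat \<Rightarrow> real"
      using jm by (subst bb; simp add: bx; auto)+
    have un: "ibox l r = ibox l ?r1 \<union> ibox ?l2norm r" and int: "ibox l ?r1 \<inter> ibox ?l2norm r = ibox ?l2norm ?r1"
      by (auto simp: bx)
    have sub3: "ibox_bd ?l2norm ?r1 \<subseteq> ibox_bd l r" and sub3': "ibox_bd l r \<inter> ibox ?l2norm ?r1 \<subseteq> ibox_bd ?l2norm ?r1"
      using mr by (auto simp: bx bbs)
    have sub1: "ibox_bd l ?r1 \<subseteq> ibox_bd l r \<union> ibox ?l2norm ?r1" and sub2: "ibox_bd ?l2norm r \<subseteq> ibox_bd l r \<union> ibox ?l2norm ?r1"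
      using mr by (auto simp: bx bbs)
    have sub4: "ibox_bd l r \<inter> ibox l ?r1 \<subseteq> ibox_bd l ?r1" "ibox_bd l r \<inter> ibox ?l2norm r \<subseteq> ibox_bd ?l2norm r"
      "ibox ?l2norm ?r1 \<subseteq> ibox_bd l ?r1" "ibox ?l2norm ?r1 \<subseteq> ibox_bd ?l2norm r"
      using mr by (auto simp: bx bbs)
    obtain e3 where e3: "adm (ibox ?l2norm ?r1) e3" "\<forall>x\<in>ibox_bd ?l2norm ?r1. e3 x = e x"
      using less.hyps[OF ms(3) b3 LH'(3) mono[OF e sub3]] by blast
    define e0 where "e0 = (\<lambda>x. if x \<in> ibox ?l2norm ?r1 then e3 x else e x)"
    have "adm (ibox_bd l r) e0"
      by (rule cong[OF e]) (use e3(2) sub3' in \<open>auto simp: e0_def\<close>)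
    moreover have "adm (ibox ?l2norm ?r1) e0" by (rule cong[OF e3(1)]) (simp add: e0_def)
    ultimately have e0: "adm (ibox_bd l r \<union> ibox ?l2norm ?r1) e0"
      by (rule glue[OF closed_ibox_bd[OF b] closed_box])
    obtain e1 where e1: "adm (ibox l ?r1) e1" "\<forall>x\<in>ibox_bd l ?r1. e1 x = e0 x"
      using less.hyps[OF ms(1) b1 LH'(1) mono[OF e0 sub1]] by blast
    obtain e2 where e2: "adm (ibox ?l2norm r) e2" "\<forall>x\<in>ibox_bd ?l2norm r. e2 x = e0 x"
      using less.hyps[OF ms(2) b2 LH'(2) mono[OF e0 sub2]] by blast
    define e' where "e' = (\<lambda>x. if x \<in> ibox l ?r1 then e1 x else e2 x)"
    have "adm (ibox l ?r1) e'" by (rule cong[OF e1(1)]) (simp add: e'_def)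
    moreover have "adm (ibox ?l2norm r) e'"
    proof (rule cong[OF e2(1)])
      fix x assume x: "x \<in> ibox ?l2norm r"
      show "e2 x = e' x"
      proof (cases "x \<in> ibox l ?r1")
        case True
        then have "x \<in> ibox ?l2norm ?r1" using int x by blast
        then have "e1 x = e0 x" "e2 x = e0 x" using e1(2) e2(2) sub4(3,4) by (meson subsetD)+
        then show ?thesis using True by (simp add: e'_def)
      qed (simp add: e'_def)
    qed
    ultimately have "adm (ibox l r) e'"
      unfolding un by (rule glue[OF closed_box closed_box])
    moreover have "e' x = e x" if x: "x \<in> ibox_bd l r" for x
    proof -
      have e0x: "e0 x = e x" using e3(2) sub3' x by (auto simp: e0_def)
      show ?thesis
      proof (cases "x \<in> ibox l ?r1")
        case True
        then show ?thesis using e1(2) sub4(1) x e0x by (auto simp: e'_def)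
      next
        case False
        then have "x \<in> ibox ?l2norm r" using un x ibox_bd_box by blast
        then show ?thesis using e2(2) sub4(2) x e0x False by (auto simp: e'_def)
      qed
    qed
    ultimately show ?thesis by blast
  qed
qed


section \<open>Subdivision into unit boxes\<close>

definition unit_boxes :: "nat \<Rightarrow> int \<Rightarrow> (nat \<Rightarrow> int) set" where
  "unit_boxes n N = {l. (\<forall>i<n. 0 \<le> l i \<and> l i < N) \<and> (\<forall>i\<ge>n. l i = 0)}"

definition unit_box :: "nat \<Rightarrow> (nat \<Rightarrow> int) \<Rightarrow> (nat \<Rightarrow> real) set" where
  "unit_box n l = ibox l (\<lambda>i. if i < n then l i + 1 else 0)"

lemma ucubeD:
  assumes "x \<in> unit_box n l" "i < n" shows "real_of_int (l i) \<le> x i" "x i \<le> real_of_int (l i + 1)"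
  using iboxD[OF assms(1)[unfolded unit_box_def], of i] assms(2) by auto

lemma finite_unit_boxes: "finite (unit_boxes n N)"
proof -
  have "finite {f. \<forall>i. (i \<in> {..<n} \<longrightarrow> f i \<in> {0..<N}) \<and> (i \<notin> {..<n} \<longrightarrow> f i = 0)}"
    by (rule finite_set_of_finite_funs) auto
  then show ?thesis by (rule rev_finite_subset) (auto simp: unit_boxes_def)
qed

lemma unit_ibox_in_unit_box:
  assumes b: "ibox_le n l r" "\<forall>i. 0 \<le> l i \<and> r i \<le> (if i < n then N else 0)" "\<forall>i. r i \<le> l i + 1" and N: "N \<ge> 1"
  shows "\<exists>l'\<in>unit_boxes n N. ibox l r \<subseteq> unit_box n l'"
proof
  \<comment> \<open>A degenerate side may lie at the far end \<open>N\<close>, where no unit box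
    starts; then the last one is taken.\<close>
  define l' where "l' = (\<lambda>i. if i < n then min (l i) (N - 1) else 0)"
  show "l' \<in> unit_boxes n N" using b(2) N by (auto simp: unit_boxes_def l'_def)
  have "l' i \<le> l i" "r i \<le> (if i < n then l' i + 1 else 0)" for i
    using spec[OF b(2), of i] spec[OF b(3), of i] by (auto simp: l'_def)
  then show "ibox l r \<subseteq> unit_box n l'" unfolding unit_box_def by (rule ibox_mono)
qed

text \<open>By integrality, a point in the relative interior of a face lies strictly between
  consecutive integers in each nondegenerate direction and at an integer in the others. Hence a unit
  box that contains the point contains the whole face.\<close>

lemma unit_ibox_meets_unit_box:
  assumes b: "ibox_le n l r" "\<forall>i. r i \<le> l i + 1" and y: "y \<in> ibox l r" "y \<notin> ibox_bd l r" and m: "y \<in> unit_box n m"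
    and m0: "m \<in> unit_boxes n N"
  shows "ibox l r \<subseteq> unit_box n m"
proof -
  have "m i \<le> l i \<and> r i \<le> (if i < n then m i + 1 else 0)" for i
  proof (cases "l i < r i")
    case True
    then have i: "i < n" using ibox_leD(2)[OF b(1)] by simp
    have r: "r i = l i + 1" using True spec[OF b(2), of i] by simp
    have "y i \<noteq> l i" "y i \<noteq> r i" using y True by (auto simp: ibox_bd_def)
    then have "real_of_int (l i) < y i" "y i < real_of_int (r i)"
      using iboxD[OF y(1), of i] by auto
    moreover have "real_of_int (m i) \<le> y i" "y i \<le> real_of_int (m i + 1)"
      using ucubeD[OF m i] by auto
    ultimately have "real_of_int (m i) < real_of_int (l i + 1)" "real_of_int (l i) < real_of_int (m i + 1)"
      using r by auto
    then have "m i < l i + 1" "l i < m i + 1" by (simp_all only: of_int_less_iff)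
    then show ?thesis using r i by simp
  next
    case False
    then have e: "l i = r i" using ibox_leD(1)[OF b(1), of i] by simp
    then have "y i = l i" by (rule ibox_eq[OF y(1)])
    moreover have "real_of_int (m i) \<le> y i" "y i \<le> real_of_int (if i < n then m i + 1 else 0)"
      using iboxD[OF m[unfolded unit_box_def], of i] by auto
    ultimately show ?thesis using e by (metis of_int_le_iff)
  qed
  then show ?thesis unfolding unit_box_def by (intro ibox_mono) auto
qed

text \<open>A relative interior point can have an integer coordinate only in a degenerate direction,
  and there the coordinate is the same on the whole face.\<close>

lemma unit_ibox_meets_boundary:
  assumes b: "ibox_le n l r" "\<forall>i. L i \<le> l i \<and> r i \<le> R i" "\<forall>i. r i \<le> l i + 1" and y: "y \<in> ibox l r" "y \<notin> ibox_bd l r" "y \<in> ibox_bd L R"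
  shows "ibox l r \<subseteq> ibox_bd L R"
proof -
  obtain i where i: "L i < R i" "y i = L i \<or> y i = R i" using y(3) by (auto simp: ibox_bd_def)
  have e: "l i = r i"
  proof (rule ccontr)
    assume "l i \<noteq> r i"
    then have lt: "l i < r i" using ibox_leD(1)[OF b(1), of i] by simp
    then have "y i \<noteq> l i" "y i \<noteq> r i" using y by (auto simp: ibox_bd_def)
    then have "real_of_int (l i) < y i" "y i < real_of_int (r i)" using iboxD[OF y(1), of i] by auto
    then have "\<exists>k::int. l i < k \<and> k < r i" using i(2) by auto
    then show False using spec[OF b(3), of i] by auto
  qed
  then have yi: "y i = l i" by (rule ibox_eq[OF y(1)])
  have sub: "ibox l r \<subseteq> ibox L R" by (rule ibox_mono) (use b(2) in auto)
  have "x \<in> ibox_bd L R" if x: "x \<in> ibox l r" for x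
  proof -
    have "x i = l i" by (rule ibox_eq[OF x e])
    then show ?thesis using sub x i yi unfolding ibox_bd_def by auto
  qed
  then show ?thesis by blast
qed

lemma cm_closed_Un':
  "closed S \<Longrightarrow> closed T \<Longrightarrow> cm S X f \<Longrightarrow> cm T X f \<Longrightarrow> cm (S \<union> T) X f"
  by (rule cm_closed_Un) (auto intro: closed_subset)

lemma cm_into_sub: "cm S X k \<Longrightarrow> (\<And>y. y \<in> S \<Longrightarrow> k y \<in> T) \<Longrightarrow> cm S (subtopology X T) k"
  by (auto simp: continuous_map_in_subtopology)

text \<open>The metric on \<open>nat \<Rightarrow> real\<close> is a weighted sum with weights
  \<open>(1/2)^n\<close>, of total 2. This connects coordinatewise estimates on a grid with uniform
  continuity.\<close>

lemma dist_fun_le: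
  fixes x y :: "nat \<Rightarrow> real"
  assumes "\<And>i. \<bar>x i - y i\<bar> \<le> e"
  shows "dist x y \<le> 2 * e"
proof -
  have s: "summable (\<lambda>n. (1/2)^n * min (dist (x (from_nat n)) (y (from_nat n))) 1)"
    by (rule summable_comparison_test'[of "\<lambda>n. (1/2)^n"]) (auto simp: summable_geometric_iff)
  have "dist x y \<le> suminf (\<lambda>n. (1/2)^n * e)"
    unfolding dist_fun_def
  proof (rule suminf_le[OF _ s])
    show "(1/2)^n * min (dist (x (from_nat n)) (y (from_nat n))) 1 \<le> (1/2)^n * e" for n
      using assms[of "from_nat n"] by (intro mult_left_mono) (auto simp: dist_real_def min_le_iff_disj)
    show "summable (\<lambda>n. (1/2)^n * e)" by (intro summable_mult2 summable_geometric) simp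
  qed
  also have "\<dots> = 2 * e" by (simp add: suminf_mult2[symmetric] summable_geometric suminf_geometric)
  finally show ?thesis .
qed

text \<open>
  The values at one object of the maps \<open>B \<rightarrow> T\<close> and \<open>D \<rightarrow> T\<close> of the introduction: \<open>h\<close> and \<open>H\<close> are the paths, \<open>\<tau>\<close> the
  height on \<open>D\<close>, \<open>\<alpha>\<close> and \<open>\<rho>\<close> the preimages of their ends, \<open>\<beta>\<close> the preimage of the start.
\<close>

locale excision_data =
  fixes A :: "'a topology" and B :: "'b topology" and C :: "'c topology" and D :: "'d topology"
    and f g b c and h :: "'b \<times> real \<Rightarrow> 'b" and H :: "'d \<times> real \<Rightarrow> 'd"
    and \<tau> :: "'d \<Rightarrow> real" and \<rho> :: "'d \<Rightarrow> 'c" and \<alpha> :: "'b \<Rightarrow> 'a" and \<beta> :: "'d \<Rightarrow> 'b"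
  assumes cont: "continuous_map A B f" "continuous_map A C g" "continuous_map B D b" "continuous_map C D c"
    and comm: "\<And>a. a \<in> topspace A \<Longrightarrow> b (f a) = c (g a)"
    and h: "continuous_map (prod_topology B (top_of_set {0..1})) B h"
    and H: "continuous_map (prod_topology D (top_of_set {0..1})) D H"
    and \<tau>: "continuous_map D euclideanreal \<tau>"
    and \<tau>01: "\<And>d. d \<in> topspace D \<Longrightarrow> 0 \<le> \<tau> d \<and> \<tau> d \<le> 1"
    and \<rho>: "continuous_map (subtopology D {d. \<tau> d > 0}) C \<rho>"
    and \<alpha>: "continuous_map (subtopology B {x. \<tau> (b x) > 0}) A \<alpha>"
    and \<beta>: "continuous_map (subtopology D {d. \<tau> d < 1}) B \<beta>"
    and h0: "\<And>x. x \<in> topspace B \<Longrightarrow> h (x, 0) = x"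
    and h1: "\<And>x. x \<in> topspace B \<Longrightarrow> \<tau> (b x) > 0 \<Longrightarrow> h (x, 1) = f (\<alpha> x)"
    and H0: "\<And>d. d \<in> topspace D \<Longrightarrow> H (d, 0) = d"
    and H1: "\<And>d. d \<in> topspace D \<Longrightarrow> \<tau> d > 0 \<Longrightarrow> H (d, 1) = c (\<rho> d)"
    and Hb: "\<And>x t. x \<in> topspace B \<Longrightarrow> t \<in> {0..1} \<Longrightarrow> H (b x, t) = b (h (x, t))"
    and \<rho>b: "\<And>x. x \<in> topspace B \<Longrightarrow> \<tau> (b x) > 0 \<Longrightarrow> \<rho> (b x) = g (\<alpha> x)"
    and b\<beta>: "\<And>d. d \<in> topspace D \<Longrightarrow> \<tau> d < 1 \<Longrightarrow> b (\<beta> d) = d"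
    and \<beta>b: "\<And>x. x \<in> topspace B \<Longrightarrow> \<tau> (b x) < 1 \<Longrightarrow> \<beta> (b x) = x"
begin

text \<open>Where \<open>\<tau>\<close> is positive the ends of the paths are lifted through
  \<open>g\<close>; where \<open>\<tau>\<close> is below 1 the map \<open>\<beta>\<close> lifts
  directly. The two fit together after \<open>u\<close> and \<open>v\<close> have been moved along
  the paths for the time \<open>z\<close>, which is 1 wherever the first way is used; a homotopy of
  squares leads back.\<close>

lemma homotopy_lift_grid:
  assumes w: "weak_lifting A C g" and N: "N \<ge> 1"
    and L_def: "L = (\<lambda>i::nat. 0::int)" and R_def: "R = (\<lambda>i. if i < n then N else 0)"
    and s: "lifting_square (ibox L R) (ibox_bd L R) B D b u v"
    and small: "\<And>l y z. l \<in> unit_boxes n N \<Longrightarrow> y \<in> unit_box n l \<Longrightarrow> z \<in> unit_box n l \<Longrightarrow> \<bar>\<tau> (v y) - \<tau> (v z)\<bar> < 1/3"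
  shows "homotopy_lift (ibox L R) (ibox_bd L R) B D b u v"
proof -
  let ?Q = "ibox L R" let ?S = "ibox_bd L R"
  have u: "cm ?S B u" and v: "cm ?Q D v" and uv: "\<And>q. q \<in> ?S \<Longrightarrow> b (u q) = v q" using s by (auto simp: lifting_square_def)
  have LR: "ibox_le n L R" using N by (simp add: ibox_le_def L_def R_def)
  have SQ: "?S \<subseteq> ?Q" by (rule ibox_bd_box)
  have uB: "u q \<in> topspace B" if "q \<in> ?S" for q using cm_image[OF u that] .
  have vD: "v q \<in> topspace D" if "q \<in> ?Q" for q using cm_image[OF v that] .
  \<comment> \<open>By \<open>small\<close>, a box with one value at most 1/3 has all values below
    2/3, so \<open>\<beta>\<close> is available on all boxes not in \<open>K\<close>.\<close>
  define isK where "isK = (\<lambda>l. \<forall>y\<in>unit_box n l. \<tau> (v y) > 1/3)"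
  define K where "K = (\<Union>l\<in>{l\<in>unit_boxes n N. isK l}. unit_box n l)"
  define Z where "Z = (\<Union>l\<in>{l\<in>unit_boxes n N. \<not> isK l}. unit_box n l)"
  have closedK: "closed K" and closedZ: "closed Z"
    unfolding K_def Z_def unit_box_def using finite_unit_boxes[of n N] by (auto intro!: closed_UN closed_box)
  have closedQ: "closed ?Q" by (rule closed_box)
  have closedS: "closed ?S" by (rule closed_ibox_bd[OF LR])
  have usub: "unit_box n l \<subseteq> ?Q" if "l \<in> unit_boxes n N" for l
  proof -
    have "L i \<le> l i" "(if i < n then l i + 1 else 0) \<le> R i" for i
      using that by (cases "i < n"; auto simp: unit_boxes_def L_def R_def)+
    then show ?thesis unfolding unit_box_def by (rule ibox_mono)
  qed
  have KQ: "K \<subseteq> ?Q" and ZQ: "Z \<subseteq> ?Q" using usub by (auto simp: K_def Z_def)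
  have QKZ: "?Q = K \<union> Z"
  proof -
    have "\<exists>l\<in>unit_boxes n N. y \<in> unit_box n l" if y: "y \<in> ?Q" for y
    proof -
      have y0: "y i = 0" if "n \<le> i" for i using ibox_eq[OF y, of i] that by (simp add: L_def R_def)
      then have b1: "ibox_le n (\<lambda>i. \<lfloor>y i\<rfloor>) (\<lambda>i. \<lceil>y i\<rceil>)"
        by (simp add: ibox_le_def floor_le_ceiling)
      have b2: "0 \<le> \<lfloor>y i\<rfloor> \<and> \<lceil>y i\<rceil> \<le> (if i < n then N else 0)" for i
        using iboxD[OF y, of i] y0[of i] by (cases "i < n") (auto simp: L_def R_def ceiling_le_iff)
      have b3: "\<lceil>y i\<rceil> \<le> \<lfloor>y i\<rfloor> + 1" for i by linarith
      obtain l' where "l' \<in> unit_boxes n N" "ibox (\<lambda>i. \<lfloor>y i\<rfloor>) (\<lambda>i. \<lceil>y i\<rceil>) \<subseteq> unit_box n l'"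
        using unit_ibox_in_unit_box[OF b1 allI[OF b2] allI[OF b3] N] by blast
      moreover have "y \<in> ibox (\<lambda>i. \<lfloor>y i\<rfloor>) (\<lambda>i. \<lceil>y i\<rceil>)" by (simp add: ibox_def)
      ultimately show ?thesis by blast
    qed
    then have "?Q \<subseteq> K \<union> Z" by (auto simp: K_def Z_def)
    then show ?thesis using KQ ZQ by blast
  qed
  have \<tau>K: "\<tau> (v y) > 1/3" if "y \<in> K" for y using that by (auto simp: K_def isK_def)
  have \<tau>Z: "\<tau> (v y) < 1" if "y \<in> Z" for y
  proof -
    obtain l z where l: "l \<in> unit_boxes n N" "y \<in> unit_box n l" "z \<in> unit_box n l" "\<tau> (v z) \<le> 1/3"
      using \<open>y \<in> Z\<close> by (auto simp: Z_def isK_def not_less)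
    then show ?thesis using small[OF l(1-3)] by linarith
  qed
  \<comment> \<open>Where the boundary meets \<open>Z\<close>, the two choices agree by
    \<open>\<beta>b\<close>, since \<open>b\<close> sends \<open>u\<close> to
    \<open>v\<close>.\<close>
  define x where "x = (\<lambda>y. if y \<in> ?S then u y else \<beta> (v y))"
  have bv: "cm Z B (\<lambda>y. \<beta> (v y))"
    by (rule cm_post[OF cm_into_sub[OF cm_subset[OF v ZQ]] \<beta>]) (use \<tau>Z in auto)
  have xS: "x y = u y" if "y \<in> ?S" for y using that by (simp add: x_def)
  have xZ: "x y = \<beta> (v y)" if "y \<in> Z" for y
  proof (cases "y \<in> ?S")
    case True
    then have "\<tau> (b (u y)) < 1" using \<tau>Z[OF that] uv by simp
    then have "\<beta> (b (u y)) = u y" by (rule \<beta>b[OF uB[OF True]])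
    then show ?thesis using uv[OF True] True by (simp add: x_def)
  qed (simp add: x_def)
  have xc: "cm (?S \<union> Z) B x"
  proof (rule cm_closed_Un'[OF closedS closedZ])
    show "cm ?S B x" by (rule cm_cong[OF u]) (simp add: xS)
    show "cm Z B x" by (rule cm_cong[OF bv]) (simp add: xZ)
  qed
  have bx: "b (x y) = v y" if "y \<in> ?S \<union> Z" for y
    using that xS uv xZ b\<beta>[OF vD] \<tau>Z ZQ by auto
  have xB: "x y \<in> topspace B" if "y \<in> ?S \<union> Z" for y using cm_image[OF xc that] .
  \<comment> \<open>Here \<open>x\<close> is already chosen and \<open>\<alpha> (x y)\<close> is a
    strict preimage of \<open>\<rho> (v y)\<close> under \<open>g\<close>; prescribing it with the
    constant homotopy lets the two ways of lifting match.\<close>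
  define La where "La = K \<inter> (?S \<union> Z)"
  have \<tau>La: "\<tau> (b (x y)) > 0" if "y \<in> La" for y using \<tau>K[of y] bx[of y] that by (auto simp: La_def)
  have ac: "cm La A (\<lambda>y. \<alpha> (x y))"
    by (rule cm_post[OF cm_into_sub[OF cm_subset[OF xc]] \<alpha>]) (use \<tau>La in \<open>auto simp: La_def\<close>)
  have ga: "g (\<alpha> (x y)) = \<rho> (v y)" if "y \<in> La" for y
    using \<rho>b[OF xB \<tau>La[OF that]] bx that by (auto simp: La_def)
  have rv: "cm K C (\<lambda>y. \<rho> (v y))"
    by (rule cm_post[OF cm_into_sub[OF cm_subset[OF v KQ]] \<rho>]) (use \<tau>K in force)
  have rvt: "cm (K \<times> {0..1::real}) C (\<lambda>z. \<rho> (v (fst z)))"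
    by (rule cm_compose[OF rv]) (auto intro!: continuous_intros)
  \<comment> \<open>Lifts of \<open>\<rho> \<circ> v\<close> through \<open>g\<close> up to homotopy over \<open>S \<inter> K\<close>, prescribed on \<open>La\<close>.\<close>
  define adm :: "(nat \<Rightarrow> real) set \<Rightarrow> ((nat \<Rightarrow> real) \<Rightarrow> 'a \<times> (real \<Rightarrow> 'c)) \<Rightarrow> bool" where
    "adm = (\<lambda>S e. cm (S \<inter> K) A (\<lambda>y. fst (e y)) \<and> cm ((S \<inter> K) \<times> {0..1}) C (\<lambda>z. snd (e (fst z)) (snd z)) \<and>
       (\<forall>y\<in>S \<inter> K. snd (e y) 0 = g (fst (e y)) \<and> snd (e y) 1 = \<rho> (v y)) \<and>
       (\<forall>y\<in>S \<inter> La. fst (e y) = \<alpha> (x y) \<and> (\<forall>t\<in>{0..1}. snd (e y) t = \<rho> (v y))))"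
  define e0 where "e0 = (\<lambda>y. (\<alpha> (x y), \<lambda>t::real. \<rho> (v y)))"
  have adm0: "adm S e0" if "S \<inter> K \<subseteq> La" for S
  proof -
    have "cm (S \<inter> K) A (\<lambda>y. \<alpha> (x y))" by (rule cm_subset[OF ac that])
    moreover have "cm ((S \<inter> K) \<times> {0..1::real}) C (\<lambda>z. \<rho> (v (fst z)))" by (rule cm_subset[OF rvt]) auto
    ultimately show ?thesis using ga that unfolding adm_def e0_def by auto
  qed
  have adm_cong: "adm S e'" if a: "adm S e" and e: "\<And>y. y \<in> S \<Longrightarrow> e y = e' y" for S e e'
  proof -
    have "cm (S \<inter> K) A (\<lambda>y. fst (e' y))" "cm ((S \<inter> K) \<times> {0..1}) C (\<lambda>z. snd (e' (fst z)) (snd z))"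
      using a unfolding adm_def by (auto elim!: cm_cong simp: e)
    then show ?thesis using a e unfolding adm_def by auto
  qed
  have adm_mono: "adm S' e" if "adm S e" "S' \<subseteq> S" for S S' e
    using that unfolding adm_def by (auto elim!: cm_subset)
  have adm_glue: "adm (S \<union> S') e" if "closed S" "closed S'" and a: "adm S e" "adm S' e" for S S' e
  proof -
    have "cm (S \<inter> K \<union> S' \<inter> K) A (\<lambda>y. fst (e y))"
      using that closedK unfolding adm_def by (intro cm_closed_Un') auto
    moreover have "cm ((S \<inter> K) \<times> {0..1} \<union> (S' \<inter> K) \<times> {0..1}) C (\<lambda>z. snd (e (fst z)) (snd z))"
      using that closedK unfolding adm_def by (intro cm_closed_Un' closed_Times) auto
    moreover have "S \<inter> K \<union> S' \<inter> K = (S \<union> S') \<inter> K" "(S \<inter> K) \<times> {0..1::real} \<union> (S' \<inter> K) \<times> {0..1} = ((S \<union> S') \<inter> K) \<times> {0..1}"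
      by auto
    ultimately show ?thesis using a unfolding adm_def by auto
  qed
  have "\<exists>e'. adm (ibox L R) e' \<and> (\<forall>y\<in>ibox_bd L R. e' y = e0 y)"
  proof (rule ibox_extend[where n = n and Lo = L and Hi = R and adm = adm])
    show "adm (ibox_bd L R) e0" by (rule adm0) (auto simp: La_def)
    fix l r e assume lr: "ibox_le n l r" "\<forall>i. L i \<le> l i \<and> r i \<le> R i" "\<forall>i. r i \<le> l i + 1" and e: "adm (ibox_bd l r) e"
    show "\<exists>e'. adm (ibox l r) e' \<and> (\<forall>y\<in>ibox_bd l r. e' y = e y)"
    proof (cases "ibox l r \<inter> K \<subseteq> La")
      case True
      \<comment> \<open>On the boundary the given values are kept literally; they agree with
        \<open>e0\<close> only on \<open>K\<close> and for times in \<open>{0..1}\<close>, which is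
        all that \<open>adm\<close> controls.\<close>
      define e' where "e' = (\<lambda>y. if y \<in> ibox_bd l r then (fst (e y), \<lambda>t. snd (e y) t) else e0 y)"
      have a0: "adm (ibox l r) e0" by (rule adm0[OF True])
      have eq: "fst (e' y) = fst (e0 y) \<and> (\<forall>t\<in>{0..1}. snd (e' y) t = snd (e0 y) t)" if "y \<in> ibox l r \<inter> K" for y
        using that True e unfolding adm_def e'_def e0_def by auto
      have "cm (ibox l r \<inter> K) A (\<lambda>y. fst (e' y))" "cm ((ibox l r \<inter> K) \<times> {0..1}) C (\<lambda>z. snd (e' (fst z)) (snd z))"
        using a0 unfolding adm_def by (auto elim!: cm_cong simp: eq)
      then have "adm (ibox l r) e'"
        using a0 eq unfolding adm_def La_def by auto
      then show ?thesis by (intro exI[of _ e']) (simp add: e'_def)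
    next
      case False
      obtain m where m: "m \<in> unit_boxes n N" "ibox l r \<subseteq> unit_box n m"
        using unit_ibox_in_unit_box[OF lr(1) _ lr(3) N] lr(2) by (auto simp: L_def R_def)
      have nZ: "\<not> ibox l r \<subseteq> ?S \<union> Z" using False by (auto simp: La_def)
      have "isK m" using m nZ by (auto simp: Z_def)
      then have cK: "ibox l r \<subseteq> K" using m by (auto simp: K_def)
      \<comment> \<open>If a relative interior point lay on the outer boundary or in a box of
        \<open>Z\<close>, so would the whole face. Hence the prescribed values concern only the
        boundary of the face, and it can be filled freely.\<close>
      have int: "ibox l r \<inter> La \<subseteq> ibox_bd l r"
      proof
        fix y assume y: "y \<in> ibox l r \<inter> La"
        show "y \<in> ibox_bd l r"
        proof (rule ccontr)
          assume nb: "y \<notin> ibox_bd l r"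
          consider "y \<in> ?S" | m' where "m' \<in> unit_boxes n N" "\<not> isK m'" "y \<in> unit_box n m'"
            using y by (auto simp: La_def Z_def)
          then show False
          proof cases
            case 1
            then show ?thesis using unit_ibox_meets_boundary[OF lr _ nb] y nZ by blast
          next
            case 2
            then show ?thesis using unit_ibox_meets_unit_box[OF lr(1,3) _ nb 2(3,1)] y nZ by (auto simp: Z_def)
          qed
        qed
      qed
      obtain d where cell: "is_cell d (ibox l r) (ibox_bd l r)" by (rule is_cell_box[OF lr(1)])
      have bK: "ibox_bd l r \<inter> K = ibox_bd l r" using cK ibox_bd_box by blast
      have iK: "ibox l r \<inter> K = ibox l r" using cK by blast
      have e1: "cm (ibox_bd l r) A (\<lambda>y. fst (e y))" "cm (ibox_bd l r \<times> {0..1}) C (\<lambda>z. snd (e (fst z)) (snd z))"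
        "\<And>y. y \<in> ibox_bd l r \<Longrightarrow> snd (e y) 0 = g (fst (e y))" "\<And>y. y \<in> ibox_bd l r \<Longrightarrow> snd (e y) 1 = \<rho> (v y)"
        using e unfolding adm_def bK by auto
      have "extending_lift (ibox l r) (ibox_bd l r) A C g (\<lambda>y. fst (e y)) (\<lambda>z. snd (e (fst z)) (snd z)) (\<lambda>y. \<rho> (v y))"
        by (rule weak_lifting_extending_lift[OF cell w cont(2) e1(1) cm_subset[OF rv cK] e1(2)]) (use e1(3,4) in auto)
      then obtain k W where k: "cm (ibox l r) A k" "\<And>y. y \<in> ibox_bd l r \<Longrightarrow> k y = fst (e y)"
        and W: "cm (ibox l r \<times> {0..1::real}) C W" "\<And>y. y \<in> ibox l r \<Longrightarrow> W (y, 0) = g (k y) \<and> W (y, 1) = \<rho> (v y)"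
          "\<And>y t. y \<in> ibox_bd l r \<Longrightarrow> t \<in> {0..1} \<Longrightarrow> W (y, t) = snd (e y) t"
        unfolding extending_lift_def by auto
      define e' where "e' = (\<lambda>y. if y \<in> ibox_bd l r then e y else (k y, \<lambda>t. W (y, t)))"
      have f1: "fst (e' y) = k y" if "y \<in> ibox l r" for y using k(2) by (simp add: e'_def)
      have s1: "snd (e' y) t = W (y, t)" if "y \<in> ibox l r" "t \<in> {0..1}" for y t using W(3) that by (simp add: e'_def)
      have "cm (ibox l r) A (\<lambda>y. fst (e' y))" by (rule cm_cong[OF k(1)]) (simp add: f1)
      moreover have "cm (ibox l r \<times> {0..1}) C (\<lambda>z. snd (e' (fst z)) (snd z))"
        by (rule cm_cong[OF W(1)]) (auto simp: s1)
      moreover have "fst (e' y) = \<alpha> (x y) \<and> (\<forall>t\<in>{0..1}. snd (e' y) t = \<rho> (v y))" if "y \<in> ibox l r \<inter> La" for y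
        using that int e unfolding adm_def e'_def by auto
      ultimately have "adm (ibox l r) e'"
        unfolding adm_def iK using W(2) f1 s1 by auto
      then show ?thesis by (intro exI[of _ e']) (simp add: e'_def)
    qed
  next
    show "adm S e'" if "adm S e" "\<And>y. y \<in> S \<Longrightarrow> e y = e' y" for S e e' by (rule adm_cong[OF that])
    show "adm S' e" if "adm S e" "S' \<subseteq> S" for S S' e by (rule adm_mono[OF that])
    show "adm (S \<union> S') e" if "closed S" "closed S'" "adm S e" "adm S' e" for S S' e by (rule adm_glue[OF that])
  qed (simp_all add: LR)
  then obtain e where e: "adm ?Q e" by blast
  have iK: "?Q \<inter> K = K" and iL: "?Q \<inter> La = La" using KQ by (auto simp: La_def)
  define a where "a = (\<lambda>y. fst (e y))"
  define W where "W = (\<lambda>z. snd (e (fst z)) (snd z))"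
  have a: "cm K A a" and W: "cm (K \<times> {0..1}) C W" and W0: "\<And>y. y \<in> K \<Longrightarrow> W (y, 0) = g (a y)"
    and W1: "\<And>y. y \<in> K \<Longrightarrow> W (y, 1) = \<rho> (v y)" and aL: "\<And>y. y \<in> La \<Longrightarrow> a y = \<alpha> (x y)"
    and WL: "\<And>y t. y \<in> La \<Longrightarrow> t \<in> {0..1} \<Longrightarrow> W (y, t) = \<rho> (v y)"
    using e unfolding adm_def iK iL a_def W_def by auto
  \<comment> \<open>Full deformation on \<open>K\<close>, where \<open>\<tau>\<close> exceeds 1/3,
    fading continuously to 0 with \<open>\<tau>\<close>.\<close>
  define z where "z = (\<lambda>y. min 1 (3 * \<tau> (v y)))"
  have \<tau>v: "continuous_on ?Q (\<lambda>y. \<tau> (v y))" using cm_post[OF v \<tau>] by simp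
  have zc: "continuous_on ?Q z" unfolding z_def by (intro continuous_intros continuous_on_min \<tau>v)
  have z01: "z y \<in> {0..1}" if "y \<in> ?Q" for y using \<tau>01[OF vD[OF that]] by (auto simp: z_def)
  have zK: "z y = 1" if "y \<in> K" for y using \<tau>K[OF that] by (simp add: z_def)
  have hcm: "cm T B (\<lambda>y. h (k y, t y))" if "cm T B k" "continuous_on T t" "\<And>y. y \<in> T \<Longrightarrow> t y \<in> {0..1}"
    for T :: "'z::topological_space set" and k t
    using cm_post[OF continuous_map_prodI[OF that(1) cm_into[OF that(2,3)]] h] .
  have Hcm: "cm T D (\<lambda>y. H (k y, t y))" if "cm T D k" "continuous_on T t" "\<And>y. y \<in> T \<Longrightarrow> t y \<in> {0..1}"
    for T :: "'z::topological_space set" and k t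
    using cm_post[OF continuous_map_prodI[OF that(1) cm_into[OF that(2,3)]] H] .
  define v1 where "v1 = (\<lambda>y. H (v y, z y))"
  define u1 where "u1 = (\<lambda>y. h (u y, z y))"
  have v1: "cm ?Q D v1" unfolding v1_def by (rule Hcm[OF v zc z01])
  have v1K: "v1 y = c (\<rho> (v y))" if "y \<in> K" for y
    using H1[OF vD, of y] \<tau>K[OF that] zK[OF that] KQ that by (auto simp: v1_def)
  have hx1: "h (x y, z y) = f (\<alpha> (x y))" if "y \<in> La" for y
    using h1[OF xB \<tau>La[OF that]] zK that by (auto simp: La_def)
  \<comment> \<open>The lift through \<open>g\<close> on \<open>K\<close> and the deformed
    \<open>x\<close> on the rest; on \<open>La\<close> both are
    \<open>f (\<alpha> (x y))\<close>.\<close>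
  define X where "X = (\<lambda>y. if y \<in> K then f (a y) else h (x y, z y))"
  have XK: "X y = f (a y)" if "y \<in> K" for y using that by (simp add: X_def)
  have XSZ: "X y = h (x y, z y)" if "y \<in> ?S \<union> Z" for y
    using that hx1[of y] aL[of y] by (auto simp: X_def La_def)
  have Xc: "cm ?Q B X"
    unfolding QKZ
  proof (rule cm_closed_Un'[OF closedK closedZ])
    show "cm K B X" by (rule cm_cong[OF cm_post[OF a cont(1)]]) (simp add: XK)
    have "cm Z B (\<lambda>y. h (x y, z y))"
      by (rule hcm[OF cm_subset[OF xc] continuous_on_subset[OF zc ZQ]]) (use z01 ZQ in auto)
    then show "cm Z B X" by (rule cm_cong) (simp add: XSZ)
  qed
  \<comment> \<open>On \<open>K\<close> the homotopy is the image of the one in \<open>C\<close>; on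
    the boundary and on \<open>Z\<close> it is constant.\<close>
  define G where "G = (\<lambda>w. if fst w \<in> K then c (W w) else v1 (fst w))"
  have GZ: "G (y, t) = v1 y" if "y \<in> ?S \<union> Z" "t \<in> {0..1}" for y t
    using that WL[of y t] v1K[of y] by (auto simp: G_def La_def)
  have Gc: "cm (?Q \<times> {0..1}) D G"
  proof -
    have "cm (K \<times> {0..1} \<union> Z \<times> {0..1}) D G"
    proof (rule cm_closed_Un'[OF closed_Times[OF closedK] closed_Times[OF closedZ]])
      show "cm (K \<times> {0..1}) D G" by (rule cm_cong[OF cm_post[OF W cont(4)]]) (auto simp: G_def)
      have "cm (Z \<times> {0..1::real}) D (\<lambda>w. v1 (fst w))"
        by (rule cm_compose[OF v1]) (use ZQ in \<open>auto intro!: continuous_intros\<close>)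
      then show "cm (Z \<times> {0..1}) D G" by (rule cm_cong) (auto simp: GZ)
    qed auto
    moreover have "K \<times> {0..1::real} \<union> Z \<times> {0..1} = ?Q \<times> {0..1}" using QKZ by auto
    ultimately show ?thesis by simp
  qed
  have aA: "a y \<in> topspace A" if "y \<in> K" for y using cm_image[OF a that] .
  have solv1: "homotopy_lift ?Q ?S B D b u1 v1"
    unfolding homotopy_lift_def
  proof (intro exI conjI ballI)
    show "cm ?Q B X" "cm (?Q \<times> {0..1}) D G" by (rule Xc Gc)+
    show "X y = u1 y" if "y \<in> ?S" for y using XSZ xS that by (simp add: u1_def)
    show "G (y, 0) = b (X y)" if y: "y \<in> ?Q" for y
    proof (cases "y \<in> K")
      case True
      then show ?thesis using W0 comm[OF aA] by (simp add: G_def XK)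
    next
      case False
      then have Zy: "y \<in> Z" using y QKZ by blast
      then show ?thesis using GZ[of y 0] XSZ[of y] Hb[OF xB, of y "z y"] bx[of y] z01[OF y] by (simp add: v1_def)
    qed
    show "G (y, 1) = v1 y" if "y \<in> ?Q" for y using W1 v1K by (simp add: G_def)
    show "G (y, t) = v1 y" if "y \<in> ?S" "t \<in> {0..1}" for y t using GZ that by blast
  qed
  obtain d where cell: "is_cell d ?Q ?S" by (rule is_cell_box[OF LR])
  \<comment> \<open>Undoes the deformation: at time \<open>t\<close> the square is moved along the
    paths only for the time \<open>t * z q\<close>.\<close>
  have "homotopy_lift ?Q ?S B D b (\<lambda>q. h (u q, 0 * z q)) (\<lambda>q. H (v q, 0 * z q))"
  proof (rule homotopy_lift_homotopy[OF cell cont(3), where U = "\<lambda>w. h (u (fst w), snd w * z (fst w))"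
        and V = "\<lambda>w. H (v (fst w), snd w * z (fst w))", unfolded fst_conv snd_conv])
    have m01: "snd w * z (fst w) \<in> {0..1}" if "w \<in> ?Q \<times> {0..1}" for w
      using that z01[of "fst w"] by (auto intro: mult_le_one)
    have mc: "continuous_on (?Q \<times> {0..1}) (\<lambda>w. snd w * z (fst w))"
      by (intro continuous_intros continuous_on_compose2[OF zc]) auto
    show "cm (?S \<times> {0..1}) B (\<lambda>w. h (u (fst w), snd w * z (fst w)))"
    proof (rule hcm)
      show "cm (?S \<times> {0..1::real}) B (\<lambda>w. u (fst w))" by (rule cm_compose[OF u]) (auto intro!: continuous_intros)
      show "continuous_on (?S \<times> {0..1}) (\<lambda>w. snd w * z (fst w))" by (rule continuous_on_subset[OF mc]) (use SQ in auto)
    qed (use m01 SQ in auto)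
    show "cm (?Q \<times> {0..1}) D (\<lambda>w. H (v (fst w), snd w * z (fst w)))"
    proof (rule Hcm)
      show "cm (?Q \<times> {0..1::real}) D (\<lambda>w. v (fst w))" by (rule cm_compose[OF v]) (auto intro!: continuous_intros)
    qed (use m01 mc in auto)
    show "b (h (u q, t * z q)) = H (v q, t * z q)" if "q \<in> ?S" "t \<in> {0..1}" for q t
      using Hb[OF uB[OF that(1)], of "t * z q"] uv[OF that(1)] m01[of "(q, t)"] that SQ by auto
    show "homotopy_lift ?Q ?S B D b (\<lambda>q. h (u q, 1 * z q)) (\<lambda>q. H (v q, 1 * z q))"
      using solv1 by (simp add: u1_def v1_def)
  qed
  then show ?thesis
    by (rule homotopy_lift_cong[OF _ _ SQ, rotated 2]) (use h0 uB H0 vD in auto)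
qed

text \<open>Uniform continuity of the height on the compact cube gives the mesh of the grid.\<close>

lemma weak_lifting_excision:
  assumes w: "weak_lifting A C g"
  shows "weak_lifting B D b"
  unfolding weak_lifting_def
proof (intro allI impI)
  fix n u v assume s: "lifting_square (cube n) (cube_bd n) B D b u v"
  have u: "cm (cube_bd n) B u" and v: "cm (cube n) D v" and uv: "\<And>q. q \<in> cube_bd n \<Longrightarrow> b (u q) = v q"
    using s by (auto simp: lifting_square_def)
  have "continuous_on (cube n) (\<lambda>y. \<tau> (v y))" using cm_post[OF v \<tau>] by simp
  then have "uniformly_continuous_on (cube n) (\<lambda>y. \<tau> (v y))"
    by (rule compact_uniformly_continuous[OF _ compact_cube])
  then obtain \<delta> where \<delta>: "\<delta> > 0" "\<And>x y. x \<in> cube n \<Longrightarrow> y \<in> cube n \<Longrightarrow> dist y x < \<delta> \<Longrightarrow> dist (\<tau> (v y)) (\<tau> (v x)) < 1/3"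
    unfolding uniformly_continuous_on_def by (metis divide_pos_pos zero_less_numeral zero_less_one)
  \<comment> \<open>The cube has side length 2, so points of one grid box differ by at most
    \<open>2 / N\<close> in each coordinate and have distance at most \<open>4 / N\<close>.\<close>
  obtain N0 :: nat where N0: "real N0 > 4 / \<delta>" using reals_Archimedean2 by blast
  define N where "N = int N0 + 1"
  have N: "N \<ge> 1" and Npos: "real_of_int N > 0" by (simp_all add: N_def)
  have Nd: "4 / N < \<delta>"
  proof -
    have "4 / \<delta> < N" using N0 by (simp add: N_def)
    then show ?thesis using \<delta>(1) Npos by (simp add: field_simps)
  qed
  define L where "L = (\<lambda>i::nat. 0::int)"
  define R where "R = (\<lambda>i. if i < n then N else 0)"
  define \<mu> :: "(nat \<Rightarrow> real) \<Rightarrow> nat \<Rightarrow> real" where "\<mu> = (\<lambda>(y::nat\<Rightarrow>real) i. if i < n then 2 * y i / N - 1 else 0)"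
  define \<nu> :: "(nat \<Rightarrow> real) \<Rightarrow> nat \<Rightarrow> real" where "\<nu> = (\<lambda>(x::nat\<Rightarrow>real) i. if i < n then N * (x i + 1) / 2 else 0)"
  have \<mu>c: "continuous_on T \<mu>" for T unfolding \<mu>_def using Npos by (intro continuous_on_coordinatewise_then_product) (auto intro!: continuous_intros)
  have \<nu>c: "continuous_on T \<nu>" for T unfolding \<nu>_def by (intro continuous_on_coordinatewise_then_product) (auto intro!: continuous_intros)
  have box: "y \<in> ibox L R \<longleftrightarrow> (\<forall>i<n. 0 \<le> y i \<and> y i \<le> N) \<and> (\<forall>i\<ge>n. y i = 0)" for y
  proof
    assume y: "y \<in> ibox L R"
    show "(\<forall>i<n. 0 \<le> y i \<and> y i \<le> N) \<and> (\<forall>i\<ge>n. y i = 0)"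
    proof (intro conjI allI impI)
      show "0 \<le> y i" "y i \<le> N" if "i < n" for i using iboxD[OF y, of i] that by (auto simp: L_def R_def)
      show "y i = 0" if "n \<le> i" for i using ibox_eq[OF y, of i] that by (auto simp: L_def R_def)
    qed
  next
    assume y: "(\<forall>i<n. 0 \<le> y i \<and> y i \<le> N) \<and> (\<forall>i\<ge>n. y i = 0)"
    show "y \<in> ibox L R"
    proof (rule iboxI)
      show "real_of_int (L i) \<le> y i" "y i \<le> real_of_int (R i)" for i
        using y by (cases "i < n"; simp add: L_def R_def)+
    qed
  qed
  have cb: "x \<in> cube n \<longleftrightarrow> (\<forall>i<n. -1 \<le> x i \<and> x i \<le> 1) \<and> (\<forall>i\<ge>n. x i = 0)" for x
    by (auto simp: cube_def sup_norm_le_iff abs_le_iff)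
  have \<mu>Q: "\<mu> y \<in> cube n" if "y \<in> ibox L R" for y
    using that Npos unfolding box cb \<mu>_def by (auto simp: field_simps)
  have \<nu>Q: "\<nu> x \<in> ibox L R" if "x \<in> cube n" for x
  proof -
    have "0 \<le> N * (x i + 1) / 2 \<and> N * (x i + 1) / 2 \<le> N" if "i < n" for i
    proof -
      have "-1 \<le> x i" "x i \<le> 1" using \<open>x \<in> cube n\<close> that by (auto simp: cb)
      then have "0 \<le> real_of_int N * (x i + 1)" "real_of_int N * (x i + 1) \<le> N * 2" using Npos by (auto intro!: mult_left_mono)
      then show ?thesis by simp
    qed
    then show ?thesis unfolding box \<nu>_def by auto
  qed
  have \<mu>\<nu>: "\<mu> (\<nu> x) = x" if "x \<in> cube n" for x
    using that Npos by (auto simp: \<mu>_def \<nu>_def cb fun_eq_iff)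
  have \<mu>b: "\<mu> y \<in> cube_bd n" if yb: "y \<in> ibox_bd L R" for y
  proof -
    have y: "y \<in> ibox L R" using yb ibox_bd_box by blast
    obtain i where i: "L i < R i" "y i = L i \<or> y i = R i" using yb by (auto simp: ibox_bd_def)
    then have "i < n" "\<bar>\<mu> y i\<bar> = 1" using Npos by (auto simp: \<mu>_def L_def R_def split: if_splits)
    then show ?thesis using sup_norm_eq_1_iff[OF sup_norm_le1[OF \<mu>Q[OF y]]] \<mu>Q[OF y] by (auto simp: cube_bd_def)
  qed
  have \<nu>b: "\<nu> x \<in> ibox_bd L R" if xb: "x \<in> cube_bd n" for x
  proof -
    have x: "x \<in> cube n" by (rule cube_bd_cube[OF xb])
    obtain i where i: "i < n" "\<bar>x i\<bar> = 1" using xb sup_norm_eq_1_iff[OF sup_norm_le1[OF x]] by (auto simp: cube_bd_def)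
    then have "x i = 1 \<or> x i = -1" by (auto simp: abs_if split: if_splits)
    then have "L i < R i" "\<nu> x i = L i \<or> \<nu> x i = R i" using i(1) N by (auto simp: \<nu>_def L_def R_def)
    then show ?thesis using \<nu>Q[OF x] by (auto simp: ibox_bd_def)
  qed
  have "homotopy_lift (ibox L R) (ibox_bd L R) B D b (\<lambda>y. u (\<mu> y)) (\<lambda>y. v (\<mu> y))"
  proof (rule homotopy_lift_grid[OF w N L_def R_def])
    show "lifting_square (ibox L R) (ibox_bd L R) B D b (\<lambda>y. u (\<mu> y)) (\<lambda>y. v (\<mu> y))"
      unfolding lifting_square_def using cm_compose[OF u \<mu>c \<mu>b] cm_compose[OF v \<mu>c \<mu>Q] uv \<mu>b by auto
    fix l y z assume l: "l \<in> unit_boxes n N" "y \<in> unit_box n l" "z \<in> unit_box n l"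
    have "L i \<le> l i" "(if i < n then l i + 1 else 0) \<le> R i" for i
      using l(1) by (cases "i < n"; auto simp: unit_boxes_def L_def R_def)+
    then have "unit_box n l \<subseteq> ibox L R" unfolding unit_box_def by (rule ibox_mono)
    then have yz: "\<mu> y \<in> cube n" "\<mu> z \<in> cube n" using l \<mu>Q by auto
    have "\<bar>\<mu> y i - \<mu> z i\<bar> \<le> 2 / N" for i
    proof (cases "i < n")
      case True
      have "real_of_int (l i) \<le> y i" "y i \<le> l i + 1" "real_of_int (l i) \<le> z i" "z i \<le> l i + 1"
        using ucubeD[OF l(2) True] ucubeD[OF l(3) True] by auto
      then have d: "\<bar>y i - z i\<bar> \<le> 1" by (auto simp: abs_le_iff)
      have "\<mu> y i - \<mu> z i = 2 * (y i - z i) / N" using True by (simp add: \<mu>_def diff_divide_distrib[symmetric] algebra_simps)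
      then have "\<bar>\<mu> y i - \<mu> z i\<bar> = 2 * \<bar>y i - z i\<bar> / N" using Npos by (simp only: abs_divide abs_mult abs_of_pos abs_numeral)
      then show ?thesis using d Npos by (simp add: divide_right_mono)
    qed (use Npos in \<open>simp add: \<mu>_def\<close>)
    then have "dist (\<mu> y) (\<mu> z) \<le> 2 * (2 / N)" by (rule dist_fun_le)
    then have "dist (\<mu> y) (\<mu> z) < \<delta>" using Nd by simp
    then show "\<bar>\<tau> (v (\<mu> y)) - \<tau> (v (\<mu> z))\<bar> < 1/3"
      using \<delta>(2)[OF yz(2,1)] by (simp add: dist_real_def)
  qed
  then show "homotopy_lift (cube n) (cube_bd n) B D b u v"
    by (rule homotopy_lift_transfer[OF _ \<nu>c \<nu>Q \<mu>\<nu> \<nu>b]) (use cube_bd_cube in auto)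
qed

end

section \<open>The enriched functor category\<close>

lemma continuous_map_in: "continuous_map X Y f \<Longrightarrow> x \<in> topspace X \<Longrightarrow> f x \<in> topspace Y"
  using continuous_map_funspace by blast

lemma ex1_eqI: "\<exists>!k. Q k \<Longrightarrow> Q x \<Longrightarrow> Q y \<Longrightarrow> x = y"
  by blast

lemma compose_eq_iff: "compose S f g = compose S f' g' \<longleftrightarrow> (\<forall>x\<in>S. f (g x) = f' (g' x))"
proof
  assume *: "compose S f g = compose S f' g'"
  show "\<forall>x\<in>S. f (g x) = f' (g' x)"
  proof
    fix x assume "x \<in> S" then show "f (g x) = f' (g' x)" using fun_cong[OF *, of x] by (simp add: compose_eq)
  qed
qed (auto simp: compose_def fun_eq_iff)

locale enriched =
  fixes P :: "('u, 'u) enriched_category"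
  assumes P: "is_enriched_category P"
begin

abbreviation "Ob \<equiv> EObj P"
abbreviation "Mor a b \<equiv> topspace (EHom P a b)"
abbreviation "EF \<equiv> enriched_functor_category P"

text \<open>Naturality without the normalisation of morphisms off their domains;
  \<open>normalize_map\<close> passes back to morphisms of the category.\<close>

definition natural :: "('u, 'u, 'u topology, 'u \<Rightarrow> 'u) ftor \<Rightarrow> ('u, 'u, 'u topology, 'u \<Rightarrow> 'u) ftor \<Rightarrow> ('u \<Rightarrow> 'u \<Rightarrow> 'u) \<Rightarrow> bool" where
  "natural F G \<eta> \<longleftrightarrow> (\<forall>a\<in>Ob. continuous_map (fob F a) (fob G a) (\<eta> a)) \<and>
     (\<forall>a\<in>Ob. \<forall>b\<in>Ob. \<forall>p\<in>Mor a b. \<forall>x\<in>topspace (fob F a). \<eta> b (farr F a b p x) = farr G a b p (\<eta> a x))"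

definition normalize_map :: "('u, 'u, 'u topology, 'u \<Rightarrow> 'u) ftor \<Rightarrow> ('u \<Rightarrow> 'u \<Rightarrow> 'u) \<Rightarrow> 'u \<Rightarrow> 'u \<Rightarrow> 'u" where
  "normalize_map F \<eta> = (\<lambda>a\<in>Ob. restrict (\<eta> a) (topspace (fob F a)))"

lemma normalize_map_apply [simp]: "a \<in> Ob \<Longrightarrow> x \<in> topspace (fob F a) \<Longrightarrow> normalize_map F \<eta> a x = \<eta> a x"
  by (simp add: normalize_map_def)

lemma Obj_EF: "F \<in> Obj EF \<longleftrightarrow> is_enriched_functor P F"
  by (auto simp: enriched_functor_category_def full_subcategory_def functor_category_def is_enriched_functor_def)

lemma functor_dg: "is_enriched_functor P F \<Longrightarrow> a \<in> Ob \<Longrightarrow> delta_generated (fob F a)"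
  by (auto simp: is_enriched_functor_def is_functor_def underlying_category_def Top_def)

lemma functor_map:
  "is_enriched_functor P F \<Longrightarrow> a \<in> Ob \<Longrightarrow> b \<in> Ob \<Longrightarrow> p \<in> Mor a b \<Longrightarrow> farr F a b p \<in> top_maps (fob F a) (fob F b)"
  by (auto simp: is_enriched_functor_def is_functor_def underlying_category_def Top_def)

lemma functor_cont:
  "is_enriched_functor P F \<Longrightarrow> a \<in> Ob \<Longrightarrow> b \<in> Ob \<Longrightarrow> p \<in> Mor a b \<Longrightarrow> continuous_map (fob F a) (fob F b) (farr F a b p)"
  using functor_map[of F a b p] by (simp add: top_maps_def)

lemma functor_in:
  "is_enriched_functor P F \<Longrightarrow> a \<in> Ob \<Longrightarrow> b \<in> Ob \<Longrightarrow> p \<in> Mor a b \<Longrightarrow> x \<in> topspace (fob F a) \<Longrightarrow> farr F a b p x \<in> topspace (fob F b)"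
  by (rule continuous_map_in[OF functor_cont])

lemma functor_id:
  "is_enriched_functor P F \<Longrightarrow> a \<in> Ob \<Longrightarrow> x \<in> topspace (fob F a) \<Longrightarrow> farr F a a (EIdent P a) x = x"
  by (simp add: is_enriched_functor_def is_functor_def underlying_category_def Top_def)

lemma functor_comp:
  assumes "is_enriched_functor P F" "a \<in> Ob" "b \<in> Ob" "c \<in> Ob" "p \<in> Mor a b" "q \<in> Mor b c" "x \<in> topspace (fob F a)"
  shows "farr F a c (EComp P a b c q p) x = farr F b c q (farr F a b p x)"
proof -
  have "farr F a c (EComp P a b c q p) = compose (topspace (fob F a)) (farr F b c q) (farr F a b p)"
    using assms by (simp add: is_enriched_functor_def is_functor_def underlying_category_def Top_def)
  then show ?thesis using assms(7) by (simp add: compose_eq)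
qed

text \<open>The form in which enrichment is used: the action can be evaluated along two continuous
  families at once.\<close>

lemma functor_joint:
  assumes "is_enriched_functor P F" "a \<in> Ob" "b \<in> Ob"
    and Z: "locally_compact_space Z" "Hausdorff_space Z"
    and "continuous_map Z (EHom P a b) s" "continuous_map Z (fob F a) t"
  shows "continuous_map Z (fob F b) (\<lambda>z. farr F a b (s z) (t z))"
proof (rule continuous_map_evaluation[OF _ Z assms(6,7)])
  show "continuous_map (EHom P a b) (TOP (fob F a) (fob F b)) (farr F a b)"
    using assms(1-3) by (simp add: is_enriched_functor_def)
qed

lemma natural_cont: "natural F G \<eta> \<Longrightarrow> a \<in> Ob \<Longrightarrow> continuous_map (fob F a) (fob G a) (\<eta> a)"
  by (simp add: natural_def)

lemma natural_in: "natural F G \<eta> \<Longrightarrow> a \<in> Ob \<Longrightarrow> x \<in> topspace (fob F a) \<Longrightarrow> \<eta> a x \<in> topspace (fob G a)"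
  by (rule continuous_map_in[OF natural_cont])

lemma natural_nat: "natural F G \<eta> \<Longrightarrow> a \<in> Ob \<Longrightarrow> b \<in> Ob \<Longrightarrow> p \<in> Mor a b \<Longrightarrow> x \<in> topspace (fob F a) \<Longrightarrow>
    \<eta> b (farr F a b p x) = farr G a b p (\<eta> a x)"
  by (simp add: natural_def)

lemma Hom_EF:
  "\<alpha> \<in> Hom EF F G \<longleftrightarrow> natural F G \<alpha> \<and> \<alpha> \<in> extensional Ob \<and> (\<forall>a\<in>Ob. \<alpha> a \<in> extensional (topspace (fob F a)))"
  by (auto simp: enriched_functor_category_def full_subcategory_def functor_category_def nat_transfs_def
      underlying_category_def Top_def top_maps_def PiE_iff natural_def compose_eq_iff)

lemma Hom_natural: "\<alpha> \<in> Hom EF F G \<Longrightarrow> natural F G \<alpha>"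
  by (simp add: Hom_EF)

lemma normalize_map_Hom:
  assumes F: "is_enriched_functor P F" and \<eta>: "natural F G \<eta>"
  shows "normalize_map F \<eta> \<in> Hom EF F G"
proof -
  have "continuous_map (fob F a) (fob G a) (normalize_map F \<eta> a)" if "a \<in> Ob" for a
    using natural_cont[OF \<eta> that] by (rule continuous_map_eq) (simp add: that)
  then have "natural F G (normalize_map F \<eta>)"
    unfolding natural_def using natural_nat[OF \<eta>] functor_in[OF F] by simp
  then show ?thesis by (simp add: Hom_EF) (simp add: normalize_map_def)
qed

lemma Comp_EF: "Comp EF F G H \<beta> \<alpha> = normalize_map F (\<lambda>a x. \<beta> a (\<alpha> a x))"
  by (auto simp: enriched_functor_category_def full_subcategory_def functor_category_def underlying_category_def
      Top_def normalize_map_def compose_def)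

lemma normalize_map_eq_iff: "normalize_map F \<eta> = normalize_map F \<theta> \<longleftrightarrow> (\<forall>a\<in>Ob. \<forall>x\<in>topspace (fob F a). \<eta> a x = \<theta> a x)"
proof
  assume *: "normalize_map F \<eta> = normalize_map F \<theta>"
  show "\<forall>a\<in>Ob. \<forall>x\<in>topspace (fob F a). \<eta> a x = \<theta> a x"
  proof (intro ballI)
    fix a x assume "a \<in> Ob" "x \<in> topspace (fob F a)"
    then show "\<eta> a x = \<theta> a x" using fun_cong[OF fun_cong[OF *, of a], of x] by simp
  qed
qed (auto simp: normalize_map_def fun_eq_iff)

lemma natural_id: "natural F F (\<lambda>a x. x)"
  by (simp add: natural_def)

lemma natural_compose: "natural F G \<alpha> \<Longrightarrow> natural G H \<beta> \<Longrightarrow> natural F H (\<lambda>a x. \<beta> a (\<alpha> a x))"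
proof -
  assume \<alpha>: "natural F G \<alpha>" and \<beta>: "natural G H \<beta>"
  have "continuous_map (fob F a) (fob H a) (\<lambda>x. \<beta> a (\<alpha> a x))" if "a \<in> Ob" for a
    using continuous_map_compose[OF natural_cont[OF \<alpha> that] natural_cont[OF \<beta> that]] by (simp add: o_def)
  then show ?thesis
    unfolding natural_def using natural_nat[OF \<alpha>] natural_nat[OF \<beta>] natural_in[OF \<alpha>] by simp
qed

text \<open>The universal property is restated for natural families that are not normalised, with
  equations between values. Uniqueness says that \<open>i\<close> and \<open>j\<close> are jointly
  epimorphic.\<close>

lemma pushoutE:
  assumes po: "is_pushout EF A B C D f g i j"
  shows "is_enriched_functor P A" "is_enriched_functor P B" "is_enriched_functor P C" "is_enriched_functor P D"
    "natural A B f" "natural A C g" "natural B D i" "natural C D j"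
    "\<And>a x. a \<in> Ob \<Longrightarrow> x \<in> topspace (fob A a) \<Longrightarrow> i a (f a x) = j a (g a x)"
    and pushout_ex: "\<And>X u v. is_enriched_functor P X \<Longrightarrow> natural B X u \<Longrightarrow> natural C X v \<Longrightarrow>
       (\<And>a x. a \<in> Ob \<Longrightarrow> x \<in> topspace (fob A a) \<Longrightarrow> u a (f a x) = v a (g a x)) \<Longrightarrow>
       \<exists>h. natural D X h \<and> (\<forall>a\<in>Ob. (\<forall>x\<in>topspace (fob B a). h a (i a x) = u a x) \<and> (\<forall>x\<in>topspace (fob C a). h a (j a x) = v a x))"
    and pushout_unique: "\<And>X h h' a d. is_enriched_functor P X \<Longrightarrow> natural D X h \<Longrightarrow> natural D X h' \<Longrightarrow>
       (\<And>a x. a \<in> Ob \<Longrightarrow> x \<in> topspace (fob B a) \<Longrightarrow> h a (i a x) = h' a (i a x)) \<Longrightarrow>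
       (\<And>a x. a \<in> Ob \<Longrightarrow> x \<in> topspace (fob C a) \<Longrightarrow> h a (j a x) = h' a (j a x)) \<Longrightarrow>
       a \<in> Ob \<Longrightarrow> d \<in> topspace (fob D a) \<Longrightarrow> h a d = h' a d"
proof -
  have ob: "is_enriched_functor P A" "is_enriched_functor P B" "is_enriched_functor P C" "is_enriched_functor P D"
    and hom: "f \<in> Hom EF A B" "g \<in> Hom EF A C" "i \<in> Hom EF B D" "j \<in> Hom EF C D"
    and com: "Comp EF A B D i f = Comp EF A C D j g"
    using po unfolding is_pushout_def Obj_EF by blast+
  have uni: "\<forall>X\<in>Obj EF. \<forall>u\<in>Hom EF B X. \<forall>v\<in>Hom EF C X. Comp EF A B X u f = Comp EF A C X v g \<longrightarrow>
      (\<exists>!h. h \<in> Hom EF D X \<and> Comp EF B D X h i = u \<and> Comp EF C D X h j = v)"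
    using po unfolding is_pushout_def by (elim conjE)
  have n: "natural A B f" "natural A C g" "natural B D i" "natural C D j" using hom by (auto intro: Hom_natural)
  show "is_enriched_functor P A" "is_enriched_functor P B" "is_enriched_functor P C" "is_enriched_functor P D"
    "natural A B f" "natural A C g" "natural B D i" "natural C D j" by fact+
  show cm: "i a (f a x) = j a (g a x)" if "a \<in> Ob" "x \<in> topspace (fob A a)" for a x
    using com that unfolding Comp_EF normalize_map_eq_iff by blast
  have key: "\<exists>!h. h \<in> Hom EF D X \<and> Comp EF B D X h i = normalize_map B u \<and> Comp EF C D X h j = normalize_map C v"
    if X: "is_enriched_functor P X" and u: "natural B X u" and v: "natural C X v"
      and uv: "\<And>a x. a \<in> Ob \<Longrightarrow> x \<in> topspace (fob A a) \<Longrightarrow> u a (f a x) = v a (g a x)" for X u v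
  proof (rule uni[rule_format])
    show "Comp EF A B X (normalize_map B u) f = Comp EF A C X (normalize_map C v) g"
      unfolding Comp_EF normalize_map_eq_iff using uv natural_in[OF n(1)] natural_in[OF n(2)] by simp
  qed (use X u v ob normalize_map_Hom in \<open>auto simp: Obj_EF\<close>)
  show "\<exists>h. natural D X h \<and> (\<forall>a\<in>Ob. (\<forall>x\<in>topspace (fob B a). h a (i a x) = u a x) \<and> (\<forall>x\<in>topspace (fob C a). h a (j a x) = v a x))"
    if "is_enriched_functor P X" "natural B X u" "natural C X v"
      "\<And>a x. a \<in> Ob \<Longrightarrow> x \<in> topspace (fob A a) \<Longrightarrow> u a (f a x) = v a (g a x)" for X u v
  proof -
    note hyps = that
    obtain h where "h \<in> Hom EF D X" "Comp EF B D X h i = normalize_map B u" "Comp EF C D X h j = normalize_map C v"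
      using key[OF hyps] by blast
    then show ?thesis unfolding Comp_EF normalize_map_eq_iff by (intro exI[of _ h]) (auto intro: Hom_natural)
  qed
  show "h a d = h' a d" if X: "is_enriched_functor P X" and h: "natural D X h" "natural D X h'"
    and ei: "\<And>a x. a \<in> Ob \<Longrightarrow> x \<in> topspace (fob B a) \<Longrightarrow> h a (i a x) = h' a (i a x)"
    and ej: "\<And>a x. a \<in> Ob \<Longrightarrow> x \<in> topspace (fob C a) \<Longrightarrow> h a (j a x) = h' a (j a x)"
    and ad: "a \<in> Ob" "d \<in> topspace (fob D a)" for X h h' a d
  proof -
    have ex: "\<exists>!k. k \<in> Hom EF D X \<and> Comp EF B D X k i = normalize_map B (\<lambda>a x. h a (i a x)) \<and> Comp EF C D X k j = normalize_map C (\<lambda>a x. h a (j a x))"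
      by (rule key[OF X natural_compose[OF n(3) h(1)] natural_compose[OF n(4) h(1)]]) (simp add: cm)
    have cp: "Comp EF B D X (normalize_map D k) i = normalize_map B (\<lambda>a x. h a (i a x)) \<and> Comp EF C D X (normalize_map D k) j = normalize_map C (\<lambda>a x. h a (j a x))"
      if "k = h \<or> k = h'" for k
      unfolding Comp_EF normalize_map_eq_iff using that ei ej natural_in[OF n(3)] natural_in[OF n(4)] by auto
    have "normalize_map D h = normalize_map D h'"
      using normalize_map_Hom[OF ob(4) h(1)] normalize_map_Hom[OF ob(4) h(2)] by (intro ex1_eqI[OF ex]) (simp_all add: cp)
    then show ?thesis using ad unfolding normalize_map_eq_iff by blast
  qed
qed

text \<open>The dual restatement; uniqueness says that \<open>i\<close> and \<open>j\<close> are
  jointly monomorphic.\<close>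

lemma pullbackE:
  assumes pb: "is_pullback EF A B C D f g i j"
  shows "is_enriched_functor P A" "is_enriched_functor P B" "is_enriched_functor P C" "is_enriched_functor P D"
    "natural B A f" "natural C A g" "natural D B i" "natural D C j"
    "\<And>a x. a \<in> Ob \<Longrightarrow> x \<in> topspace (fob D a) \<Longrightarrow> f a (i a x) = g a (j a x)"
    and pullback_ex: "\<And>X u v. is_enriched_functor P X \<Longrightarrow> natural X B u \<Longrightarrow> natural X C v \<Longrightarrow>
       (\<And>a x. a \<in> Ob \<Longrightarrow> x \<in> topspace (fob X a) \<Longrightarrow> f a (u a x) = g a (v a x)) \<Longrightarrow>
       \<exists>h. natural X D h \<and> (\<forall>a\<in>Ob. \<forall>x\<in>topspace (fob X a). i a (h a x) = u a x \<and> j a (h a x) = v a x)"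
    and pullback_unique: "\<And>X h h' a x. is_enriched_functor P X \<Longrightarrow> natural X D h \<Longrightarrow> natural X D h' \<Longrightarrow>
       (\<And>a x. a \<in> Ob \<Longrightarrow> x \<in> topspace (fob X a) \<Longrightarrow> i a (h a x) = i a (h' a x) \<and> j a (h a x) = j a (h' a x)) \<Longrightarrow>
       a \<in> Ob \<Longrightarrow> x \<in> topspace (fob X a) \<Longrightarrow> h a x = h' a x"
proof -
  have ob: "is_enriched_functor P A" "is_enriched_functor P B" "is_enriched_functor P C" "is_enriched_functor P D"
    and hom: "f \<in> Hom EF B A" "g \<in> Hom EF C A" "i \<in> Hom EF D B" "j \<in> Hom EF D C"
    and com: "Comp EF D B A f i = Comp EF D C A g j"
    using pb unfolding is_pullback_def Obj_EF by blast+
  have uni: "\<forall>X\<in>Obj EF. \<forall>u\<in>Hom EF X B. \<forall>v\<in>Hom EF X C. Comp EF X B A f u = Comp EF X C A g v \<longrightarrow>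
      (\<exists>!h. h \<in> Hom EF X D \<and> Comp EF X D B i h = u \<and> Comp EF X D C j h = v)"
    using pb unfolding is_pullback_def by (elim conjE)
  have n: "natural B A f" "natural C A g" "natural D B i" "natural D C j" using hom by (auto intro: Hom_natural)
  show "is_enriched_functor P A" "is_enriched_functor P B" "is_enriched_functor P C" "is_enriched_functor P D"
    "natural B A f" "natural C A g" "natural D B i" "natural D C j" by fact+
  show cm: "f a (i a x) = g a (j a x)" if "a \<in> Ob" "x \<in> topspace (fob D a)" for a x
    using com that unfolding Comp_EF normalize_map_eq_iff by blast
  have key: "\<exists>!h. h \<in> Hom EF X D \<and> Comp EF X D B i h = normalize_map X u \<and> Comp EF X D C j h = normalize_map X v"
    if X: "is_enriched_functor P X" and u: "natural X B u" and v: "natural X C v"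
      and uv: "\<And>a x. a \<in> Ob \<Longrightarrow> x \<in> topspace (fob X a) \<Longrightarrow> f a (u a x) = g a (v a x)" for X u v
  proof (rule uni[rule_format])
    show "Comp EF X B A f (normalize_map X u) = Comp EF X C A g (normalize_map X v)"
      unfolding Comp_EF normalize_map_eq_iff using uv by simp
  qed (use X u v ob normalize_map_Hom in \<open>auto simp: Obj_EF\<close>)
  show "\<exists>h. natural X D h \<and> (\<forall>a\<in>Ob. \<forall>x\<in>topspace (fob X a). i a (h a x) = u a x \<and> j a (h a x) = v a x)"
    if "is_enriched_functor P X" "natural X B u" "natural X C v"
      "\<And>a x. a \<in> Ob \<Longrightarrow> x \<in> topspace (fob X a) \<Longrightarrow> f a (u a x) = g a (v a x)" for X u v
  proof -
    note hyps = that
    obtain h where "h \<in> Hom EF X D" "Comp EF X D B i h = normalize_map X u" "Comp EF X D C j h = normalize_map X v"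
      using key[OF hyps] by blast
    then show ?thesis unfolding Comp_EF normalize_map_eq_iff by (intro exI[of _ h]) (auto intro: Hom_natural)
  qed
  show "h a x = h' a x" if X: "is_enriched_functor P X" and h: "natural X D h" "natural X D h'"
    and e: "\<And>a x. a \<in> Ob \<Longrightarrow> x \<in> topspace (fob X a) \<Longrightarrow> i a (h a x) = i a (h' a x) \<and> j a (h a x) = j a (h' a x)"
    and ax: "a \<in> Ob" "x \<in> topspace (fob X a)" for X h h' a x
  proof -
    have ex: "\<exists>!k. k \<in> Hom EF X D \<and> Comp EF X D B i k = normalize_map X (\<lambda>a x. i a (h a x)) \<and> Comp EF X D C j k = normalize_map X (\<lambda>a x. j a (h a x))"
      by (rule key[OF X natural_compose[OF h(1) n(3)] natural_compose[OF h(1) n(4)]]) (simp add: cm natural_in[OF h(1)])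
    have cp: "Comp EF X D B i (normalize_map X k) = normalize_map X (\<lambda>a x. i a (h a x)) \<and> Comp EF X D C j (normalize_map X k) = normalize_map X (\<lambda>a x. j a (h a x))"
      if "k = h \<or> k = h'" for k
      unfolding Comp_EF normalize_map_eq_iff using that e by auto
    have "normalize_map X h = normalize_map X h'"
      using normalize_map_Hom[OF X h(1)] normalize_map_Hom[OF X h(2)] by (intro ex1_eqI[OF ex]) (simp_all add: cp)
    then show ?thesis using ax unfolding normalize_map_eq_iff by blast
  qed
qed

section \<open>Functors given by sets, plots and an action\<close>

definition plot_functor :: "('u \<Rightarrow> 'u set) \<Rightarrow> ('u \<Rightarrow> nat \<Rightarrow> ((nat \<Rightarrow> real) \<Rightarrow> 'u) \<Rightarrow> bool)
    \<Rightarrow> ('u \<Rightarrow> 'u \<Rightarrow> 'u \<Rightarrow> 'u \<Rightarrow> 'u) \<Rightarrow> ('u, 'u, 'u topology, 'u \<Rightarrow> 'u) ftor" where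
  "plot_functor S Pl act = \<lparr>fob = (\<lambda>a. plot_topology (S a) (Pl a)), farr = (\<lambda>a b p. restrict (act a b p) (S a))\<rparr>"

text \<open>Continuity of a single \<open>act a b p\<close> comes from the constant simplex at
  \<open>p\<close>, continuity in \<open>p\<close> from the criterion for maps into a mapping space;
  both are instances of \<open>act_plot\<close>.\<close>

lemma plot_functor:
  assumes ps: "\<And>a. a \<in> Ob \<Longrightarrow> plot_space (S a) (Pl a)"
    and act_in: "\<And>a b p x. a \<in> Ob \<Longrightarrow> b \<in> Ob \<Longrightarrow> p \<in> Mor a b \<Longrightarrow> x \<in> S a \<Longrightarrow> act a b p x \<in> S b"
    and act_id: "\<And>a x. a \<in> Ob \<Longrightarrow> x \<in> S a \<Longrightarrow> act a a (EIdent P a) x = x"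
    and act_comp: "\<And>a b c p q x. a \<in> Ob \<Longrightarrow> b \<in> Ob \<Longrightarrow> c \<in> Ob \<Longrightarrow> p \<in> Mor a b \<Longrightarrow> q \<in> Mor b c \<Longrightarrow> x \<in> S a \<Longrightarrow>
        act a c (EComp P a b c q p) x = act b c q (act a b p x)"
    and act_plot: "\<And>a b n \<sigma> \<tau>. a \<in> Ob \<Longrightarrow> b \<in> Ob \<Longrightarrow> cm (standard_simplex n) (EHom P a b) \<sigma> \<Longrightarrow> Pl a n \<tau> \<Longrightarrow>
        Pl b n (\<lambda>z. act a b (\<sigma> z) (\<tau> z))"
  shows "is_enriched_functor P (plot_functor S Pl act)"
proof -
  let ?F = "plot_functor S Pl act"
  have ts: "topspace (plot_topology (S a) (Pl a)) = S a" if "a \<in> Ob" for a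
    using plot_space.topspace_plot[OF ps[OF that]] .
  have fob: "fob ?F a = plot_topology (S a) (Pl a)" and farr: "farr ?F a b p = restrict (act a b p) (S a)" for a b p
    by (simp_all add: plot_functor_def)
  have joint: "cm (standard_simplex n) (fob ?F b) (\<lambda>z. farr ?F a b (\<sigma> z) (\<tau> z))"
    if ab: "a \<in> Ob" "b \<in> Ob" and s: "cm (standard_simplex n) (EHom P a b) \<sigma>" and t: "Pl a n \<tau>" for a b n \<sigma> \<tau>
  proof -
    have "Pl b n (\<lambda>z. act a b (\<sigma> z) (\<tau> z))" by (rule act_plot[OF ab s t])
    then have "cm (standard_simplex n) (fob ?F b) (\<lambda>z. act a b (\<sigma> z) (\<tau> z))"
      unfolding fob by (rule plot_space.plot_cm[OF ps[OF ab(2)]])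
    then show ?thesis
      by (rule cm_cong) (simp add: farr plot_space.plot_in[OF ps[OF ab(1)] t])
  qed
  have maps: "farr ?F a b p \<in> top_maps (fob ?F a) (fob ?F b)" if ab: "a \<in> Ob" "b \<in> Ob" and p: "p \<in> Mor a b" for a b p
  proof -
    have "continuous_map (fob ?F a) (fob ?F b) (farr ?F a b p)"
      unfolding fob
    proof (rule plot_space.continuous_map_from_plot[OF ps[OF ab(1)]])
      show "farr ?F a b p x \<in> topspace (plot_topology (S b) (Pl b))" if "x \<in> S a" for x
        using act_in[OF ab p that] that by (simp add: ts ab farr)
      show "cm (standard_simplex n) (plot_topology (S b) (Pl b)) (\<lambda>z. farr ?F a b p (\<tau> z))" if "Pl a n \<tau>" for n \<tau>
        using joint[OF ab _ that, of "\<lambda>_. p"] p by (simp add: fob)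
    qed
    then show ?thesis by (simp add: top_maps_def) (simp add: fob farr ts ab)
  qed
  have "is_category (underlying_category P)" using P by (simp add: is_enriched_category_def)
  then have id: "EIdent P a \<in> Mor a a" if "a \<in> Ob" for a
    using that by (auto simp: is_category_def underlying_category_def)
  have cp: "EComp P a b c q p \<in> Mor a c" if "a \<in> Ob" "b \<in> Ob" "c \<in> Ob" "p \<in> Mor a b" "q \<in> Mor b c" for a b c p q
    using \<open>is_category (underlying_category P)\<close> that by (auto simp: is_category_def underlying_category_def)
  have "is_functor (underlying_category P) Top ?F"
    unfolding is_functor_def
  proof (intro conjI ballI)
    show "fob ?F a \<in> Obj Top" if "a \<in> Obj (underlying_category P)" for a
      using that plot_space.delta_generated_plot[OF ps] by (simp add: Top_def fob underlying_category_def)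
    show "farr ?F a b p \<in> Hom Top (fob ?F a) (fob ?F b)"
      if "a \<in> Obj (underlying_category P)" "b \<in> Obj (underlying_category P)" "p \<in> Hom (underlying_category P) a b" for a b p
      using that maps by (simp add: Top_def underlying_category_def)
    show "farr ?F a a (Ident (underlying_category P) a) = Ident Top (fob ?F a)" if "a \<in> Obj (underlying_category P)" for a
      using that act_id by (auto simp: Top_def fob farr underlying_category_def ts fun_eq_iff)
    show "farr ?F a c (Comp (underlying_category P) a b c q p) = Comp Top (fob ?F a) (fob ?F b) (fob ?F c) (farr ?F b c q) (farr ?F a b p)"
      if "a \<in> Obj (underlying_category P)" "b \<in> Obj (underlying_category P)" "c \<in> Obj (underlying_category P)"
        "p \<in> Hom (underlying_category P) a b" "q \<in> Hom (underlying_category P) b c" for a b c p q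
      using that act_comp act_in by (auto simp: Top_def fob farr underlying_category_def ts fun_eq_iff compose_def)
  qed
  moreover have "continuous_map (EHom P a b) (TOP (fob ?F a) (fob ?F b)) (farr ?F a b)" if ab: "a \<in> Ob" "b \<in> Ob" for a b
    unfolding fob[of a]
  proof (rule plot_space.continuous_map_TOP[OF ps[OF ab(1)]])
    show "delta_generated (EHom P a b)" using P ab by (simp add: is_enriched_category_def)
  qed (use maps[OF ab] joint[OF ab] in \<open>auto simp: fob[of a]\<close>)
  ultimately show ?thesis by (simp add: is_enriched_functor_def)
qed

end

section \<open>A path space with two cone coordinates\<close>

text \<open>The four data become values of one function on the reals, at 0, 1, 2 and elsewhere, and
  \<open>i\<close> turns this function into an element. The path and the height are first turned
  into elements by \<open>i\<close> as well.\<close>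

lemma universe_code:
  assumes "universe TYPE('u)"
  obtains code :: "(real \<Rightarrow> 'u) \<times> real \<times> 'u \<times> 'u \<Rightarrow> 'u" where "inj code"
proof -
  obtain e0 e1 :: 'u and i :: "(real \<Rightarrow> 'u) \<Rightarrow> 'u" where e: "e0 \<noteq> e1" and i: "inj i"
    using assms unfolding universe_def by blast
  \<comment> \<open>A real number is represented by its cut: the function that jumps from
    \<open>e0\<close> to \<open>e1\<close> at \<open>s\<close>.\<close>
  define st where "st = (\<lambda>s q :: real. if q < s then e0 else e1)"
  have st: "s = s'" if "st s = st s'" for s s'
  proof (rule ccontr)
    assume "s \<noteq> s'"
    then show False using fun_cong[OF that, of "min s s'"] e by (auto simp: st_def min_def split: if_splits)
  qed
  define g where "g = (\<lambda>(\<gamma>, s, y, x) (r::real). if r = 0 then i \<gamma> else if r = 1 then y else if r = 2 then x else i (st s))"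
  have "inj (\<lambda>w. i (g w))"
  proof (rule injI)
    fix w w' assume "i (g w) = i (g w')"
    then have g: "g w = g w'" using i by (simp add: inj_eq)
    obtain \<gamma> s y x \<gamma>' s' y' x' where w: "w = (\<gamma>, s, y, x)" "w' = (\<gamma>', s', y', x')" by (metis prod_cases4)
    show "w = w'"
      using fun_cong[OF g, of 0] fun_cong[OF g, of 1] fun_cong[OF g, of 2] fun_cong[OF g, of 3] i st
      by (auto simp: g_def w inj_eq)
  qed
  then show thesis by (rule that)
qed

lemma locally_compact_Hausdorff_compact: "compact S \<Longrightarrow> locally_compact_space (top_of_set S) \<and> Hausdorff_space (top_of_set S)"
  for S :: "'z::metric_space set"
  by (simp add: compact_imp_locally_compact_space compact_space_subtopology Hausdorff_space_subtopology)

text \<open>Preimages vary continuously only over open parts of a simplex. Evaluation there needs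
  local compactness, which open subsets of compact sets inherit.\<close>

lemma locally_compact_Hausdorff_open:
  fixes S :: "'z::metric_space set"
  assumes "compact S" "openin (top_of_set S) V"
  shows "locally_compact_space (top_of_set V) \<and> Hausdorff_space (top_of_set V)"
proof -
  have "locally_compact_space (subtopology (top_of_set S) V)"
    by (rule locally_compact_space_open_subset) (use locally_compact_Hausdorff_compact[OF assms(1)] assms(2) in auto)
  moreover have "subtopology (top_of_set S) V = top_of_set V"
    using openin_subset[OF assms(2)] by (simp add: subtopology_subtopology Int_absorb1)
  ultimately show ?thesis by (simp add: Hausdorff_space_subtopology)
qed

locale enriched_code = enriched P for P :: "('u, 'u) enriched_category" +
  fixes code :: "(real \<Rightarrow> 'u) \<times> real \<times> 'u \<times> 'u \<Rightarrow> 'u"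
  assumes inj_code: "inj code"
begin

definition "path_of z = fst (inv_into UNIV code z)"
definition "height z = fst (snd (inv_into UNIV code z))"
definition "C_point z = fst (snd (snd (inv_into UNIV code z)))"
definition "B_point z = snd (snd (snd (inv_into UNIV code z)))"

lemma code_sel [simp]: "path_of (code (\<gamma>, s, y, x)) = \<gamma>" "height (code (\<gamma>, s, y, x)) = s"
  "C_point (code (\<gamma>, s, y, x)) = y" "B_point (code (\<gamma>, s, y, x)) = x"
  by (simp_all add: path_of_def height_def C_point_def B_point_def inj_code)

lemma code_eqI: "z \<in> range code \<Longrightarrow> z' \<in> range code \<Longrightarrow> path_of z = path_of z' \<Longrightarrow> height z = height z' \<Longrightarrow> C_point z = C_point z' \<Longrightarrow> B_point z = B_point z' \<Longrightarrow> z = z'"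
  by auto

text \<open>Components that carry no information are normalised, so that equality of points is
  equality of the relevant components.\<close>

definition T_code :: "(real \<Rightarrow> 'u) \<Rightarrow> real \<Rightarrow> 'u \<Rightarrow> 'u \<Rightarrow> 'u" where
  "T_code \<gamma> s y x = code (restrict \<gamma> {0..1}, s, if s > 0 then y else undefined, if s < 1 then x else undefined)"

lemma T_code_sel: "t \<in> {0..1} \<Longrightarrow> path_of (T_code \<gamma> s y x) t = \<gamma> t" "height (T_code \<gamma> s y x) = s"
  "s > 0 \<Longrightarrow> C_point (T_code \<gamma> s y x) = y" "s < 1 \<Longrightarrow> B_point (T_code \<gamma> s y x) = x"
  by (simp_all add: T_code_def)

end

text \<open>
  The functor \<open>T\<close> of the introduction.  A point is a quadruple coded as an element of \<open>'u\<close>, with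
  \<open>undefined\<close> in place of the missing preimages at heights \<open>0\<close> and \<open>1\<close>.  Plots are required to have a
  continuous preimage only over the open region where it exists, so that the topology is that of
  a coarse cone.
\<close>

locale path_functor = enriched_code P code for P :: "('u, 'u) enriched_category" and code +
  fixes D C B :: "('u, 'u, 'u topology, 'u \<Rightarrow> 'u) ftor" and c b :: "'u \<Rightarrow> 'u \<Rightarrow> 'u"
  assumes D: "is_enriched_functor P D" and C: "is_enriched_functor P C" and B: "is_enriched_functor P B"
    and c: "natural C D c" and b: "natural B D b"
begin

definition T_points :: "'u \<Rightarrow> 'u set" where
  "T_points a = {z \<in> range code. cm {0..1} (fob D a) (path_of z) \<and> path_of z \<in> extensional {0..1} \<and> height z \<in> {0..1} \<and>
     (if height z > 0 then C_point z \<in> topspace (fob C a) \<and> path_of z 1 = c a (C_point z) else C_point z = undefined) \<and>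
     (if height z < 1 then B_point z \<in> topspace (fob B a) \<and> path_of z 0 = b a (B_point z) else B_point z = undefined)}"

definition T_plot :: "'u \<Rightarrow> nat \<Rightarrow> ((nat \<Rightarrow> real) \<Rightarrow> 'u) \<Rightarrow> bool" where
  "T_plot a n \<sigma> \<longleftrightarrow> (\<forall>p\<in>standard_simplex n. \<sigma> p \<in> T_points a) \<and>
     cm (standard_simplex n \<times> {0..1}) (fob D a) (\<lambda>w. path_of (\<sigma> (fst w)) (snd w)) \<and>
     continuous_on (standard_simplex n) (\<lambda>p. height (\<sigma> p)) \<and>
     cm {p \<in> standard_simplex n. height (\<sigma> p) > 0} (fob C a) (\<lambda>p. C_point (\<sigma> p)) \<and>
     cm {p \<in> standard_simplex n. height (\<sigma> p) < 1} (fob B a) (\<lambda>p. B_point (\<sigma> p))"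

definition T_act :: "'u \<Rightarrow> 'u \<Rightarrow> 'u \<Rightarrow> 'u \<Rightarrow> 'u" where
  "T_act a a' p z = T_code (\<lambda>t. farr D a a' p (path_of z t)) (height z) (farr C a a' p (C_point z)) (farr B a a' p (B_point z))"

definition T :: "('u, 'u, 'u topology, 'u \<Rightarrow> 'u) ftor" where
  "T = plot_functor T_points T_plot T_act"

lemma TsetD:
  assumes "z \<in> T_points a"
  shows "cm {0..1} (fob D a) (path_of z)" "0 \<le> height z" "height z \<le> 1"
    "height z > 0 \<Longrightarrow> C_point z \<in> topspace (fob C a)" "height z > 0 \<Longrightarrow> path_of z 1 = c a (C_point z)"
    "height z < 1 \<Longrightarrow> B_point z \<in> topspace (fob B a)" "height z < 1 \<Longrightarrow> path_of z 0 = b a (B_point z)"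
  using assms by (auto simp: T_points_def split: if_splits)

lemma T_code_T_points:
  assumes "cm {0..1} (fob D a) \<gamma>" "s \<in> {0..1}"
    "s > 0 \<Longrightarrow> y \<in> topspace (fob C a) \<and> \<gamma> 1 = c a y" "s < 1 \<Longrightarrow> x \<in> topspace (fob B a) \<and> \<gamma> 0 = b a x"
  shows "T_code \<gamma> s y x \<in> T_points a"
proof -
  have "cm {0..1} (fob D a) (restrict \<gamma> {0..1})" by (rule cm_cong[OF assms(1)]) simp
  then show ?thesis using assms by (auto simp: T_points_def T_code_def)
qed

lemma T_points_eqI:
  assumes z: "z \<in> T_points a" "z' \<in> T_points a" and "\<And>t. t \<in> {0..1} \<Longrightarrow> path_of z t = path_of z' t" "height z = height z'"
    "height z > 0 \<Longrightarrow> C_point z = C_point z'" "height z < 1 \<Longrightarrow> B_point z = B_point z'"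
  shows "z = z'"
proof (rule code_eqI)
  show "path_of z = path_of z'"
    by (rule extensionalityI[of _ "{0..1}"]) (use z assms(3) in \<open>auto simp: T_points_def\<close>)
  show "C_point z = C_point z'" using z assms(4,5) by (cases "height z > 0") (auto simp: T_points_def)
  show "B_point z = B_point z'" using z assms(4,6) by (cases "height z < 1") (auto simp: T_points_def)
qed (use z assms(4) in \<open>auto simp: T_points_def\<close>)

lemma T_plot_in: "T_plot a n \<sigma> \<Longrightarrow> p \<in> standard_simplex n \<Longrightarrow> \<sigma> p \<in> T_points a"
  by (simp add: T_plot_def)

lemma plot_space_T: "plot_space (T_points a) (T_plot a)"
proof
  show "\<sigma> p \<in> T_points a" if "T_plot a n \<sigma>" "p \<in> standard_simplex n" for n \<sigma> p using T_plot_in that .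
  show "T_plot a n (\<lambda>_. z)" if z: "z \<in> T_points a" for z n
  proof -
    have "cm (standard_simplex n \<times> {0..1}) (fob D a) (\<lambda>w. path_of z (snd w))"
      by (rule cm_compose[OF TsetD(1)[OF z]]) (auto intro!: continuous_intros)
    moreover have "cm {p \<in> standard_simplex n. height z > 0} (fob C a) (\<lambda>p. C_point z)"
      using TsetD(4)[OF z] by (cases "height z > 0") auto
    moreover have "cm {p \<in> standard_simplex n. height z < 1} (fob B a) (\<lambda>p. B_point z)"
      using TsetD(6)[OF z] by (cases "height z < 1") auto
    ultimately show ?thesis using z unfolding T_plot_def by simp
  qed
  show "T_plot a m (\<lambda>p. \<sigma> (\<theta> p))" if s: "T_plot a n \<sigma>" and t: "continuous_on (standard_simplex m) \<theta>"
    "\<And>p. p \<in> standard_simplex m \<Longrightarrow> \<theta> p \<in> standard_simplex n" for n \<sigma> m \<theta>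
  proof -
    have 1: "cm (standard_simplex n \<times> {0..1}) (fob D a) (\<lambda>w. path_of (\<sigma> (fst w)) (snd w))"
      and 2: "continuous_on (standard_simplex n) (\<lambda>p. height (\<sigma> p))"
      and 3: "cm {p \<in> standard_simplex n. height (\<sigma> p) > 0} (fob C a) (\<lambda>p. C_point (\<sigma> p))"
      and 4: "cm {p \<in> standard_simplex n. height (\<sigma> p) < 1} (fob B a) (\<lambda>p. B_point (\<sigma> p))"
      using s by (auto simp: T_plot_def)
    have "cm (standard_simplex m \<times> {0..1}) (fob D a) (\<lambda>w. path_of (\<sigma> (fst (\<theta> (fst w), snd w))) (snd (\<theta> (fst w), snd w)))"
      by (rule cm_compose[OF 1]) (auto intro!: continuous_intros continuous_on_compose2[OF t(1)] t(2))
    moreover have "continuous_on (standard_simplex m) (\<lambda>p. height (\<sigma> (\<theta> p)))"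
      by (rule continuous_on_compose2[OF 2 t(1)]) (use t(2) in auto)
    moreover have "cm {p \<in> standard_simplex m. height (\<sigma> (\<theta> p)) > 0} (fob C a) (\<lambda>p. C_point (\<sigma> (\<theta> p)))"
      by (rule cm_compose[OF 3 continuous_on_subset[OF t(1)]]) (use t(2) in auto)
    moreover have "cm {p \<in> standard_simplex m. height (\<sigma> (\<theta> p)) < 1} (fob B a) (\<lambda>p. B_point (\<sigma> (\<theta> p)))"
      by (rule cm_compose[OF 4 continuous_on_subset[OF t(1)]]) (use t(2) in auto)
    ultimately show ?thesis using s t(2) by (simp add: T_plot_def)
  qed
qed

lemma T_act_T_points:
  assumes "a \<in> Ob" "a' \<in> Ob" "p \<in> Mor a a'" "z \<in> T_points a"
  shows "T_act a a' p z \<in> T_points a'"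
proof -
  note z = TsetD[OF assms(4)]
  have p0: "path_of z 0 \<in> topspace (fob D a)" "path_of z 1 \<in> topspace (fob D a)" using cm_image[OF z(1)] by auto
  show ?thesis
    unfolding T_act_def
  proof (rule T_code_T_points)
    show "cm {0..1} (fob D a') (\<lambda>t. farr D a a' p (path_of z t))"
      by (rule cm_post[OF z(1) functor_cont[OF D assms(1-3)]])
    show "farr C a a' p (C_point z) \<in> topspace (fob C a') \<and> farr D a a' p (path_of z 1) = c a' (farr C a a' p (C_point z))" if "height z > 0"
      using z(4,5)[OF that] functor_in[OF C assms(1-3)] natural_nat[OF c assms(1-3)] by simp
    show "farr B a a' p (B_point z) \<in> topspace (fob B a') \<and> farr D a a' p (path_of z 0) = b a' (farr B a a' p (B_point z))" if "height z < 1"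
      using z(6,7)[OF that] functor_in[OF B assms(1-3)] natural_nat[OF b assms(1-3)] by simp
  qed (use z in auto)
qed

text \<open>The laws hold component by component. For plots, joint evaluation is applied over the
  compact prism for the paths, and over the open parts of positive height and of height below 1 for
  the preimages.\<close>

lemma T_functor: "is_enriched_functor P T"
  unfolding T_def
proof (rule plot_functor[OF plot_space_T T_act_T_points])
  have cat: "is_category (underlying_category P)" using P by (simp add: is_enriched_category_def)
  have id: "EIdent P a \<in> Mor a a" if "a \<in> Ob" for a
    using that cat by (auto simp: is_category_def underlying_category_def)
  have cp: "EComp P a a' a'' q p \<in> Mor a a''" if "a \<in> Ob" "a' \<in> Ob" "a'' \<in> Ob" "p \<in> Mor a a'" "q \<in> Mor a' a''" for a a' a'' p q
    using cat that by (auto simp: is_category_def underlying_category_def)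
  show "T_act a a (EIdent P a) z = z" if a: "a \<in> Ob" and z: "z \<in> T_points a" for a z
    by (rule T_points_eqI[OF T_act_T_points[OF a a id[OF a] z] z])
      (use TsetD[OF z] a cm_image[OF TsetD(1)[OF z]] functor_id[OF D a] functor_id[OF C a] functor_id[OF B a] in
        \<open>auto simp: T_act_def T_code_sel\<close>)
  show "T_act a a'' (EComp P a a' a'' q p) z = T_act a' a'' q (T_act a a' p z)"
    if a: "a \<in> Ob" "a' \<in> Ob" "a'' \<in> Ob" and p: "p \<in> Mor a a'" and q: "q \<in> Mor a' a''" and z: "z \<in> T_points a" for a a' a'' p q z
    by (rule T_points_eqI[OF T_act_T_points[OF a(1,3) cp[OF a p q] z] T_act_T_points[OF a(2,3) q T_act_T_points[OF a(1,2) p z]]])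
      (use TsetD[OF z] cm_image[OF TsetD(1)[OF z]] functor_comp[OF D a p q] functor_comp[OF C a p q] functor_comp[OF B a p q] in
        \<open>auto simp: T_act_def T_code_sel\<close>)
  fix a a' n \<sigma> \<tau>
  assume a: "a \<in> Ob" "a' \<in> Ob" and s: "cm (standard_simplex n) (EHom P a a') \<sigma>" and t: "T_plot a n \<tau>"
  let ?S = "standard_simplex n"
  have t1: "cm (?S \<times> {0..1}) (fob D a) (\<lambda>w. path_of (\<tau> (fst w)) (snd w))"
    and t2: "continuous_on ?S (\<lambda>p. height (\<tau> p))"
    and t3: "cm {p \<in> ?S. height (\<tau> p) > 0} (fob C a) (\<lambda>p. C_point (\<tau> p))"
    and t4: "cm {p \<in> ?S. height (\<tau> p) < 1} (fob B a) (\<lambda>p. B_point (\<tau> p))"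
    using t by (auto simp: T_plot_def)
  have hg: "height (T_act a a' (\<sigma> p) (\<tau> p)) = height (\<tau> p)" for p by (simp add: T_act_def T_code_sel)
  have o3: "openin (top_of_set ?S) {p \<in> ?S. height (\<tau> p) > 0}" and o4: "openin (top_of_set ?S) {p \<in> ?S. height (\<tau> p) < 1}"
    using continuous_openin_preimage[OF t2, of "UNIV" "{0<..}"] continuous_openin_preimage[OF t2, of "UNIV" "{..<1}"]
    by (simp_all add: vimage_def Int_def)
  show "T_plot a' n (\<lambda>p. T_act a a' (\<sigma> p) (\<tau> p))"
    unfolding T_plot_def hg
  proof (intro conjI ballI t2)
    show "T_act a a' (\<sigma> p) (\<tau> p) \<in> T_points a'" if "p \<in> ?S" for p
      by (rule T_act_T_points[OF a cm_image[OF s that] T_plot_in[OF t that]])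
    have "cm (?S \<times> {0..1}) (fob D a') (\<lambda>w. farr D a a' (\<sigma> (fst w)) (path_of (\<tau> (fst w)) (snd w)))"
    proof (rule functor_joint[OF D a _ _ _ t1])
      show "cm (?S \<times> {0..1::real}) (EHom P a a') (\<lambda>w. \<sigma> (fst w))"
        by (rule cm_compose[OF s]) (auto intro!: continuous_intros)
      have "compact (?S \<times> {0..1::real})" by (intro compact_Times compact_standard_simplex) simp
      then show "locally_compact_space (top_of_set (?S \<times> {0..1::real}))" "Hausdorff_space (top_of_set (?S \<times> {0..1::real}))"
        using locally_compact_Hausdorff_compact by blast+
    qed
    then show "cm (?S \<times> {0..1}) (fob D a') (\<lambda>w. path_of (T_act a a' (\<sigma> (fst w)) (\<tau> (fst w))) (snd w))"
      by (rule cm_cong) (auto simp: T_act_def T_code_sel)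
    have "cm {p \<in> ?S. height (\<tau> p) > 0} (fob C a') (\<lambda>p. farr C a a' (\<sigma> p) (C_point (\<tau> p)))"
      by (rule functor_joint[OF C a _ _ cm_subset[OF s] t3]) (use locally_compact_Hausdorff_open[OF compact_standard_simplex o3] in auto)
    then show "cm {p \<in> ?S. height (\<tau> p) > 0} (fob C a') (\<lambda>p. C_point (T_act a a' (\<sigma> p) (\<tau> p)))"
      by (rule cm_cong) (auto simp: T_act_def T_code_sel)
    have "cm {p \<in> ?S. height (\<tau> p) < 1} (fob B a') (\<lambda>p. farr B a a' (\<sigma> p) (B_point (\<tau> p)))"
      by (rule functor_joint[OF B a _ _ cm_subset[OF s] t4]) (use locally_compact_Hausdorff_open[OF compact_standard_simplex o4] in auto)
    then show "cm {p \<in> ?S. height (\<tau> p) < 1} (fob B a') (\<lambda>p. B_point (T_act a a' (\<sigma> p) (\<tau> p)))"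
      by (rule cm_cong) (auto simp: T_act_def T_code_sel)
  qed
qed

lemma fob_T: "fob T a = plot_topology (T_points a) (T_plot a)"
  and farr_T: "farr T a a' p = restrict (T_act a a' p) (T_points a)"
  by (simp_all add: T_def plot_functor_def)

lemma topspace_T [simp]: "topspace (fob T a) = T_points a"
  unfolding fob_T by (rule plot_space.topspace_plot[OF plot_space_T])

text \<open>Being a plot includes joint continuity on the prism, so the product criterion applies
  with the compact interval as second factor.\<close>

lemma path_of_cont: "continuous_map (prod_topology (fob T a) (top_of_set {0..1})) (fob D a) (\<lambda>(z, t). path_of z t)"
  unfolding fob_T
proof (rule plot_space.continuous_map_plot_prod[OF plot_space_T])
  show "locally_compact_space (top_of_set {0..1::real})" "Hausdorff_space (top_of_set {0..1::real})"
    using locally_compact_Hausdorff_compact[of "{0..1::real}"] by auto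
  show "cm {0..1} (fob D a) (\<lambda>t. case (z, t) of (z, t) \<Rightarrow> path_of z t)" if "z \<in> T_points a" for z
    using TsetD(1)[OF that] by simp
  show "continuous_map (prod_topology (top_of_set (standard_simplex n)) (top_of_set {0..1})) (fob D a)
      (\<lambda>(q, z). case (\<tau> q, z) of (z, t) \<Rightarrow> path_of z t)" if "T_plot a n \<tau>" for n \<tau>
  proof -
    have "(\<lambda>(q, z). case (\<tau> q, z) of (z, t) \<Rightarrow> path_of z t) = (\<lambda>w. path_of (\<tau> (fst w)) (snd w))" by auto
    then show ?thesis using that by (simp add: T_plot_def)
  qed
qed

lemma height_cont: "continuous_map (fob T a) euclideanreal height"
  unfolding fob_T
  by (rule plot_space.continuous_map_from_plot[OF plot_space_T]) (auto simp: T_plot_def)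

text \<open>Openness in \<open>T\<close> is tested on plots, where the region is open and the
  component is continuous on it by assumption. The region is not tested on its own simplices, since
  these need not be plots.\<close>

lemma part_cont:
  assumes V: "open V" and in_X: "\<And>z. z \<in> T_points a \<Longrightarrow> height z \<in> V \<Longrightarrow> k z \<in> topspace X"
    and pl: "\<And>n \<tau>. T_plot a n \<tau> \<Longrightarrow> cm {p \<in> standard_simplex n. height (\<tau> p) \<in> V} X (\<lambda>p. k (\<tau> p))"
  shows "continuous_map (subtopology (fob T a) {z. height z \<in> V}) X k"
  unfolding continuous_map
proof (intro conjI allI impI)
  show "k ` topspace (subtopology (fob T a) {z. height z \<in> V}) \<subseteq> topspace X"
    using in_X by auto
  fix W assume W: "openin X W"
  define U where "U = {z \<in> T_points a. height z \<in> V \<and> k z \<in> W}"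
  have "openin (fob T a) U"
    unfolding fob_T openin_plot_topology
  proof (intro conjI allI impI)
    fix n \<sigma> assume s: "T_plot a n \<sigma>"
    let ?S = "standard_simplex n" let ?V = "{p \<in> ?S. height (\<sigma> p) \<in> V}"
    have "continuous_on ?S (\<lambda>p. height (\<sigma> p))" using s by (simp add: T_plot_def)
    from continuous_openin_preimage_gen[OF this V] have "openin (top_of_set ?S) ?V" by (simp add: vimage_def Int_def)
    moreover have "openin (top_of_set ?V) {p \<in> ?V. k (\<sigma> p) \<in> W}"
      using openin_continuous_map_preimage[OF pl[OF s] W] by simp
    ultimately have "openin (top_of_set ?S) {p \<in> ?V. k (\<sigma> p) \<in> W}" by (meson openin_trans)
    moreover have "{p \<in> ?V. k (\<sigma> p) \<in> W} = {p \<in> ?S. \<sigma> p \<in> U}" using T_plot_in[OF s] by (auto simp: U_def)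
    ultimately show "openin (top_of_set ?S) {p \<in> ?S. \<sigma> p \<in> U}" by simp
  qed (auto simp: U_def)
  then show "openin (subtopology (fob T a) {z. height z \<in> V}) {z \<in> topspace (subtopology (fob T a) {z. height z \<in> V}). k z \<in> W}"
    unfolding openin_subtopology by (intro exI[of _ U]) (auto simp: U_def)
qed

lemma C_point_cont: "continuous_map (subtopology (fob T a) {z. height z > 0}) (fob C a) C_point"
  using part_cont[of "{0<..}" a C_point "fob C a"] TsetD(4) by (auto simp: T_plot_def)

lemma B_point_cont: "continuous_map (subtopology (fob T a) {z. height z < 1}) (fob B a) B_point"
  using part_cont[of "{..<1}" a B_point "fob B a"] TsetD(6) by (auto simp: T_plot_def)

text \<open>Each simplex of \<open>Z\<close> is turned into a plot by the given components. In this
  sense the coarse cone has a universal property for maps into it.\<close>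

lemma continuous_into_T:
  assumes Z: "delta_generated Z"
    and Hm: "continuous_map (prod_topology Z (top_of_set {0..1})) (fob D a) Hm"
    and s: "continuous_map Z euclideanreal s" and s01: "\<And>w. w \<in> topspace Z \<Longrightarrow> s w \<in> {0..1}"
    and y: "continuous_map (subtopology Z {w. s w > 0}) (fob C a) y"
    and x: "continuous_map (subtopology Z {w. s w < 1}) (fob B a) x"
    and yc: "\<And>w. w \<in> topspace Z \<Longrightarrow> s w > 0 \<Longrightarrow> Hm (w, 1) = c a (y w)"
    and xb: "\<And>w. w \<in> topspace Z \<Longrightarrow> s w < 1 \<Longrightarrow> Hm (w, 0) = b a (x w)"
  shows "continuous_map Z (fob T a) (\<lambda>w. T_code (\<lambda>t. Hm (w, t)) (s w) (y w) (x w))"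
    and "\<And>w. w \<in> topspace Z \<Longrightarrow> T_code (\<lambda>t. Hm (w, t)) (s w) (y w) (x w) \<in> T_points a"
proof -
  show in_T: "T_code (\<lambda>t. Hm (w, t)) (s w) (y w) (x w) \<in> T_points a" if w: "w \<in> topspace Z" for w
  proof (rule T_code_T_points)
    show "cm {0..1} (fob D a) (\<lambda>t. Hm (w, t))"
      using continuous_map_compose[OF continuous_map_prodI[of "top_of_set {0..1}" Z "\<lambda>_. w" "top_of_set {0..1}" "\<lambda>t. t"] Hm] w
      by (simp add: o_def)
    show "y w \<in> topspace (fob C a) \<and> Hm (w, 1) = c a (y w)" if "s w > 0"
      using yc[OF w that] continuous_map_in[OF y] w that by simp
    show "x w \<in> topspace (fob B a) \<and> Hm (w, 0) = b a (x w)" if "s w < 1"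
      using xb[OF w that] continuous_map_in[OF x] w that by simp
  qed (use s01[OF w] in auto)
  show "continuous_map Z (fob T a) (\<lambda>w. T_code (\<lambda>t. Hm (w, t)) (s w) (y w) (x w))"
    unfolding fob_T
  proof (rule plot_space.continuous_map_into_plot[OF plot_space_T Z in_T])
    fix n \<sigma> assume \<sigma>: "cm (standard_simplex n) Z \<sigma>"
    let ?S = "standard_simplex n"
    have "cm (?S \<times> {0..1::real}) Z (\<lambda>w. \<sigma> (fst w))" by (rule cm_compose[OF \<sigma>]) (auto intro!: continuous_intros)
    moreover have "cm (?S \<times> {0..1::real}) (top_of_set {0..1}) snd" by (rule cm_into) (auto intro!: continuous_intros)
    ultimately have "cm (?S \<times> {0..1::real}) (prod_topology Z (top_of_set {0..1})) (\<lambda>w. (\<sigma> (fst w), snd w))"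
      by (rule continuous_map_prodI)
    then have 1: "cm (?S \<times> {0..1}) (fob D a) (\<lambda>w. Hm (\<sigma> (fst w), snd w))" by (rule cm_post[OF _ Hm])
    have 2: "continuous_on ?S (\<lambda>p. s (\<sigma> p))" using cm_post[OF \<sigma> s] by simp
    have sub: "cm {p \<in> ?S. Q (s (\<sigma> p))} (subtopology Z {w. Q (s w)}) \<sigma>" for Q
      using cm_subset[OF \<sigma>, of "{p \<in> ?S. Q (s (\<sigma> p))}"] by (auto simp: continuous_map_in_subtopology)
    have 3: "cm {p \<in> ?S. s (\<sigma> p) > 0} (fob C a) (\<lambda>p. y (\<sigma> p))" by (rule cm_post[OF sub y])
    have 4: "cm {p \<in> ?S. s (\<sigma> p) < 1} (fob B a) (\<lambda>p. x (\<sigma> p))" by (rule cm_post[OF sub x])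
    show "T_plot a n (\<lambda>p. T_code (\<lambda>t. Hm (\<sigma> p, t)) (s (\<sigma> p)) (y (\<sigma> p)) (x (\<sigma> p)))"
      unfolding T_plot_def T_code_sel
    proof (intro conjI ballI)
      show "T_code (\<lambda>t. Hm (\<sigma> p, t)) (s (\<sigma> p)) (y (\<sigma> p)) (x (\<sigma> p)) \<in> T_points a" if "p \<in> ?S" for p
        by (rule in_T[OF cm_image[OF \<sigma> that]])
      show "cm (?S \<times> {0..1}) (fob D a) (\<lambda>w. path_of (T_code (\<lambda>t. Hm (\<sigma> (fst w), t)) (s (\<sigma> (fst w))) (y (\<sigma> (fst w))) (x (\<sigma> (fst w)))) (snd w))"
        by (rule cm_cong[OF 1]) (auto simp: T_code_sel)
      show "cm {p \<in> ?S. s (\<sigma> p) > 0} (fob C a) (\<lambda>p. C_point (T_code (\<lambda>t. Hm (\<sigma> p, t)) (s (\<sigma> p)) (y (\<sigma> p)) (x (\<sigma> p))))"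
        by (rule cm_cong[OF 3]) (auto simp: T_code_sel)
      show "cm {p \<in> ?S. s (\<sigma> p) < 1} (fob B a) (\<lambda>p. B_point (T_code (\<lambda>t. Hm (\<sigma> p, t)) (s (\<sigma> p)) (y (\<sigma> p)) (x (\<sigma> p))))"
        by (rule cm_cong[OF 4]) (auto simp: T_code_sel)
    qed (rule 2)
  qed
qed

text \<open>Points of \<open>T\<close> are compared on their components, so naturality splits into
  one condition for each of the four.\<close>

lemma natural_into_T:
  assumes F: "is_enriched_functor P F"
    and Hm: "\<And>a. a \<in> Ob \<Longrightarrow> continuous_map (prod_topology (fob F a) (top_of_set {0..1})) (fob D a) (Hm a)"
    and s: "\<And>a. a \<in> Ob \<Longrightarrow> continuous_map (fob F a) euclideanreal (s a)" and s01: "\<And>a w. a \<in> Ob \<Longrightarrow> w \<in> topspace (fob F a) \<Longrightarrow> s a w \<in> {0..1}"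
    and y: "\<And>a. a \<in> Ob \<Longrightarrow> continuous_map (subtopology (fob F a) {w. s a w > 0}) (fob C a) (y a)"
    and x: "\<And>a. a \<in> Ob \<Longrightarrow> continuous_map (subtopology (fob F a) {w. s a w < 1}) (fob B a) (x a)"
    and yc: "\<And>a w. a \<in> Ob \<Longrightarrow> w \<in> topspace (fob F a) \<Longrightarrow> s a w > 0 \<Longrightarrow> Hm a (w, 1) = c a (y a w)"
    and xb: "\<And>a w. a \<in> Ob \<Longrightarrow> w \<in> topspace (fob F a) \<Longrightarrow> s a w < 1 \<Longrightarrow> Hm a (w, 0) = b a (x a w)"
    and nHm: "\<And>a a' p w t. a \<in> Ob \<Longrightarrow> a' \<in> Ob \<Longrightarrow> p \<in> Mor a a' \<Longrightarrow> w \<in> topspace (fob F a) \<Longrightarrow> t \<in> {0..1} \<Longrightarrow>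
        Hm a' (farr F a a' p w, t) = farr D a a' p (Hm a (w, t))"
    and ns: "\<And>a a' p w. a \<in> Ob \<Longrightarrow> a' \<in> Ob \<Longrightarrow> p \<in> Mor a a' \<Longrightarrow> w \<in> topspace (fob F a) \<Longrightarrow> s a' (farr F a a' p w) = s a w"
    and ny: "\<And>a a' p w. a \<in> Ob \<Longrightarrow> a' \<in> Ob \<Longrightarrow> p \<in> Mor a a' \<Longrightarrow> w \<in> topspace (fob F a) \<Longrightarrow> s a w > 0 \<Longrightarrow>
        y a' (farr F a a' p w) = farr C a a' p (y a w)"
    and nx: "\<And>a a' p w. a \<in> Ob \<Longrightarrow> a' \<in> Ob \<Longrightarrow> p \<in> Mor a a' \<Longrightarrow> w \<in> topspace (fob F a) \<Longrightarrow> s a w < 1 \<Longrightarrow>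
        x a' (farr F a a' p w) = farr B a a' p (x a w)"
  shows "natural F T (\<lambda>a w. T_code (\<lambda>t. Hm a (w, t)) (s a w) (y a w) (x a w))"
proof -
  let ?k = "\<lambda>a w. T_code (\<lambda>t. Hm a (w, t)) (s a w) (y a w) (x a w)"
  have cont: "continuous_map (fob F a) (fob T a) (?k a)" if a: "a \<in> Ob" for a
    by (rule continuous_into_T(1)[OF functor_dg[OF F a] Hm[OF a] s[OF a] s01[OF a] y[OF a] x[OF a] yc[OF a] xb[OF a]])
  have in_T: "?k a w \<in> T_points a" if a: "a \<in> Ob" and w: "w \<in> topspace (fob F a)" for a w
    by (rule continuous_into_T(2)[OF functor_dg[OF F a] Hm[OF a] s[OF a] s01[OF a] y[OF a] x[OF a] yc[OF a] xb[OF a] w])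
  have "?k a' (farr F a a' p w) = farr T a a' p (?k a w)"
    if a: "a \<in> Ob" "a' \<in> Ob" and p: "p \<in> Mor a a'" and w: "w \<in> topspace (fob F a)" for a a' p w
  proof -
    have "?k a' (farr F a a' p w) = T_act a a' p (?k a w)"
      by (rule T_points_eqI[OF in_T[OF a(2) functor_in[OF F a p w]] T_act_T_points[OF a p in_T[OF a(1) w]]])
        (use nHm[OF a p w] ns[OF a p w] ny[OF a p w] nx[OF a p w] in \<open>auto simp: T_act_def T_code_sel\<close>)
    then show ?thesis using in_T[OF a(1) w] by (simp add: farr_T)
  qed
  then show ?thesis using cont by (simp add: natural_def)
qed

lemma ev0: "natural T D (\<lambda>a z. path_of z 0)"
  unfolding natural_def
proof (intro conjI ballI)
  fix a assume a: "a \<in> Ob"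
  have "continuous_map (fob T a) (prod_topology (fob T a) (top_of_set {0..1::real})) (\<lambda>z. (z, 0))"
    by (intro continuous_map_prodI) auto
  from continuous_map_compose[OF this path_of_cont] show "continuous_map (fob T a) (fob D a) (\<lambda>z. path_of z 0)"
    by (simp add: o_def)
qed (simp add: farr_T T_act_def T_code_sel)

lemma T_nat_components:
  assumes k: "natural F T \<kappa>" and F: "is_enriched_functor P F" and a: "a \<in> Ob" "a' \<in> Ob" and p: "p \<in> Mor a a'" and w: "w \<in> topspace (fob F a)"
  shows "t \<in> {0..1} \<Longrightarrow> path_of (\<kappa> a' (farr F a a' p w)) t = farr D a a' p (path_of (\<kappa> a w) t)"
    and "height (\<kappa> a' (farr F a a' p w)) = height (\<kappa> a w)"
    and "height (\<kappa> a w) > 0 \<Longrightarrow> C_point (\<kappa> a' (farr F a a' p w)) = farr C a a' p (C_point (\<kappa> a w))"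
    and "height (\<kappa> a w) < 1 \<Longrightarrow> B_point (\<kappa> a' (farr F a a' p w)) = farr B a a' p (B_point (\<kappa> a w))"
  using natural_nat[OF k a p w] natural_in[OF k a(1) w] by (simp_all add: farr_T T_act_def T_code_sel)

lemma T_cont_components:
  assumes k: "natural F T \<kappa>" and a: "a \<in> Ob"
  shows "continuous_map (prod_topology (fob F a) (top_of_set {0..1})) (fob D a) (\<lambda>w. path_of (\<kappa> a (fst w)) (snd w))"
    and "continuous_map (fob F a) euclideanreal (\<lambda>w. height (\<kappa> a w))"
    and "continuous_map (subtopology (fob F a) {w. height (\<kappa> a w) > 0}) (fob C a) (\<lambda>w. C_point (\<kappa> a w))"
    and "continuous_map (subtopology (fob F a) {w. height (\<kappa> a w) < 1}) (fob B a) (\<lambda>w. B_point (\<kappa> a w))"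
proof -
  note kc = natural_cont[OF k a]
  have "continuous_map (prod_topology (fob F a) (top_of_set {0..1::real})) (prod_topology (fob T a) (top_of_set {0..1})) (\<lambda>w. (\<kappa> a (fst w), snd w))"
    by (intro continuous_map_prodI continuous_map_snd continuous_map_compose[OF continuous_map_fst kc, unfolded o_def])
  from continuous_map_compose[OF this path_of_cont]
  show "continuous_map (prod_topology (fob F a) (top_of_set {0..1})) (fob D a) (\<lambda>w. path_of (\<kappa> a (fst w)) (snd w))"
    by (simp add: o_def)
  show "continuous_map (fob F a) euclideanreal (\<lambda>w. height (\<kappa> a w))"
    using continuous_map_compose[OF kc height_cont] by (simp add: o_def)
  have sub: "continuous_map (subtopology (fob F a) {w. Q (height (\<kappa> a w))}) (subtopology (fob T a) {z. Q (height z)}) (\<kappa> a)" for Q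
    using continuous_map_from_subtopology[OF kc, of "{w. Q (height (\<kappa> a w))}"] by (auto simp: continuous_map_in_subtopology)
  show "continuous_map (subtopology (fob F a) {w. height (\<kappa> a w) > 0}) (fob C a) (\<lambda>w. C_point (\<kappa> a w))"
    using continuous_map_compose[OF sub C_point_cont] by (simp add: o_def)
  show "continuous_map (subtopology (fob F a) {w. height (\<kappa> a w) < 1}) (fob B a) (\<lambda>w. B_point (\<kappa> a w))"
    using continuous_map_compose[OF sub B_point_cont] by (simp add: o_def)
qed

end

section \<open>Independence of values off the carrier; cubes and discs as test spaces\<close>

lemma continuous_map_empty: "continuous_map (subtopology X {}) Y f"
  by (simp add: continuous_map_def)

lemma closed_cube_bd: "closed (cube_bd n)"
proof -
  have "continuous_on (cube n) (sup_norm n)" using continuous_on_sup_norm[OF continuous_on_id] by simp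
  from continuous_closed_preimage[OF this compact_imp_closed[OF compact_cube] closed_singleton[of 1]]
  show ?thesis by (simp add: cube_bd_def vimage_def Int_def)
qed

lemma weak_lifting_cong:
  assumes e: "\<And>x. x \<in> topspace X \<Longrightarrow> f x = f' x" and w: "weak_lifting X Y f"
  shows "weak_lifting X Y f'"
  unfolding weak_lifting_def
proof (intro allI impI)
  fix n u v assume s: "lifting_square (cube n) (cube_bd n) X Y f' u v"
  then have "lifting_square (cube n) (cube_bd n) X Y f u v" using e cm_image[of "cube_bd n" X u] by (auto simp: lifting_square_def)
  then have "homotopy_lift (cube n) (cube_bd n) X Y f u v" using w by (simp add: weak_lifting_def)
  then obtain h L where h: "cm (cube n) X h" "\<forall>q\<in>cube_bd n. h q = u q" "cm (cube n \<times> {0..1::real}) Y L"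
     "\<forall>q\<in>cube n. L (q, 0) = f (h q) \<and> L (q, 1) = v q" "\<forall>q\<in>cube_bd n. \<forall>t\<in>{0..1}. L (q, t) = v q"
    unfolding homotopy_lift_def by blast
  then show "homotopy_lift (cube n) (cube_bd n) X Y f' u v"
    unfolding homotopy_lift_def using e cm_image[OF h(1)] by (intro exI[of _ h] exI[of _ L]) auto
qed

lemma weak_homotopy_equivalence_cong:
  assumes "\<And>x. x \<in> topspace X \<Longrightarrow> f x = f' x" "weak_homotopy_equivalence X Y f"
  shows "weak_homotopy_equivalence X Y f'"
  using assms weak_lifting_cong[of X f f' Y] continuous_map_eq[of X Y f f']
  unfolding weak_homotopy_equivalence_iff_weak_lifting by blast

lemma Serre_fibration_cong:
  assumes e: "\<And>x. x \<in> topspace X \<Longrightarrow> f x = f' x" and S: "Serre_fibration X Y f"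
  shows "Serre_fibration X Y f'"
  unfolding Serre_fibration_def
proof (intro conjI allI impI)
  show "continuous_map X Y f'" using S e continuous_map_eq unfolding Serre_fibration_def by blast
  let ?I = "top_of_set {0..1::real}"
  fix n g h assume *: "continuous_map (disc n) X g \<and> continuous_map (prod_topology (disc n) ?I) Y h \<and>
    (\<forall>p\<in>topspace (disc n). f' (g p) = h (p, 0))"
  then have "\<forall>p\<in>topspace (disc n). f (g p) = h (p, 0)" using e continuous_map_in[of "disc n" X g] by simp
  then obtain k where k: "continuous_map (prod_topology (disc n) ?I) X k" "\<forall>p\<in>topspace (disc n). k (p, 0) = g p"
      "\<forall>p\<in>topspace (disc n). \<forall>t\<in>{0..1}. f (k (p, t)) = h (p, t)"
    using S * unfolding Serre_fibration_def by blast
  have "k (p, t) \<in> topspace X" if "p \<in> topspace (disc n)" "t \<in> {0..1}" for p t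
    using continuous_map_in[OF k(1)] that by simp
  then show "\<exists>k. continuous_map (prod_topology (disc n) ?I) X k \<and> (\<forall>p\<in>topspace (disc n). k (p, 0) = g p) \<and>
      (\<forall>p\<in>topspace (disc n). \<forall>t\<in>{0..1}. f' (k (p, t)) = h (p, t))"
    using k e by (intro exI[of _ k]) auto
qed

lemma delta_generated_cube: "delta_generated (top_of_set (cube n))"
proof (induction n)
  case 0
  show ?case
    by (rule delta_generated_retract_on[OF delta_generated_interval, of "\<lambda>_ _. 0" _ "\<lambda>_. 0"])
      (auto simp: cube_0 intro!: continuous_intros)
next
  case (Suc n)
  have dg: "delta_generated (top_of_set (cube n \<times> {0..1::real}))"
    using delta_generated_prod_interval[OF Suc] by simp
  obtain \<phi> \<psi> where p: "continuous_on (cube (Suc n)) \<phi>" "continuous_on (cube n \<times> {0..1::real}) \<psi>"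
    "\<And>x. x \<in> cube (Suc n) \<Longrightarrow> \<phi> x \<in> cube n \<times> {0..1}" "\<And>x. x \<in> cube n \<times> {0..1} \<Longrightarrow> \<psi> x \<in> cube (Suc n)"
    "\<And>x. x \<in> cube (Suc n) \<Longrightarrow> \<psi> (\<phi> x) = x"
    by (rule is_cellE[OF is_cell_prod[of n]]; rule that)
  show ?case by (rule delta_generated_retract_on[OF dg p(2,1,4,3,5)])
qed

text \<open>The disc lies in the cube, and radial projection in the Euclidean norm retracts the cube
  onto it.\<close>

lemma delta_generated_closed_disc: "delta_generated (top_of_set (closed_disc n))"
proof (rule delta_generated_retract_on[OF delta_generated_cube[of n], of "\<lambda>y i. y i / max 1 (l2norm n y)" _ "\<lambda>y. y"])
  show "continuous_on (cube n) (\<lambda>y i. y i / max 1 (l2norm n y))"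
    by (intro continuous_on_coordinatewise_then_product continuous_intros continuous_on_max) (auto simp: max_def)
  have l2d: "l2norm n y \<le> 1" if "y \<in> closed_disc n" for y using that by (simp add: l2norm_def closed_disc_def)
  show "(\<lambda>i. y i / max 1 (l2norm n y)) \<in> closed_disc n" if "y \<in> cube n" for y
  proof -
    have "l2norm n (\<lambda>i. (1 / max 1 (l2norm n y)) * y i) = \<bar>1 / max 1 (l2norm n y)\<bar> * l2norm n y" by (rule l2norm_scale)
    also have "\<dots> \<le> 1" by (simp add: max_def)
    finally have "(\<Sum>i<n. (y i / max 1 (l2norm n y))\<^sup>2) \<le> 1" by (simp add: l2norm_def)
    then show ?thesis using that by (auto simp: closed_disc_def cube_def)
  qed
  show "y \<in> cube n" if "y \<in> closed_disc n" for y
    using l2d[OF that] sup_norm_le_l2norm[of n y] that by (auto simp: cube_def closed_disc_def)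
  show "(\<lambda>i. y i / max 1 (l2norm n y)) = y" if "y \<in> closed_disc n" for y using l2d[OF that] by (simp add: max_def)
qed (auto intro!: continuous_intros)

section \<open>Evaluation at the start as a trivial fibration\<close>

context path_functor
begin

context
  fixes a
  assumes a: "a \<in> Ob" and BD: "B = D" and bid: "b = (\<lambda>_ x. x)"
begin

lemma B_point_path_of: "z \<in> T_points a \<Longrightarrow> height z < 1 \<Longrightarrow> B_point z = path_of z 0"
  using TsetD(7) by (simp add: bid)

lemma path_of_top: "z \<in> T_points a \<Longrightarrow> t \<in> {0..1} \<Longrightarrow> path_of z t \<in> topspace (fob D a)"
  using cm_image[OF TsetD(1)] by blast

text \<open>The start of a path is moved by putting the reversed base homotopy in front of it. Its
  end, its height and the preimage of its end are unchanged; the preimage of the start is the start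
  itself, since the second leg is the identity.\<close>

lemma ev0_Serre: "Serre_fibration (fob T a) (fob D a) (\<lambda>z. path_of z 0)"
  unfolding Serre_fibration_def
proof (intro conjI allI impI)
  show "continuous_map (fob T a) (fob D a) (\<lambda>z. path_of z 0)" by (rule natural_cont[OF ev0 a])
  fix n g h
  assume "continuous_map (disc n) (fob T a) g \<and>
       continuous_map (prod_topology (disc n) (top_of_set {0..1})) (fob D a) h \<and>
       (\<forall>p\<in>topspace (disc n). path_of (g p) 0 = h (p, 0::real))"
  then have g: "cm (closed_disc n) (fob T a) g" and h: "cm (closed_disc n \<times> {0..1}) (fob D a) h"
    and gh: "\<And>q. q \<in> closed_disc n \<Longrightarrow> path_of (g q) 0 = h (q, 0)" by (auto simp: disc_eq)
  have gT: "g q \<in> T_points a" if "q \<in> closed_disc n" for q using cm_image[OF g that] by simp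
  let ?Z = "closed_disc n \<times> {0..1::real}"
  \<comment> \<open>At time \<open>t\<close> of the base homotopy, the part up to \<open>t/2\<close>
    runs \<open>h\<close> back from \<open>t\<close> to 0 and the rest is the old path. This share
    never exceeds 1/2, so the denominator stays positive, and for \<open>t = 0\<close> the old path
    is unchanged.\<close>
  define Hm where "Hm = (\<lambda>w :: ((nat \<Rightarrow> real) \<times> real) \<times> real. if snd w \<le> snd (fst w) / 2 then h (fst (fst w), snd (fst w) - 2 * snd w)
      else path_of (g (fst (fst w))) ((snd w - snd (fst w) / 2) / (1 - snd (fst w) / 2)))"
  have "cm (?Z \<times> {0..1}) (fob D a) Hm"
    unfolding Hm_def
  proof (rule cm_If_le)
    show "cm {w \<in> ?Z \<times> {0..1}. snd w \<le> snd (fst w) / 2} (fob D a) (\<lambda>w. h (fst (fst w), snd (fst w) - 2 * snd w))"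
      by (rule cm_compose[OF h]) (auto intro!: continuous_intros)
    let ?W = "{w \<in> ?Z \<times> {0..1::real}. snd (fst w) / 2 \<le> snd w}"
    have g': "cm ?W (fob T a) (\<lambda>w. g (fst (fst w)))"
      by (rule cm_compose[OF g]) (auto intro!: continuous_intros)
    have t': "cm ?W (top_of_set {0..1}) (\<lambda>w. (snd w - snd (fst w) / 2) / (1 - snd (fst w) / 2))"
      by (rule cm_into) (auto intro!: continuous_intros simp: divide_le_eq)
    show "cm ?W (fob D a) (\<lambda>w. path_of (g (fst (fst w))) ((snd w - snd (fst w) / 2) / (1 - snd (fst w) / 2)))"
      using cm_post[OF continuous_map_prodI[OF g' t'] path_of_cont] by simp
    show "h (fst (fst w), snd (fst w) - 2 * snd w) = path_of (g (fst (fst w))) ((snd w - snd (fst w) / 2) / (1 - snd (fst w) / 2))"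
      if "w \<in> ?Z \<times> {0..1}" "snd w = snd (fst w) / 2" for w
      using that gh[of "fst (fst w)"] by auto
  qed (auto intro!: continuous_intros)
  then have Hm: "continuous_map (prod_topology (top_of_set ?Z) (top_of_set {0..1})) (fob D a) Hm" by simp
  have dg: "delta_generated (top_of_set ?Z)"
    using delta_generated_prod_interval[OF delta_generated_closed_disc[of n]] by simp
  have gZ: "cm ?Z (fob T a) (\<lambda>w. g (fst w))" by (rule cm_compose[OF g]) (auto intro!: continuous_intros)
  have s: "cm ?Z euclideanreal (\<lambda>w. height (g (fst w)))" by (rule cm_post[OF gZ height_cont])
  have y: "continuous_map (subtopology (top_of_set ?Z) {w. height (g (fst w)) > 0}) (fob C a) (\<lambda>w. C_point (g (fst w)))"
  proof -
    have "continuous_map (subtopology (top_of_set ?Z) {w. height (g (fst w)) > 0}) (subtopology (fob T a) {z. height z > 0}) (\<lambda>w. g (fst w))"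
      using continuous_map_from_subtopology[OF gZ] by (auto simp: continuous_map_in_subtopology)
    from continuous_map_compose[OF this C_point_cont] show ?thesis by (simp add: o_def)
  qed
  have x: "continuous_map (subtopology (top_of_set ?Z) {w. height (g (fst w)) < 1}) (fob B a) h"
    using continuous_map_from_subtopology[OF h] by (simp add: BD)
  have Hm1: "Hm (w, 1) = path_of (g (fst w)) 1" if "w \<in> ?Z" for w using that by (auto simp: Hm_def)
  have Hm0: "Hm (w, 0) = h w" if "w \<in> ?Z" for w using that by (auto simp: Hm_def)
  have yc: "Hm (w, 1) = c a (C_point (g (fst w)))" if "w \<in> topspace (top_of_set ?Z)" "height (g (fst w)) > 0" for w
    using Hm1[of w] TsetD(5)[OF gT that(2)] that(1) by auto
  have xb: "Hm (w, 0) = b a (h w)" if "w \<in> topspace (top_of_set ?Z)" for w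
    using Hm0[of w] that by (auto simp: bid)
  have s01: "height (g (fst w)) \<in> {0..1}" if "w \<in> topspace (top_of_set ?Z)" for w
    using TsetD(2,3)[OF gT, of "fst w"] that by auto
  let ?k = "\<lambda>w. T_code (\<lambda>t. Hm (w, t)) (height (g (fst w))) (C_point (g (fst w))) (h w)"
  note into = continuous_into_T[OF dg Hm s s01 y x yc xb]
  show "\<exists>k. continuous_map (prod_topology (disc n) (top_of_set {0..1})) (fob T a) k \<and>
      (\<forall>p\<in>topspace (disc n). k (p, 0) = g p) \<and> (\<forall>p\<in>topspace (disc n). \<forall>t\<in>{0..1}. path_of (k (p, t)) 0 = h (p, t))"
  proof (intro exI[of _ ?k] conjI ballI)
    show "continuous_map (prod_topology (disc n) (top_of_set {0..1})) (fob T a) ?k"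
      using into(1) by (simp add: disc_eq)
    show "?k (p, 0) = g p" if "p \<in> topspace (disc n)" for p
    proof -
      have p: "p \<in> closed_disc n" using that by (simp add: disc_eq)
      show ?thesis
        by (rule T_points_eqI[OF into(2) gT[OF p]])
          (use p gh[OF p] B_point_path_of[OF gT[OF p]] in \<open>auto simp: T_code_sel Hm_def\<close>)
    qed
    show "path_of (?k (p, t)) 0 = h (p, t)" if "p \<in> topspace (disc n)" "t \<in> {0..1}" for p t
      using that Hm0[of "(p, t)"] by (simp add: T_code_sel disc_eq)
  qed
qed

text \<open>A section of the evaluation, at height 0, where no preimage in \<open>C\<close> is
  required.\<close>

definition "const_lift w = T_code (\<lambda>t. w) 0 undefined w"

lemma const_lift_cont: "continuous_map (fob D a) (fob T a) const_lift"
  unfolding const_lift_def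
proof (rule continuous_into_T(1)[where Hm = "\<lambda>w. fst w" and s = "\<lambda>_. 0", unfolded fst_conv])
  show "delta_generated (fob D a)" by (rule functor_dg[OF D a])
  show "continuous_map (prod_topology (fob D a) (top_of_set {0..1})) (fob D a) fst" by (rule continuous_map_fst)
  show "continuous_map (subtopology (fob D a) {w. (0::real) < 0}) (fob C a) (\<lambda>_. undefined)"
    using continuous_map_empty[of "fob D a"] by simp
  show "continuous_map (subtopology (fob D a) {w. (0::real) < 1}) (fob B a) (\<lambda>w. w)"
    by (simp add: BD)
qed (auto simp: bid)

text \<open>Read from 1 down to 0, the parameter first lowers the height to 0 and then shortens the
  path to its start. The order matters: an inner point of the path may have no preimage in
  \<open>C\<close>, so the path can be shortened only at height 0.\<close>

lemma T_contraction:
  obtains K where "continuous_map (prod_topology (fob T a) (top_of_set {0..1::real})) (fob T a) K"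
    "\<And>z. z \<in> T_points a \<Longrightarrow> K (z, 1) = z" "\<And>z. z \<in> T_points a \<Longrightarrow> K (z, 0) = const_lift (path_of z 0)"
    "\<And>z r. z \<in> T_points a \<Longrightarrow> r \<in> {0..1} \<Longrightarrow> path_of (K (z, r)) 0 = path_of z 0"
proof -
  let ?Z = "prod_topology (fob T a) (top_of_set {0..1::real})"
  define Hm where "Hm = (\<lambda>w :: ('u \<times> real) \<times> real. path_of (fst (fst w)) (min 1 (2 * snd (fst w)) * snd w))"
  define s where "s = (\<lambda>w :: 'u \<times> real. height (fst w) * max 0 (2 * snd w - 1))"
  have dg: "delta_generated ?Z" by (rule delta_generated_prod_interval[OF functor_dg[OF T_functor a]])
  have rc: "continuous_map ?Z euclideanreal snd"
    using continuous_map_snd[of "fob T a" "top_of_set {0..1::real}"] by (simp add: continuous_map_in_subtopology)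
  have Hmc: "continuous_map (prod_topology ?Z (top_of_set {0..1})) (fob D a) Hm"
  proof -
    let ?ZI = "prod_topology ?Z (top_of_set {0..1::real})"
    have 1: "continuous_map ?ZI (fob T a) (\<lambda>w. fst (fst w))"
      using continuous_map_compose[OF continuous_map_fst continuous_map_fst] by (auto simp: o_def)
    have 2: "continuous_map ?ZI euclideanreal (\<lambda>w. snd (fst w))"
      using continuous_map_compose[OF continuous_map_fst rc] by (auto simp: o_def)
    have 3: "continuous_map ?ZI euclideanreal snd"
      using continuous_map_snd[of ?Z "top_of_set {0..1::real}"] by (simp add: continuous_map_in_subtopology)
    have 4: "continuous_map ?ZI euclideanreal (\<lambda>w. min 1 (2 * snd (fst w)) * snd w)"
      by (intro continuous_map_real_mult continuous_map_real_min 2 3) (auto intro!: continuous_map_real_mult 2)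
    have "continuous_map ?ZI (top_of_set {0..1}) (\<lambda>w. min 1 (2 * snd (fst w)) * snd w)"
      using 4 by (auto simp: continuous_map_in_subtopology intro!: mult_le_one)
    from continuous_map_compose[OF continuous_map_prodI[OF 1 this] path_of_cont] show ?thesis by (simp add: Hm_def o_def)
  qed
  have hc: "continuous_map ?Z euclideanreal (\<lambda>w. height (fst w))"
    using continuous_map_compose[OF continuous_map_fst height_cont] by (auto simp: o_def)
  have sc: "continuous_map ?Z euclideanreal s"
    unfolding s_def
    by (intro continuous_map_real_mult hc continuous_map_real_max continuous_map_diff rc) (auto intro!: continuous_map_real_mult rc)
  have s01: "s w \<in> {0..1}" if "w \<in> topspace ?Z" for w
    using that TsetD(2,3)[of "fst w" a] by (auto simp: s_def intro!: mult_le_one)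
  have spos: "height (fst w) > 0 \<and> snd w > 1/2" if "s w > 0" "w \<in> topspace ?Z" for w
  proof -
    have h0: "height (fst w) \<ge> 0" using that(2) TsetD(2)[of "fst w" a] by auto
    have "height (fst w) \<noteq> 0" "max 0 (2 * snd w - 1) \<noteq> 0" using that(1) by (auto simp: s_def)
    then show ?thesis using h0 by (auto simp: max_def split: if_splits)
  qed
  have yc': "continuous_map (subtopology ?Z {w. s w > 0}) (fob C a) (\<lambda>w. C_point (fst w))"
  proof -
    have "continuous_map (subtopology ?Z {w. s w > 0}) (subtopology (fob T a) {z. height z > 0}) fst"
      using continuous_map_from_subtopology[OF continuous_map_fst] spos by (auto simp: continuous_map_in_subtopology)
    from continuous_map_compose[OF this C_point_cont] show ?thesis by (simp add: o_def)
  qed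
  have xc': "continuous_map (subtopology ?Z {w. s w < 1}) (fob B a) (\<lambda>w. path_of (fst w) 0)"
    using continuous_map_from_subtopology[OF continuous_map_compose[OF continuous_map_fst natural_cont[OF ev0 a]]]
    by (auto simp: o_def BD)
  have yc: "Hm (w, 1) = c a (C_point (fst w))" if "w \<in> topspace ?Z" "s w > 0" for w
    using spos[OF that(2,1)] TsetD(5)[of "fst w" a] that(1) by (auto simp: Hm_def)
  have xb: "Hm (w, 0) = b a (path_of (fst w) 0)" for w by (simp add: Hm_def bid)
  note into = continuous_into_T[OF dg Hmc sc s01 yc' xc' yc xb]
  show thesis
  proof (rule that[of "\<lambda>w. T_code (\<lambda>t. Hm (w, t)) (s w) (C_point (fst w)) (path_of (fst w) 0)"])
    show "continuous_map ?Z (fob T a) (\<lambda>w. T_code (\<lambda>t. Hm (w, t)) (s w) (C_point (fst w)) (path_of (fst w) 0))"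
      by (rule into(1))
    show "T_code (\<lambda>t. Hm ((z, 1), t)) (s (z, 1)) (C_point (fst (z, 1::real))) (path_of (fst (z, 1::real)) 0) = z" if z: "z \<in> T_points a" for z
      by (rule T_points_eqI[OF into(2)[of "(z, 1)"] z]) (use z B_point_path_of[OF z] in \<open>auto simp: T_code_sel Hm_def s_def\<close>)
    show "T_code (\<lambda>t. Hm ((z, 0), t)) (s (z, 0)) (C_point (fst (z, 0::real))) (path_of (fst (z, 0::real)) 0) = const_lift (path_of z 0)" for z
      by (simp add: Hm_def s_def const_lift_def T_code_def)
    show "path_of (T_code (\<lambda>t. Hm ((z, r), t)) (s (z, r)) (C_point (fst (z, r))) (path_of (fst (z, r)) 0)) 0 = path_of z 0" for z r
      by (simp add: T_code_sel Hm_def)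
  qed
qed

text \<open>A fibrewise contraction to a section and relative homotopy lifting give strict lifts:
  \<open>const_lift\<close> applied to \<open>v\<close> on the bottom and the contraction tracks of
  \<open>u\<close> on the sides are extended over the constant homotopy of \<open>v\<close>, and the
  top is the lift.\<close>

lemma ev0_weak_equivalence: "weak_homotopy_equivalence (fob T a) (fob D a) (\<lambda>z. path_of z 0)"
  unfolding weak_homotopy_equivalence_iff_weak_lifting
proof
  show "continuous_map (fob T a) (fob D a) (\<lambda>z. path_of z 0)" by (rule natural_cont[OF ev0 a])
  obtain K where K: "continuous_map (prod_topology (fob T a) (top_of_set {0..1::real})) (fob T a) K"
    "\<And>z. z \<in> T_points a \<Longrightarrow> K (z, 1) = z" "\<And>z. z \<in> T_points a \<Longrightarrow> K (z, 0) = const_lift (path_of z 0)"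
    "\<And>z r. z \<in> T_points a \<Longrightarrow> r \<in> {0..1} \<Longrightarrow> path_of (K (z, r)) 0 = path_of z 0"
    by (rule T_contraction; rule that)
  show "weak_lifting (fob T a) (fob D a) (\<lambda>z. path_of z 0)"
    unfolding weak_lifting_def
  proof (intro allI impI)
    fix n u v assume "lifting_square (cube n) (cube_bd n) (fob T a) (fob D a) (\<lambda>z. path_of z 0) u v"
    then have u: "cm (cube_bd n) (fob T a) u" and v: "cm (cube n) (fob D a) v" and uv: "\<And>q. q \<in> cube_bd n \<Longrightarrow> path_of (u q) 0 = v q"
      by (auto simp: lifting_square_def)
    have uT: "u q \<in> T_points a" if "q \<in> cube_bd n" for q using cm_image[OF u that] by simp
    let ?J = "cube n \<times> {0} \<union> cube_bd n \<times> {0..1::real}"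
    define g where "g = (\<lambda>w::(nat\<Rightarrow>real)\<times>real. if snd w = 0 then const_lift (v (fst w)) else K (u (fst w), snd w))"
    have g0: "g w = K (u (fst w), snd w)" if "w \<in> cube_bd n \<times> {0..1}" for w
      using that K(3)[OF uT, of "fst w"] uv[of "fst w"] by (auto simp: g_def)
    have gc: "cm ?J (fob T a) g"
    proof (rule cm_closed_Un')
      show "closed (cube n \<times> {0::real})" by (intro closed_Times compact_imp_closed compact_cube) simp
      show "closed (cube_bd n \<times> {0..1::real})" by (intro closed_Times closed_cube_bd) simp
      have "cm (cube n \<times> {0::real}) (fob D a) (\<lambda>w. v (fst w))"
        by (rule cm_compose[OF v]) (auto intro!: continuous_intros)
      then have "cm (cube n \<times> {0::real}) (fob T a) (\<lambda>w. const_lift (v (fst w)))" by (rule cm_post[OF _ const_lift_cont])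
      then show "cm (cube n \<times> {0}) (fob T a) g" by (rule cm_cong) (auto simp: g_def)
      let ?W = "cube_bd n \<times> {0..1::real}"
      have 1: "cm ?W (fob T a) (\<lambda>w. u (fst w))" by (rule cm_compose[OF u]) (auto intro!: continuous_intros)
      have 2: "cm ?W (top_of_set {0..1}) snd" by (rule cm_into) (auto intro!: continuous_intros)
      have "cm ?W (fob T a) (\<lambda>w. K (u (fst w), snd w))" by (rule cm_post[OF continuous_map_prodI[OF 1 2] K(1)])
      then show "cm ?W (fob T a) g" by (rule cm_cong) (simp add: g0)
    qed
    have Gc: "cm (cube n \<times> {0..1::real}) (fob D a) (\<lambda>w. v (fst w))"
      by (rule cm_compose[OF v]) (auto intro!: continuous_intros)
    have gG: "path_of (g w) 0 = v (fst w)" if w: "w \<in> ?J" for w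
    proof (cases "snd w = 0")
      case True
      then show ?thesis by (simp add: g_def const_lift_def T_code_sel)
    next
      case False
      then have "w \<in> cube_bd n \<times> {0..1}" using w by auto
      then show ?thesis using g0 K(4)[OF uT, of "fst w" "snd w"] uv[of "fst w"] by auto
    qed
    obtain k where k: "cm (cube n \<times> {0..1::real}) (fob T a) k" "\<And>w. w \<in> ?J \<Longrightarrow> k w = g w"
      "\<And>w. w \<in> cube n \<times> {0..1::real} \<Longrightarrow> path_of (k w) 0 = v (fst w)"
      by (rule relative_homotopy_lifting[OF ev0_Serre gc Gc]; (rule gG that; assumption)?)
    show "homotopy_lift (cube n) (cube_bd n) (fob T a) (fob D a) (\<lambda>z. path_of z 0) u v"
      unfolding homotopy_lift_def
    proof (intro exI conjI ballI)
      show "cm (cube n) (fob T a) (\<lambda>q. k (q, 1))" by (rule cm_compose[OF k(1)]) (auto intro!: continuous_intros)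
      show "cm (cube n \<times> {0..1::real}) (fob D a) (\<lambda>w. v (fst w))" by (rule Gc)
      show "k (q, 1) = u q" if "q \<in> cube_bd n" for q
        using k(2)[of "(q, 1)"] g0[of "(q, 1)"] K(2)[OF uT[OF that]] that by simp
    qed (use k(3) in auto)
  qed
qed

end

end

section \<open>Left properness\<close>

context enriched_code
begin

text \<open>The first path space has the legs \<open>f\<close> and the identity of \<open>B\<close>,
  so that \<open>cof\<close> applies to its evaluation; the second has the legs \<open>j\<close> and
  \<open>i\<close> over \<open>D\<close>. The lift into the first induces a map from the pushout to
  the second, and its components are the data for excision.\<close>

lemma weak_equivalence_pushout:
  assumes po: "is_pushout EF A B C D f g i j"
    and cof: "\<And>X Y p. is_enriched_functor P X \<Longrightarrow> is_enriched_functor P Y \<Longrightarrow> p \<in> Hom EF X Y \<Longrightarrow>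
        (\<And>a. a \<in> Ob \<Longrightarrow> weak_homotopy_equivalence (fob X a) (fob Y a) (p a) \<and> Serre_fibration (fob X a) (fob Y a) (p a)) \<Longrightarrow>
        has_lifting_property EF A B f X Y p"
    and weq: "\<And>a. a \<in> Ob \<Longrightarrow> weak_homotopy_equivalence (fob A a) (fob C a) (g a)"
    and a: "a \<in> Ob"
  shows "weak_homotopy_equivalence (fob B a) (fob D a) (i a)"
proof -
  note obj = pushoutE(1-4)[OF po] and n = pushoutE(5-8)[OF po] and com = pushoutE(9)[OF po]
  interpret T1: path_functor P code B A B f "\<lambda>a x. x"
    by unfold_locales (use obj n natural_id in auto)
  interpret T2: path_functor P code D C B j i
    by unfold_locales (use obj n in auto)
  have fB: "f a w \<in> topspace (fob B a)" if "a \<in> Ob" "w \<in> topspace (fob A a)" for a w by (rule natural_in[OF n(1) that])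
  \<comment> \<open>A point of \<open>A\<close> gives a constant path at height 1, where no preimage
    in the second leg is recorded.\<close>
  define \<iota> where "\<iota> = (\<lambda>(a::'u) w. T_code (\<lambda>t. f a w) 1 w undefined)"
  have \<iota>: "natural A T1.T \<iota>"
    unfolding \<iota>_def
  proof (rule T1.natural_into_T[where Hm = "\<lambda>a w. f a (fst w)" and s = "\<lambda>_ _. 1" and y = "\<lambda>_ w. w" and x = "\<lambda>_ _. undefined", unfolded fst_conv])
    show "continuous_map (prod_topology (fob A a) (top_of_set {0..1::real})) (fob B a) (\<lambda>w. f a (fst w))" if "a \<in> Ob" for a
      using continuous_map_compose[OF continuous_map_fst natural_cont[OF n(1) that]] by (auto simp: o_def)
    show "continuous_map (subtopology (fob A a) {w. (1::real) < 1}) (fob B a) (\<lambda>_. undefined)" for a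
      using continuous_map_empty[of "fob A a"] by simp
  qed (use obj natural_nat[OF n(1)] in auto)
  define p where "p = normalize_map T1.T (\<lambda>a z. path_of z 0)"
  have p_Hom: "p \<in> Hom EF T1.T B" unfolding p_def by (rule normalize_map_Hom[OF T1.T_functor T1.ev0])
  have "has_lifting_property EF A B f T1.T B p"
  proof (rule cof[OF T1.T_functor obj(2) p_Hom])
    fix a assume a: "a \<in> Ob"
    have e: "path_of z 0 = p a z" if "z \<in> topspace (fob T1.T a)" for z using that a by (simp add: p_def)
    show "weak_homotopy_equivalence (fob T1.T a) (fob B a) (p a) \<and> Serre_fibration (fob T1.T a) (fob B a) (p a)"
      using weak_homotopy_equivalence_cong[OF e T1.ev0_weak_equivalence[OF a refl refl]]
        Serre_fibration_cong[OF e T1.ev0_Serre[OF a refl refl]] by blast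
  qed
  moreover have "normalize_map A \<iota> \<in> Hom EF A T1.T" by (rule normalize_map_Hom[OF obj(1) \<iota>])
  moreover have "normalize_map B (\<lambda>a x. x) \<in> Hom EF B B" by (rule normalize_map_Hom[OF obj(2) natural_id])
  moreover have "Comp EF A T1.T B p (normalize_map A \<iota>) = Comp EF A B B (normalize_map B (\<lambda>a x. x)) f"
    unfolding Comp_EF normalize_map_eq_iff using natural_in[OF \<iota>] fB by (simp add: p_def) (simp add: \<iota>_def T_code_sel)
  ultimately obtain \<theta> where th: "\<theta> \<in> Hom EF B T1.T" "Comp EF A B T1.T \<theta> f = normalize_map A \<iota>" "Comp EF B T1.T B p \<theta> = normalize_map B (\<lambda>a x. x)"
    unfolding has_lifting_property_def by blast
  have \<theta>: "natural B T1.T \<theta>" by (rule Hom_natural[OF th(1)])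
  have \<theta>T: "\<theta> a x \<in> T1.T_points a" if "a \<in> Ob" "x \<in> topspace (fob B a)" for a x using natural_in[OF \<theta> that] by simp
  have \<theta>f: "\<theta> a (f a w) = \<iota> a w" if "a \<in> Ob" "w \<in> topspace (fob A a)" for a w
    using th(2) that unfolding Comp_EF normalize_map_eq_iff by blast
  have \<theta>0: "path_of (\<theta> a x) 0 = x" if "a \<in> Ob" "x \<in> topspace (fob B a)" for a x
  proof -
    have "p a (\<theta> a x) = x" using th(3) that unfolding Comp_EF normalize_map_eq_iff by blast
    then show ?thesis using \<theta>T[OF that] that by (simp add: p_def)
  qed
  note cB = T1.T_cont_components[OF \<theta>] and nB = T1.T_nat_components[OF \<theta> obj(2)]
  \<comment> \<open>The deformation of \<open>B\<close> is transported to \<open>D\<close>: the path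
    along \<open>i\<close>, the preimage in \<open>A\<close> along \<open>g\<close>, and the point
    itself as preimage of the start.\<close>
  define lB where "lB = (\<lambda>a x. T_code (\<lambda>t. i a (path_of (\<theta> a x) t)) (height (\<theta> a x)) (g a (C_point (\<theta> a x))) x)"
  have lB: "natural B T2.T lB"
    unfolding lB_def
  proof (rule T2.natural_into_T[where Hm = "\<lambda>a w. i a (path_of (\<theta> a (fst w)) (snd w))" and s = "\<lambda>a x. height (\<theta> a x)"
        and y = "\<lambda>a x. g a (C_point (\<theta> a x))" and x = "\<lambda>a x. x", unfolded fst_conv snd_conv])
    show "is_enriched_functor P B" by (rule obj(2))
    fix a assume a: "a \<in> Ob"
    show "continuous_map (prod_topology (fob B a) (top_of_set {0..1})) (fob D a) (\<lambda>w. i a (path_of (\<theta> a (fst w)) (snd w)))"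
      using continuous_map_compose[OF cB(1)[OF a] natural_cont[OF n(3) a]] by (simp add: o_def)
    show "continuous_map (fob B a) euclideanreal (\<lambda>x. height (\<theta> a x))" by (rule cB(2)[OF a])
    show "continuous_map (subtopology (fob B a) {w. height (\<theta> a w) > 0}) (fob C a) (\<lambda>x. g a (C_point (\<theta> a x)))"
      using continuous_map_compose[OF cB(3)[OF a] natural_cont[OF n(2) a]] by (simp add: o_def)
    show "continuous_map (subtopology (fob B a) {w. height (\<theta> a w) < 1}) (fob B a) (\<lambda>x. x)"
      by (simp add: continuous_map_from_subtopology)
    fix x assume x: "x \<in> topspace (fob B a)"
    note TD = T1.TsetD[OF \<theta>T[OF a x]]
    show "height (\<theta> a x) \<in> {0..1}" using TD by simp
    show "i a (path_of (\<theta> a x) 1) = j a (g a (C_point (\<theta> a x)))" if "height (\<theta> a x) > 0"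
      using TD(4,5)[OF that] com[OF a] by simp
    show "i a (path_of (\<theta> a x) 0) = i a x" by (simp add: \<theta>0[OF a x])
    fix a' q assume a': "a' \<in> Ob" and q: "q \<in> Mor a a'"
    show "i a' (path_of (\<theta> a' (farr B a a' q x)) t) = farr D a a' q (i a (path_of (\<theta> a x) t))" if t: "t \<in> {0..1}" for t
      using nB(1)[OF a a' q x t] natural_nat[OF n(3) a a' q T1.path_of_top[OF a refl refl \<theta>T[OF a x] t]] by simp
    show "height (\<theta> a' (farr B a a' q x)) = height (\<theta> a x)" by (rule nB(2)[OF a a' q x])
    show "g a' (C_point (\<theta> a' (farr B a a' q x))) = farr C a a' q (g a (C_point (\<theta> a x)))" if "height (\<theta> a x) > 0"
      using nB(3)[OF a a' q x that] natural_nat[OF n(2) a a' q TD(4)[OF that]] by simp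
  qed auto
  define lC where "lC = (\<lambda>(a::'u) y. T_code (\<lambda>t. j a y) 1 y undefined)"
  have lC: "natural C T2.T lC"
    unfolding lC_def
  proof (rule T2.natural_into_T[where Hm = "\<lambda>a w. j a (fst w)" and s = "\<lambda>_ _. 1" and y = "\<lambda>_ w. w" and x = "\<lambda>_ _. undefined", unfolded fst_conv])
    show "continuous_map (prod_topology (fob C a) (top_of_set {0..1::real})) (fob D a) (\<lambda>w. j a (fst w))" if "a \<in> Ob" for a
      using continuous_map_compose[OF continuous_map_fst natural_cont[OF n(4) that]] by (auto simp: o_def)
    show "continuous_map (subtopology (fob C a) {w. (1::real) < 1}) (fob B a) (\<lambda>_. undefined)" for a
      using continuous_map_empty[of "fob C a"] by simp
  qed (use obj natural_nat[OF n(4)] in auto)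
  have "lB a (f a w) = lC a (g a w)" if aw: "a \<in> Ob" "w \<in> topspace (fob A a)" for a w
  proof (rule T2.T_points_eqI)
    show "lB a (f a w) \<in> T2.T_points a" "lC a (g a w) \<in> T2.T_points a"
      using natural_in[OF lB aw(1) fB[OF aw]] natural_in[OF lC aw(1) natural_in[OF n(2) aw]] by auto
  qed (use \<theta>f[OF aw] com[OF aw] in \<open>auto simp: lB_def lC_def T_code_sel \<iota>_def\<close>)
  then obtain \<kappa> where \<kappa>: "natural D T2.T \<kappa>" and \<kappa>i: "\<And>a x. a \<in> Ob \<Longrightarrow> x \<in> topspace (fob B a) \<Longrightarrow> \<kappa> a (i a x) = lB a x"
    and \<kappa>j: "\<And>a y. a \<in> Ob \<Longrightarrow> y \<in> topspace (fob C a) \<Longrightarrow> \<kappa> a (j a y) = lC a y"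
    using pushout_ex[OF po T2.T_functor lB lC] by blast
  have \<kappa>T: "\<kappa> a d \<in> T2.T_points a" if "d \<in> topspace (fob D a)" for d using natural_in[OF \<kappa> a that] by simp
  \<comment> \<open>Evaluation after \<open>\<kappa>\<close> and the identity of \<open>D\<close>
    agree on both legs of the pushout, hence everywhere by uniqueness.\<close>
  have \<kappa>0: "path_of (\<kappa> a d) 0 = d" if d: "d \<in> topspace (fob D a)" for d
  proof (rule pushout_unique[OF po obj(4) natural_compose[OF \<kappa> T2.ev0] natural_id _ _ a d])
    show "path_of (\<kappa> a (i a x)) 0 = i a x" if "a \<in> Ob" "x \<in> topspace (fob B a)" for a x
      using \<kappa>i[OF that] \<theta>0[OF that] by (simp add: lB_def T_code_sel)
    show "path_of (\<kappa> a (j a y)) 0 = j a y" if "a \<in> Ob" "y \<in> topspace (fob C a)" for a y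
      using \<kappa>j[OF that] by (simp add: lC_def T_code_sel)
  qed
  note cD = T2.T_cont_components[OF \<kappa> a]
  have iD: "i a x \<in> topspace (fob D a)" if "x \<in> topspace (fob B a)" for x by (rule natural_in[OF n(3) a that])
  have hi: "height (\<kappa> a (i a x)) = height (\<theta> a x)" if "x \<in> topspace (fob B a)" for x
    using \<kappa>i[OF a that] by (simp add: lB_def T_code_sel)
  \<comment> \<open>The two heights agree only on points of \<open>B\<close>, so the subspaces are
    compared after intersecting with the carrier.\<close>
  have subeq: "subtopology (fob B a) {x. height (\<kappa> a (i a x)) > 0} = subtopology (fob B a) {x. height (\<theta> a x) > 0}"
  proof -
    have "topspace (fob B a) \<inter> {x. height (\<kappa> a (i a x)) > 0} = topspace (fob B a) \<inter> {x. height (\<theta> a x) > 0}"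
      using hi by auto
    then show ?thesis by (metis subtopology_restrict)
  qed
  \<comment> \<open>Compatibility with \<open>i\<close> comes from \<open>\<kappa>i\<close>; the
    conditions on single points come from membership in the two path spaces together with
    \<open>\<theta>0\<close> and \<open>\<kappa>0\<close>.\<close>
  have "excision_data (fob A a) (fob B a) (fob C a) (fob D a) (f a) (g a) (i a) (j a)
      (\<lambda>w. path_of (\<theta> a (fst w)) (snd w)) (\<lambda>w. path_of (\<kappa> a (fst w)) (snd w))
      (\<lambda>d. height (\<kappa> a d)) (\<lambda>d. C_point (\<kappa> a d)) (\<lambda>x. C_point (\<theta> a x)) (\<lambda>d. B_point (\<kappa> a d))"
  proof (rule excision_data.intro, unfold fst_conv snd_conv)
    show "continuous_map (fob A a) (fob B a) (f a)" "continuous_map (fob A a) (fob C a) (g a)"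
      "continuous_map (fob B a) (fob D a) (i a)" "continuous_map (fob C a) (fob D a) (j a)"
      using n a by (auto intro: natural_cont)
    show "i a (f a w) = j a (g a w)" if "w \<in> topspace (fob A a)" for w by (rule com[OF a that])
    show "continuous_map (subtopology (fob B a) {x. height (\<kappa> a (i a x)) > 0}) (fob A a) (\<lambda>x. C_point (\<theta> a x))"
      unfolding subeq by (rule cB(3)[OF a])
    show "0 \<le> height (\<kappa> a d) \<and> height (\<kappa> a d) \<le> 1" if "d \<in> topspace (fob D a)" for d
      using T2.TsetD(2,3)[OF \<kappa>T[OF that]] by simp
    show "path_of (\<theta> a x) 1 = f a (C_point (\<theta> a x))" if "x \<in> topspace (fob B a)" "height (\<kappa> a (i a x)) > 0" for x
      using T1.TsetD(5)[OF \<theta>T[OF a that(1)]] that hi by simp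
    show "path_of (\<kappa> a d) 1 = j a (C_point (\<kappa> a d))" if "d \<in> topspace (fob D a)" "height (\<kappa> a d) > 0" for d
      using T2.TsetD(5)[OF \<kappa>T[OF that(1)] that(2)] .
    show "path_of (\<kappa> a (i a x)) t = i a (path_of (\<theta> a x) t)" if "x \<in> topspace (fob B a)" "t \<in> {0..1}" for x t
      using \<kappa>i[OF a that(1)] that(2) by (simp add: lB_def T_code_sel)
    show "C_point (\<kappa> a (i a x)) = g a (C_point (\<theta> a x))" if "x \<in> topspace (fob B a)" "height (\<kappa> a (i a x)) > 0" for x
      using \<kappa>i[OF a that(1)] that(2) hi[OF that(1)] by (simp add: lB_def T_code_sel)
    show "i a (B_point (\<kappa> a d)) = d" if "d \<in> topspace (fob D a)" "height (\<kappa> a d) < 1" for d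
      using T2.TsetD(7)[OF \<kappa>T[OF that(1)] that(2)] \<kappa>0[OF that(1)] by simp
    show "B_point (\<kappa> a (i a x)) = x" if "x \<in> topspace (fob B a)" "height (\<kappa> a (i a x)) < 1" for x
      using \<kappa>i[OF a that(1)] that(2) hi[OF that(1)] by (simp add: lB_def T_code_sel)
  qed (use cB(1)[OF a] cD \<theta>0[OF a] \<kappa>0 in auto)
  then have "weak_lifting (fob B a) (fob D a) (i a)"
    using weq[OF a] unfolding weak_homotopy_equivalence_iff_weak_lifting by (blast intro: excision_data.weak_lifting_excision)
  then show ?thesis using natural_cont[OF n(3) a] by (simp add: weak_homotopy_equivalence_iff_weak_lifting)
qed

end

section \<open>Right properness\<close>

text \<open>The pointwise pullback as a test functor. A given pullback square is known only by its
  universal property among functors, while maps into its corner have to be produced from pairs of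
  maps on cubes.\<close>

locale pullback_functor = enriched_code P code for P :: "('u, 'u) enriched_category" and code +
  fixes A B C :: "('u, 'u, 'u topology, 'u \<Rightarrow> 'u) ftor" and f g :: "'u \<Rightarrow> 'u \<Rightarrow> 'u"
  assumes A: "is_enriched_functor P A" and B: "is_enriched_functor P B" and C: "is_enriched_functor P C"
    and f: "natural B A f" and g: "natural C A g"
begin

text \<open>The coding of quadruples is reused, with a fixed path and height as fillers.\<close>

definition E_code :: "'u \<Rightarrow> 'u \<Rightarrow> 'u" where
  "E_code x y = code (\<lambda>_. undefined, 0, y, x)"

lemma E_code_sel [simp]: "B_point (E_code x y) = x" "C_point (E_code x y) = y"
  by (simp_all add: E_code_def)

definition E_points :: "'u \<Rightarrow> 'u set" where
  "E_points a = {E_code x y | x y. x \<in> topspace (fob B a) \<and> y \<in> topspace (fob C a) \<and> f a x = g a y}"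

definition E_plot :: "'u \<Rightarrow> nat \<Rightarrow> ((nat \<Rightarrow> real) \<Rightarrow> 'u) \<Rightarrow> bool" where
  "E_plot a n \<sigma> \<longleftrightarrow> (\<forall>p\<in>standard_simplex n. \<sigma> p \<in> E_points a) \<and> cm (standard_simplex n) (fob B a) (\<lambda>p. B_point (\<sigma> p)) \<and>
     cm (standard_simplex n) (fob C a) (\<lambda>p. C_point (\<sigma> p))"

definition E_act :: "'u \<Rightarrow> 'u \<Rightarrow> 'u \<Rightarrow> 'u \<Rightarrow> 'u" where
  "E_act a a' p z = E_code (farr B a a' p (B_point z)) (farr C a a' p (C_point z))"

definition E :: "('u, 'u, 'u topology, 'u \<Rightarrow> 'u) ftor" where
  "E = plot_functor E_points E_plot E_act"

lemma EsetD: assumes "z \<in> E_points a"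
  shows "B_point z \<in> topspace (fob B a)" "C_point z \<in> topspace (fob C a)" "f a (B_point z) = g a (C_point z)" "E_code (B_point z) (C_point z) = z"
  using assms by (auto simp: E_points_def)

lemma plot_space_E: "plot_space (E_points a) (E_plot a)"
proof
  show "\<sigma> p \<in> E_points a" if "E_plot a n \<sigma>" "p \<in> standard_simplex n" for n \<sigma> p using that by (simp add: E_plot_def)
  show "E_plot a n (\<lambda>_. z)" if "z \<in> E_points a" for z n using EsetD[OF that] that by (simp add: E_plot_def)
  show "E_plot a m (\<lambda>p. \<sigma> (\<theta> p))" if s: "E_plot a n \<sigma>" and t: "continuous_on (standard_simplex m) \<theta>"
    "\<And>p. p \<in> standard_simplex m \<Longrightarrow> \<theta> p \<in> standard_simplex n" for n \<sigma> m \<theta>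
    using s t(2) cm_compose[OF _ t] unfolding E_plot_def by blast
qed

lemma E_act_E_points: "a \<in> Ob \<Longrightarrow> a' \<in> Ob \<Longrightarrow> p \<in> Mor a a' \<Longrightarrow> z \<in> E_points a \<Longrightarrow> E_act a a' p z \<in> E_points a'"
proof -
  assume a: "a \<in> Ob" "a' \<in> Ob" and p: "p \<in> Mor a a'" and z: "z \<in> E_points a"
  note D = EsetD[OF z]
  have "f a' (farr B a a' p (B_point z)) = g a' (farr C a a' p (C_point z))"
    using natural_nat[OF f a p D(1)] natural_nat[OF g a p D(2)] D(3) by simp
  then show ?thesis
    unfolding E_act_def E_points_def using functor_in[OF B a p D(1)] functor_in[OF C a p D(2)] by blast
qed

lemma E_functor: "is_enriched_functor P E"
  unfolding E_def
proof (rule plot_functor[OF plot_space_E E_act_E_points])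
  show "E_act a a (EIdent P a) z = z" if "a \<in> Ob" "z \<in> E_points a" for a z
    using EsetD[OF that(2)] functor_id[OF B that(1)] functor_id[OF C that(1)] by (simp add: E_act_def)
  show "E_act a a'' (EComp P a a' a'' q p) z = E_act a' a'' q (E_act a a' p z)"
    if "a \<in> Ob" "a' \<in> Ob" "a'' \<in> Ob" "p \<in> Mor a a'" "q \<in> Mor a' a''" "z \<in> E_points a" for a a' a'' p q z
    using EsetD[OF that(6)] functor_comp[OF B that(1-5)] functor_comp[OF C that(1-5)] by (simp add: E_act_def)
  fix a a' n \<sigma> \<tau>
  assume a: "a \<in> Ob" "a' \<in> Ob" and s: "cm (standard_simplex n) (EHom P a a') \<sigma>" and t: "E_plot a n \<tau>"
  have l: "locally_compact_space (top_of_set (standard_simplex n))" "Hausdorff_space (top_of_set (standard_simplex n))"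
    by (simp_all add: compact_imp_locally_compact_space compact_space_subtopology compact_standard_simplex Hausdorff_space_subtopology)
  show "E_plot a' n (\<lambda>p. E_act a a' (\<sigma> p) (\<tau> p))"
    unfolding E_plot_def
  proof (intro conjI ballI)
    show "E_act a a' (\<sigma> p) (\<tau> p) \<in> E_points a'" if "p \<in> standard_simplex n" for p
      by (rule E_act_E_points[OF a cm_image[OF s that]]) (use t that in \<open>simp add: E_plot_def\<close>)
    show "cm (standard_simplex n) (fob B a') (\<lambda>p. B_point (E_act a a' (\<sigma> p) (\<tau> p)))"
      using functor_joint[OF B a l s] t by (simp add: E_plot_def E_act_def)
    show "cm (standard_simplex n) (fob C a') (\<lambda>p. C_point (E_act a a' (\<sigma> p) (\<tau> p)))"
      using functor_joint[OF C a l s] t by (simp add: E_plot_def E_act_def)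
  qed
qed

lemma fob_E: "fob E a = plot_topology (E_points a) (E_plot a)"
  and farr_E: "farr E a a' p = restrict (E_act a a' p) (E_points a)"
  by (simp_all add: E_def plot_functor_def)

lemma topspace_E [simp]: "topspace (fob E a) = E_points a"
  unfolding fob_E by (rule plot_space.topspace_plot[OF plot_space_E])

lemma E_projections: "natural E B (\<lambda>_. B_point)" "natural E C (\<lambda>_. C_point)"
proof -
  have "continuous_map (fob E a) (fob B a) B_point" "continuous_map (fob E a) (fob C a) C_point" for a
    unfolding fob_E
    by (rule plot_space.continuous_map_from_plot[OF plot_space_E]; use EsetD in \<open>auto simp: E_plot_def\<close>)+
  then show "natural E B (\<lambda>_. B_point)" "natural E C (\<lambda>_. C_point)"
    by (auto simp: natural_def farr_E E_act_def)
qed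

lemma continuous_into_E:
  assumes Z: "delta_generated Z" and u: "continuous_map Z (fob B a) u" and v: "continuous_map Z (fob C a) v"
    and uv: "\<And>z. z \<in> topspace Z \<Longrightarrow> f a (u z) = g a (v z)"
  shows "continuous_map Z (fob E a) (\<lambda>z. E_code (u z) (v z))"
proof -
  have in_E: "E_code (u z) (v z) \<in> E_points a" if "z \<in> topspace Z" for z
    using uv[OF that] continuous_map_in[OF u that] continuous_map_in[OF v that] by (auto simp: E_points_def)
  show ?thesis
    unfolding fob_E
  proof (rule plot_space.continuous_map_into_plot[OF plot_space_E Z in_E])
    fix n \<sigma> assume \<sigma>: "cm (standard_simplex n) Z \<sigma>"
    show "E_plot a n (\<lambda>p. E_code (u (\<sigma> p)) (v (\<sigma> p)))"
      unfolding E_plot_def E_code_sel using in_E cm_image[OF \<sigma>] cm_post[OF \<sigma> u] cm_post[OF \<sigma> v] by blast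
  qed
qed

end

text \<open>The universal property gives \<open>k\<close> from the explicit pullback
  \<open>E\<close> to \<open>D\<close>, and the pair of projections gives a map from
  \<open>D\<close> to \<open>E\<close>. The composite on \<open>D\<close> is the identity by
  uniqueness, so the projections are jointly injective; pairs of maps on a cube reach
  \<open>D\<close> through \<open>k\<close>.\<close>

lemma (in enriched_code) weak_equivalence_pullback:
  assumes pb: "is_pullback EF A B C D f g i j"
    and fib: "\<And>a. a \<in> Ob \<Longrightarrow> Serre_fibration (fob B a) (fob A a) (f a)"
    and weq: "\<And>a. a \<in> Ob \<Longrightarrow> weak_homotopy_equivalence (fob C a) (fob A a) (g a)"
    and a: "a \<in> Ob"
  shows "weak_homotopy_equivalence (fob D a) (fob B a) (i a)"
proof -
  note obj = pullbackE(1-4)[OF pb] and n = pullbackE(5-8)[OF pb] and com = pullbackE(9)[OF pb]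
  interpret pullback_functor P code A B C f g
    by unfold_locales (use obj n in auto)
  have "f a (B_point z) = g a (C_point z)" if "z \<in> topspace (fob E a)" for a z using EsetD(3) that by simp
  then obtain k where k: "natural E D k" and ik: "\<And>a z. a \<in> Ob \<Longrightarrow> z \<in> E_points a \<Longrightarrow> i a (k a z) = B_point z"
    and jk: "\<And>a z. a \<in> Ob \<Longrightarrow> z \<in> E_points a \<Longrightarrow> j a (k a z) = C_point z"
    using pullback_ex[OF pb E_functor E_projections] by auto
  have m_in: "E_code (i a d) (j a d) \<in> E_points a" if "a \<in> Ob" "d \<in> topspace (fob D a)" for a d
    using com[OF that] natural_in[OF n(3) that] natural_in[OF n(4) that] by (auto simp: E_points_def)
  have m: "natural D E (\<lambda>a d. E_code (i a d) (j a d))"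
    unfolding natural_def
  proof (intro conjI ballI)
    show "continuous_map (fob D a) (fob E a) (\<lambda>d. E_code (i a d) (j a d))" if a: "a \<in> Ob" for a
      by (rule continuous_into_E[OF functor_dg[OF obj(4) a] natural_cont[OF n(3) a] natural_cont[OF n(4) a] com[OF a]])
    show "E_code (i a' (farr D a a' p d)) (j a' (farr D a a' p d)) = farr E a a' p (E_code (i a d) (j a d))"
      if "a \<in> Ob" "a' \<in> Ob" "p \<in> Mor a a'" "d \<in> topspace (fob D a)" for a a' p d
      using natural_nat[OF n(3) that] natural_nat[OF n(4) that] m_in[OF that(1,4)] by (simp add: farr_E E_act_def)
  qed
  have km: "k a (E_code (i a d) (j a d)) = d" if d: "d \<in> topspace (fob D a)" for d
    by (rule pullback_unique[OF pb obj(4) natural_compose[OF m k] natural_id _ a d]) (use m_in ik jk in auto)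
  have "weak_lifting (fob D a) (fob B a) (i a)"
  proof (rule weak_lifting_pullback[OF fib[OF a]])
    show "weak_lifting (fob C a) (fob A a) (g a)" using weq[OF a] by (simp add: weak_homotopy_equivalence_iff_weak_lifting)
    show "continuous_map (fob D a) (fob B a) (i a)" "continuous_map (fob D a) (fob C a) (j a)"
      by (rule natural_cont[OF n(3) a], rule natural_cont[OF n(4) a])
    show "f a (i a d) = g a (j a d)" if "d \<in> topspace (fob D a)" for d by (rule com[OF a that])
    show "d = d'" if "d \<in> topspace (fob D a)" "d' \<in> topspace (fob D a)" "i a d = i a d'" "j a d = j a d'" for d d'
    proof -
      have "d = k a (E_code (i a d) (j a d))" by (rule km[OF that(1), symmetric])
      also have "\<dots> = k a (E_code (i a d') (j a d'))" by (simp only: that(3,4))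
      also have "\<dots> = d'" by (rule km[OF that(2)])
      finally show ?thesis .
    qed
    fix n :: nat and \<beta> \<gamma> assume \<beta>: "cm (cube n) (fob B a) \<beta>" and \<gamma>: "cm (cube n) (fob C a) \<gamma>"
      and eq: "\<forall>q\<in>cube n. f a (\<beta> q) = g a (\<gamma> q)"
    have "cm (cube n) (fob E a) (\<lambda>q. E_code (\<beta> q) (\<gamma> q))"
      by (rule continuous_into_E[OF delta_generated_cube \<beta> \<gamma>]) (use eq in auto)
    then have "cm (cube n) (fob D a) (\<lambda>q. k a (E_code (\<beta> q) (\<gamma> q)))" "\<And>q. q \<in> cube n \<Longrightarrow> E_code (\<beta> q) (\<gamma> q) \<in> E_points a"
      using cm_image[of "cube n" "fob E a"] by (auto intro: cm_post[OF _ natural_cont[OF k a]])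
    then show "\<exists>k. cm (cube n) (fob D a) k \<and> (\<forall>q\<in>cube n. i a (k q) = \<beta> q \<and> j a (k q) = \<gamma> q)"
      using ik[OF a] jk[OF a] by (intro exI[of _ "\<lambda>q. k a (E_code (\<beta> q) (\<gamma> q))"]) auto
  qed
  then show ?thesis using natural_cont[OF n(3) a] by (simp add: weak_homotopy_equivalence_iff_weak_lifting)
qed

theorem theorem6p6:
  fixes P :: "('u, 'u) enriched_category"
  assumes "universe TYPE('u)"
    and "is_enriched_category P"
    and "EObj P \<noteq> {}"
  shows "proper (enriched_functor_category P) (projective_model_structure P)"
proof -
  obtain code :: "(real \<Rightarrow> 'u) \<times> real \<times> 'u \<times> 'u \<Rightarrow> 'u" where "inj code"
    by (rule universe_code[OF assms(1)])
  then interpret enriched_code P code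
    using assms(2) by unfold_locales
  have "left_proper EF (projective_model_structure P)"
    unfolding left_proper_def projective_model_structure_def model_structure_of_def model_structure.simps
    using weak_equivalence_pushout by (auto simp: Obj_EF)
  moreover have "right_proper EF (projective_model_structure P)"
    unfolding right_proper_def projective_model_structure_def model_structure_of_def model_structure.simps
    using weak_equivalence_pullback by blast
  ultimately show ?thesis by (simp add: proper_def)
qed

end
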